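(* Fix any $h_{\min}\leq 1/2$ and any constant $\epsilon>0$. Consider the throughput maximization problem on tree-networks with arbitrary heights in which every demand $a$ satisfies $h(a)\geq h_{\min}$. There is a distributed algorithm for this problem with approximation ratio $(80+\epsilon)$, i.e. it outputs a feasible solution $S$ with $p(S)\ge p(\mathrm{Opt})/(80+\epsilon)$. Its number of communication rounds is $O\!\left(\frac{T_{MIS}}{h_{\min}}\log n\,\log\frac{1}{\epsilon}\,\log\frac{p_{\max}}{p_{\min}}\right)$.
   Context: Throughput maximization on tree-networks with heights: $V$ is a set of $n$ vertices and $\mathcal{T}=\{T_1,\dots,T_r\}$ is a set of trees ("tree-networks") on vertex set $V$ (edge sets may differ). Every edge offers bandwidth $1$. There are $m$ processors. Each processor $P$ owns one demand $a=(u,v)$ with $u,v\in V$, profit $p(a)>0$ and height $h(a)\in(0,1]$, and has a set $\mathrm{Acc}(P)\subseteq\mathcal{T}$ of accessible tree-networks. For each $T\in\mathrm{Acc}(P)$ there is a demand instance of $a$ on $T$, with the same endpoints, height and profit; its path is the unique $u$–$v$ path in $T$. A feasible solution is a set $S$ of demand instances such that at most one instance of each demand is chosen, and for every edge $e$ of every tree-network, the total height of chosen instances whose path contains $e$ is at most $1$. The profit $p(S)$ is the sum of profits. $\mathrm{Opt}$ is an optimal solution, and $p_{\max},p_{\min}$ are the maximum and minimum profits. The value $h_{\min}$ is known to all processors. Distributed model: synchronous message passing. Processors $P_1,P_2$ communicate directly iff $\mathrm{Acc}(P_1)\cap\mathrm{Acc}(P_2)\ne\emptyset$. Local computation is polynomial.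 $T_{MIS}$ is the number of rounds needed to compute a maximal independent set in an arbitrary graph with $N=mr$ vertices. *)

theory Defs
  imports Complex_Main "HOL-Computational_Algebra.Polynomial"
begin

section \<open>Local computation\<close>

text \<open>
  The libraries have no notion of computation time, so local computation is given by programs of a
  small deterministic list-processing language over real numbers. Each elementary operation costs
  one unit: values are immutable and shared, so pushing onto a list or binding a value copies
  nothing, and real arithmetic and comparison are unit-cost (real RAM, without a floor operation).
  Only natural numbers occur as literals, so a program cannot hide information in a real constant.
  Loops range over lists. This guarantees termination but not polynomial time (a loop may double
  the length of its accumulator), so polynomial time is a separate requirement on \<open>cost\<close>.
\<close>

datatype val = Num real | Lst "val list"

primrec num :: "val \<Rightarrow> real" where
  "num (Num x) = x"
| "num (Lst xs) = 0"

primrec elems :: "val \<Rightarrow> val list" where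
  "elems (Num x) = []"
| "elems (Lst xs) = xs"

datatype prog =
    Var nat  \<comment> \<open>de Bruijn index into the environment\<close>
  | Lit nat
  | Add prog prog
  | Sub prog prog
  | Mul prog prog
  | Div prog prog
  | Leq prog prog
  | Ite prog prog prog
  | Bind prog prog
  | Empty
  | Push prog prog
  | First prog
  | Rest prog
  | IsEmpty prog
  | Foreach prog prog prog  \<comment> \<open>body (variable 0: element, variable 1: accumulator), list, start\<close>

primrec ev :: "prog \<Rightarrow> val list \<Rightarrow> val" where
  "ev (Var i) env = (if i < length env then env ! i else Lst [])"
| "ev (Lit k) env = Num (real k)"
| "ev (Add a b) env = Num (num (ev a env) + num (ev b env))"
| "ev (Sub a b) env = Num (num (ev a env) - num (ev b env))"
| "ev (Mul a b) env = Num (num (ev a env) * num (ev b env))"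
| "ev (Div a b) env = Num (num (ev a env) / num (ev b env))"
| "ev (Leq a b) env = Num (if num (ev a env) \<le> num (ev b env) then 1 else 0)"
| "ev (Ite c a b) env = (if num (ev c env) \<noteq> 0 then ev a env else ev b env)"
| "ev (Bind a b) env = ev b (ev a env # env)"
| "ev Empty env = Lst []"
| "ev (Push a b) env = Lst (ev a env # elems (ev b env))"
| "ev (First a) env = (case elems (ev a env) of [] \<Rightarrow> Lst [] | x # xs \<Rightarrow> x)"
| "ev (Rest a) env = Lst (tl (elems (ev a env)))"
| "ev (IsEmpty a) env = Num (if elems (ev a env) = [] then 1 else 0)"
| "ev (Foreach b l a) env =
     foldl (\<lambda>acc x. ev b (x # acc # env)) (ev a env) (elems (ev l env))"

primrec cost :: "prog \<Rightarrow> val list \<Rightarrow> nat" where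
  "cost (Var i) env = 1"
| "cost (Lit k) env = 1"
| "cost (Add a b) env = 1 + cost a env + cost b env"
| "cost (Sub a b) env = 1 + cost a env + cost b env"
| "cost (Mul a b) env = 1 + cost a env + cost b env"
| "cost (Div a b) env = 1 + cost a env + cost b env"
| "cost (Leq a b) env = 1 + cost a env + cost b env"
| "cost (Ite c a b) env =
     1 + cost c env + (if num (ev c env) \<noteq> 0 then cost a env else cost b env)"
| "cost (Bind a b) env = 1 + cost a env + cost b (ev a env # env)"
| "cost Empty env = 1"
| "cost (Push a b) env = 1 + cost a env + cost b env"
| "cost (First a) env = 1 + cost a env"
| "cost (Rest a) env = 1 + cost a env"
| "cost (IsEmpty a) env = 1 + cost a env"
| "cost (Foreach b l a) env =
     1 + cost l env + cost a env +
     snd (foldl (\<lambda>(acc, c) x. (ev b (x # acc # env), c + cost b (x # acc # env)))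
           (ev a env, 0) (elems (ev l env)))"


section \<open>Synchronous message passing\<close>

text \<open>
  Nodes are \<open>0, \<dots>, N - 1\<close>. In every round each node emits one message (of any size), which reaches
  exactly its neighbours; a message may contain parts addressed to individual neighbours. A node
  starts with its own input only and learns of its neighbours through their messages. The program
  \<open>out_of\<close> inspects the state: a nonempty list means that the node has decided on the first element
  of that list. The first decision is final; a decided node may go on relaying messages.
\<close>

record dist_alg =
  init_of :: prog
  msg_of :: prog
  step_of :: prog
  out_of :: prog

definition received :: "dist_alg \<Rightarrow> nat \<Rightarrow> (nat \<Rightarrow> nat \<Rightarrow> bool) \<Rightarrow> (nat \<Rightarrow> val) \<Rightarrow> nat \<Rightarrow> val" where
  "received A N adj st v =
     Lst (map (\<lambda>w. ev (msg_of A) [st w]) (filter (adj v) [0..<N]))"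

primrec state :: "dist_alg \<Rightarrow> nat \<Rightarrow> (nat \<Rightarrow> nat \<Rightarrow> bool) \<Rightarrow> (nat \<Rightarrow> val) \<Rightarrow> nat \<Rightarrow> nat \<Rightarrow> val" where
  "state A N adj inp 0 = (\<lambda>v. ev (init_of A) [inp v])"
| "state A N adj inp (Suc t) =
     (\<lambda>v. ev (step_of A)
            [state A N adj inp t v, received A N adj (state A N adj inp t) v])"

definition decision ::
  "dist_alg \<Rightarrow> nat \<Rightarrow> (nat \<Rightarrow> nat \<Rightarrow> bool) \<Rightarrow> (nat \<Rightarrow> val) \<Rightarrow> nat \<Rightarrow> nat \<Rightarrow> val option" where
  "decision A N adj inp t v =
     (case ev (out_of A) [state A N adj inp t v] of
        Lst (x # xs) \<Rightarrow> Some x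
      | _ \<Rightarrow> None)"

definition terminates_within ::
  "dist_alg \<Rightarrow> nat \<Rightarrow> (nat \<Rightarrow> nat \<Rightarrow> bool) \<Rightarrow> (nat \<Rightarrow> val) \<Rightarrow> nat \<Rightarrow> bool" where
  "terminates_within A N adj inp R \<longleftrightarrow> (\<forall>v<N. \<exists>t\<le>R. decision A N adj inp t v \<noteq> None)"

definition result ::
  "dist_alg \<Rightarrow> nat \<Rightarrow> (nat \<Rightarrow> nat \<Rightarrow> bool) \<Rightarrow> (nat \<Rightarrow> val) \<Rightarrow> nat \<Rightarrow> val" where
  "result A N adj inp v =
     the (decision A N adj inp (LEAST t. decision A N adj inp t v \<noteq> None) v)"

definition local_work ::
  "dist_alg \<Rightarrow> nat \<Rightarrow> (nat \<Rightarrow> nat \<Rightarrow> bool) \<Rightarrow> (nat \<Rightarrow> val) \<Rightarrow> nat \<Rightarrow> nat \<Rightarrow> nat" where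
  "local_work A N adj inp t v =
     (let st = state A N adj inp t
      in cost (init_of A) [inp v] + cost (out_of A) [st v] + cost (msg_of A) [st v]
         + cost (step_of A) [st v, received A N adj st v])"


section \<open>Maximal independent sets\<close>

definition simple_graph :: "nat \<Rightarrow> (nat \<Rightarrow> nat \<Rightarrow> bool) \<Rightarrow> bool" where
  "simple_graph N adj \<longleftrightarrow> (\<forall>u v. adj u v \<longrightarrow> u < N \<and> v < N \<and> u \<noteq> v \<and> adj v u)"

definition independent_set :: "nat \<Rightarrow> (nat \<Rightarrow> nat \<Rightarrow> bool) \<Rightarrow> nat set \<Rightarrow> bool" where
  "independent_set N adj X \<longleftrightarrow> X \<subseteq> {..<N} \<and> (\<forall>u\<in>X. \<forall>v\<in>X. \<not> adj u v)"

definition maximal_independent_set :: "nat \<Rightarrow> (nat \<Rightarrow> nat \<Rightarrow> bool) \<Rightarrow> nat set \<Rightarrow> bool" where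
  "maximal_independent_set N adj X \<longleftrightarrow>
     independent_set N adj X \<and> (\<forall>Y. X \<subset> Y \<longrightarrow> \<not> independent_set N adj Y)"

definition mis_input :: "nat \<Rightarrow> nat \<Rightarrow> val" where
  "mis_input N v = Lst [Num (real N), Num (real v)]"

text \<open>
  \<open>M\<close> computes a maximal independent set of every \<open>N\<close>-vertex graph (each vertex being a node which
  knows \<open>N\<close> and its own identifier) within \<open>T N\<close> rounds, with polynomial local computation.
  A vertex joins the set by deciding on the number 1.
\<close>

definition mis_algorithm :: "dist_alg \<Rightarrow> (nat \<Rightarrow> nat) \<Rightarrow> bool" where
  "mis_algorithm M T \<longleftrightarrow>
     (\<forall>N adj. simple_graph N adj \<longrightarrow>
        terminates_within M N adj (mis_input N) (T N) \<and>
        maximal_independent_set N adj {v. v < N \<and> result M N adj (mis_input N) v = Num 1}) \<and>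
     (\<exists>q :: nat poly. \<forall>N adj. simple_graph N adj \<longrightarrow>
        (\<forall>t. \<forall>v<N. local_work M N adj (mis_input N) t v \<le> poly q (N + t)))"


section \<open>Throughput maximization on tree-networks\<close>

definition path_between :: "nat set set \<Rightarrow> nat \<Rightarrow> nat \<Rightarrow> nat list \<Rightarrow> bool" where
  "path_between E u v p \<longleftrightarrow>
     p \<noteq> [] \<and> hd p = u \<and> last p = v \<and> distinct p \<and> successively (\<lambda>x y. {x, y} \<in> E) p"

definition cycle :: "nat set set \<Rightarrow> nat list \<Rightarrow> bool" where
  "cycle E p \<longleftrightarrow>
     length p \<ge> 3 \<and> distinct p \<and> successively (\<lambda>x y. {x, y} \<in> E) p \<and> {last p, hd p} \<in> E"

definition tree_network :: "nat \<Rightarrow> nat set set \<Rightarrow> bool" where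
  "tree_network n E \<longleftrightarrow>
     E \<subseteq> {{x, y} | x y. x < n \<and> y < n \<and> x \<noteq> y} \<and>
     (\<forall>u<n. \<forall>v<n. \<exists>p. path_between E u v p) \<and>
     (\<nexists>p. cycle E p)"

definition tree_path :: "nat set set \<Rightarrow> nat \<Rightarrow> nat \<Rightarrow> nat set set" where
  "tree_path E u v =
     (let p = (THE p. path_between E u v p) in {{x, y} | x y. (x, y) \<in> set (zip p (tl p))})"

text \<open>
  The vertices are \<open>0, \<dots>, n - 1\<close>, the tree-networks \<open>0, \<dots>, r - 1\<close> (given by their edge sets), the
  processors \<open>0, \<dots>, m - 1\<close>. Processors and their demands share indices, so the demand instance of
  demand \<open>i\<close> on tree-network \<open>j\<close> is the pair \<open>(i, j)\<close>.
\<close>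

record problem =
  n_vertices :: nat
  n_trees :: nat
  n_procs :: nat
  tree :: "nat \<Rightarrow> nat set set"
  acc :: "nat \<Rightarrow> nat set"
  src :: "nat \<Rightarrow> nat"
  dst :: "nat \<Rightarrow> nat"
  profit :: "nat \<Rightarrow> real"
  height :: "nat \<Rightarrow> real"

definition valid_problem :: "real \<Rightarrow> problem \<Rightarrow> bool" where
  "valid_problem hmin I \<longleftrightarrow>
     0 < n_procs I \<and>
     (\<forall>j<n_trees I. tree_network (n_vertices I) (tree I j)) \<and>
     (\<forall>i<n_procs I.
        acc I i \<subseteq> {..<n_trees I} \<and>
        src I i < n_vertices I \<and> dst I i < n_vertices I \<and>
        0 < profit I i \<and> 0 < height I i \<and> height I i \<le> 1 \<and> hmin \<le> height I i)"

definition demand_instances :: "problem \<Rightarrow> (nat \<times> nat) set" where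
  "demand_instances I = {(i, j). i < n_procs I \<and> j \<in> acc I i}"

definition inst_path :: "problem \<Rightarrow> nat \<times> nat \<Rightarrow> nat set set" where
  "inst_path I d = tree_path (tree I (snd d)) (src I (fst d)) (dst I (fst d))"

definition feasible :: "problem \<Rightarrow> (nat \<times> nat) set \<Rightarrow> bool" where
  "feasible I S \<longleftrightarrow>
     S \<subseteq> demand_instances I \<and>
     (\<forall>i j j'. (i, j) \<in> S \<and> (i, j') \<in> S \<longrightarrow> j = j') \<and>
     (\<forall>j<n_trees I. \<forall>e\<in>tree I j.
        (\<Sum>d \<in> {d \<in> S. snd d = j \<and> e \<in> inst_path I d}. height I (fst d)) \<le> 1)"

definition total_profit :: "problem \<Rightarrow> (nat \<times> nat) set \<Rightarrow> real" where
  "total_profit I S = (\<Sum>d\<in>S. profit I (fst d))"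

definition opt_profit :: "problem \<Rightarrow> real" where
  "opt_profit I = Max (total_profit I ` {S. feasible I S})"

definition p_max :: "problem \<Rightarrow> real" where
  "p_max I = Max (profit I ` {..<n_procs I})"

definition p_min :: "problem \<Rightarrow> real" where
  "p_min I = Min (profit I ` {..<n_procs I})"

definition comm :: "problem \<Rightarrow> nat \<Rightarrow> nat \<Rightarrow> bool" where
  "comm I i i' \<longleftrightarrow> i \<noteq> i' \<and> acc I i \<inter> acc I i' \<noteq> {}"

definition tree_input :: "problem \<Rightarrow> nat \<Rightarrow> val" where
  "tree_input I j =
     Lst [Num (real j),
          Lst [Lst [Num (real x), Num (real y)].
                 x \<leftarrow> [0..<n_vertices I], y \<leftarrow> [Suc x..<n_vertices I], {x, y} \<in> tree I j]]"

text \<open>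
  Initial knowledge of processor \<open>i\<close>: the global sizes, the parameters \<open>hmin\<close> and \<open>\<epsilon>\<close>, its own
  identifier and demand, and the tree-networks accessible to it. In particular neither the other
  demands nor the extreme profits are known.
\<close>

definition proc_input :: "real \<Rightarrow> real \<Rightarrow> problem \<Rightarrow> nat \<Rightarrow> val" where
  "proc_input hmin \<epsilon> I i =
     Lst [Num (real (n_vertices I)), Num (real (n_trees I)), Num (real (n_procs I)),
          Num hmin, Num \<epsilon>,
          Num (real i), Num (real (src I i)), Num (real (dst I i)),
          Num (profit I i), Num (height I i),
          Lst (map (tree_input I) (filter (\<lambda>j. j \<in> acc I i) [0..<n_trees I]))]"

text \<open>
  A processor selects its instance on tree-network \<open>j\<close> by deciding on the number \<open>j\<close>; any decision
  that is not a natural number leaves its demand unscheduled.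
\<close>

definition computed_solution :: "dist_alg \<Rightarrow> real \<Rightarrow> real \<Rightarrow> problem \<Rightarrow> (nat \<times> nat) set" where
  "computed_solution A hmin \<epsilon> I =
     {(i, j). i < n_procs I \<and>
              result A (n_procs I) (comm I) (proc_input hmin \<epsilon> I) i = Num (real j)}"

text \<open>
  Logarithmic factor of a round bound. The cut-off at 1 follows the usual convention: a bound that
  vanishes, say for equal profits, would exclude all communication.
\<close>

definition lg :: "real \<Rightarrow> real" where
  "lg x = max 1 (log 2 x)"

end

theory Submission
  imports Defs
begin

text \<open>
  On a single tree the paths have a layering of logarithmic depth in which eight edges of a path
  meet every path of the same or a higher layer that intersects it (split at a centroid, or at a
  median of the guards when there are three). Processors recover these layers locally by peeling:
  a demand can be removed as soon as eight of its edges pierce all remaining paths that meet it.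

  The algorithm is a local-ratio (equivalently primal-dual) scheme on residual profits. An instance
  is unsatisfied while more than half of its profit is left. In a superstep, a maximal independent
  set of the conflict graph of the eligible instances is raised, which charges the residual profit of
  each of them in full to the other instances of its demand, and to its conflicting instances in
  proportion to \<open>coef\<close> (twice the height for narrow instances, of height at most 1/2, and 1
  for wide ones; narrow and wide instances do not conflict with each other).
  Only instances of the lowest unfinished layer are eligible, and only if no eligible conflicting
  instance has more than twice their profit. Hence each superstep takes at least
  \<open>hmin / 2\<close> times its profit from every eligible instance that is not raised, and
  \<open>O(1 / hmin)\<close> supersteps finish a profit class of a layer. The raised instances are then
  selected greedily in reverse order, and every tree keeps the better of its narrow and wide parts.
  For each class the optimum is at most 34 times the raised residual profit, so the ratio is 68.

  The processors are not synchronised and do not know when a superstep ends globally. Each one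
  simulates the independent-set algorithm for its own instances and moves on as soon as its
  neighbours have supplied what it needs.
\<close>

section \<open>Cuts of a tree\<close>

text \<open>Processors with access to a common tree communicate directly, so each sees all demands
  on its trees, and layers, eligibility and conflicts can be computed from neighbouring states. The
  extreme profits are unknown, so no schedule of profit thresholds is possible; the comparison with
  twice the profit makes the classes emerge by themselves, and they are named only in the analysis.

  The 34 is 2 * (1 + 16). A raise is charged to at most one optimal instance of its own demand, and
  to conflicting ones with weight at most 8 * 2: eight piercing edges, each with total
  \<open>coef\<close> at most 2 in a feasible solution. The outer 2 pays for counting charges only
  while an instance is unsatisfied. Keeping the better height class of each tree doubles 34 to 68.

  Two obstacles shape the rest. Additive overhead must fit into a bound proportional to the running
  time of \<open>M\<close>; this needs that time to be positive, which holds from two vertices on,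
  and a separate case below. And \<open>M\<close> is known to be cheap only on genuine runs, so the
  cost analysis has to follow the environments that really occur.\<close>

definition cn :: "nat set set \<Rightarrow> nat \<Rightarrow> nat \<Rightarrow> bool" where
  "cn F u v \<longleftrightarrow> (u, v) \<in> {(x, y). {x, y} \<in> F}\<^sup>*"

lemma cn_refl [simp]: "cn F u u"
  by (simp add: cn_def)

lemma cn_trans [trans]: "cn F u v \<Longrightarrow> cn F v w \<Longrightarrow> cn F u w"
  by (simp add: cn_def)

lemma cn_edge: "{u, v} \<in> F \<Longrightarrow> cn F u v"
  by (auto simp: cn_def)

lemma cn_sym: "cn F u v \<Longrightarrow> cn F v u"
proof -
  have "sym {(x, y). {x, y} \<in> F}"
    by (auto simp: sym_def insert_commute)
  then show "cn F u v \<Longrightarrow> cn F v u"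
    unfolding cn_def by (meson sym_rtrancl symE)
qed

lemma cn_mono: "cn F u v \<Longrightarrow> F \<subseteq> G \<Longrightarrow> cn G u v"
  unfolding cn_def by (rule rtrancl_mono[THEN subsetD]) auto

lemma cn_induct [consumes 1, case_names refl step]:
  assumes "cn F u v" "P u" "\<And>x y. cn F u x \<Longrightarrow> P x \<Longrightarrow> {x, y} \<in> F \<Longrightarrow> P y"
  shows "P v"
  using assms(1) unfolding cn_def
proof (induction rule: rtrancl_induct)
  case base
  then show ?case by (rule assms(2))
next
  case (step y z)
  then show ?case using assms(3)[of y z] by (simp add: cn_def)
qed

lemma cn_closed:
  assumes "cn F u v" "u \<in> A" "\<And>x y. x \<in> A \<Longrightarrow> {x, y} \<in> F \<Longrightarrow> y \<in> A"
  shows "v \<in> A"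
  using assms(1) by (induction rule: cn_induct) (use assms in auto)

text \<open>A walk from \<open>a\<close> that uses the deleted edge visits \<open>x\<close>; while
  \<open>x\<close> is out of reach, the deletion changes nothing.\<close>

lemma cn_delete:
  assumes "cn F a b"
  shows "cn (F - {{x, y}}) a b \<or> cn F a x"
  using assms
proof (induction rule: cn_induct)
  case (step v w)
  show ?case
  proof (cases "cn F a x")
    case False
    then have "v \<noteq> x" "w \<noteq> x"
      using step cn_trans[OF step(1) cn_edge[OF step(2)]] by auto
    then have "{v, w} \<in> F - {{x, y}}"
      using step by (auto simp: doubleton_eq_iff)
    then have "cn (F - {{x, y}}) v w" by (rule cn_edge)
    then show ?thesis using False step.IH cn_trans[of "F - {{x, y}}" a v w] by blast
  qed auto
qed auto

lemma cn_two_sides: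
  assumes "cn F x v"
  shows "cn (F - {{x, y}}) x v \<or> cn (F - {{x, y}}) y v"
  using assms
proof (induction rule: cn_induct)
  case (step v w)
  show ?case
  proof (cases "{v, w} = {x, y}")
    case True
    then show ?thesis by (auto simp: doubleton_eq_iff)
  next
    case False
    then have vw: "cn (F - {{x, y}}) v w" using step(2) by (intro cn_edge) auto
    show ?thesis using step.IH cn_trans[OF _ vw] by blast
  qed
qed auto

lemma path_between_cn:
  assumes "successively (\<lambda>x y. {x, y} \<in> F) p" "p \<noteq> []"
  shows "cn F (hd p) (last p)"
  using assms
proof (induction p)
  case (Cons a p)
  then show ?case
    by (cases p) (auto intro: cn_trans[OF cn_edge])
qed auto

lemma cn_path_between:
  assumes "cn F a b"
  shows "\<exists>p. path_between F a b p"
  using assms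
proof (induction rule: cn_induct)
  case refl
  show ?case by (rule exI[of _ "[a]"]) (simp add: path_between_def)
next
  case (step v w)
  then obtain p where p: "path_between F a v p" by blast
  show ?case
  proof (cases "w \<in> set p")
    case True
    then obtain q r where qr: "p = q @ w # r" by (meson split_list)
    have "path_between F a w (q @ [w])"
    proof -
      have "successively (\<lambda>x y. {x, y} \<in> F) (q @ [w])"
        using p unfolding path_between_def qr successively_append_iff by simp
      then show ?thesis using p unfolding path_between_def qr by (cases q) auto
    qed
    then show ?thesis by blast
  next
    case False
    have "path_between F a w (p @ [w])"
      using p step(2) False unfolding path_between_def
      by (auto simp: successively_append_iff)
    then show ?thesis by blast
  qed
qed

text \<open>In a tree these separating edges are the edges of the path. Using this set in place of a
  vertex list turns path arguments into Boolean algebra, by \<open>P_sd\<close>.\<close>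

definition cut :: "nat set set \<Rightarrow> nat \<Rightarrow> nat \<Rightarrow> nat set set" where
  "cut E u v = {e \<in> E. \<not> cn (E - {e}) u v}"

definition pedges :: "nat list \<Rightarrow> nat set set" where
  "pedges p = {{x, y} | x y. (x, y) \<in> set (zip p (tl p))}"

lemma pedges_simps [simp]:
  "pedges [] = {}" "pedges [a] = {}" "pedges (a # b # p) = insert {a, b} (pedges (b # p))"
  by (auto simp: pedges_def)

lemma pedges_subset: "successively (\<lambda>x y. {x, y} \<in> F) p \<Longrightarrow> pedges p \<subseteq> F"
  by (induction p rule: induct_list012) auto

lemma pedges_verts: "e \<in> pedges p \<Longrightarrow> e \<subseteq> set p"
  by (induction p rule: induct_list012) auto

lemma successively_pedges: "successively (\<lambda>x y. {x, y} \<in> pedges p) p"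
proof (induction p rule: induct_list012)
  case (3 a b p)
  then show ?case by (auto elim: successively_mono)
qed auto

lemma cycle_free_edge:
  assumes "\<nexists>p. cycle E p" "{x, y} \<in> E" "x \<noteq> y"
  shows "\<not> cn (E - {{x, y}}) x y"
proof
  assume "cn (E - {{x, y}}) x y"
  then obtain p where p: "path_between (E - {{x, y}}) x y p"
    using cn_path_between by blast
  have "length p \<ge> 3"
  proof (rule ccontr)
    assume "\<not> length p \<ge> 3"
    then consider "length p = 0" | "length p = 1" | "length p = 2" by linarith
    then show False
      using p assms(3)
      by cases (auto simp: path_between_def length_Suc_conv numeral_2_eq_2)
  qed
  moreover have "successively (\<lambda>x y. {x, y} \<in> E) p"
    using p unfolding path_between_def by (auto elim: successively_mono)
  ultimately have "cycle E p"
    using p assms(2) by (auto simp: cycle_def path_between_def insert_commute)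
  then show False using assms(1) by blast
qed

text \<open>Only the first edge contains the head, so the list can be read off from its edge set
  step by step. With \<open>cut_path\<close> this makes tree paths unique and evaluates the
  \<open>THE\<close> in \<open>tree_path\<close>.\<close>

lemma pedges_unique:
  assumes "distinct p" "distinct q" "p \<noteq> []" "q \<noteq> []" "hd p = hd q" "pedges p = pedges q"
  shows "p = q"
  using assms
proof (induction p arbitrary: q)
  case (Cons a p)
  then obtain q' where q: "q = a # q'" by (cases q) auto
  show ?case
  proof (cases p)
    case Nil
    then show ?thesis using Cons q by (cases q') auto
  next
    case p: (Cons b p')
    then obtain c q'' where q': "q' = c # q''" using Cons q by (cases q') auto
    have nin: "e \<in> pedges (b # p') \<Longrightarrow> a \<notin> e" "e \<in> pedges (c # q'') \<Longrightarrow> a \<notin> e" for e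
      using Cons.prems p q q' pedges_verts by fastforce+
    have eq: "insert {a, b} (pedges (b # p')) = insert {a, c} (pedges (c # q''))"
      using Cons.prems p q q' by simp
    have "{a, b} \<in> insert {a, c} (pedges (c # q''))" using eq by blast
    then have bc: "b = c" using nin(2)[of "{a, b}"] by (auto simp: doubleton_eq_iff)
    then have "pedges (b # p') = pedges (c # q'')"
      using eq nin by (metis insertI1 insert_ident)
    then show ?thesis
      using Cons.IH[of "c # q''"] Cons.prems p q q' bc by simp
  qed
qed auto

section \<open>Tree paths as sets of separating edges\<close>

locale tree_net =
  fixes n :: nat and E :: "nat set set"
  assumes tn: "tree_network n E"
begin

abbreviation "P \<equiv> cut E"

lemma edge_form: "e \<in> E \<Longrightarrow> \<exists>x y. e = {x, y} \<and> x < n \<and> y < n \<and> x \<noteq> y"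
  using tn unfolding tree_network_def by blast

lemma no_cycle: "\<nexists>p. cycle E p"
  using tn unfolding tree_network_def by blast

lemma has_path: "u < n \<Longrightarrow> v < n \<Longrightarrow> \<exists>p. path_between E u v p"
  using tn unfolding tree_network_def by blast

lemma conn: "u < n \<Longrightarrow> v < n \<Longrightarrow> cn E u v"
  using has_path[of u v] path_between_cn[of E] unfolding path_between_def by auto

lemma finite_E: "finite E"
proof (rule finite_subset)
  show "E \<subseteq> Pow {..<n}" using edge_form by blast
qed simp

lemma finite_P [simp]: "finite (P u v)"
  using finite_E by (simp add: cut_def)

lemma P_sub: "P u v \<subseteq> E"
  by (auto simp: cut_def)

lemma P_self [simp]: "P u u = {}"
  by (simp add: cut_def)

lemma P_sym: "P u v = P v u"
  unfolding cut_def using cn_sym by blast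

lemma sep_edge: "{x, y} \<in> E \<Longrightarrow> \<not> cn (E - {{x, y}}) x y"
  using cycle_free_edge[OF no_cycle, of x y] edge_form[of "{x, y}"] by (auto simp: doubleton_eq_iff)

text \<open>Deleting a tree edge leaves two sides, and the edge belongs to a path iff the ends are
  on different sides; being on different sides is additive modulo 2.\<close>

lemma P_sd:
  assumes "u < n" "v < n" "w < n"
  shows "P u w = sym_diff (P u v) (P v w)"
proof -
  have "\<not> cn (E - {e}) u w \<longleftrightarrow> (\<not> cn (E - {e}) u v) \<noteq> (\<not> cn (E - {e}) v w)" if e: "e \<in> E" for e
  proof -
    obtain x y where xy: "e = {x, y}" "x < n" using edge_form[OF e] by blast
    have side: "cn (E - {e}) x t \<or> cn (E - {e}) y t" if "t < n" for t
      using cn_two_sides[OF conn[OF xy(2) that]] xy(1) by simp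
    have "\<not> cn (E - {e}) x y" using sep_edge e xy(1) by simp
    then show ?thesis
      using side[OF assms(1)] side[OF assms(2)] side[OF assms(3)] cn_sym[of "E - {e}"] cn_trans[of "E - {e}"]
      by metis
  qed
  then show ?thesis unfolding cut_def by blast
qed

text \<open>Deleting an edge of a simple path leaves both pieces intact, and they end on different
  sides of the edge. Conversely, a path avoiding an edge shows that the edge does not separate its
  ends.\<close>

lemma cut_path:
  assumes p: "path_between E u v p" and uv: "u < n" "v < n"
  shows "pedges p = P u v"
proof (intro equalityI subsetI)
  fix e assume e: "e \<in> pedges p"
  then obtain x y where xy: "e = {x, y}" "(x, y) \<in> set (zip p (tl p))"
    by (auto simp: pedges_def)
  have "\<exists>q r. p = q @ x # y # r"
    using xy(2)
  proof (induction p)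
    case (Cons a p)
    show ?case
    proof (cases p)
      case (Cons b p')
      then consider "x = a" "y = b" | "(x, y) \<in> set (zip p (tl p))" using Cons.prems by auto
      then show ?thesis
      proof cases
        case 1
        then show ?thesis using Cons by (intro exI[of _ "[]"] exI[of _ p']) auto
      next
        case 2
        then obtain q r where "p = q @ x # y # r" using Cons.IH by blast
        then show ?thesis by (intro exI[of _ "a # q"] exI[of _ r]) auto
      qed
    qed (use Cons in auto)
  qed auto
  then obtain q r where qr: "p = q @ x # y # r" by blast
  have eE: "e \<in> E"
    using e p pedges_subset unfolding path_between_def by blast
  have d: "distinct p" "successively (\<lambda>x y. {x, y} \<in> E) p" "hd p = u" "last p = v"
    using p unfolding path_between_def by auto
  \<comment> \<open>Distinctness keeps \<open>y\<close> out of the first piece, so that piece does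
    not use \<open>e\<close>; likewise for \<open>x\<close> and the second piece below.\<close>
  have "successively (\<lambda>x y. {x, y} \<in> E - {e}) (q @ [x])"
  proof -
    have "successively (\<lambda>x y. {x, y} \<in> E) (q @ [x])"
      using d(2) unfolding qr by (auto simp: successively_append_iff)
    moreover have "e \<notin> pedges (q @ [x])"
      using d(1) pedges_verts xy(1) unfolding qr by fastforce
    ultimately show ?thesis
      using successively_pedges[of "q @ [x]"]
      by (auto simp: successively_conv_nth)
  qed
  then have ux: "cn (E - {e}) u x"
    using path_between_cn[of "E - {e}" "q @ [x]"] d(3) unfolding qr by (cases q) auto
  have "successively (\<lambda>x y. {x, y} \<in> E - {e}) (y # r)"
  proof -
    have "successively (\<lambda>x y. {x, y} \<in> E) (y # r)"
      using d(2) unfolding qr by (auto simp: successively_append_iff)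
    moreover have "e \<notin> pedges (y # r)"
      using d(1) pedges_verts xy(1) unfolding qr by fastforce
    ultimately show ?thesis
      using successively_pedges[of "y # r"]
      by (auto simp: successively_conv_nth)
  qed
  then have yv: "cn (E - {e}) y v"
    using path_between_cn[of "E - {e}" "y # r"] d(4) unfolding qr by simp
  have "\<not> cn (E - {e}) x y" using sep_edge eE xy(1) by simp
  then have "\<not> cn (E - {e}) u v"
    using cn_trans[OF cn_trans[OF cn_sym[OF ux]] cn_sym[OF yv]] by blast
  then show "e \<in> P u v" using eE by (simp add: cut_def)
next
  fix e assume e: "e \<in> P u v"
  show "e \<in> pedges p"
  proof (rule ccontr)
    assume "e \<notin> pedges p"
    then have "pedges p \<subseteq> E - {e}"
      using pedges_subset p unfolding path_between_def by blast
    then have "cn (E - {e}) u v"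
      using path_between_cn[OF successively_pedges[of p]] p cn_mono
      unfolding path_between_def by blast
    then show False using e by (simp add: cut_def)
  qed
qed

lemma tree_path_cut:
  assumes uv: "u < n" "v < n"
  shows "tree_path E u v = P u v"
proof -
  obtain p where p: "path_between E u v p" using has_path uv by blast
  have "(THE p. path_between E u v p) = p"
  proof (rule the_equality)
    fix q assume q: "path_between E u v q"
    then show "q = p"
      using cut_path[OF p uv] cut_path[OF q uv] pedges_unique[of q p] p
      unfolding path_between_def by auto
  qed (rule p)
  then show ?thesis
    using cut_path[OF p uv] by (simp add: tree_path_def pedges_def)
qed

lemma P_empty:
  assumes "u < n" "v < n" "P u v = {}"
  shows "u = v"
proof -
  obtain p where p: "path_between E u v p" using has_path assms by blast
  then have "pedges p = {}" using cut_path assms by simp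
  then have "length p = 1" using p by (cases p rule: remdups_adj.cases) (auto simp: path_between_def)
  then show ?thesis using p by (auto simp: path_between_def length_Suc_conv)
qed

text \<open>\<open>w\<close> lies on the path from \<open>a\<close> to \<open>b\<close>: the parts
  before and after \<open>w\<close> share no edge, so nothing cancels in
  \<open>P_sd\<close>.\<close>

definition on :: "nat \<Rightarrow> nat \<Rightarrow> nat \<Rightarrow> bool" where
  "on w a b \<longleftrightarrow> P a w \<inter> P w b = {}"

lemma on_sym: "on w a b \<longleftrightarrow> on w b a"
  using P_sym[of a w] P_sym[of w b] unfolding on_def by auto

lemma on_iff:
  assumes "a < n" "b < n" "w < n"
  shows "on w a b \<longleftrightarrow> P a w \<subseteq> P a b"
  using P_sd[of a w b] assms unfolding on_def by blast

lemma on_un: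
  assumes "a < n" "b < n" "w < n" "on w a b"
  shows "P a b = P a w \<union> P w b"
  using P_sd[of a w b] assms unfolding on_def by blast

lemma on_self [simp]: "on a a b" "on b a b"
  by (auto simp: on_def)

lemma on_trans:
  assumes "a < n" "b < n" "w < n" "x < n" "on w a b" "on x a w"
  shows "on x a b"
  using assms on_iff[of a b w] on_iff[of a w x] on_iff[of a b x] by auto

lemma edge_ends:
  assumes "e \<in> E"
  obtains x y where "x < n" "y < n" "x \<noteq> y" "e = {x, y}" "P x y = {e}"
    "\<And>a b. a < n \<Longrightarrow> b < n \<Longrightarrow> e \<in> P a b \<Longrightarrow> on x a b \<and> on y a b"
proof -
  obtain x y where xy: "e = {x, y}" "x < n" "y < n" "x \<noteq> y" using edge_form assms by blast
  have Pxy: "P x y = {e}"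
  proof -
    have "cn (E - {g}) x y" if "g \<noteq> e" for g
      using that assms xy(1) by (intro cn_edge) auto
    then show ?thesis using sep_edge[of x y] assms xy(1) unfolding cut_def by blast
  qed
  have on1: "on x a b" if ab: "a < n" "b < n" "e \<in> P a b" "e = {x, y}" "x < n" for a b x y
  proof (rule ccontr)
    assume "\<not> on x a b"
    then obtain g where g: "g \<in> P a x" "g \<in> P x b" unfolding on_def by blast
    then have "g \<notin> P a b" "g \<in> E" using P_sd[of a x b] ab P_sub by blast+
    then have 1: "cn (E - {g}) a b" by (simp add: cut_def)
    have "\<not> cn (E - {g}) a x" using g by (simp add: cut_def)
    \<comment> \<open>With \<open>g\<close> already gone, \<open>x\<close> cannot be reached from
      \<open>a\<close>; dropping \<open>e\<close> as well then keeps \<open>a\<close> and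
      \<open>b\<close> connected, although \<open>e\<close> separates them.\<close>
    then have "cn (E - {g} - {{x, y}}) a b" using cn_delete[OF 1, of x y] by blast
    then have "cn (E - {e}) a b" using ab(4) by (auto elim!: cn_mono)
    then show False using ab(3) by (simp add: cut_def)
  qed
  show ?thesis
  proof (rule that[OF xy(2,3,4,1) Pxy])
    fix a b assume "a < n" "b < n" "e \<in> P a b"
    then show "on x a b \<and> on y a b"
      using on1[of a b x y] on1[of a b y x] xy by (simp add: insert_commute)
  qed
qed

text \<open>The end of \<open>e\<close> away from \<open>w\<close>: the path to it is the shortest
  from \<open>w\<close> through \<open>e\<close>, hence an initial segment of all the
  others.\<close>

lemma far_end:
  assumes "e \<in> E" "w < n"
  obtains y where "y < n" "e \<in> P w y" "\<And>b. b < n \<Longrightarrow> e \<in> P w b \<Longrightarrow> P w y \<subseteq> P w b"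
proof -
  obtain x y where xy: "x < n" "y < n" "P x y = {e}"
    "\<And>a b. a < n \<Longrightarrow> b < n \<Longrightarrow> e \<in> P a b \<Longrightarrow> on x a b \<and> on y a b"
    using edge_ends[OF assms(1)] by metis
  have "e \<in> P w x \<or> e \<in> P w y" using P_sd[of w x y] xy assms by blast
  then show ?thesis
  proof
    assume e: "e \<in> P w x"
    show ?thesis
    proof (rule that[OF xy(1) e])
      fix b assume "b < n" "e \<in> P w b"
      then show "P w x \<subseteq> P w b" using xy(4)[of w b] on_iff[of w b x] xy(1) assms by simp
    qed
  next
    assume e: "e \<in> P w y"
    show ?thesis
    proof (rule that[OF xy(2) e])
      fix b assume "b < n" "e \<in> P w b"
      then show "P w y \<subseteq> P w b" using xy(4)[of w b] on_iff[of w b y] xy(2) assms by simp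
    qed
  qed
qed

text \<open>A branch at \<open>z\<close> is represented by its first edge. This makes "same branch"
  transitive in \<open>not_on_trans\<close> and lets one edge pierce a whole branch in
  \<open>vertex_pierce\<close>.\<close>

lemma first_edge:
  assumes z: "z < n" "x < n" "z \<noteq> x"
  obtains z' f where "z' < n" "P z z' = {f}" "f \<in> P z x"
    "\<And>y. y < n \<Longrightarrow> P z x \<inter> P z y \<noteq> {} \<Longrightarrow> f \<in> P z y"
proof -
  let ?A = "{y. y < n \<and> y \<noteq> z \<and> on y z x}"
  have "x \<in> ?A" using z by auto
  then obtain y where y: "y \<in> ?A" and ymin: "\<And>y'. y' \<in> ?A \<Longrightarrow> card (P z y) \<le> card (P z y')"
    using ex_has_least_nat[of "\<lambda>y. y \<in> ?A" x "\<lambda>y. card (P z y)"] by blast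
  then have "P z y \<noteq> {}" using P_empty[of z y] z by blast
  then obtain f where f: "f \<in> P z y" by blast
  then have fE: "f \<in> E" using P_sub by blast
  obtain a b where ab: "a < n" "b < n" "P a b = {f}"
    "\<And>c d. c < n \<Longrightarrow> d < n \<Longrightarrow> f \<in> P c d \<Longrightarrow> on a c d \<and> on b c d"
    using edge_ends[OF fE] by metis
  \<comment> \<open>\<open>c\<close> is the end of \<open>f\<close> nearer to \<open>z\<close>.
    Since \<open>y\<close> is a vertex other than \<open>z\<close> at least distance on the path,
    \<open>c\<close> can only be \<open>z\<close>.\<close>
  have near: "\<exists>c d. c < n \<and> d < n \<and> P c d = {f} \<and> f \<notin> P z c \<and> on c z y \<and> on d z y"
  proof (cases "f \<in> P z a")
    have o: "on a z y \<and> on b z y" using ab(4)[of z y] f y z by simp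
    case True
    then have "f \<notin> P z b" using P_sd[of z a b] ab z by blast
    moreover have "P b a = {f}" using ab P_sym[of a b] by simp
    ultimately show ?thesis using ab(1,2) o by (intro exI[of _ b] exI[of _ a]) simp
  next
    case False
    then show ?thesis using ab(1-3) ab(4)[of z y] f y z by (intro exI[of _ a] exI[of _ b]) simp
  qed
  then obtain c d where cd: "c < n" "d < n" "P c d = {f}" "f \<notin> P z c" "on c z y" "on d z y" by blast
  have "c = z"
  proof (rule ccontr)
    assume "c \<noteq> z"
    then have "c \<in> ?A" using cd y z on_trans[of z x y c] by blast
    then have "card (P z y) \<le> card (P z c)" by (rule ymin)
    moreover have "P z c \<subset> P z y" using cd y z f on_iff[of z y c] by blast
    ultimately show False using psubset_card_mono[of "P z y"] by (metis finite_P linorder_not_less)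
  qed
  then have zd: "P z d = {f}" using cd by simp
  have fx: "f \<in> P z x" using f y z on_iff[of z x y] by blast
  have "f \<in> P z v" if v: "v < n" "P z x \<inter> P z v \<noteq> {}" for v
  proof -
    obtain e where e: "e \<in> P z x" "e \<in> P z v" using v by blast
    obtain u where u: "u < n" "e \<in> P z u" "\<And>b. b < n \<Longrightarrow> e \<in> P z b \<Longrightarrow> P z u \<subseteq> P z b"
      using far_end[of e z] e P_sub z by blast
    \<comment> \<open>If the shortest path from \<open>z\<close> through \<open>e\<close> missed
      \<open>f\<close>, then \<open>f\<close>, and with it its end \<open>z\<close>, would lie
      between \<open>u\<close> and \<open>x\<close>; but \<open>P z u\<close> is contained in
      \<open>P z x\<close>.\<close>
    have "f \<in> P z u"
    proof (rule ccontr)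
      assume nf: "f \<notin> P z u"
      have "P z u \<subseteq> P z x" using u e z by blast
      then have "f \<in> P u x" using P_sd[of z u x] fx nf z u by blast
      moreover obtain a b where ab: "f = {a, b}" "P a b = {f}" "a < n" "b < n"
        "\<And>c d. c < n \<Longrightarrow> d < n \<Longrightarrow> f \<in> P c d \<Longrightarrow> on a c d \<and> on b c d"
        using edge_ends[OF fE] by metis
      moreover have "z = a \<or> z = b"
      proof -
        have "on a z d" "on b z d" using ab z cd zd by auto
        then have "P z a \<subseteq> {f}" "P z b \<subseteq> {f}" using on_iff[of z d] z cd ab zd by auto
        then have "P z a = {} \<or> P z a = {f}" "P z b = {} \<or> P z b = {f}" by (auto dest: subset_singletonD)
        moreover have "sym_diff (P z a) (P z b) = {f}" using P_sd[of a z b] P_sym[of a z] ab z by simp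
        ultimately have "P z a = {} \<or> P z b = {}" by auto
        then show ?thesis using P_empty[of z a] P_empty[of z b] z ab by blast
      qed
      ultimately have "on z u x" using u z by blast
      then have "P u z \<inter> P z x = {}" by (simp add: on_def)
      then show False using \<open>P z u \<subseteq> P z x\<close> u(2) P_sym[of u z] by blast
    qed
    then show ?thesis using u(3)[OF v(1) e(2)] by blast
  qed
  then show ?thesis using that[of d f] cd zd fx by blast
qed

text \<open>\<open>\<not> on w a b\<close> says that \<open>a\<close> and \<open>b\<close> lie in
  the same branch at \<open>w\<close>, that is, share the first edge out of
  \<open>w\<close>.\<close>

lemma not_on_trans:
  assumes "w < n" "a < n" "b < n" "c < n" "\<not> on w a b" "\<not> on w b c"
  shows "\<not> on w a c"
proof -
  have "w \<noteq> b" using assms by auto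
  then obtain f where f: "f \<in> P w b" "\<And>y. y < n \<Longrightarrow> P w b \<inter> P w y \<noteq> {} \<Longrightarrow> f \<in> P w y"
    using first_edge[of w b] assms by metis
  have "f \<in> P w a" "f \<in> P w c"
    using assms f P_sym[of a w] P_sym[of b w] unfolding on_def by blast+
  then show ?thesis unfolding on_def using P_sym[of a w] by blast
qed

text \<open>Take the last common vertex of the paths from \<open>a\<close> to \<open>b\<close> and
  from \<open>a\<close> to \<open>c\<close>: if the remainders shared an edge, the far end of that
  edge would be a later common vertex.\<close>

lemma median:
  assumes "a < n" "b < n" "c < n"
  obtains w where "w < n" "on w a b" "on w a c" "on w b c"
proof -
  let ?A = "{w. w < n \<and> on w a b \<and> on w a c}"
  have "a \<in> ?A" using assms by auto
  moreover have "card (P a w) < Suc (card E)" for w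
    using card_mono[OF finite_E P_sub[of a w]] by simp
  ultimately obtain w where w: "w \<in> ?A" and wmax: "\<And>w'. w' \<in> ?A \<Longrightarrow> card (P a w') \<le> card (P a w)"
    using ex_has_greatest_nat[of "\<lambda>w. w \<in> ?A" a "\<lambda>w. card (P a w)" "Suc (card E)"] by blast
  have "on w b c"
  proof (rule ccontr)
    assume "\<not> on w b c"
    then obtain e where e: "e \<in> P w b" "e \<in> P w c" unfolding on_def using P_sym[of b w] by blast
    obtain y where y: "y < n" "e \<in> P w y" "\<And>b. b < n \<Longrightarrow> e \<in> P w b \<Longrightarrow> P w y \<subseteq> P w b"
      using far_end[of e w] e P_sub w by blast
    have s: "P w y \<subseteq> P w b" "P w y \<subseteq> P w c" using y e assms by blast+
    have u: "P a b = P a w \<union> P w b" "P a c = P a w \<union> P w c" "P a w \<inter> P w b = {}"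
      using on_un[of a b w] on_un[of a c w] w assms unfolding on_def by auto
    have "P a y = P a w \<union> P w y" using P_sd[of a w y] s u w y assms by blast
    moreover from this have "on y a b" "on y a c"
      using on_iff[of a b y] on_iff[of a c y] y w assms s u by auto
    ultimately have "card (P a w \<union> P w y) \<le> card (P a w)" using wmax[of y] y(1) by simp
    moreover have "P a w \<subset> P a w \<union> P w y" using s u y by blast
    ultimately show False using psubset_card_mono[of "P a w \<union> P w y"] by (metis finite_P finite_Un linorder_not_less)
  qed
  then show ?thesis using that w by blast
qed

text \<open>Both edges are incident to the projection of the vertex \<open>w\<close> onto the path.\<close>

lemma vertex_pierce:
  assumes "a < n" "b < n" "w < n"
  obtains F where "finite F" "card F \<le> 2" "F \<subseteq> P a b"
    "\<And>a2 b2. a2 < n \<Longrightarrow> b2 < n \<Longrightarrow> on w a2 b2 \<Longrightarrow> P a b \<inter> P a2 b2 \<noteq> {} \<Longrightarrow> F \<inter> P a2 b2 \<noteq> {}"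
proof -
  obtain m where m: "m < n" "on m a b" "on m a w" "on m b w" using median[OF assms] by blast
  \<comment> \<open>One half of the path, seen from the projection \<open>m\<close>: a path from
    \<open>w\<close> that meets this half enters it at \<open>m\<close> and uses its first
    edge.\<close>
  have one: "\<exists>F. finite F \<and> card F \<le> 1 \<and> F \<subseteq> P a m \<and>
     (\<forall>c<n. P a m \<inter> P w c \<noteq> {} \<longrightarrow> F \<inter> P w c \<noteq> {})" if a: "a < n" "on m a w" for a
  proof (cases "a = m")
    case True
    then show ?thesis by (intro exI[of _ "{}"]) auto
  next
    case False
    then obtain f where f: "f \<in> P m a" "\<And>y. y < n \<Longrightarrow> P m a \<inter> P m y \<noteq> {} \<Longrightarrow> f \<in> P m y"
      using first_edge[of m a] m a by metis
    have "f \<in> P w c" if c: "c < n" "P a m \<inter> P w c \<noteq> {}" for c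
    proof -
      have d: "P a m \<inter> P m w = {}" using a by (simp add: on_def)
      have sd: "P m c = sym_diff (P m w) (P w c)" using P_sd[of m w c] m assms c by blast
      then have "P m a \<inter> P m c \<noteq> {}" using c d P_sym[of a m] P_sym[of m w] by blast
      then have "f \<in> P m c" using f c by blast
      then show ?thesis using sd d f(1) P_sym[of a m] by blast
    qed
    then show ?thesis using f(1) P_sym[of a m] by (intro exI[of _ "{f}"]) auto
  qed
  obtain F1 where F1: "finite F1" "card F1 \<le> 1" "F1 \<subseteq> P a m"
     "\<And>c. c < n \<Longrightarrow> P a m \<inter> P w c \<noteq> {} \<Longrightarrow> F1 \<inter> P w c \<noteq> {}" using one[of a] m assms by metis
  obtain F2 where F2: "finite F2" "card F2 \<le> 1" "F2 \<subseteq> P b m"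
     "\<And>c. c < n \<Longrightarrow> P b m \<inter> P w c \<noteq> {} \<Longrightarrow> F2 \<inter> P w c \<noteq> {}" using one[of b] m assms by metis
  have ab: "P a b = P a m \<union> P b m" using on_un[of a b m] m assms P_sym[of b m] by simp
  show ?thesis
  proof (rule that[of "F1 \<union> F2"])
    show "card (F1 \<union> F2) \<le> 2" using card_Un_le[of F1 F2] F1 F2 by linarith
    fix a2 b2 assume *: "a2 < n" "b2 < n" "on w a2 b2" "P a b \<inter> P a2 b2 \<noteq> {}"
    have "P a2 b2 = P w a2 \<union> P w b2" using on_un[of a2 b2 w] * assms P_sym[of a2 w] by simp
    then show "(F1 \<union> F2) \<inter> P a2 b2 \<noteq> {}" using F1(4) F2(4) * ab by blast
  qed (use F1 F2 ab in auto)
qed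

end

section \<open>Logarithmic layering of the paths of a tree\<close>

context tree_net
begin

definition convex :: "nat set \<Rightarrow> bool" where
  "convex C \<longleftrightarrow> C \<subseteq> {..<n} \<and> (\<forall>a\<in>C. \<forall>b\<in>C. \<forall>w<n. on w a b \<longrightarrow> w \<in> C)"

text \<open>The guards control the exits of a subtree. They come from earlier splits; only their
  number enters the piercing bound, so it has to stay bounded along the recursion.\<close>

definition guarded :: "nat set \<Rightarrow> nat set \<Rightarrow> bool" where
  "guarded B C \<longleftrightarrow> finite B \<and> B \<subseteq> {..<n} \<and> (\<forall>c\<in>C. \<forall>x<n. x \<notin> C \<longrightarrow> (\<exists>w\<in>B. on w c x))"

text \<open>The branch of \<open>C\<close> at \<open>z\<close> that contains \<open>x\<close>;
  \<open>z\<close> itself is in no branch.\<close>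

definition component :: "nat set \<Rightarrow> nat \<Rightarrow> nat \<Rightarrow> nat set" where
  "component C z x = {y \<in> C. \<not> on z x y}"

text \<open>Layers are compared only for paths with both ends in \<open>C\<close>; paths with an end
  outside must be met whatever their layer, which is the task of the guards. The 4 allows three
  guards and the splitting vertex.\<close>

definition layered :: "nat set \<Rightarrow> nat \<Rightarrow> (nat \<Rightarrow> nat \<Rightarrow> nat) \<Rightarrow> bool" where
  "layered C K lam \<longleftrightarrow> (\<forall>a\<in>C. \<forall>b\<in>C. lam a b < K) \<and>
     (\<forall>a\<in>C. \<forall>b\<in>C. \<exists>W. finite W \<and> card W \<le> 4 \<and> W \<subseteq> {..<n} \<and>
        (\<forall>a2<n. \<forall>b2<n. P a b \<inter> P a2 b2 \<noteq> {} \<longrightarrow> (a2 \<in> C \<longrightarrow> b2 \<in> C \<longrightarrow> lam a b \<le> lam a2 b2) \<longrightarrow>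
           (\<exists>w\<in>W. on w a2 b2)))"

lemma on_refl_iff: "z < n \<Longrightarrow> x < n \<Longrightarrow> on z x x \<longleftrightarrow> z = x"
  using P_empty[of z x] P_sym[of x z] by (auto simp: on_def)

lemma component_self: "x \<in> C \<Longrightarrow> C \<subseteq> {..<n} \<Longrightarrow> z < n \<Longrightarrow> x \<noteq> z \<Longrightarrow> x \<in> component C z x"
  using on_refl_iff[of z x] by (auto simp: component_def)

lemma component_eq:
  assumes "C \<subseteq> {..<n}" "z < n" "x \<in> C" "y \<in> component C z x"
  shows "component C z y = component C z x"
proof -
  have y: "y < n" "x < n" "\<not> on z x y" "\<not> on z y x"
    using assms on_sym[of z x y] by (auto simp: component_def)
  have "on z y t \<longleftrightarrow> on z x t" if "t < n" for t
    using not_on_trans[of z x y t] not_on_trans[of z y x t] y assms that by blast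
  then show ?thesis using assms(1) by (auto simp: component_def)
qed

lemma component_convex:
  assumes "convex C" "z < n" "x \<in> C"
  shows "convex (component C z x)"
proof -
  have C: "C \<subseteq> {..<n}" using assms by (simp add: convex_def)
  have "w \<in> component C z x"
    if ab: "a \<in> component C z x" "b \<in> component C z x" "w < n" "on w a b" for a b w
  proof -
    have m: "a \<in> C" "b \<in> C" "a < n" "b < n" "x < n" "\<not> on z x a" "\<not> on z x b"
      using ab C assms by (auto simp: component_def)
    have wC: "w \<in> C" using assms m ab unfolding convex_def by blast
    have "\<not> on z a b" using not_on_trans[of z a x b] m assms on_sym[of z x a] by blast
    have "\<not> on z a w"
      using on_trans[of a b w z] ab m assms \<open>\<not> on z a b\<close> by blast
    then have "\<not> on z x w" using not_on_trans[of z x a w] m assms ab by blast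
    then show ?thesis using wC by (simp add: component_def)
  qed
  then show ?thesis using C unfolding convex_def component_def by blast
qed

lemma component_guarded:
  assumes "guarded B C" "z < n" "x \<in> C" "C \<subseteq> {..<n}"
  shows "guarded (insert z B) (component C z x)"
proof -
  have "\<exists>w\<in>insert z B. on w c t" if c: "c \<in> component C z x" "t < n" "t \<notin> component C z x" for c t
  proof (cases "t \<in> C")
    case True
    have "c < n" "x < n" "\<not> on z x c" using c assms by (auto simp: component_def)
    moreover have "on z x t" using c True by (simp add: component_def)
    ultimately have "on z c t" using not_on_trans[of z x c t] c assms by blast
    then show ?thesis by blast
  next
    case False
    have "c \<in> C" using c by (simp add: component_def)
    then show ?thesis using assms(1) False c(2) unfolding guarded_def by blast
  qed
  then show ?thesis using assms unfolding guarded_def by auto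
qed

text \<open>Splitting at a median of three guards leaves at most one of them visible from each component.\<close>

lemma component_guarded_median:
  assumes "guarded B C" "w < n" "x \<in> C" "C \<subseteq> {..<n}"
    and med: "\<And>g g'. g \<in> B \<Longrightarrow> g' \<in> B \<Longrightarrow> g \<noteq> g' \<Longrightarrow> on w g g'"
  shows "\<exists>B'. guarded B' (component C w x) \<and> card B' \<le> 2"
proof -
  let ?V = "{g \<in> B. \<not> on w x g}"
  have B: "finite B" "B \<subseteq> {..<n}" using assms by (auto simp: guarded_def)
  have "g = g'" if "g \<in> ?V" "g' \<in> ?V" for g g'
  proof (rule ccontr)
    assume "g \<noteq> g'"
    then have "on w g g'" using med that by blast
    moreover have "g < n" "g' < n" "x < n" using that B assms by auto
    ultimately show False
      using not_on_trans[of w g x g'] that assms on_sym[of w x g] by blast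
  qed
  then have "card ?V \<le> 1"
    using card_le_Suc0_iff_eq[of ?V] B by auto
  then have card: "card (insert w ?V) \<le> 2"
    using card_insert_le_m1[of 2 ?V w] by simp
  have "\<exists>v\<in>insert w ?V. on v c t"
    if c: "c \<in> component C w x" "t < n" "t \<notin> component C w x" for c t
  proof -
    obtain v where v: "v \<in> insert w B" "on v c t"
      using component_guarded[OF assms(1-4)] c unfolding guarded_def by blast
    have m: "c < n" "x < n" "\<not> on w x c" "v < n" using c v B assms by (auto simp: component_def)
    show ?thesis
    proof (cases "v \<in> insert w ?V")
      case False
      then have "on w x v" using v by blast
      then have "on w c v" using not_on_trans[of w x c v] m assms by blast
      then have "on w c t" using on_trans[of c t v w] v m c assms by blast
      then show ?thesis by blast
    qed (use v in blast)
  qed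
  then have "guarded (insert w ?V) (component C w x)"
    using B assms unfolding guarded_def by auto
  then show ?thesis using card by blast
qed

text \<open>Paths through \<open>z\<close> form a new top layer, the others stay in one component
  and keep its layering. Against a top path, \<open>z\<close> meets the other top paths and the
  guards meet all that leaves \<open>C\<close>.\<close>

lemma layered_split:
  assumes C: "convex C" and B: "guarded B C" "card B \<le> 3" and z: "z < n"
    and D: "\<And>x. x \<in> C \<Longrightarrow> x \<noteq> z \<Longrightarrow> \<exists>lam. layered (component C z x) K lam"
  shows "\<exists>lam. layered C (Suc K) lam"
proof -
  have Cn: "C \<subseteq> {..<n}" using C by (simp add: convex_def)
  \<comment> \<open>The choice depends on the component only as a set, so all pairs of one component
    are compared by the same function.\<close>
  define Lam where "Lam D = (SOME lam. layered D K lam)" for D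
  have Lam: "layered (component C z x) K (Lam (component C z x))" if "x \<in> C" "x \<noteq> z" for x
    unfolding Lam_def using someI_ex[OF D[OF that]] .
  define lam where "lam a b = (if on z a b then K else Lam (component C z a) a b)" for a b
  have inD: "a \<in> component C z a \<and> b \<in> component C z a \<and> a \<noteq> z"
    if "a \<in> C" "b \<in> C" "\<not> on z a b" for a b
  proof -
    have "a \<noteq> z" using that(3) by auto
    then show ?thesis using that component_self[of a C z] Cn z by (auto simp: component_def)
  qed
  have lt: "lam a b < (if on z a b then Suc K else K)" if "a \<in> C" "b \<in> C" for a b
    using inD[OF that] Lam[of a] that unfolding layered_def lam_def by auto
  have "\<exists>W. finite W \<and> card W \<le> 4 \<and> W \<subseteq> {..<n} \<and>
        (\<forall>a2<n. \<forall>b2<n. P a b \<inter> P a2 b2 \<noteq> {} \<longrightarrow> (a2 \<in> C \<longrightarrow> b2 \<in> C \<longrightarrow> lam a b \<le> lam a2 b2) \<longrightarrow>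
           (\<exists>w\<in>W. on w a2 b2))" if ab: "a \<in> C" "b \<in> C" for a b
  proof (cases "on z a b")
    case True
    \<comment> \<open>The paths share a vertex \<open>y\<close>, which is in \<open>C\<close> by
      convexity; between \<open>y\<close> and the end outside there is a guard.\<close>
    have guard: "\<exists>w\<in>B. on w a2 b2"
      if 2: "a2 < n" "b2 < n" "P a b \<inter> P a2 b2 \<noteq> {}" "a2 \<notin> C" for a2 b2
    proof -
      obtain e where e: "e \<in> P a b" "e \<in> P a2 b2" using 2 by blast
      obtain y where y: "y < n" "\<And>a b. a < n \<Longrightarrow> b < n \<Longrightarrow> e \<in> P a b \<Longrightarrow> on y a b"
        using edge_ends[of e] e P_sub by (metis subsetD)
      have "on y a b" "on y a2 b2" using y(2) e ab 2 Cn by auto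
      then have "y \<in> C" using C ab y(1) unfolding convex_def by blast
      then obtain w where w: "w \<in> B" "on w y a2" using B 2 unfolding guarded_def by blast
      have "w < n" using w B unfolding guarded_def by blast
      then have "on w a2 b2"
        using on_trans[of a2 b2 y w] \<open>on y a2 b2\<close> w 2 y(1) on_sym[of w y a2] by blast
      then show ?thesis using w by blast
    qed
    have "\<exists>w\<in>insert z B. on w a2 b2"
      if h: "a2 < n" "b2 < n" "P a b \<inter> P a2 b2 \<noteq> {}" "a2 \<in> C \<longrightarrow> b2 \<in> C \<longrightarrow> lam a b \<le> lam a2 b2" for a2 b2
    proof -
      consider "a2 \<notin> C" | "b2 \<notin> C" | "a2 \<in> C" "b2 \<in> C" by blast
      then show ?thesis
      proof cases
        case 1
        then show ?thesis using guard[of a2 b2] h by blast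
      next
        case 2
        then show ?thesis using guard[of b2 a2] h P_sym[of a2 b2] on_sym[of _ a2 b2] by auto
      next
        case 3
        then have "K \<le> lam a2 b2" using h True by (simp add: lam_def)
        then have "on z a2 b2" using lt[OF 3] by (auto split: if_splits)
        then show ?thesis by blast
      qed
    qed
    moreover have "card (insert z B) \<le> 4" using B card_insert_le_m1[of 4 B z] by simp
    ultimately show ?thesis
      using B z unfolding guarded_def by (intro exI[of _ "insert z B"]) auto
  next
    case False
    let ?D = "component C z a"
    note i = inD[OF ab False]
    then obtain W where W: "finite W" "card W \<le> 4" "W \<subseteq> {..<n}"
      "\<And>a2 b2. a2 < n \<Longrightarrow> b2 < n \<Longrightarrow> P a b \<inter> P a2 b2 \<noteq> {} \<Longrightarrow>
         (a2 \<in> ?D \<longrightarrow> b2 \<in> ?D \<longrightarrow> Lam ?D a b \<le> Lam ?D a2 b2) \<Longrightarrow> \<exists>w\<in>W. on w a2 b2"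
      using Lam[OF ab(1)] unfolding layered_def by metis
    have "\<exists>w\<in>W. on w a2 b2"
      if 2: "a2 < n" "b2 < n" "P a b \<inter> P a2 b2 \<noteq> {}" "a2 \<in> C \<longrightarrow> b2 \<in> C \<longrightarrow> lam a b \<le> lam a2 b2" for a2 b2
    \<comment> \<open>If the ends are not both in \<open>?D\<close>, the layer condition of
      \<open>W\<close> is vacuous.\<close>
    proof (rule W(4)[OF 2(1-3)], intro impI)
      assume d: "a2 \<in> ?D" "b2 \<in> ?D"
      have eq: "component C z a2 = ?D" using component_eq[OF Cn z ab(1) d(1)] .
      then have "\<not> on z a2 b2" using d(2) by (auto simp: component_def)
      moreover have "lam a b \<le> lam a2 b2" using 2 d by (auto simp: component_def)
      ultimately show "Lam ?D a b \<le> Lam ?D a2 b2" using False eq by (simp add: lam_def)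
    qed
    then show ?thesis using W by blast
  qed
  moreover have "lam a b < Suc K" if "a \<in> C" "b \<in> C" for a b
    using lt[OF that] by (simp split: if_splits)
  ultimately have "layered C (Suc K) lam"
    unfolding layered_def by blast
  then show ?thesis by blast
qed

text \<open>A vertex minimising the sum of distances: crossing \<open>e\<close> towards
  \<open>x\<close> shortens by one the distances to the vertices behind \<open>e\<close> and
  lengthens all others by one, so at most half of \<open>C\<close> lies behind
  \<open>e\<close>.\<close>

lemma centroid:
  assumes C: "convex C" "C \<noteq> {}"
  obtains z where "z \<in> C" "\<And>x. x \<in> C \<Longrightarrow> x \<noteq> z \<Longrightarrow> 2 * card (component C z x) \<le> card C"
proof -
  have Cn: "C \<subseteq> {..<n}" using C by (simp add: convex_def)
  then have fin: "finite C" by (rule finite_subset) simp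
  define f where "f z = (\<Sum>x\<in>C. int (card (P z x)))" for z
  obtain z where z: "z \<in> C" and zmin: "\<And>z'. z' \<in> C \<Longrightarrow> f z \<le> f z'"
  proof (rule that[of "arg_min_on f C"])
    show "arg_min_on f C \<in> C" using arg_min_if_finite(1)[OF fin C(2)] .
    show "f (arg_min_on f C) \<le> f z'" if "z' \<in> C" for z' using arg_min_least[OF fin C(2) that] .
  qed
  have "2 * card (component C z x) \<le> card C" if x: "x \<in> C" "x \<noteq> z" for x
  proof -
    have zx: "z < n" "x < n" using z x Cn by auto
    obtain z' e where e: "z' < n" "P z z' = {e}" "e \<in> P z x"
      "\<And>y. y < n \<Longrightarrow> P z x \<inter> P z y \<noteq> {} \<Longrightarrow> e \<in> P z y"
      using first_edge[of z x] zx x by metis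
    have "on z' z x" using on_iff[of z x z'] e zx by simp
    then have z': "z' \<in> C" using C z x e(1) unfolding convex_def by blast
    let ?D = "{y \<in> C. e \<in> P z y}"
    have sub: "component C z x \<subseteq> ?D"
    proof
      fix y assume y: "y \<in> component C z x"
      then have "y \<in> C" "y < n" "\<not> on z x y" using Cn by (auto simp: component_def)
      then show "y \<in> ?D" using e(4)[of y] P_sym[of x z] by (auto simp: on_def)
    qed
    have dist: "int (card (P z' y)) = int (card (P z y)) + 1 - 2 * of_bool (e \<in> P z y)"
      if "y \<in> C" for y
    proof -
      have sd: "P z' y = sym_diff {e} (P z y)"
        using P_sd[of z' z y] P_sym[of z z'] e zx that Cn by auto
      show ?thesis
      proof (cases "e \<in> P z y")
        case True
        then have "P z' y = P z y - {e}" using sd by auto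
        moreover have "card (P z y) > 0" using True card_gt_0_iff by fastforce
        ultimately show ?thesis using True by (simp add: card_Diff_singleton of_nat_diff)
      next
        case False
        then have "P z' y = insert e (P z y)" using sd by auto
        then show ?thesis using False by simp
      qed
    qed
    have "f z' = (\<Sum>y\<in>C. int (card (P z y)) + 1 - 2 * of_bool (e \<in> P z y))"
      unfolding f_def using dist by (intro sum.cong) auto
    also have "\<dots> = f z + int (card C) - 2 * (\<Sum>y\<in>C. of_bool (e \<in> P z y))"
      by (simp add: f_def sum.distrib sum_subtractf sum_distrib_left)
    also have "(\<Sum>y\<in>C. of_bool (e \<in> P z y)) = int (card ?D)"
      using fin by (simp add: of_bool_def sum.If_cases Int_def)
    finally have "2 * card ?D \<le> card C" using zmin[OF z'] by linarith
    moreover have "card (component C z x) \<le> card ?D" using sub fin by (intro card_mono) auto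
    ultimately show ?thesis by linarith
  qed
  then show ?thesis using that z by blast
qed

text \<open>Centroid splits alone would add a guard each time. So a centroid split, which leads from
  two guards to three, is followed by a median split, which need not shrink anything but returns to
  two. This costs two layers per halving.\<close>

lemma layered_exists:
  assumes "convex C" "guarded B C" "card B \<le> 2" "card C < 2 ^ k"
  shows "\<exists>lam. layered C (2 * k) lam"
  using assms
proof (induction k arbitrary: C B)
  case 0
  then have "C = {}" using finite_subset[of C "{..<n}"] by (auto simp: convex_def)
  then show ?case by (auto simp: layered_def)
next
  case (Suc k)
  have Cn: "C \<subseteq> {..<n}" using Suc.prems by (simp add: convex_def)
  have three: "\<exists>lam. layered D (Suc (2 * k)) lam"
    if D: "convex D" "guarded B D" "card B \<le> 3" "card D < 2 ^ k" for D B
  proof -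
    have Dn: "D \<subseteq> {..<n}" using D by (simp add: convex_def)
    have fD: "finite D" using Dn by (rule finite_subset) simp
    have B: "finite B" "B \<subseteq> {..<n}" using D by (auto simp: guarded_def)
    show ?thesis
    proof (cases "n = 0")
      case True
      then have "D = {}" using Dn by auto
      then show ?thesis by (auto simp: layered_def)
    next
      case False
      \<comment> \<open>Fewer than three guards are padded, so that a median is always
        available.\<close>
      have "\<exists>a b c. a < n \<and> b < n \<and> c < n \<and> B \<subseteq> {a, b, c}"
      proof -
        consider "card B = 0" | "card B = 1" | "card B = 2" | "card B = 3" using D by linarith
        then show ?thesis
        proof cases
          case 1
          then show ?thesis using B False by auto
        next
          case 2
          then show ?thesis using B by (auto simp: card_1_singleton_iff)
        next
          case 3
          then show ?thesis using B by (auto simp: card_2_iff)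
        next
          case 4
          then show ?thesis using B by (auto simp: card_3_iff)
        qed
      qed
      then obtain a b c where abc: "a < n" "b < n" "c < n" "B \<subseteq> {a, b, c}" by blast
      obtain w where w: "w < n" "on w a b" "on w a c" "on w b c" using median[OF abc(1-3)] by blast
      then have med: "on w g g'" if "g \<in> B" "g' \<in> B" "g \<noteq> g'" for g g'
        using that abc(4) on_sym[of w] by blast
      show ?thesis
      proof (rule layered_split[OF D(1,2,3) w(1)])
        fix x assume x: "x \<in> D" "x \<noteq> w"
        obtain B' where "guarded B' (component D w x)" "card B' \<le> 2"
          using component_guarded_median[OF D(2) w(1) x(1) Dn med] by blast
        moreover have "card (component D w x) \<le> card D"
          using fD by (intro card_mono) (auto simp: component_def)
        ultimately show "\<exists>lam. layered (component D w x) (2 * k) lam"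
          using Suc.IH component_convex[OF D(1) w(1) x(1)] D(4) by (meson le_less_trans)
      qed
    qed
  qed
  show ?case
  proof (cases "C = {}")
    case True
    then show ?thesis by (auto simp: layered_def)
  next
    case False
    obtain z where z: "z \<in> C" "\<And>x. x \<in> C \<Longrightarrow> x \<noteq> z \<Longrightarrow> 2 * card (component C z x) \<le> card C"
      using centroid[OF Suc.prems(1) False] by blast
    have zn: "z < n" using z Cn by auto
    have "\<exists>lam. layered C (Suc (Suc (2 * k))) lam"
    proof (rule layered_split[OF Suc.prems(1,2) _ zn])
      fix x assume x: "x \<in> C" "x \<noteq> z"
      have "card (insert z B) \<le> 3"
        using Suc.prems(2,3) card_insert_le_m1[of 3 B z] by (simp add: guarded_def)
      moreover have "card (component C z x) < 2 ^ k" using z(2)[OF x] Suc.prems(4) by simp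
      ultimately show "\<exists>lam. layered (component C z x) (Suc (2 * k)) lam"
        using three component_convex[OF Suc.prems(1) zn x(1)]
          component_guarded[OF Suc.prems(2) zn x(1) Cn] by blast
    qed (use Suc.prems in simp)
    then show ?thesis by simp
  qed
qed

text \<open>Each of the at most four vertices is replaced by two edges of the path itself, which
  gives eight.\<close>

theorem layering:
  assumes "n < 2 ^ k"
  obtains lam where "\<And>a b. a < n \<Longrightarrow> b < n \<Longrightarrow> lam a b < 2 * k"
    "\<And>a b. a < n \<Longrightarrow> b < n \<Longrightarrow> \<exists>F. finite F \<and> card F \<le> 8 \<and> F \<subseteq> P a b \<and>
       (\<forall>a2<n. \<forall>b2<n. P a b \<inter> P a2 b2 \<noteq> {} \<longrightarrow> lam a b \<le> lam a2 b2 \<longrightarrow> F \<inter> P a2 b2 \<noteq> {})"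
proof -
  have "\<exists>lam. layered {..<n} (2 * k) lam"
    by (rule layered_exists[of _ "{}"]) (use assms in \<open>auto simp: convex_def guarded_def\<close>)
  then obtain lam where lam: "layered {..<n} (2 * k) lam" by blast
  show ?thesis
  proof (rule that[of lam])
    show "a < n \<Longrightarrow> b < n \<Longrightarrow> lam a b < 2 * k" for a b
      using lam by (simp add: layered_def)
    fix a b assume ab: "a < n" "b < n"
    then obtain W where W: "finite W" "card W \<le> 4" "W \<subseteq> {..<n}"
      "\<And>a2 b2. a2 < n \<Longrightarrow> b2 < n \<Longrightarrow> P a b \<inter> P a2 b2 \<noteq> {} \<Longrightarrow> lam a b \<le> lam a2 b2 \<Longrightarrow>
         \<exists>w\<in>W. on w a2 b2"
      using lam unfolding layered_def by (metis lessThan_iff)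
    have "\<forall>w\<in>W. \<exists>F. finite F \<and> card F \<le> 2 \<and> F \<subseteq> P a b \<and>
      (\<forall>a2 b2. a2 < n \<longrightarrow> b2 < n \<longrightarrow> on w a2 b2 \<longrightarrow> P a b \<inter> P a2 b2 \<noteq> {} \<longrightarrow> F \<inter> P a2 b2 \<noteq> {})"
      using vertex_pierce[OF ab] W(3) by (metis lessThan_iff subsetD)
    then obtain F where F: "\<And>w. w \<in> W \<Longrightarrow> finite (F w) \<and> card (F w) \<le> 2 \<and> F w \<subseteq> P a b \<and>
      (\<forall>a2 b2. a2 < n \<longrightarrow> b2 < n \<longrightarrow> on w a2 b2 \<longrightarrow> P a b \<inter> P a2 b2 \<noteq> {} \<longrightarrow> F w \<inter> P a2 b2 \<noteq> {})"
      by metis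
    have "card (\<Union> (F ` W)) \<le> (\<Sum>w\<in>W. card (F w))" using W(1) by (rule card_UN_le)
    also have "\<dots> \<le> (\<Sum>w\<in>W. 2)" using F by (intro sum_mono) auto
    also have "\<dots> \<le> 8" using W by simp
    finally have c: "card (\<Union> (F ` W)) \<le> 8" .
    have "\<forall>a2<n. \<forall>b2<n. P a b \<inter> P a2 b2 \<noteq> {} \<longrightarrow> lam a b \<le> lam a2 b2 \<longrightarrow> \<Union> (F ` W) \<inter> P a2 b2 \<noteq> {}"
    proof (intro allI impI)
      fix a2 b2 assume *: "a2 < n" "b2 < n" "P a b \<inter> P a2 b2 \<noteq> {}" "lam a b \<le> lam a2 b2"
      obtain w where w: "w \<in> W" "on w a2 b2" using W(4)[OF *] by blast
      then have "F w \<inter> P a2 b2 \<noteq> {}" using F[OF w(1)] * by blast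
      then show "\<Union> (F ` W) \<inter> P a2 b2 \<noteq> {}" using w(1) by blast
    qed
    moreover have "finite (\<Union> (F ` W))" "\<Union> (F ` W) \<subseteq> P a b" using W(1) F by blast+
    ultimately show "\<exists>F. finite F \<and> card F \<le> 8 \<and> F \<subseteq> P a b \<and>
       (\<forall>a2<n. \<forall>b2<n. P a b \<inter> P a2 b2 \<noteq> {} \<longrightarrow> lam a b \<le> lam a2 b2 \<longrightarrow> F \<inter> P a2 b2 \<noteq> {})"
      using c by (intro exI[of _ "\<Union> (F ` W)"]) simp
  qed
qed

end

section \<open>The reference algorithm\<close>

text \<open>A search of fixed depth in place of a quantifier over sets: the form executed by
  \<open>p_hits\<close>, polynomial for every fixed \<open>k\<close>.\<close>

primrec hits :: "nat \<Rightarrow> 'e set \<Rightarrow> 'e set set \<Rightarrow> bool" where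
  "hits 0 A Q \<longleftrightarrow> Q = {}"
| "hits (Suc k) A Q \<longleftrightarrow> Q = {} \<or> (\<exists>e\<in>A. hits k A {q \<in> Q. e \<notin> q})"

lemma hits_iff: "hits k A Q \<longleftrightarrow> (\<exists>F. finite F \<and> card F \<le> k \<and> F \<subseteq> A \<and> (\<forall>q\<in>Q. F \<inter> q \<noteq> {}))"
proof (induction k arbitrary: Q)
  case 0
  show ?case
  proof
    assume "hits 0 A Q"
    then show "\<exists>F. finite F \<and> card F \<le> 0 \<and> F \<subseteq> A \<and> (\<forall>q\<in>Q. F \<inter> q \<noteq> {})"
      by (intro exI[of _ "{}"]) simp
  next
    assume "\<exists>F. finite F \<and> card F \<le> 0 \<and> F \<subseteq> A \<and> (\<forall>q\<in>Q. F \<inter> q \<noteq> {})"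
    then obtain F where "F = {}" "\<forall>q\<in>Q. F \<inter> q \<noteq> {}" by auto
    then show "hits 0 A Q" by simp
  qed
next
  case (Suc k)
  show ?case
  proof
    assume "hits (Suc k) A Q"
    then consider "Q = {}" | e where "e \<in> A" "hits k A {q \<in> Q. e \<notin> q}" by auto
    then show "\<exists>F. finite F \<and> card F \<le> Suc k \<and> F \<subseteq> A \<and> (\<forall>q\<in>Q. F \<inter> q \<noteq> {})"
    proof cases
      case 1
      then show ?thesis by (intro exI[of _ "{}"]) auto
    next
      case (2 e)
      then obtain F where F: "finite F" "card F \<le> k" "F \<subseteq> A" "\<forall>q\<in>{q \<in> Q. e \<notin> q}. F \<inter> q \<noteq> {}"
        using 2(2) unfolding Suc.IH by (elim exE conjE)
      have "\<forall>q\<in>Q. insert e F \<inter> q \<noteq> {}" using F(4) by blast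
      moreover have "card (insert e F) \<le> Suc k" using F(1,2) by (simp add: card_insert_if)
      ultimately show ?thesis
        using 2(1) F(1,3) by (intro exI[of _ "insert e F"]) simp
    qed
  next
    assume "\<exists>F. finite F \<and> card F \<le> Suc k \<and> F \<subseteq> A \<and> (\<forall>q\<in>Q. F \<inter> q \<noteq> {})"
    then obtain F where F: "finite F" "card F \<le> Suc k" "F \<subseteq> A" "\<forall>q\<in>Q. F \<inter> q \<noteq> {}" by auto
    show "hits (Suc k) A Q"
    proof (cases "F = {}")
      case False
      then obtain e where e: "e \<in> F" by blast
      have "\<forall>q\<in>{q \<in> Q. e \<notin> q}. (F - {e}) \<inter> q \<noteq> {}" using F(4) by blast
      moreover have "card (F - {e}) \<le> k" using F e by simp
      ultimately have "hits k A {q \<in> Q. e \<notin> q}"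
        unfolding Suc.IH using F by (intro exI[of _ "F - {e}"]) blast
      then show ?thesis using e F(3) by auto
    qed (use F in auto)
  qed
qed

section \<open>Peeling, eligibility and the conflict graph\<close>

locale prob =
  fixes hmin :: real and I :: problem
  assumes valid: "valid_problem hmin I" and hmin: "0 < hmin" "hmin \<le> 1 / 2"
begin

abbreviation "m \<equiv> n_procs I"
abbreviation "r \<equiv> n_trees I"
abbreviation "nv \<equiv> n_vertices I"
abbreviation "pr \<equiv> profit I"
abbreviation "hh \<equiv> height I"

definition pth :: "nat \<Rightarrow> nat \<Rightarrow> nat set set" where
  "pth i j = cut (tree I j) (src I i) (dst I i)"

text \<open>Doubling is written as a sum, here and in \<open>coef\<close> and \<open>unsat\<close>,
  to match the programs literally.\<close>

definition narrow :: "nat \<Rightarrow> bool" where "narrow i \<longleftrightarrow> hh i + hh i \<le> 1"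

definition coef :: "nat \<Rightarrow> real" where "coef i = (if narrow i then hh i + hh i else 1)"

definition conf :: "nat \<Rightarrow> nat \<Rightarrow> nat \<Rightarrow> bool" where
  "conf j i i' \<longleftrightarrow> i \<noteq> i' \<and> narrow i = narrow i' \<and> pth i j \<inter> pth i' j \<noteq> {}"

definition clients :: "nat \<Rightarrow> nat set" where "clients j = {i. i < m \<and> j \<in> acc I i}"

definition pierce :: "nat \<Rightarrow> nat \<Rightarrow> nat set \<Rightarrow> bool" where
  "pierce j i R \<longleftrightarrow> hits 8 (pth i j) ((\<lambda>i'. pth i' j) ` {i' \<in> R. pth i j \<inter> pth i' j \<noteq> {}})"

text \<open>Pierceable demands are removed, unless one of them is unsatisfied; then nothing is
  removed. The iteration thus comes to rest in front of the lowest layer with unsatisfied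
  demands.\<close>

definition peel :: "nat \<Rightarrow> nat set \<Rightarrow> nat set \<Rightarrow> nat set" where
  "peel j U R = {x \<in> R. \<not> pierce j x R \<or> (\<exists>y\<in>R. y \<in> U \<and> pierce j y R)}"

definition rem :: "nat \<Rightarrow> nat set \<Rightarrow> nat set" where
  "rem j U = (peel j U ^^ card (clients j)) (clients j)"

definition elig :: "nat \<Rightarrow> nat set \<Rightarrow> nat \<Rightarrow> bool" where
  "elig j U x \<longleftrightarrow> x \<in> U \<and> pierce j x (rem j U)"

definition flag :: "nat \<Rightarrow> nat set \<Rightarrow> nat \<Rightarrow> bool" where
  "flag j U x \<longleftrightarrow> elig j U x \<and> \<not> (\<exists>y\<in>clients j. elig j U y \<and> conf j x y \<and> \<not> pr y \<le> pr x + pr x)"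

definition unsat :: "(nat \<Rightarrow> nat \<Rightarrow> real) \<Rightarrow> nat \<Rightarrow> nat set" where
  "unsat w j = {i \<in> clients j. \<not> w i j + w i j \<le> pr i}"

definition active :: "(nat \<Rightarrow> nat \<Rightarrow> real) \<Rightarrow> nat \<Rightarrow> nat \<Rightarrow> bool" where
  "active w i j \<longleftrightarrow> flag j (unsat w j) i"

text \<open>Vertex \<open>i * r + j\<close> stands for the instance \<open>(i, j)\<close>. Numbers
  of inactive or nonexistent instances are isolated vertices, so every superstep has the same vertex
  count \<open>m * r\<close>, which all processors know.\<close>

definition gr :: "(nat \<Rightarrow> nat \<Rightarrow> real) \<Rightarrow> nat \<Rightarrow> nat \<Rightarrow> bool" where
  "gr w v v' \<longleftrightarrow> v < m * r \<and> v' < m * r \<and> active w (v div r) (v mod r) \<and> active w (v' div r) (v' mod r) \<and>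
     (v div r = v' div r \<and> v mod r \<noteq> v' mod r \<or>
      v mod r = v' mod r \<and> conf (v mod r) (v div r) (v' div r))"

lemma acc_lt: "i < m \<Longrightarrow> j \<in> acc I i \<Longrightarrow> j < r"
  using valid unfolding valid_problem_def by blast

lemma client_lt: "i \<in> clients j \<Longrightarrow> i < m \<and> j < r"
  using acc_lt by (auto simp: clients_def)

lemma finite_clients [simp]: "finite (clients j)"
  by (simp add: clients_def)

lemma tree_net: "j < r \<Longrightarrow> tree_net nv (tree I j)"
  using valid unfolding valid_problem_def tree_net_def by blast

lemma proc_facts:
  assumes "i < m"
  shows "src I i < nv" "dst I i < nv" "0 < pr i" "0 < hh i" "hh i \<le> 1" "hmin \<le> hh i"
  using valid assms unfolding valid_problem_def by auto

lemma inst_path_pth: "i < m \<Longrightarrow> j < r \<Longrightarrow> inst_path I (i, j) = pth i j"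
  using tree_net.tree_path_cut[OF tree_net] proc_facts by (simp add: inst_path_def pth_def)

lemma pth_subset: "pth i j \<subseteq> tree I j"
  by (auto simp: pth_def cut_def)

lemma coef_le: "coef i \<le> 2 * hh i" "coef i \<le> 1"
  by (auto simp: coef_def narrow_def)

lemma coef_ge: "i < m \<Longrightarrow> 2 * hmin \<le> coef i"
  using proc_facts[of i] hmin by (auto simp: coef_def)

lemma coef_pos: "i < m \<Longrightarrow> 0 < coef i"
  using proc_facts[of i] by (auto simp: coef_def)

lemma conf_irrefl [simp]: "\<not> conf j i i"
  by (simp add: conf_def)

lemma conf_sym: "conf j i i' \<Longrightarrow> conf j i' i"
  by (simp add: conf_def Int_commute)

lemma pierceD:
  assumes "pierce j i R"
  obtains F where "finite F" "card F \<le> 8" "F \<subseteq> pth i j"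
    "\<And>i'. i' \<in> R \<Longrightarrow> pth i j \<inter> pth i' j \<noteq> {} \<Longrightarrow> F \<inter> pth i' j \<noteq> {}"
proof -
  obtain F where F: "finite F" "card F \<le> 8" "F \<subseteq> pth i j"
    "\<forall>q\<in>(\<lambda>i'. pth i' j) ` {i' \<in> R. pth i j \<inter> pth i' j \<noteq> {}}. F \<inter> q \<noteq> {}"
    using assms unfolding pierce_def hits_iff by auto
  show ?thesis by (rule that[OF F(1-3)]) (use F(4) in simp)
qed

lemma peel_subset: "peel j U R \<subseteq> R"
  by (auto simp: peel_def)

lemma peel_pow_unsat: "U \<subseteq> R \<Longrightarrow> U \<subseteq> (peel j U ^^ k) R"
proof (induction k)
  case (Suc k)
  then have "U \<subseteq> (peel j U ^^ k) R" by blast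
  then show ?case unfolding funpow.simps o_apply by (auto simp: peel_def)
qed auto

lemma unsat_rem: "U \<subseteq> clients j \<Longrightarrow> U \<subseteq> rem j U"
  unfolding rem_def by (rule peel_pow_unsat)

lemma unsat_clients: "unsat w j \<subseteq> clients j"
  by (auto simp: unsat_def)

lemma activeD:
  assumes "active w i j"
  shows "i \<in> clients j" "i < m" "j < r" "pr i < w i j + w i j" "pierce j i (rem j (unsat w j))"
  using assms client_lt[of i j] by (auto simp: active_def flag_def elig_def unsat_def)

lemma vid_lt: "i < m \<Longrightarrow> j < r \<Longrightarrow> i * r + j < m * r"
proof -
  assume "i < m" "j < r"
  then have "i * r + j < Suc i * r" by simp
  moreover have "Suc i * r \<le> m * r" using \<open>i < m\<close> by (intro mult_le_mono) auto
  ultimately show ?thesis by linarith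
qed

lemma simple_gr: "simple_graph (m * r) (gr w)"
  unfolding simple_graph_def
proof (intro allI impI)
  fix u v assume "gr w u v"
  then show "u < m * r \<and> v < m * r \<and> u \<noteq> v \<and> gr w v u"
    using conf_sym[of "u mod r" "u div r" "v div r"] unfolding gr_def
    by (metis conf_irrefl)
qed

lemma gr_vid:
  assumes "j < r" "j' < r"
  shows "gr w (i * r + j) (i' * r + j') \<longleftrightarrow> active w i j \<and> active w i' j' \<and>
     (i = i' \<and> j \<noteq> j' \<or> j = j' \<and> conf j i i')"
  using assms activeD(2,3)[of w i j] activeD(2,3)[of w i' j'] vid_lt[of i j] vid_lt[of i' j']
  by (auto simp: gr_def)

text \<open>Peeling that never halts. Layer \<open>l\<close> consists of \<open>Lk j l\<close>
  without \<open>Lk j (Suc l)\<close>; unlike \<open>rem\<close> it does not depend on residual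
  profits, which makes it a fixed yardstick for progress.\<close>

primrec Lk :: "nat \<Rightarrow> nat \<Rightarrow> nat set" where
  "Lk j 0 = clients j"
| "Lk j (Suc k) = {x \<in> Lk j k. \<not> pierce j x (Lk j k)}"

lemma Lk_dec: "k \<le> k' \<Longrightarrow> Lk j k' \<subseteq> Lk j k"
  by (induction rule: dec_induct) auto

lemma Lk_clients: "Lk j k \<subseteq> clients j"
  using Lk_dec[of 0 k j] by simp

text \<open>Peeling is at least as fast as the layering \<open>lam\<close>: if only demands with
  \<open>lam\<close> at least \<open>l\<close> remain, those with value \<open>l\<close> are pierced
  by the eight edges from \<open>layering\<close> and leave.\<close>

lemma Lk_empty:
  assumes "j < r" "nv < 2 ^ k"
  shows "Lk j (2 * k) = {}"
proof -
  interpret tree_net nv "tree I j" by (rule tree_net[OF assms(1)])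
  obtain lam where lam: "\<And>a b. a < nv \<Longrightarrow> b < nv \<Longrightarrow> lam a b < 2 * k"
    "\<And>a b. a < nv \<Longrightarrow> b < nv \<Longrightarrow> \<exists>F. finite F \<and> card F \<le> 8 \<and> F \<subseteq> P a b \<and>
       (\<forall>a2<nv. \<forall>b2<nv. P a b \<inter> P a2 b2 \<noteq> {} \<longrightarrow> lam a b \<le> lam a2 b2 \<longrightarrow> F \<inter> P a2 b2 \<noteq> {})"
    using layering[OF assms(2)] by metis
  have "i \<in> Lk j l \<Longrightarrow> l \<le> lam (src I i) (dst I i)" for i l
  proof (induction l arbitrary: i)
    case (Suc l)
    show ?case
    proof (rule ccontr)
      assume "\<not> Suc l \<le> lam (src I i) (dst I i)"
      then have l: "lam (src I i) (dst I i) \<le> l" by simp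
      have i: "i < m" using Suc.prems Lk_clients client_lt by blast
      obtain F where F: "finite F" "card F \<le> 8" "F \<subseteq> pth i j"
        "\<And>a2 b2. a2 < nv \<Longrightarrow> b2 < nv \<Longrightarrow> pth i j \<inter> P a2 b2 \<noteq> {} \<Longrightarrow>
           lam (src I i) (dst I i) \<le> lam a2 b2 \<Longrightarrow> F \<inter> P a2 b2 \<noteq> {}"
        using lam(2)[of "src I i" "dst I i"] proc_facts[OF i] unfolding pth_def by metis
      have "F \<inter> pth i' j \<noteq> {}" if i': "i' \<in> Lk j l" "pth i j \<inter> pth i' j \<noteq> {}" for i'
      proof -
        have "i' < m" using i' Lk_clients client_lt by blast
        moreover have "l \<le> lam (src I i') (dst I i')" using Suc.IH i' by blast
        ultimately show ?thesis
          using F(4)[of "src I i'" "dst I i'"] l i' proc_facts[of i'] by (simp add: pth_def)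
      qed
      then have "pierce j i (Lk j l)"
        unfolding pierce_def hits_iff using F by (intro exI[of _ F]) auto
      then show False using Suc.prems by simp
    qed
  qed auto
  note le = this
  have "i \<notin> Lk j (2 * k)" for i
  proof
    assume i: "i \<in> Lk j (2 * k)"
    then have "i < m" using Lk_clients client_lt by blast
    then have "lam (src I i) (dst I i) < 2 * k" using lam(1) proc_facts(1,2) by blast
    then show False using le[OF i] by simp
  qed
  then show ?thesis by blast
qed

text \<open>Below layer \<open>l\<close> no unsatisfied demand is pierceable, so \<open>peel\<close>
  agrees with unconditional peeling; at \<open>l\<close> it is halted by \<open>x\<close>.\<close>

lemma rem_eq_Lk:
  assumes U: "U \<subseteq> Lk j l" and x: "x \<in> U" "x \<notin> Lk j (Suc l)"
  shows "rem j U = Lk j l"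
proof -
  have pow: "(peel j U ^^ k) (clients j) = Lk j k" if "k \<le> l" for k
    using that
  proof (induction k)
    case (Suc k)
    have "y \<in> Lk j (Suc k)" if "y \<in> U" for y
      using U Suc.prems Lk_dec[of "Suc k" l j] that by blast
    then have "peel j U (Lk j k) = Lk j (Suc k)"
      by (auto simp: peel_def)
    then show ?case using Suc by simp
  qed simp
  have fixed: "peel j U (Lk j l) = Lk j l"
    using U x by (auto simp: peel_def)
  have stay: "(peel j U ^^ (l + k)) (clients j) = Lk j l" for k
    by (induction k) (use pow[of l] fixed in auto)
  \<comment> \<open>If a step removed nothing, the sequence would be constant and \<open>x\<close>
    could not leave after \<open>l\<close>. So each of the first \<open>l\<close> steps removes a
    demand, and the \<open>card (clients j)\<close> iterations of \<open>rem\<close>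
    suffice.\<close>
  have strict: "k \<le> l \<Longrightarrow> card (Lk j k) + k \<le> card (clients j)" for k
  proof (induction k)
    case (Suc k)
    have "Lk j (Suc k) \<noteq> Lk j k"
    proof
      assume eq: "Lk j (Suc k) = Lk j k"
      have "Lk j (k + d) = Lk j k" for d
      proof (induction d)
        case (Suc d)
        then show ?case using eq by simp
      qed simp
      from this[of "l - k"] this[of "Suc l - k"] have "Lk j l = Lk j (Suc l)" using Suc.prems by simp
      then show False using U x by blast
    qed
    then have "Lk j (Suc k) \<subset> Lk j k" by auto
    then have "card (Lk j (Suc k)) < card (Lk j k)"
      using finite_subset[OF Lk_clients finite_clients] by (rule psubset_card_mono[rotated])
    then show ?case using Suc by simp
  qed simp
  have "l \<le> card (clients j)" using strict[of l] by simp
  then show ?thesis using stay[of "card (clients j) - l"] by (simp add: rem_def)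
qed

end

text \<open>The analysis allows any choice of a maximal independent set for each graph. Later the
  choice is the output of the given algorithm.\<close>

locale run = prob +
  fixes mis :: "(nat \<Rightarrow> nat \<Rightarrow> bool) \<Rightarrow> nat set"
  assumes mis: "simple_graph (n_procs I * n_trees I) adj \<Longrightarrow>
    maximal_independent_set (n_procs I * n_trees I) adj (mis adj)"
begin

definition chosen :: "(nat \<Rightarrow> nat \<Rightarrow> real) \<Rightarrow> nat \<Rightarrow> nat \<Rightarrow> bool" where
  "chosen w i j \<longleftrightarrow> active w i j \<and> i * r + j \<in> mis (gr w)"

text \<open>All instances of the raised demand are charged in full, the raised one included. The
  factor for a conflicting instance is that of the charged instance, not of the raised one; both
  sides of the ratio rely on this.\<close>

definition upd :: "(nat \<Rightarrow> nat \<Rightarrow> real) \<Rightarrow> nat \<Rightarrow> nat \<Rightarrow> real" where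
  "upd w i j = w i j - ((\<Sum>j'\<in>{j'. chosen w i j'}. w i j') +
     (\<Sum>i'\<in>{i'. conf j i i' \<and> chosen w i' j}. coef i * w i' j))"

primrec W :: "nat \<Rightarrow> nat \<Rightarrow> nat \<Rightarrow> real" where
  "W 0 = (\<lambda>i j. pr i)"
| "W (Suc s) = upd (W s)"

definition ch :: "nat \<Rightarrow> nat \<Rightarrow> nat \<Rightarrow> bool" where "ch s = chosen (W s)"

lemma indep: "u \<in> mis (gr w) \<Longrightarrow> v \<in> mis (gr w) \<Longrightarrow> \<not> gr w u v"
  using mis[OF simple_gr[of w]] unfolding maximal_independent_set_def independent_set_def by blast

lemma maximal:
  assumes "v < m * r" "v \<notin> mis (gr w)"
  obtains u where "u \<in> mis (gr w)" "gr w v u"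
proof -
  have M: "independent_set (m * r) (gr w) (mis (gr w))"
    "\<And>Y. mis (gr w) \<subset> Y \<Longrightarrow> \<not> independent_set (m * r) (gr w) Y"
    using mis[OF simple_gr[of w]] unfolding maximal_independent_set_def by blast+
  have "\<not> independent_set (m * r) (gr w) (insert v (mis (gr w)))" using assms by (intro M(2)) auto
  moreover have "\<not> gr w v v" "\<And>u v. gr w u v \<Longrightarrow> gr w v u"
    using simple_gr[of w] unfolding simple_graph_def by blast+
  ultimately show ?thesis
    using M(1) assms(1) that unfolding independent_set_def by blast
qed

lemma chD:
  assumes "ch s i j"
  shows "active (W s) i j" "i < m" "j < r" "j \<in> acc I i" "pr i < W s i j + W s i j" "0 < W s i j"
proof -
  show a: "active (W s) i j" using assms by (simp add: ch_def chosen_def)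
  note d = activeD[OF a]
  show "i < m" "j < r" "j \<in> acc I i" "pr i < W s i j + W s i j"
    using d by (auto simp: clients_def)
  then show "0 < W s i j" using proc_facts(3)[of i] by linarith
qed

lemma ch_unique: "ch s i j \<Longrightarrow> ch s i j' \<Longrightarrow> j = j'"
  using indep[of "i * r + j" "W s" "i * r + j'"] gr_vid[of j j' "W s" i i] chD(1,3)
  unfolding ch_def chosen_def by blast

lemma ch_no_conf: "ch s i j \<Longrightarrow> ch s i' j \<Longrightarrow> \<not> conf j i i'"
  using indep[of "i * r + j" "W s" "i' * r + j"] gr_vid[of j j "W s" i i'] chD(1,3)
  unfolding ch_def chosen_def by blast

section \<open>Decrements of the residual profits\<close>

definition own_dec :: "nat \<Rightarrow> nat \<Rightarrow> real" where
  "own_dec s i = (\<Sum>j'\<in>{j'. ch s i j'}. W s i j')"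

definition conf_dec :: "nat \<Rightarrow> nat \<Rightarrow> nat \<Rightarrow> real" where
  "conf_dec s i j = (\<Sum>i'\<in>{i'. conf j i i' \<and> ch s i' j}. coef i * W s i' j)"

lemma W_Suc: "W (Suc s) i j = W s i j - (own_dec s i + conf_dec s i j)"
  by (simp add: upd_def own_dec_def conf_dec_def ch_def)

lemma own_dec_ch: "ch s i j \<Longrightarrow> own_dec s i = W s i j"
proof -
  assume "ch s i j"
  then have "{j'. ch s i j'} = {j}" using ch_unique by blast
  then show ?thesis by (simp add: own_dec_def)
qed

lemma own_dec_nonneg: "0 \<le> own_dec s i"
  unfolding own_dec_def using chD(6) by (intro sum_nonneg) (auto simp: less_imp_le)

lemma conf_dec_nonneg: "i < m \<Longrightarrow> 0 \<le> conf_dec s i j"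
  unfolding conf_dec_def using chD(6) coef_pos[of i]
  by (intro sum_nonneg mult_nonneg_nonneg) (auto simp: less_imp_le)

lemma W_Suc_le: "i < m \<Longrightarrow> W (Suc t) i j \<le> W t i j"
  using W_Suc[of t i j] own_dec_nonneg[of t i] conf_dec_nonneg[of i t j] by linarith

lemma W_mono: "i < m \<Longrightarrow> s \<le> s' \<Longrightarrow> W s' i j \<le> W s i j"
  using lift_Suc_antimono_le[of "\<lambda>t. W t i j" s s'] W_Suc_le by blast

lemma W_le: "i < m \<Longrightarrow> W s i j \<le> pr i"
  using W_mono[of i 0 s j] by simp

text \<open>All instances of the demand lose the raised residual profit, which exceeds half of the
  profit.\<close>

lemma sat_after_ch:
  assumes "ch s i j" "s < s'"
  shows "W s' i j' + W s' i j' \<le> pr i"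
proof -
  have i: "i < m" using chD assms by blast
  have "W (Suc s) i j' \<le> W s i j' - W s i j"
    using W_Suc[of s i j'] own_dec_ch[OF assms(1)] conf_dec_nonneg[OF i, of s j'] by linarith
  moreover have "W s i j' \<le> pr i" "W s' i j' \<le> W (Suc s) i j'"
    using W_le[OF i] W_mono[OF i, of "Suc s" s' j'] assms by simp_all
  ultimately show ?thesis using chD(5)[OF assms(1)] by linarith
qed

lemma raised_once: "ch s i j \<Longrightarrow> ch s' i j' \<Longrightarrow> s = s' \<and> j = j'"
proof -
  assume a: "ch s i j" "ch s' i j'"
  have "s = s'"
    using sat_after_ch[OF a(1), of s' j'] sat_after_ch[OF a(2), of s j] chD(5)[OF a(1)] chD(5)[OF a(2)]
    by (cases s s' rule: linorder_cases) auto
  then show ?thesis using a ch_unique by blast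
qed

subsection \<open>Number of supersteps\<close>

definition all_sat :: "nat \<Rightarrow> bool" where
  "all_sat s \<longleftrightarrow> (\<forall>i<m. \<forall>j\<in>acc I i. W s i j + W s i j \<le> pr i)"

text \<open>An active instance left unsatisfied was not raised, so maximality yields a raised
  neighbour, and not one of the same demand, whose raise would have satisfied it. The raised
  neighbour has profit at least \<open>pr i / 2\<close> and more than half of it left, and
  \<open>coef i\<close> is at least \<open>2 * hmin\<close>.\<close>

lemma progress_step:
  assumes low: "\<And>j' i'. i' \<in> clients j' \<Longrightarrow> i' \<notin> Lk j' l \<Longrightarrow> i' \<notin> unsat (W s) j'"
    and high: "\<And>i'. i' \<in> Lk j l - Lk j (Suc l) \<Longrightarrow> 2 * pr i < pr i' \<Longrightarrow> i' \<notin> unsat (W s) j"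
    and i: "i \<in> Lk j l" "i \<notin> Lk j (Suc l)" "i \<in> unsat (W (Suc s)) j"
  shows "W (Suc s) i j \<le> W s i j - hmin * pr i / 2"
proof -
  have im: "i \<in> clients j" "i < m" "j < r" using Lk_clients i client_lt by blast+
  have un: "i \<in> unsat (W s) j"
    using i(3) W_mono[of i s "Suc s" j] im by (auto simp: unsat_def)
  have sub: "unsat (W s) j \<subseteq> Lk j l" using low unsat_clients by blast
  have rem: "rem j (unsat (W s) j) = Lk j l" by (rule rem_eq_Lk[OF sub un i(2)])
  have el: "elig j (unsat (W s) j) y \<Longrightarrow> y \<in> Lk j l - Lk j (Suc l) \<and> y \<in> unsat (W s) j" for y
    using sub unfolding elig_def rem by auto
  have "elig j (unsat (W s) j) i" using un i unfolding elig_def rem by simp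
  then have act: "active (W s) i j"
    unfolding active_def flag_def using el high by force
  have notch: "\<not> ch s i j'" for j'
    using sat_after_ch[of s i j' "Suc s" j] i(3) unfolding unsat_def by blast
  then have "i * r + j \<notin> mis (gr (W s))" using act by (auto simp: ch_def chosen_def)
  then obtain u where u: "u \<in> mis (gr (W s))" "gr (W s) (i * r + j) u"
    using maximal vid_lt im by metis
  define i' j' where "i' = u div r" "j' = u mod r"
  have uv: "u = i' * r + j'" "j' < r" using im i'_j'_def by auto
  have a: "active (W s) i' j'" "i = i' \<and> j \<noteq> j' \<or> j = j' \<and> conf j i i'"
    using u(2) gr_vid[of j j' "W s" i i'] im uv by auto
  have c: "ch s i' j'" using u(1) a(1) uv by (simp add: ch_def chosen_def)
  then have cf: "j = j'" "conf j i i'" using a(2) notch by auto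
  \<comment> \<open>The profit comparison is used from the side of the raised \<open>i'\<close>:
    being active itself, it tolerates no eligible conflicting instance of more than twice its
    profit.\<close>
  have "\<not> (elig j (unsat (W s) j) i \<and> conf j i' i \<and> \<not> pr i \<le> pr i' + pr i')"
    using a(1) cf im unfolding active_def flag_def by blast
  then have "pr i \<le> pr i' + pr i'"
    using act cf conf_sym unfolding active_def flag_def by blast
  then have "pr i / 4 \<le> W s i' j" using chD(5)[OF c] cf by simp
  moreover have pp: "0 < pr i" using proc_facts im by blast
  ultimately have "2 * hmin * (pr i / 4) \<le> coef i * W s i' j"
    using coef_ge[OF im(2)] hmin by (intro mult_mono) auto
  also have "\<dots> \<le> conf_dec s i j"
    unfolding conf_dec_def
  proof (rule member_le_sum)
    show "i' \<in> {i'. conf j i i' \<and> ch s i' j}" using c cf by simp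
    show "finite {i'. conf j i i' \<and> ch s i' j}" by (rule finite_subset[of _ "{..<m}"]) (auto dest: chD)
    show "0 \<le> coef i * W s x j" if "x \<in> {i'. conf j i i' \<and> ch s i' j} - {i'}" for x
      using that chD(6)[of s x j] coef_pos[OF im(2)] by simp
  qed
  finally show ?thesis using W_Suc[of s i j] own_dec_nonneg[of s i] by simp
qed

text \<open>By \<open>high\<close>, more profitable classes of the layer are finished, so nothing
  blocks \<open>i\<close>. Each superstep takes \<open>hmin * pr i / 2\<close>, and at least
  \<open>1 / hmin\<close> of them take half of the profit.\<close>

lemma progress_class:
  assumes low: "\<And>j' i'. i' \<in> clients j' \<Longrightarrow> i' \<notin> Lk j' l \<Longrightarrow> i' \<notin> unsat (W s) j'"
    and high: "\<And>j' i'. i' \<in> Lk j' l - Lk j' (Suc l) \<Longrightarrow> pm < 2 ^ q * pr i' \<Longrightarrow> i' \<notin> unsat (W s) j'"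
    and K: "1 / hmin \<le> real K"
    and i: "i \<in> Lk j l - Lk j (Suc l)" "pm < 2 ^ Suc q * pr i"
  shows "i \<notin> unsat (W (s + K)) j"
proof
  assume un: "i \<in> unsat (W (s + K)) j"
  have im: "i < m" using Lk_clients i client_lt by blast
  have antimono: "x \<notin> unsat (W s) j' \<Longrightarrow> s \<le> t \<Longrightarrow> x \<notin> unsat (W t) j'" for x j' t
    using W_mono[of x s t j'] client_lt by (fastforce simp: unsat_def)
  have un': "i \<in> unsat (W t) j" if "t \<le> s + K" for t
    using un that W_mono[OF im that, of j] by (auto simp: unsat_def)
  have "k \<le> K \<Longrightarrow> W (s + k) i j \<le> pr i - real k * (hmin * pr i / 2)" for k
  proof (induction k)
    case 0
    then show ?case using W_le[OF im] by simp
  next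
    case (Suc k)
    have "W (Suc (s + k)) i j \<le> W (s + k) i j - hmin * pr i / 2"
    proof (rule progress_step)
      show "i' \<notin> unsat (W (s + k)) j" if "i' \<in> Lk j l - Lk j (Suc l)" "2 * pr i < pr i'" for i'
      proof (rule antimono[OF high[OF that(1)]])
        have "pm < 2 ^ q * (2 * pr i)" using i(2) by (simp add: algebra_simps)
        also have "\<dots> < 2 ^ q * pr i'" using that by simp
        finally show "pm < 2 ^ q * pr i'" .
      qed simp
    qed (use low antimono i un'[of "Suc (s + k)"] Suc.prems in auto)
    then show ?case using Suc by (simp add: algebra_simps add_divide_distrib)
  qed
  from this[of K] have "W (s + K) i j \<le> pr i - real K * (hmin * pr i / 2)" by simp
  moreover have "1 * (pr i / 2) \<le> (real K * hmin) * (pr i / 2)"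
    using K hmin proc_facts(3)[OF im] by (intro mult_right_mono) (auto simp: field_simps)
  ultimately have "W (s + K) i j + W (s + K) i j \<le> pr i" by (simp add: algebra_simps)
  then show False using un by (simp add: unsat_def)
qed

text \<open>Induction over the layers, and within a layer over profit classes in decreasing order,
  with \<open>K\<close> supersteps for each class.\<close>

lemma progress:
  assumes K: "1 / hmin \<le> real K" and k: "nv < 2 ^ k"
    and q: "\<And>i. i < m \<Longrightarrow> pm < 2 ^ q * pr i" and pm: "\<And>i. i < m \<Longrightarrow> pr i \<le> pm"
  shows "all_sat (2 * k * q * K)"
proof -
  have layer: "i \<notin> unsat (W (l * q * K)) j" if "i \<in> clients j" "i \<notin> Lk j l" for i j l
    using that
  proof (induction l arbitrary: i j)
    case (Suc l)
    have inner: "i \<notin> unsat (W (l * q * K + d * K)) j"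
      if "i \<in> Lk j l - Lk j (Suc l)" "pm < 2 ^ d * pr i" for i j d
      using that
    proof (induction d arbitrary: i j)
      case 0
      \<comment> \<open>Class 0 is empty because \<open>pm\<close> bounds all profits.\<close>
      then show ?case using pm[of i] Lk_clients client_lt by fastforce
    next
      case (Suc d)
      have "i \<notin> unsat (W (l * q * K + d * K + K)) j"
      proof (rule progress_class[where q = d and l = l and pm = pm])
        show "i' \<notin> unsat (W (l * q * K + d * K)) j'" if "i' \<in> clients j'" "i' \<notin> Lk j' l" for i' j'
          using Suc.IH \<open>\<And>i j. i \<in> clients j \<Longrightarrow> i \<notin> Lk j l \<Longrightarrow> i \<notin> unsat (W (l * q * K)) j\<close>[OF that]
            W_mono[of i' "l * q * K" "l * q * K + d * K" j'] client_lt[OF that(1)]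
          by (auto simp: unsat_def)
      qed (use Suc K in auto)
      then show ?case by (simp add: algebra_simps)
    qed
    show ?case
    proof (cases "i \<in> Lk j l")
      case True
      then have "i \<notin> unsat (W (l * q * K + q * K)) j"
        using inner q client_lt Suc.prems by blast
      then show ?thesis by (simp add: algebra_simps)
    next
      case False
      have "i \<notin> unsat (W (l * q * K)) j" using Suc.IH Suc.prems(1) False by blast
      then show ?thesis
        using W_mono[of i "l * q * K" "Suc l * q * K" j] client_lt[OF Suc.prems(1)]
        by (auto simp: unsat_def)
    qed
  qed simp
  show ?thesis
    unfolding all_sat_def
  proof (intro allI ballI impI)
    fix i j assume ij: "i < m" "j \<in> acc I i"
    then have "i \<in> clients j" "j < r" using acc_lt by (auto simp: clients_def)
    then show "W (2 * k * q * K) i j + W (2 * k * q * K) i j \<le> pr i"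
      using layer[of i j "2 * k"] Lk_empty[OF _ k] by (auto simp: unsat_def)
  qed
qed

end

section \<open>Approximation ratio\<close>

lemma sum_of_bool:
  fixes f :: "'a \<Rightarrow> real"
  assumes "finite A"
  shows "(\<Sum>x\<in>A. of_bool (Q x) * f x) = (\<Sum>x\<in>{x \<in> A. Q x}. f x)"
proof -
  have "(\<Sum>x\<in>A. of_bool (Q x) * f x) = (\<Sum>x\<in>A. if Q x then f x else 0)" by (intro sum.cong) auto
  also have "\<dots> = (\<Sum>x\<in>{x \<in> A. Q x}. f x)" by (rule sum.inter_filter[OF assms, symmetric])
  finally show ?thesis .
qed

section \<open>Greedy selection and charging\<close>

context run
begin

text \<open>The test looks only at instances of the same height class. Narrow and wide instances
  together may overload an edge, which the choice by \<open>best\<close> repairs.\<close>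

definition ok :: "nat \<Rightarrow> nat \<Rightarrow> nat \<Rightarrow> nat \<Rightarrow> nat set \<Rightarrow> bool" where
  "ok S s i j A \<longleftrightarrow> (\<forall>e\<in>pth i j.
     (\<Sum>i'\<in>{i' \<in> A. (\<exists>s'. s < s' \<and> s' < S \<and> ch s' i' j) \<and> narrow i' = narrow i \<and> e \<in> pth i' j}. hh i')
       + hh i \<le> 1)"

text \<open>The selection after the last \<open>k\<close> of the \<open>S\<close> supersteps have
  been treated, latest first.\<close>

primrec Qs :: "nat \<Rightarrow> nat \<Rightarrow> nat set" where
  "Qs S 0 = {}"
| "Qs S (Suc k) = Qs S k \<union> {i. k < S \<and> (\<exists>j. ch (S - Suc k) i j \<and> ok S (S - Suc k) i j (Qs S k))}"

definition sel :: "nat \<Rightarrow> nat set" where "sel S = Qs S S"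

lemma Qs_mono: "k \<le> k' \<Longrightarrow> Qs S k \<subseteq> Qs S k'"
  by (induction rule: dec_induct) auto

lemma Qs_raised: "i \<in> Qs S k \<Longrightarrow> \<exists>s j. S - k \<le> s \<and> s < S \<and> ch s i j"
proof (induction k)
  case (Suc k)
  show ?case
  proof (cases "i \<in> Qs S k")
    case True
    then show ?thesis using Suc.IH by (meson diff_le_mono2 le_SucI le_refl le_trans)
  next
    case False
    then obtain j where "k < S" "ch (S - Suc k) i j" using Suc.prems by auto
    then show ?thesis by (intro exI[of _ "S - Suc k"] exI[of _ j]) auto
  qed
qed simp

lemma Qs_sel:
  assumes "k \<le> S" "ch s i j" "s < S" "S - k \<le> s"
  shows "i \<in> Qs S k \<longleftrightarrow> i \<in> sel S"
proof -
  have "i \<in> Qs S k" if "i \<in> Qs S k'" "k \<le> k'" for k'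
    using that(2,1)
  proof (induction k' rule: dec_induct)
    case (step k')
    show ?case
    proof (cases "i \<in> Qs S k'")
      case False
      then obtain j' where "k' < S" "ch (S - Suc k') i j'" using step.prems by auto
      then have "s = S - Suc k'" using raised_once assms(2) by blast
      then show ?thesis using assms step.hyps \<open>k' < S\<close> by linarith
    qed (use step in blast)
  qed
  then show ?thesis using Qs_mono[OF assms(1)] assms(1) unfolding sel_def by blast
qed

lemma ok_cong:
  assumes "\<And>i' s'. s < s' \<Longrightarrow> s' < S \<Longrightarrow> ch s' i' j \<Longrightarrow> i' \<in> A \<longleftrightarrow> i' \<in> B"
  shows "ok S s i j A \<longleftrightarrow> ok S s i j B"
proof -
  have "{i' \<in> A. (\<exists>s'. s < s' \<and> s' < S \<and> ch s' i' j) \<and> narrow i' = narrow i \<and> e \<in> pth i' j} =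
    {i' \<in> B. (\<exists>s'. s < s' \<and> s' < S \<and> ch s' i' j) \<and> narrow i' = narrow i \<and> e \<in> pth i' j}" for e
    using assms by blast
  then show ?thesis by (simp add: ok_def)
qed

text \<open>Acceptance depends only on later supersteps and each demand is raised once, so the order
  of treatment disappears: the final selection solves its own acceptance condition. This lets
  processors decide without a common clock.\<close>

lemma sel_iff:
  assumes "ch s i j" "s < S"
  shows "i \<in> sel S \<longleftrightarrow> ok S s i j (sel S)"
proof -
  define k where "k = S - Suc s"
  have k: "k < S" "S - Suc k = s" using assms k_def by auto
  have "i \<in> sel S \<longleftrightarrow> i \<in> Qs S (Suc k)"
    using Qs_sel[of "Suc k" S s i j] k assms by simp
  also have "\<dots> \<longleftrightarrow> i \<in> Qs S k \<or> ok S s i j (Qs S k)"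
  proof -
    have "(\<exists>j'. ch s i j' \<and> ok S s i j' (Qs S k)) \<longleftrightarrow> ok S s i j (Qs S k)"
      using assms(1) ch_unique[OF assms(1)] by blast
    then show ?thesis using k by simp
  qed
  also have "i \<in> Qs S k \<longleftrightarrow> False"
  proof -
    have False if i: "i \<in> Qs S k"
    proof -
      obtain s' j' where "S - k \<le> s'" "ch s' i j'" using Qs_raised[OF i] by blast
      then show False using raised_once[OF assms(1)] k by fastforce
    qed
    then show ?thesis by blast
  qed
  also have "False \<or> ok S s i j (Qs S k) \<longleftrightarrow> ok S s i j (sel S)"
  proof -
    have "ok S s i j (Qs S k) \<longleftrightarrow> ok S s i j (sel S)"
      by (rule ok_cong, rule Qs_sel) (use k in auto)
    then show ?thesis by blast
  qed
  finally show ?thesis .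
qed

lemma sel_raised: "i \<in> sel S \<Longrightarrow> \<exists>s j. s < S \<and> ch s i j"
  unfolding sel_def using Qs_raised by blast

lemma sel_lt: "i \<in> sel S \<Longrightarrow> i < m"
  using sel_raised chD by blast

lemma finite_sel [simp]: "finite (sel S)"
  by (rule finite_subset[of _ "{..<m}"]) (use sel_lt in auto)

definition raised :: "nat \<Rightarrow> bool \<Rightarrow> (nat \<times> nat \<times> nat) set" where
  "raised S c = {(s, i, j). s < S \<and> ch s i j \<and> narrow i = c}"

lemma finite_raised [simp]: "finite (raised S c)"
  by (rule finite_subset[of _ "{..<S} \<times> {..<m} \<times> {..<r}"]) (auto simp: raised_def dest: chD)

lemma sum_raised:
  "(\<Sum>(s, i, j)\<in>raised S c. f s i j) = (\<Sum>s<S. \<Sum>i\<in>{i. i < m \<and> narrow i = c}. \<Sum>j\<in>{j. ch s i j}. f s i j)"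
proof -
  have fin: "finite {j. ch s i j}" for s i
    by (rule finite_subset[of _ "{..<r}"]) (auto dest: chD)
  have "raised S c = (SIGMA s:{..<S}. SIGMA i:{i. i < m \<and> narrow i = c}. {j. ch s i j})"
    by (auto simp: raised_def dest: chD)
  then show ?thesis by (simp add: sum.Sigma fin)
qed

lemma conf_dec_raised:
  assumes "narrow i = c"
  shows "(\<Sum>s<S. conf_dec s i j * of_bool (B s)) =
    (\<Sum>(s, i', j')\<in>raised S c. of_bool (B s \<and> j' = j \<and> conf j i i') * coef i * W s i' j')"
proof -
  have "(\<Sum>i'\<in>{i'. i' < m \<and> narrow i' = c}. \<Sum>j'\<in>{j'. ch s i' j'}.
      of_bool (B s \<and> j' = j \<and> conf j i i') * coef i * W s i' j') = conf_dec s i j * of_bool (B s)" for s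
  proof -
    have fin: "finite {j. ch s i j}" for i
      by (rule finite_subset[of _ "{..<r}"]) (auto dest: chD)
    have "(\<Sum>j'\<in>{j'. ch s i' j'}. of_bool (B s \<and> j' = j \<and> conf j i i') * coef i * W s i' j') =
        of_bool (B s) * (if conf j i i' \<and> ch s i' j then coef i * W s i' j else 0)" for i'
    proof -
      have "(\<Sum>j'\<in>{j'. ch s i' j'}. of_bool (B s \<and> j' = j \<and> conf j i i') * coef i * W s i' j') =
        (\<Sum>j'\<in>{j'. ch s i' j'}. if j' = j then of_bool (B s \<and> conf j i i') * coef i * W s i' j else 0)"
        by (intro sum.cong) auto
      also have "\<dots> = of_bool (B s) * (if conf j i i' \<and> ch s i' j then coef i * W s i' j else 0)"
        using fin[of i'] by (simp add: sum.delta)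
      finally show ?thesis .
    qed
    then have "(\<Sum>i'\<in>{i'. i' < m \<and> narrow i' = c}. \<Sum>j'\<in>{j'. ch s i' j'}.
      of_bool (B s \<and> j' = j \<and> conf j i i') * coef i * W s i' j') =
      of_bool (B s) * (\<Sum>i'\<in>{i'. i' < m \<and> narrow i' = c}. if conf j i i' \<and> ch s i' j then coef i * W s i' j else 0)"
      by (simp add: sum_distrib_left)
    also have "(\<Sum>i'\<in>{i'. i' < m \<and> narrow i' = c}. if conf j i i' \<and> ch s i' j then coef i * W s i' j else 0)
       = (\<Sum>i'\<in>{i'. conf j i i' \<and> ch s i' j}. coef i * W s i' j)"
    proof -
      have "{i'. conf j i i' \<and> ch s i' j} = {i' \<in> {i'. i' < m \<and> narrow i' = c}. conf j i i' \<and> ch s i' j}"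
        using assms chD(2) by (auto simp: conf_def)
      then show ?thesis by (simp only: sum.inter_filter[symmetric] finite_Collect_conjI finite_Collect_less_nat simp_thms)
    qed
    finally show ?thesis by (simp add: conf_dec_def)
  qed
  then show ?thesis by (simp only: sum_raised)
qed

lemma profit_sum: "pr i = W S i j + (\<Sum>s<S. own_dec s i + conf_dec s i j)"
proof (induction S)
  case (Suc S)
  then show ?case using W_Suc[of S i j] by simp
qed simp

text \<open>Double counting of what selected demands have been charged up to their own raise. A
  selected raise is paid by its own residual profit. A rejected one was blocked at an edge by later
  selected instances; their \<open>coef\<close> sums to at least 1, so together they were charged at
  least its residual profit.\<close>

lemma raised_le_sel: "(\<Sum>(s, i, j)\<in>raised S c. W s i j) \<le> (\<Sum>i\<in>{i \<in> sel S. narrow i = c}. pr i)"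
proof -
  let ?A = "{i \<in> sel S. narrow i = c}"
  define st where "st i = (SOME p. fst p < S \<and> ch (fst p) i (snd p))" for i
  have st: "fst (st i) < S \<and> ch (fst (st i)) i (snd (st i))" if "i \<in> sel S" for i
    unfolding st_def using sel_raised[OF that] by (intro someI_ex[of "\<lambda>p. fst p < S \<and> ch (fst p) i (snd p)"]) auto
  have stD: "s = fst (st i) \<and> j = snd (st i)" if "i \<in> sel S" "ch s i j" for s i j
    using raised_once[OF that(2), of "fst (st i)" "snd (st i)"] st[OF that(1)] by simp
  have fA: "finite ?A" by simp
  have Wpos: "0 \<le> W s i j" if "(s, i, j) \<in> raised S c" for s i j
    using that chD(6) by (fastforce simp: raised_def less_imp_le)
  let ?own = "\<lambda>i s' i' j'. of_bool (i' = i) * W s' i' j'"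
  let ?cf = "\<lambda>i s' i' j'. of_bool (s' < fst (st i) \<and> j' = snd (st i) \<and> conf (snd (st i)) i i') * coef i * W s' i' j'"
  have eq: "(\<Sum>(s', i', j')\<in>raised S c. ?own i s' i' j' + ?cf i s' i' j') \<le> pr i" if i: "i \<in> ?A" for i
  proof -
    define s j where "s = fst (st i)" and "j = snd (st i)"
    have sj: "s < S" "ch s i j" "i < m" using st[of i] i chD(2)[of "fst (st i)" i "snd (st i)"] by (auto simp: s_def j_def)
    have "(\<Sum>(s', i', j')\<in>raised S c. ?own i s' i' j') = W s i j"
    proof -
      have "(s, i, j) \<in> raised S c" using sj i by (simp add: raised_def)
      have "(\<Sum>x\<in>raised S c. (\<lambda>(s', i', j'). ?own i s' i' j') x) = (\<Sum>x\<in>raised S c. if x = (s, i, j) then W s i j else 0)"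
      proof (intro sum.cong refl)
        fix x assume x: "x \<in> raised S c"
        obtain s' i' j' where x': "x = (s', i', j')" by (cases x) auto
        have "i' = i \<Longrightarrow> s' = s \<and> j' = j" using x x' stD i by (auto simp: raised_def s_def j_def)
        then show "(\<lambda>(s', i', j'). ?own i s' i' j') x = (if x = (s, i, j) then W s i j else 0)" using x' by auto
      qed
      also have "\<dots> = W s i j" using \<open>(s, i, j) \<in> raised S c\<close> by (simp add: sum.delta)
      finally show ?thesis .
    qed
    moreover have "(\<Sum>(s', i', j')\<in>raised S c. ?cf i s' i' j') = (\<Sum>s'<S. conf_dec s' i j * of_bool (s' < s))"
      using conf_dec_raised[where i = i and c = c and S = S and j = j and B = "\<lambda>s'. s' < s"] i by (simp add: s_def j_def)
    moreover have "\<dots> = (\<Sum>s'<s. conf_dec s' i j)"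
    proof -
      have "(\<Sum>s'<S. conf_dec s' i j * of_bool (s' < s)) = (\<Sum>s'\<in>{s' \<in> {..<S}. s' < s}. conf_dec s' i j)"
        using sum_of_bool[of "{..<S}" "\<lambda>s'. s' < s" "\<lambda>s'. conf_dec s' i j"] by (simp only: mult.commute finite_lessThan)
      also have "{s' \<in> {..<S}. s' < s} = {..<s}" using sj by auto
      finally show ?thesis .
    qed
    moreover have "\<dots> \<le> (\<Sum>s'<s. own_dec s' i + conf_dec s' i j)"
      using own_dec_nonneg by (intro sum_mono) simp
    moreover have "pr i = W s i j + (\<Sum>s'<s. own_dec s' i + conf_dec s' i j)" by (rule profit_sum)
    ultimately show ?thesis by (simp add: sum.distrib case_prod_unfold)
  qed
  have one: "W s' i' j' \<le> (\<Sum>i\<in>?A. ?own i s' i' j' + ?cf i s' i' j')" if D: "(s', i', j') \<in> raised S c" for s' i' j'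
  proof -
    have D': "s' < S" "ch s' i' j'" "narrow i' = c" "i' < m" using D chD(2) by (auto simp: raised_def)
    have nn: "0 \<le> ?own i s' i' j' + ?cf i s' i' j'" if "i \<in> ?A" for i
      using Wpos[OF D] coef_pos[of i] sel_lt[of i S] that by simp
    show ?thesis
    proof (cases "i' \<in> sel S")
      case True
      then have A: "i' \<in> ?A" using D' by simp
      have "W s' i' j' \<le> ?own i' s' i' j' + ?cf i' s' i' j'" by simp
      also have "\<dots> \<le> (\<Sum>i\<in>?A. ?own i s' i' j' + ?cf i s' i' j')"
      proof (rule member_le_sum[OF A, where f = "\<lambda>i. ?own i s' i' j' + ?cf i s' i' j'"])
        show "0 \<le> ?own x s' i' j' + ?cf x s' i' j'" if "x \<in> ?A - {i'}" for x using nn that by blast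
      qed (rule fA)
      finally show ?thesis .
    next
      case False
      then have "\<not> ok S s' i' j' (sel S)" using sel_iff[OF D'(2,1)] by simp
      then obtain e where e: "e \<in> pth i' j'"
        "1 < (\<Sum>i\<in>{i \<in> sel S. (\<exists>s. s' < s \<and> s < S \<and> ch s i j') \<and> narrow i = narrow i' \<and> e \<in> pth i j'}. hh i) + hh i'"
        unfolding ok_def by (auto simp: not_le)
      let ?B = "{i \<in> sel S. (\<exists>s. s' < s \<and> s < S \<and> ch s i j') \<and> narrow i = narrow i' \<and> e \<in> pth i j'}"
      have fB: "finite ?B" by simp
      \<comment> \<open>Narrow: the blocking heights exceed \<open>1 - hh i' \<ge> 1 / 2\<close>,
        and \<open>coef\<close> doubles them. Wide: a single height is at most 1, so some blocker
        exists, and its \<open>coef\<close> is 1.\<close>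
      have Bc: "1 \<le> (\<Sum>i\<in>?B. coef i)"
      proof (cases c)
        case True
        have "(\<Sum>i\<in>?B. coef i) = (\<Sum>i\<in>?B. 2 * hh i)"
          using D' True by (intro sum.cong) (auto simp: coef_def)
        also have "\<dots> = 2 * (\<Sum>i\<in>?B. hh i)" by (simp add: sum_distrib_left)
        finally show ?thesis using e(2) D' True unfolding narrow_def by linarith
      next
        case False
        have "?B \<noteq> {}"
        proof
          assume B: "?B = {}"
          show False using e(2) proc_facts(5)[OF D'(4)] unfolding B by simp
        qed
        then have "1 \<le> real (card ?B)" using fB by (simp add: Suc_leI card_gt_0_iff)
        also have "\<dots> = (\<Sum>i\<in>?B. coef i)" using D' False by (simp add: coef_def)
        finally show ?thesis .
      qed
      have "W s' i' j' \<le> (\<Sum>i\<in>?B. coef i) * W s' i' j'" using mult_right_mono[OF Bc Wpos[OF D]] by simp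
      also have "\<dots> = (\<Sum>i\<in>?B. coef i * W s' i' j')" by (rule sum_distrib_right)
      also have "\<dots> \<le> (\<Sum>i\<in>?B. ?own i s' i' j' + ?cf i s' i' j')"
      proof (rule sum_mono)
        fix i assume i: "i \<in> ?B"
        then obtain s where s: "s' < s" "s < S" "ch s i j'" "i \<in> sel S" "e \<in> pth i j'" "narrow i = narrow i'" by blast
        have st': "fst (st i) = s" "snd (st i) = j'" using stD[OF s(4,3)] by auto
        have "conf j' i i'" using s e(1) raised_once[OF s(3), of s' j'] D' unfolding conf_def by auto
        then have "?cf i s' i' j' = coef i * W s' i' j'" using st' s by simp
        moreover have "0 \<le> ?own i s' i' j'" using Wpos[OF D] by simp
        ultimately show "coef i * W s' i' j' \<le> ?own i s' i' j' + ?cf i s' i' j'" by linarith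
      qed
      also have "\<dots> \<le> (\<Sum>i\<in>?A. ?own i s' i' j' + ?cf i s' i' j')"
        using nn D' by (intro sum_mono2) auto
      finally show ?thesis .
    qed
  qed
  have "(\<Sum>(s, i, j)\<in>raised S c. W s i j) \<le> (\<Sum>(s, i, j)\<in>raised S c. \<Sum>x\<in>?A. ?own x s i j + ?cf x s i j)"
    using one by (intro sum_mono) auto
  also have "\<dots> = (\<Sum>x\<in>?A. \<Sum>(s, i, j)\<in>raised S c. ?own x s i j + ?cf x s i j)"
    unfolding case_prod_unfold by (rule sum.swap)
  also have "\<dots> \<le> (\<Sum>i\<in>?A. pr i)" using eq by (intro sum_mono) auto
  finally show ?thesis .
qed

lemma feasible_edge:
  assumes Op: "feasible I Op" and j: "j < r"
  shows "(\<Sum>d\<in>{d \<in> Op. snd d = j \<and> e \<in> pth (fst d) j}. coef (fst d)) \<le> 2"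
proof (cases "e \<in> tree I j")
  case True
  have "\<forall>d\<in>Op. fst d < m" using Op unfolding feasible_def demand_instances_def by auto
  then have "{d \<in> Op. snd d = j \<and> e \<in> inst_path I d} = {d \<in> Op. snd d = j \<and> e \<in> pth (fst d) j}"
    using inst_path_pth[OF _ j] by auto
  moreover have "(\<Sum>d\<in>{d \<in> Op. snd d = j \<and> e \<in> inst_path I d}. hh (fst d)) \<le> 1"
    using Op j True unfolding feasible_def by blast
  ultimately have "(\<Sum>d\<in>{d \<in> Op. snd d = j \<and> e \<in> pth (fst d) j}. hh (fst d)) \<le> 1"
    by simp
  moreover have "(\<Sum>d\<in>{d \<in> Op. snd d = j \<and> e \<in> pth (fst d) j}. coef (fst d)) \<le>
    (\<Sum>d\<in>{d \<in> Op. snd d = j \<and> e \<in> pth (fst d) j}. 2 * hh (fst d))"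
    by (intro sum_mono coef_le)
  ultimately show ?thesis by (simp add: sum_distrib_left[symmetric])
next
  case False
  then have "{d \<in> Op. snd d = j \<and> e \<in> pth (fst d) j} = {}" using pth_subset by blast
  then show ?thesis by (simp only: sum.empty)
qed

lemma finite_instances: "finite (demand_instances I)"
  by (rule finite_subset[of _ "{..<m} \<times> {..<r}"]) (auto simp: demand_instances_def dest: acc_lt)

text \<open>Charges count only while the charged instance is unsatisfied: then its demand is still
  in \<open>rem\<close>, against which the raised path has its eight edges. These charges alone make
  up half of the profit.\<close>

lemma opt_le_raised:
  assumes S: "all_sat S" and Op: "feasible I Op"
  shows "(\<Sum>d\<in>{d \<in> Op. narrow (fst d) = c}. pr (fst d)) \<le> 34 * (\<Sum>(s, i, j)\<in>raised S c. W s i j)"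
proof -
  let ?Op = "{d \<in> Op. narrow (fst d) = c}"
  have Osub: "Op \<subseteq> demand_instances I" "\<And>i j j'. (i, j) \<in> Op \<Longrightarrow> (i, j') \<in> Op \<Longrightarrow> j = j'"
    using Op unfolding feasible_def by blast+
  have fO: "finite Op" using Osub(1) finite_instances by (rule finite_subset)
  have inO: "fst d < m" "snd d < r" "snd d \<in> acc I (fst d)" if "d \<in> Op" for d
    using that Osub(1) acc_lt by (auto simp: demand_instances_def)
  define us where "us s d \<longleftrightarrow> fst d \<in> unsat (W s) (snd d)" for s d
  let ?own = "\<lambda>d s' i' j'. of_bool (us s' d \<and> i' = fst d) * W s' i' j'"
  let ?cf = "\<lambda>d s' i' j'. of_bool (us s' d \<and> j' = snd d \<and> conf (snd d) (fst d) i') * coef (fst d) * W s' i' j'"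
  have half: "pr (fst d) / 2 \<le> (\<Sum>(s, i, j)\<in>raised S c. ?own d s i j + ?cf d s i j)" if d: "d \<in> ?Op" for d
  proof -
    obtain i j where ij: "d = (i, j)" by (cases d)
    have i: "i < m" "j \<in> acc I i" "narrow i = c" using d inO ij by auto
    have us: "us s d \<longleftrightarrow> \<not> W s i j + W s i j \<le> pr i" for s
      using i by (auto simp: us_def ij unsat_def clients_def)
    define s0 where "s0 = (LEAST s. \<not> us s d)"
    have "\<not> us S d" using S i us unfolding all_sat_def by blast
    then have s0: "\<not> us s0 d" "s0 \<le> S" unfolding s0_def using LeastI[of "\<lambda>s. \<not> us s d" S] Least_le[of "\<lambda>s. \<not> us s d" S] by auto
    have us0: "us s d" if "s < s0" for s using not_less_Least that unfolding s0_def by blast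
    have "pr i / 2 \<le> pr i - W s0 i j" using s0(1) us by auto
    also have "\<dots> = (\<Sum>s<s0. own_dec s i + conf_dec s i j)" using profit_sum[of i s0 j] by simp
    also have "\<dots> = (\<Sum>s<s0. (own_dec s i + conf_dec s i j) * of_bool (us s d))"
      using us0 by (intro sum.cong) auto
    also have "\<dots> \<le> (\<Sum>s<S. (own_dec s i + conf_dec s i j) * of_bool (us s d))"
      using s0(2) own_dec_nonneg conf_dec_nonneg[OF i(1)] by (intro sum_mono2) auto
    also have "\<dots> = (\<Sum>s<S. own_dec s i * of_bool (us s d)) + (\<Sum>s<S. conf_dec s i j * of_bool (us s d))"
      by (simp add: sum.distrib distrib_right)
    also have "(\<Sum>s<S. own_dec s i * of_bool (us s d)) = (\<Sum>(s, i', j')\<in>raised S c. ?own d s i' j')"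
      unfolding sum_raised
    proof (rule sum.cong[OF refl])
      fix s
      have "(\<Sum>i'\<in>{i'. i' < m \<and> narrow i' = c}. \<Sum>j'\<in>{j'. ch s i' j'}. ?own d s i' j') =
        (\<Sum>i'\<in>{i'. i' < m \<and> narrow i' = c}. if i' = i then \<Sum>j'\<in>{j'. ch s i j'}. of_bool (us s d) * W s i j' else 0)"
        by (intro sum.cong) (auto simp: ij)
      also have "\<dots> = own_dec s i * of_bool (us s d)"
        using i by (simp add: sum.delta own_dec_def sum_distrib_left mult.commute)
      finally show "own_dec s i * of_bool (us s d) =
        (\<Sum>i'\<in>{i'. i' < m \<and> narrow i' = c}. \<Sum>j'\<in>{j'. ch s i' j'}. ?own d s i' j')" by simp
    qed
    also have "(\<Sum>s<S. conf_dec s i j * of_bool (us s d)) = (\<Sum>(s, i', j')\<in>raised S c. ?cf d s i' j')"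
      using conf_dec_raised[OF i(3), where S = S and j = j and B = "\<lambda>s. us s d"] by (simp add: ij)
    finally show ?thesis by (simp add: sum.distrib case_prod_unfold ij)
  qed
  have seventeen: "(\<Sum>d\<in>?Op. ?own d s i j + ?cf d s i j) \<le> 17 * W s i j" if D: "(s, i, j) \<in> raised S c" for s i j
  proof -
    have D': "ch s i j" "narrow i = c" using D by (auto simp: raised_def)
    note chd = chD[OF D'(1)]
    have "(\<Sum>d\<in>?Op. of_bool (us s d \<and> i = fst d) :: real) \<le> 1"
    proof -
      have "(\<Sum>d\<in>?Op. of_bool (us s d \<and> i = fst d) :: real) = real (card {d \<in> ?Op. us s d \<and> i = fst d})"
        using fO by (simp add: of_bool_def sum.If_cases Int_def)
      also have "{d \<in> ?Op. us s d \<and> i = fst d} \<subseteq> {d \<in> Op. fst d = i}" by auto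
      then have "card {d \<in> ?Op. us s d \<and> i = fst d} \<le> card {d \<in> Op. fst d = i}" using fO by (intro card_mono) auto
      also have "\<dots> \<le> 1" using fO Osub(2)[of i] by (auto simp: card_le_Suc0_iff_eq)
      finally show ?thesis by simp
    qed
    \<comment> \<open>Each such \<open>d\<close> passes one of at most eight edges in
      \<open>F\<close>, and feasibility of \<open>Op\<close> bounds the sum of \<open>coef\<close>
      on each of them by 2.\<close>
    moreover have "(\<Sum>d\<in>?Op. of_bool (us s d \<and> j = snd d \<and> conf (snd d) (fst d) i) * coef (fst d)) \<le> 16"
    proof -
      obtain F where F: "finite F" "card F \<le> 8" "F \<subseteq> pth i j"
        "\<And>i'. i' \<in> rem j (unsat (W s) j) \<Longrightarrow> pth i j \<inter> pth i' j \<noteq> {} \<Longrightarrow> F \<inter> pth i' j \<noteq> {}"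
        using pierceD[OF activeD(5)[OF chd(1)]] by metis
      let ?E = "\<lambda>e. {d \<in> Op. snd d = j \<and> e \<in> pth (fst d) j}"
      have cp: "0 \<le> coef (fst d)" if "d \<in> Op" for d using coef_pos[OF inO(1)[OF that]] by simp
      have "(\<Sum>d\<in>?Op. of_bool (us s d \<and> j = snd d \<and> conf (snd d) (fst d) i) * coef (fst d)) =
        (\<Sum>d\<in>{d \<in> ?Op. us s d \<and> j = snd d \<and> conf (snd d) (fst d) i}. coef (fst d))"
        using fO by (intro sum_of_bool) simp
      also have "\<dots> \<le> (\<Sum>d\<in>(\<Union>e\<in>F. ?E e). coef (fst d))"
      proof (rule sum_mono2)
        show "finite (\<Union>e\<in>F. ?E e)" using F(1) fO by simp
        show "{d \<in> ?Op. us s d \<and> j = snd d \<and> conf (snd d) (fst d) i} \<subseteq> (\<Union>e\<in>F. ?E e)"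
        proof
          fix d assume d: "d \<in> {d \<in> ?Op. us s d \<and> j = snd d \<and> conf (snd d) (fst d) i}"
          then have "fst d \<in> rem j (unsat (W s) j)" using unsat_rem[OF unsat_clients] unfolding us_def by blast
          moreover have "pth i j \<inter> pth (fst d) j \<noteq> {}" using d unfolding conf_def by blast
          ultimately have "F \<inter> pth (fst d) j \<noteq> {}" by (rule F(4))
          then show "d \<in> (\<Union>e\<in>F. ?E e)" using d by blast
        qed
      qed (use cp in auto)
      also have "\<dots> \<le> (\<Sum>e\<in>F. \<Sum>d\<in>?E e. coef (fst d))"
        using F(1) fO cp
      proof (induction F rule: finite_induct)
        case (insert e F)
        have "(\<Sum>d\<in>(\<Union>e\<in>insert e F. ?E e). coef (fst d)) =
          (\<Sum>d\<in>?E e \<union> (\<Union>e\<in>F. ?E e). coef (fst d))" by simp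
        also have "\<dots> \<le> (\<Sum>d\<in>?E e. coef (fst d)) + (\<Sum>d\<in>(\<Union>e\<in>F. ?E e). coef (fst d))"
          using insert.hyps(1) insert.prems sum.union_inter[of "?E e" "\<Union>e\<in>F. ?E e" "\<lambda>d. coef (fst d)"]
            sum_nonneg[of "?E e \<inter> (\<Union>e\<in>F. ?E e)" "\<lambda>d. coef (fst d)"] by fastforce
        finally show ?case using insert by simp
      qed simp
      also have "\<dots> \<le> (\<Sum>e\<in>F. 2)" using feasible_edge[OF Op chd(3)] by (intro sum_mono)
      also have "\<dots> \<le> 16" using F(2) by simp
      finally show ?thesis .
    qed
    ultimately have "(\<Sum>d\<in>?Op. of_bool (us s d \<and> i = fst d)) +
       (\<Sum>d\<in>?Op. of_bool (us s d \<and> j = snd d \<and> conf (snd d) (fst d) i) * coef (fst d)) \<le> 17" by linarith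
    then have "((\<Sum>d\<in>?Op. of_bool (us s d \<and> i = fst d)) +
       (\<Sum>d\<in>?Op. of_bool (us s d \<and> j = snd d \<and> conf (snd d) (fst d) i) * coef (fst d))) * W s i j \<le> 17 * W s i j"
      using chd(6) by (intro mult_right_mono) auto
    then show ?thesis by (simp add: sum.distrib sum_distrib_right distrib_right)
  qed
  have "(\<Sum>d\<in>?Op. pr (fst d)) / 2 \<le> (\<Sum>d\<in>?Op. \<Sum>(s, i, j)\<in>raised S c. ?own d s i j + ?cf d s i j)"
    unfolding sum_divide_distrib using half by (rule sum_mono)
  also have "\<dots> = (\<Sum>(s, i, j)\<in>raised S c. \<Sum>d\<in>?Op. ?own d s i j + ?cf d s i j)"
    unfolding case_prod_unfold by (rule sum.swap)
  also have "\<dots> \<le> (\<Sum>(s, i, j)\<in>raised S c. 17 * W s i j)"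
    using seventeen by (intro sum_mono) auto
  also have "\<dots> = 17 * (\<Sum>(s, i, j)\<in>raised S c. W s i j)"
    by (simp add: sum_distrib_left case_prod_unfold)
  finally show ?thesis by simp
qed

section \<open>The better height class of every tree\<close>

definition on_tree :: "nat \<Rightarrow> nat \<Rightarrow> nat \<Rightarrow> bool" where
  "on_tree S i j \<longleftrightarrow> i \<in> sel S \<and> (\<exists>s<S. ch s i j)"

definition best :: "nat \<Rightarrow> nat \<Rightarrow> bool" where
  "best S j \<longleftrightarrow> (\<Sum>i\<in>{i. on_tree S i j \<and> \<not> narrow i}. pr i) \<le> (\<Sum>i\<in>{i. on_tree S i j \<and> narrow i}. pr i)"

definition solution :: "nat \<Rightarrow> (nat \<times> nat) set" where
  "solution S = {(i, j). on_tree S i j \<and> narrow i = best S j}"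

lemma on_tree_facts: "on_tree S i j \<Longrightarrow> i < m \<and> j < r \<and> j \<in> acc I i"
  unfolding on_tree_def using chD by blast

lemma on_tree_unique: "on_tree S i j \<Longrightarrow> on_tree S i j' \<Longrightarrow> j = j'"
  unfolding on_tree_def using raised_once by blast

text \<open>Consider the first raised instance on \<open>e\<close>. Instances raised together do not
  conflict, so all others on \<open>e\<close> were raised later and took part in its acceptance
  test.\<close>

lemma load:
  "(\<Sum>i\<in>{i. on_tree S i j \<and> narrow i = c \<and> e \<in> pth i j}. hh i) \<le> 1"
proof (cases "{i. on_tree S i j \<and> narrow i = c \<and> e \<in> pth i j} = {}")
  case False
  let ?A = "{i. on_tree S i j \<and> narrow i = c \<and> e \<in> pth i j}"
  have fA: "finite ?A" by (rule finite_subset[of _ "{..<m}"]) (auto dest: on_tree_facts)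
  define st where "st i = (SOME s. s < S \<and> ch s i j)" for i
  have st: "st i < S \<and> ch (st i) i j" if "i \<in> ?A" for i
    unfolding st_def using that unfolding on_tree_def by (intro someI_ex[of "\<lambda>s. s < S \<and> ch s i j"]) blast
  obtain i0 where i0: "i0 \<in> ?A" and least: "\<And>i. i \<in> ?A \<Longrightarrow> st i0 \<le> st i"
    using ex_has_least_nat[of "\<lambda>i. i \<in> ?A" _ st] False by blast
  have s0: "st i0 < S" "ch (st i0) i0 j" using st i0 by auto
  have "i0 \<in> sel S" "e \<in> pth i0 j" "narrow i0 = c" using i0 by (auto simp: on_tree_def)
  then have le: "(\<Sum>i'\<in>{i' \<in> sel S. (\<exists>s'. st i0 < s' \<and> s' < S \<and> ch s' i' j) \<and> narrow i' = narrow i0 \<and> e \<in> pth i' j}. hh i') + hh i0 \<le> 1"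
    using sel_iff[OF s0(2,1)] unfolding ok_def by blast
  have "{i' \<in> sel S. (\<exists>s'. st i0 < s' \<and> s' < S \<and> ch s' i' j) \<and> narrow i' = narrow i0 \<and> e \<in> pth i' j} = ?A - {i0}"
  proof (intro equalityI subsetI)
    fix i assume "i \<in> {i' \<in> sel S. (\<exists>s'. st i0 < s' \<and> s' < S \<and> ch s' i' j) \<and> narrow i' = narrow i0 \<and> e \<in> pth i' j}"
    then obtain s' where s': "st i0 < s'" "s' < S" "ch s' i j" "i \<in> sel S" "narrow i = narrow i0" "e \<in> pth i j"
      by blast
    have "i \<noteq> i0" using raised_once[OF s0(2), of s' j] s' by auto
    then show "i \<in> ?A - {i0}"
      using s' \<open>narrow i0 = c\<close> unfolding on_tree_def by auto
  next
    fix i assume i: "i \<in> ?A - {i0}"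
    then have si: "st i < S" "ch (st i) i j" using st by auto
    have "st i \<noteq> st i0"
    proof
      assume "st i = st i0"
      then have "\<not> conf j i i0" using ch_no_conf si s0 by metis
      then show False using i i0 unfolding conf_def by auto
    qed
    then have "st i0 < st i" using least i by (metis DiffD1 le_neq_implies_less)
    then show "i \<in> {i' \<in> sel S. (\<exists>s'. st i0 < s' \<and> s' < S \<and> ch s' i' j) \<and> narrow i' = narrow i0 \<and> e \<in> pth i' j}"
      using i i0 si unfolding on_tree_def by auto
  qed
  then show ?thesis using le fA i0 by (simp add: sum.remove[of ?A i0])
qed (simp only: sum.empty zero_le_one)

lemma solution_feasible: "feasible I (solution S)"
  unfolding feasible_def
proof (intro conjI allI impI ballI)
  show "solution S \<subseteq> demand_instances I"
    using on_tree_facts by (auto simp: solution_def demand_instances_def)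
  show "j = j'" if "(i, j) \<in> solution S \<and> (i, j') \<in> solution S" for i j j'
    using that on_tree_unique by (auto simp: solution_def)
  fix j e assume j: "j < r" "e \<in> tree I j"
  have "{d \<in> solution S. snd d = j \<and> e \<in> inst_path I d} =
    (\<lambda>i. (i, j)) ` {i. on_tree S i j \<and> narrow i = best S j \<and> e \<in> pth i j}"
    using inst_path_pth on_tree_facts by (force simp: solution_def image_iff)
  then show "(\<Sum>d\<in>{d \<in> solution S. snd d = j \<and> e \<in> inst_path I d}. hh (fst d)) \<le> 1"
    using load[of S j "best S j" e] by (simp add: sum.reindex inj_on_def)
qed

lemma solution_profit: "(\<Sum>i\<in>sel S. pr i) \<le> 2 * total_profit I (solution S)"
proof -
  let ?A = "\<lambda>j c. {i. on_tree S i j \<and> narrow i = c}"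
  have fA: "finite (?A j c)" for j c by (rule finite_subset[of _ "{..<m}"]) (auto dest: on_tree_facts)
  have fB: "finite {i. on_tree S i j}" for j by (rule finite_subset[of _ "{..<m}"]) (auto dest: on_tree_facts)
  have "sel S = (\<Union>j<r. {i. on_tree S i j})"
    using sel_raised[of _ S] chD(3) by (fastforce simp: on_tree_def)
  then have "(\<Sum>i\<in>sel S. pr i) = (\<Sum>i\<in>(\<Union>j<r. {i. on_tree S i j}). pr i)" by simp
  also have "\<dots> = (\<Sum>j<r. \<Sum>i\<in>{i. on_tree S i j}. pr i)"
    using fB on_tree_unique by (intro sum.UNION_disjoint) auto
  also have "\<dots> \<le> (\<Sum>j<r. 2 * (\<Sum>i\<in>?A j (best S j). pr i))"
  proof (rule sum_mono)
    fix j
    have un: "{i. on_tree S i j} = ?A j True \<union> ?A j False" by auto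
    have "?A j True \<inter> ?A j False = {}" by auto
    then have "(\<Sum>i\<in>{i. on_tree S i j}. pr i) = (\<Sum>i\<in>?A j True. pr i) + (\<Sum>i\<in>?A j False. pr i)"
      unfolding un using sum.union_disjoint[OF fA fA] by blast
    then show "(\<Sum>i\<in>{i. on_tree S i j}. pr i) \<le> 2 * (\<Sum>i\<in>?A j (best S j). pr i)"
      by (cases "best S j") (auto simp: best_def)
  qed
  also have "\<dots> = 2 * (\<Sum>j<r. \<Sum>i\<in>?A j (best S j). pr i)" by (simp add: sum_distrib_left)
  also have "(\<Sum>j<r. \<Sum>i\<in>?A j (best S j). pr i) = total_profit I (solution S)"
  proof -
    have "solution S = (\<lambda>(j, i). (i, j)) ` (SIGMA j:{..<r}. ?A j (best S j))"
      using on_tree_facts by (force simp: solution_def image_iff)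
    then have "total_profit I (solution S) =
      (\<Sum>x\<in>(SIGMA j:{..<r}. ?A j (best S j)). pr (fst ((\<lambda>(j, i). (i, j)) x)))"
      unfolding total_profit_def by (simp add: sum.reindex inj_on_def)
    also have "\<dots> = (\<Sum>j<r. \<Sum>i\<in>?A j (best S j). pr i)"
      using fA by (simp add: sum.Sigma case_prod_unfold)
    finally show ?thesis by simp
  qed
  finally show ?thesis .
qed

theorem approximation:
  assumes "all_sat S" "feasible I Op"
  shows "total_profit I Op \<le> 68 * total_profit I (solution S)"
proof -
  have fO: "finite Op" using assms(2) finite_subset[OF _ finite_instances] unfolding feasible_def by blast
  have "Op = {d \<in> Op. narrow (fst d) = True} \<union> {d \<in> Op. narrow (fst d) = False}" by auto
  then have "total_profit I Op = (\<Sum>d\<in>{d \<in> Op. narrow (fst d) = True} \<union> {d \<in> Op. narrow (fst d) = False}. pr (fst d))"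
    by (simp add: total_profit_def)
  also have "\<dots> = (\<Sum>d\<in>{d \<in> Op. narrow (fst d) = True}. pr (fst d)) + (\<Sum>d\<in>{d \<in> Op. narrow (fst d) = False}. pr (fst d))"
    using fO by (intro sum.union_disjoint) auto
  also have "\<dots> \<le> 34 * (\<Sum>i\<in>{i \<in> sel S. narrow i = True}. pr i) + 34 * (\<Sum>i\<in>{i \<in> sel S. narrow i = False}. pr i)"
    using opt_le_raised[OF assms, of True] opt_le_raised[OF assms, of False]
      raised_le_sel[of S True] raised_le_sel[of S False] by linarith
  also have "\<dots> = 34 * (\<Sum>i\<in>{i \<in> sel S. narrow i = True} \<union> {i \<in> sel S. narrow i = False}. pr i)"
    by (subst sum.union_disjoint) auto
  also have "{i \<in> sel S. narrow i = True} \<union> {i \<in> sel S. narrow i = False} = sel S" by auto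
  finally show ?thesis using solution_profit[of S] by linarith
qed

end

section \<open>Derived program constructs\<close>

primrec lift :: "prog \<Rightarrow> nat \<Rightarrow> prog" where
  "lift (Var i) k = Var (if i < k then i else Suc i)"
| "lift (Lit x) k = Lit x"
| "lift (Add a b) k = Add (lift a k) (lift b k)"
| "lift (Sub a b) k = Sub (lift a k) (lift b k)"
| "lift (Mul a b) k = Mul (lift a k) (lift b k)"
| "lift (Div a b) k = Div (lift a k) (lift b k)"
| "lift (Leq a b) k = Leq (lift a k) (lift b k)"
| "lift (Ite c a b) k = Ite (lift c k) (lift a k) (lift b k)"
| "lift (Bind a b) k = Bind (lift a k) (lift b (Suc k))"
| "lift Empty k = Empty"
| "lift (Push a b) k = Push (lift a k) (lift b k)"
| "lift (First a) k = First (lift a k)"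
| "lift (Rest a) k = Rest (lift a k)"
| "lift (IsEmpty a) k = IsEmpty (lift a k)"
| "lift (Foreach b l a) k = Foreach (lift b (Suc (Suc k))) (lift l k) (lift a k)"

text \<open>Variables beyond the \<open>k\<close> parameters become \<open>Empty\<close>, which has
  the value and the cost of an index outside the environment. A called program thus behaves as if
  its arguments were the whole environment.\<close>

primrec close :: "prog \<Rightarrow> nat \<Rightarrow> prog" where
  "close (Var i) k = (if i < k then Var i else Empty)"
| "close (Lit x) k = Lit x"
| "close (Add a b) k = Add (close a k) (close b k)"
| "close (Sub a b) k = Sub (close a k) (close b k)"
| "close (Mul a b) k = Mul (close a k) (close b k)"
| "close (Div a b) k = Div (close a k) (close b k)"
| "close (Leq a b) k = Leq (close a k) (close b k)"
| "close (Ite c a b) k = Ite (close c k) (close a k) (close b k)"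
| "close (Bind a b) k = Bind (close a k) (close b (Suc k))"
| "close Empty k = Empty"
| "close (Push a b) k = Push (close a k) (close b k)"
| "close (First a) k = First (close a k)"
| "close (Rest a) k = Rest (close a k)"
| "close (IsEmpty a) k = IsEmpty (close a k)"
| "close (Foreach b l a) k = Foreach (close b (Suc (Suc k))) (close l k) (close a k)"

lemma lift_sem:
  "ev (lift p (length xs)) (xs @ y # env) = ev p (xs @ env) \<and>
   cost (lift p (length xs)) (xs @ y # env) = cost p (xs @ env)"
proof (induction p arbitrary: xs)
  case (Bind a b)
  show ?case using Bind.IH(1)[of xs] Bind.IH(2)[of "_ # xs"] by simp
next
  case (Foreach b l a)
  show ?case using Foreach.IH(1)[of "_ # _ # xs"] Foreach.IH(2,3)[of xs] by simp
next
  case (Var i)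
  show ?case by (auto simp: nth_append)
qed auto

lemma lift_1 [simp]:
  "ev (lift p (Suc 0)) (x # y # env) = ev p (x # env)" "cost (lift p (Suc 0)) (x # y # env) = cost p (x # env)"
  using lift_sem[of p "[x]" y env] by auto

lemma lift_0 [simp]:
  "ev (lift p 0) (y # env) = ev p env" "cost (lift p 0) (y # env) = cost p env"
  using lift_sem[of p "[]" y env] by auto

lemma close_sem: "ev (close p k) env = ev p (take k env) \<and> cost (close p k) env = cost p (take k env)"
  by (induction p arbitrary: k env) auto

lemma lift_pow:
  "ev (((\<lambda>p. lift p 0) ^^ length xs) p) (xs @ env) = ev p env \<and>
   cost (((\<lambda>p. lift p 0) ^^ length xs) p) (xs @ env) = cost p env"
  by (induction xs) auto

text \<open>All arguments refer to the environment of the caller, so each is shifted past the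
  bindings already made.\<close>

fun bindall :: "nat \<Rightarrow> prog list \<Rightarrow> prog \<Rightarrow> prog" where
  "bindall k [] q = q"
| "bindall k (a # as) q = Bind (((\<lambda>p. lift p 0) ^^ k) a) (bindall (Suc k) as q)"

lemma bindall_sem:
  "ev (bindall (length xs) as q) (xs @ env) = ev q (rev (map (\<lambda>a. ev a env) as) @ xs @ env) \<and>
   cost (bindall (length xs) as q) (xs @ env) =
     length as + sum_list (map (\<lambda>a. cost a env) as) + cost q (rev (map (\<lambda>a. ev a env) as) @ xs @ env)"
proof (induction as arbitrary: xs)
  case (Cons a as)
  show ?case using Cons.IH[of "ev a env # xs"] lift_pow[of xs a env] by simp
qed simp

text \<open>The last binding becomes variable 0; binding in reverse makes that the first
  argument.\<close>

definition Call :: "prog \<Rightarrow> prog list \<Rightarrow> prog" where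
  "Call p as = bindall 0 (rev as) (close p (length as))"

lemma ev_Call [simp]: "ev (Call p as) env = ev p (map (\<lambda>a. ev a env) as)"
  using bindall_sem[of "[]" "rev as" "close p (length as)" env] close_sem[of p "length as"]
  by (simp add: Call_def rev_map)

lemma cost_Call: "cost (Call p as) env =
    length as + sum_list (map (\<lambda>a. cost a env) as) + cost p (map (\<lambda>a. ev a env) as)"
  using bindall_sem[of "[]" "rev as" "close p (length as)" env] close_sem[of p "length as"]
  by (simp add: Call_def rev_map sum_list_rev[of "map _ as", simplified rev_map])

section \<open>List combinators and their values\<close>

definition tr :: "val \<Rightarrow> bool" where "tr v \<longleftrightarrow> num v \<noteq> 0"

definition bv :: "bool \<Rightarrow> val" where "bv b = Num (if b then 1 else 0)"

definition nthv :: "val \<Rightarrow> nat \<Rightarrow> val" where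
  "nthv v n = (if n < length (elems v) then elems v ! n else Lst [])"

definition "It n a = First ((Rest ^^ n) a)"
definition "EQ a b = Ite (Leq a b) (Leq b a) (Lit 0)"
definition "AND a b = Ite a (Ite b (Lit 1) (Lit 0)) (Lit 0)"
definition "OR a b = Ite a (Lit 1) (Ite b (Lit 1) (Lit 0))"
definition "NOT a = Ite a (Lit 0) (Lit 1)"
definition "REV l = Foreach (Push (Var 0) (Var 1)) l Empty"
definition "MAP e l = REV (Foreach (Push (lift e 1) (Var 1)) l Empty)"
definition "FILT c l = REV (Foreach (Ite (lift c 1) (Push (Var 0) (Var 1)) (Var 1)) l Empty)"
definition "EXS c l = Foreach (Ite (lift c 1) (Lit 1) (Var 1)) l (Lit 0)"
definition "TOT e l = Foreach (Add (lift e 1) (Var 1)) l (Lit 0)"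
text \<open>The double reversal turns a number into the empty list, so the result is a list even if
  \<open>a\<close> is empty.\<close>

definition "APP a b = Foreach (Push (Var 0) (Var 1)) (REV a) (REV (REV b))"
definition "CMAP e l = Foreach (APP (lift e 1) (Var 1)) (REV l) Empty"
text \<open>One filtering per element of \<open>l\<close>; the condition sees an element as variable
  0 and the current list as variable 1. Filtering never lengthens a list, so the iteration stays
  polynomial.\<close>

definition "ITERF c l a = Foreach (FILT (lift c 1) (Var 1)) l a"

primrec TUP :: "prog list \<Rightarrow> prog" where
  "TUP [] = Empty"
| "TUP (a # as) = Push a (TUP as)"

lemma tr_bv [simp]: "tr (bv b) = b"
  by (simp add: tr_def bv_def)

lemma num_bv [simp]: "num (bv b) = (if b then 1 else 0)"
  by (simp add: bv_def)

lemma ev_Leq [simp]: "ev (Leq a b) env = bv (num (ev a env) \<le> num (ev b env))"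
  by (simp add: bv_def)

lemma ev_Ite [simp]: "ev (Ite c a b) env = (if tr (ev c env) then ev a env else ev b env)"
  by (simp add: tr_def)

lemma ev_IsEmpty [simp]: "ev (IsEmpty a) env = bv (elems (ev a env) = [])"
  by (simp add: bv_def)

declare ev.simps(7,8,14) [simp del]

lemma cost_Ite [simp]: "cost (Ite c a b) env = 1 + cost c env + (if tr (ev c env) then cost a env else cost b env)"
  by (simp add: tr_def)

declare cost.simps(8) [simp del]

lemma ev_Rests: "elems (ev ((Rest ^^ n) a) env) = drop n (elems (ev a env))"
  by (induction n) (auto simp: drop_Suc tl_drop)

lemma ev_It [simp]: "ev (It n a) env = nthv (ev a env) n"
  by (auto simp: It_def nthv_def ev_Rests Cons_nth_drop_Suc[symmetric] split: list.split)

lemma nthv_Lst [simp]: "n < length xs \<Longrightarrow> nthv (Lst xs) n = xs ! n"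
  by (simp add: nthv_def)

lemma nthv_Nil [simp]: "nthv (Lst []) n = Lst []"
  by (simp add: nthv_def)

lemma ev_First [simp]: "ev (First a) env = nthv (ev a env) 0"
  by (simp add: nthv_def split: list.split)

declare ev.simps(12) [simp del]

lemma ev_bool [simp]:
  "ev (EQ a b) env = bv (num (ev a env) = num (ev b env))"
  "ev (AND a b) env = bv (tr (ev a env) \<and> tr (ev b env))"
  "ev (OR a b) env = bv (tr (ev a env) \<or> tr (ev b env))"
  "ev (NOT a) env = bv (\<not> tr (ev a env))"
  by (auto simp: EQ_def AND_def OR_def NOT_def bv_def tr_def)

lemma foldl_push_Lst: "foldl (\<lambda>acc x. Lst (f x # elems acc)) (Lst a) xs = Lst (rev (map f xs) @ a)"
  by (induction xs arbitrary: a) auto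

lemma ev_REV [simp]: "ev (REV l) env = Lst (rev (elems (ev l env)))"
  using foldl_push_Lst[of "\<lambda>x. x" "[]"] by (simp add: REV_def)

lemma ev_MAP [simp]: "ev (MAP e l) env = Lst (map (\<lambda>x. ev e (x # env)) (elems (ev l env)))"
  using foldl_push_Lst[of "\<lambda>x. ev e (x # env)" "[]"] by (simp add: MAP_def rev_map)

lemma ev_FILT [simp]: "ev (FILT c l) env = Lst (filter (\<lambda>x. tr (ev c (x # env))) (elems (ev l env)))"
proof -
  have "foldl (\<lambda>acc x. if P x then Lst (x # elems acc) else acc) (Lst a) xs = Lst (rev (filter P xs) @ a)"
    for P :: "val \<Rightarrow> bool" and a xs
    by (induction xs arbitrary: a) auto
  then show ?thesis by (simp add: FILT_def cong: if_cong)
qed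

lemma ev_EXS [simp]: "ev (EXS c l) env = bv (\<exists>x\<in>set (elems (ev l env)). tr (ev c (x # env)))"
proof -
  have one: "foldl (\<lambda>acc x. if P x then Num 1 else acc) (Num 1) xs = Num 1" for P :: "val \<Rightarrow> bool" and xs
    by (induction xs) auto
  have "foldl (\<lambda>acc x. if P x then Num 1 else acc) (Num 0) xs = bv (\<exists>x\<in>set xs. P x)"
    for P :: "val \<Rightarrow> bool" and xs
    by (induction xs) (auto simp: bv_def one)
  from this[of "\<lambda>x. tr (ev c (x # env))"] show ?thesis by (simp add: EXS_def cong: if_cong)
qed

lemma ev_TOT [simp]: "ev (TOT e l) env = Num (\<Sum>x\<leftarrow>elems (ev l env). num (ev e (x # env)))"
proof -
  have "foldl (\<lambda>acc x. Num (f x + num acc)) (Num a) xs = Num (sum_list (map f xs) + a)"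
    for f :: "val \<Rightarrow> real" and a xs
    by (induction xs arbitrary: a) auto
  from this[of "\<lambda>x. num (ev e (x # env))" 0] show ?thesis by (simp add: TOT_def)
qed

lemma ev_APP [simp]: "ev (APP a b) env = Lst (elems (ev a env) @ elems (ev b env))"
  using foldl_push_Lst[of "\<lambda>x. x" "elems (ev b env)"] by (simp add: APP_def)

lemma foldl_app: "foldl (\<lambda>acc x. Lst (f x @ elems acc)) (Lst a) xs = Lst (concat (map f (rev xs)) @ a)"
  by (induction xs arbitrary: a) auto

lemma ev_CMAP [simp]: "ev (CMAP e l) env = Lst (concat (map (\<lambda>x. elems (ev e (x # env))) (elems (ev l env))))"
  using foldl_app[of "\<lambda>x. elems (ev e (x # env))" "[]"] by (simp add: CMAP_def)

lemma ev_ITERF: "ev (ITERF c l a) env =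
   ((\<lambda>acc. Lst (filter (\<lambda>x. tr (ev c (x # acc # env))) (elems acc))) ^^ length (elems (ev l env))) (ev a env)"
proof -
  have lift2: "ev (lift c (Suc 0)) (x # y # acc # env) = ev c (x # acc # env)" for x y acc
    using lift_sem[of c "[x]" y "acc # env"] by simp
  have "foldl (\<lambda>acc x. f acc) a xs = (f ^^ length xs) a" for f :: "val \<Rightarrow> val" and a and xs :: "val list"
    by (induction xs arbitrary: a) (auto simp: funpow_swap1)
  then show ?thesis by (simp add: ITERF_def lift2)
qed

section \<open>Polynomial cost\<close>

text \<open>Since only pushing makes lists longer, \<open>wd\<close> grows by at most the cost of a program.\<close>

primrec wd :: "val \<Rightarrow> nat" where
  "wd (Num x) = 0"
| "wd (Lst xs) = foldr max (map wd xs) (length xs)"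

lemma foldr_max_le: "foldr max ys b \<le> (B :: nat) \<longleftrightarrow> b \<le> B \<and> (\<forall>y\<in>set ys. y \<le> B)"
  by (induction ys) auto

lemma wd_Lst: "wd (Lst xs) \<le> B \<longleftrightarrow> length xs \<le> B \<and> (\<forall>x\<in>set xs. wd x \<le> B)"
  by (simp add: foldr_max_le)

declare wd.simps(2) [simp del]

lemma wd_elem: "x \<in> set (elems v) \<Longrightarrow> wd x \<le> wd v"
  by (cases v) (use wd_Lst in auto)

lemma wd_length: "length (elems v) \<le> wd v"
  by (cases v) (use wd_Lst in auto)

definition wde :: "val list \<Rightarrow> nat" where "wde env = foldr max (map wd env) 0"

lemma wde_le: "wde env \<le> B \<longleftrightarrow> (\<forall>v\<in>set env. wd v \<le> B)"
  by (simp add: wde_def foldr_max_le)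

lemma wde_simps [simp]: "wde [] = 0" "wde (v # env) = max (wd v) (wde env)"
  by (auto simp: wde_def)

lemma foldl_pair:
  "foldl (\<lambda>(acc, c) x. (f acc x, c + g acc x)) (a, c :: nat) xs =
   (foldl f a xs, c + (\<Sum>k<length xs. g (foldl f a (take k xs)) (xs ! k)))"
proof (induction xs rule: rev_induct)
  case (snoc x xs)
  then show ?case by (simp add: nth_append)
qed simp

lemma cost_Foreach: "cost (Foreach b l a) env = 1 + cost l env + cost a env +
    (\<Sum>k<length (elems (ev l env)).
       cost b (elems (ev l env) ! k # foldl (\<lambda>acc x. ev b (x # acc # env)) (ev a env) (take k (elems (ev l env))) # env))"
  using foldl_pair[of "\<lambda>acc x. ev b (x # acc # env)" "\<lambda>acc x. cost b (x # acc # env)" "ev a env" 0]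
  by simp

declare cost.simps(15) [simp del]

lemma wd_ev: "wd (ev p env) \<le> wde env + cost p env"
proof (induction p arbitrary: env)
  case (Var i)
  have "i < length env \<Longrightarrow> wd (env ! i) \<le> wde env" using wde_le[of env "wde env"] by auto
  then show ?case by (auto simp: wd_Lst intro: le_SucI)
next
  case (Ite c a b)
  show ?case using Ite.IH(2,3)[of env] by auto
next
  case (Bind a b)
  show ?case using Bind.IH(1)[of env] Bind.IH(2)[of "ev a env # env"] by simp
next
  case (Push a b)
  show ?case
    using Push.IH[of env] wd_elem[of _ "ev b env"] wd_length[of "ev b env"] by (force simp: wd_Lst)
next
  case (First a)
  show ?case using First.IH[of env] wd_elem[of "elems (ev a env) ! 0" "ev a env"]
    by (auto simp: nthv_def wd_Lst)
next
  case (Rest a)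
  have "set (tl (elems (ev a env))) \<subseteq> set (elems (ev a env))" by (cases "elems (ev a env)") auto
  then show ?case using Rest.IH[of env] wd_elem[of _ "ev a env"] wd_length[of "ev a env"]
    by (fastforce simp: wd_Lst)
next
  case (Foreach b l a)
  let ?xs = "elems (ev l env)" and ?f = "\<lambda>acc x. ev b (x # acc # env)"
  let ?c = "\<lambda>k. cost b (?xs ! k # foldl ?f (ev a env) (take k ?xs) # env)"
  have "n \<le> length ?xs \<Longrightarrow> wd (foldl ?f (ev a env) (take n ?xs)) \<le>
     wde env + cost l env + cost a env + (\<Sum>k<n. ?c k)" for n
  proof (induction n)
    case 0
    then show ?case using Foreach.IH(3)[of env] by simp
  next
    case (Suc n)
    have "wd (?xs ! n) \<le> wde env + cost l env"
      using wd_elem[of "?xs ! n" "ev l env"] Foreach.IH(2)[of env] Suc.prems by fastforce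
    moreover have "foldl ?f (ev a env) (take (Suc n) ?xs) = ?f (foldl ?f (ev a env) (take n ?xs)) (?xs ! n)"
      using Suc.prems by (simp add: take_Suc_conv_app_nth)
    ultimately show ?case
      using Suc Foreach.IH(1)[of "?xs ! n # foldl ?f (ev a env) (take n ?xs) # env"] by simp
  qed
  from this[of "length ?xs"] show ?case by (simp add: cost_Foreach)
qed (auto simp: wd_Lst bv_def)

text \<open>\<open>R\<close> relates environments to a size \<open>Z\<close>, and one exponent
  serves all related pairs. The size is kept apart from the environment because it will be the
  problem size plus the time.\<close>

definition pl :: "(nat \<Rightarrow> val list \<Rightarrow> bool) \<Rightarrow> (nat \<Rightarrow> val list \<Rightarrow> nat) \<Rightarrow> bool" where
  "pl R f \<longleftrightarrow> (\<exists>k. \<forall>Z env. R Z env \<longrightarrow> f Z env \<le> Z ^ k)"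

definition bd :: "(nat \<Rightarrow> val list \<Rightarrow> bool) \<Rightarrow> bool" where
  "bd R \<longleftrightarrow> (\<forall>Z env. R Z env \<longrightarrow> 2 \<le> Z) \<and> pl R (\<lambda>Z env. wde env)"

definition pol :: "(nat \<Rightarrow> val list \<Rightarrow> bool) \<Rightarrow> prog \<Rightarrow> bool" where
  "pol R p \<longleftrightarrow> pl R (\<lambda>Z env. cost p env)"

text \<open>The unconditional notion, measured in the width of an arbitrary environment, for
  programs that do not run \<open>M\<close>.\<close>

definition polyc :: "prog \<Rightarrow> bool" where
  "polyc p \<longleftrightarrow> (\<exists>k. \<forall>env. cost p env \<le> (2 + wde env) ^ k)"

lemma bd2: "bd R \<Longrightarrow> R Z env \<Longrightarrow> 2 \<le> Z"
  unfolding bd_def by blast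

lemma pl_mono: "pl R g \<Longrightarrow> (\<And>Z env. R Z env \<Longrightarrow> f Z env \<le> g Z env) \<Longrightarrow> pl R f"
  unfolding pl_def by (meson order_trans)

lemma pl_weaken: "pl R f \<Longrightarrow> (\<And>Z env. R' Z env \<Longrightarrow> R Z env) \<Longrightarrow> pl R' f"
  unfolding pl_def by meson

lemma pl_Z: "pl R (\<lambda>Z env. Z)"
  unfolding pl_def by (rule exI[of _ 1]) simp

lemma pl_const: "bd R \<Longrightarrow> pl R (\<lambda>Z env. c)"
proof -
  assume R: "bd R"
  have "c \<le> Z ^ c" if "2 \<le> Z" for Z :: nat
  proof -
    have "c \<le> 2 ^ c" using less_exp[of c] by simp
    also have "\<dots> \<le> Z ^ c" using that by (rule power_mono) simp
    finally show ?thesis .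
  qed
  then show ?thesis unfolding pl_def using bd2[OF R] by blast
qed

lemma pl_mult: "pl R f \<Longrightarrow> pl R g \<Longrightarrow> pl R (\<lambda>Z env. f Z env * g Z env)"
proof -
  assume "pl R f" "pl R g"
  then obtain k l where "\<And>Z env. R Z env \<Longrightarrow> f Z env \<le> Z ^ k" "\<And>Z env. R Z env \<Longrightarrow> g Z env \<le> Z ^ l"
    unfolding pl_def by meson
  then have "R Z env \<Longrightarrow> f Z env * g Z env \<le> Z ^ (k + l)" for Z env
    by (simp add: power_add mult_le_mono)
  then show ?thesis unfolding pl_def by blast
qed

lemma pl_add: "bd R \<Longrightarrow> pl R f \<Longrightarrow> pl R g \<Longrightarrow> pl R (\<lambda>Z env. f Z env + g Z env)"
proof -
  assume R: "bd R" and "pl R f" "pl R g"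
  then obtain k l where kl: "\<And>Z env. R Z env \<Longrightarrow> f Z env \<le> Z ^ k" "\<And>Z env. R Z env \<Longrightarrow> g Z env \<le> Z ^ l"
    unfolding pl_def by meson
  have "f Z env + g Z env \<le> Z ^ Suc (max k l)" if r: "R Z env" for Z env
  proof -
    have Z: "2 \<le> Z" using bd2[OF R r] .
    have "Z ^ k \<le> Z ^ max k l" "Z ^ l \<le> Z ^ max k l" using Z by (auto intro: power_increasing)
    then have "f Z env + g Z env \<le> 2 * Z ^ max k l" using kl[OF r] by linarith
    also have "\<dots> \<le> Z * Z ^ max k l" using Z by (intro mult_right_mono) auto
    finally show ?thesis by simp
  qed
  then show ?thesis unfolding pl_def by blast
qed

lemma pl_power: "pl R f \<Longrightarrow> pl R (\<lambda>Z env. f Z env ^ k)"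
  by (induction k) (auto intro: pl_mult simp: pl_def[of R "\<lambda>Z env. Suc 0"] intro!: exI[of _ 0])

lemma polyc_pol:
  assumes "polyc p" "bd R"
  shows "pol R p"
proof -
  obtain k where k: "\<And>env. cost p env \<le> (2 + wde env) ^ k" using assms(1) unfolding polyc_def by blast
  have "pl R (\<lambda>Z env. (2 + wde env) ^ k)"
    using assms(2) by (intro pl_power pl_add pl_const) (auto simp: bd_def)
  then show ?thesis unfolding pol_def by (rule pl_mono) (rule k)
qed

definition R0 :: "nat \<Rightarrow> val list \<Rightarrow> bool" where "R0 Z env \<longleftrightarrow> 2 \<le> Z \<and> wde env \<le> Z"

lemma bd_R0 [simp]: "bd R0"
  unfolding bd_def by (auto simp: R0_def intro: pl_mono[OF pl_Z])

lemma pol_polyc: "pol R0 p \<Longrightarrow> polyc p"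
proof -
  assume "pol R0 p"
  then obtain k where "\<And>Z env. R0 Z env \<Longrightarrow> cost p env \<le> Z ^ k" unfolding pol_def pl_def by blast
  then have "cost p env \<le> (2 + wde env) ^ k" for env by (simp add: R0_def)
  then show ?thesis unfolding polyc_def by blast
qed

lemma pol_wd: "bd R \<Longrightarrow> pol R p \<Longrightarrow> pl R (\<lambda>Z env. wd (ev p env))"
proof -
  assume "bd R" "pol R p"
  then have "pl R (\<lambda>Z env. wde env + cost p env)" by (intro pl_add) (auto simp: bd_def pol_def)
  then show ?thesis by (rule pl_mono) (rule wd_ev)
qed

text \<open>The environments in which an expression is evaluated once per element of
  \<open>l\<close>.\<close>

definition ext :: "(nat \<Rightarrow> val list \<Rightarrow> bool) \<Rightarrow> prog \<Rightarrow> nat \<Rightarrow> val list \<Rightarrow> bool" where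
  "ext R l Z env' \<longleftrightarrow> (\<exists>env x. R Z env \<and> x \<in> set (elems (ev l env)) \<and> env' = x # env)"

lemma bd_ext:
  assumes "bd R" "pol R l"
  shows "bd (ext R l)"
proof -
  have "pl R (\<lambda>Z env. wd (ev l env) + wde env)"
    using assms pol_wd by (intro pl_add) (auto simp: bd_def)
  then obtain k where k: "\<And>Z env. R Z env \<Longrightarrow> wd (ev l env) + wde env \<le> Z ^ k" unfolding pl_def by blast
  have "wde env' \<le> Z ^ k" if h: "ext R l Z env'" for Z env'
  proof -
    obtain env x where e: "R Z env" "x \<in> set (elems (ev l env))" "env' = x # env"
      using h unfolding ext_def by blast
    then show ?thesis using k[OF e(1)] wd_elem[OF e(2)] by simp
  qed
  then show ?thesis using assms(1) unfolding bd_def pl_def ext_def by blast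
qed

text \<open>Accumulators are described as folds over arbitrary short lists of loop elements; this
  covers all prefixes without mentioning positions.\<close>

lemma pol_Foreach:
  assumes R: "bd R" and l: "pol R l" and a: "pol R a"
    and b: "\<exists>g. pl R g \<and> (\<forall>Z env ys x. R Z env \<longrightarrow> x \<in> set (elems (ev l env)) \<longrightarrow> set ys \<subseteq> set (elems (ev l env)) \<longrightarrow>
      length ys \<le> length (elems (ev l env)) \<longrightarrow>
      cost b (x # foldl (\<lambda>acc x. ev b (x # acc # env)) (ev a env) ys # env) \<le> g Z env)"
  shows "pol R (Foreach b l a)"
proof -
  obtain g where g: "pl R g" "\<And>Z env ys x. R Z env \<Longrightarrow> x \<in> set (elems (ev l env)) \<Longrightarrow> set ys \<subseteq> set (elems (ev l env)) \<Longrightarrow>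
      length ys \<le> length (elems (ev l env)) \<Longrightarrow>
      cost b (x # foldl (\<lambda>acc x. ev b (x # acc # env)) (ev a env) ys # env) \<le> g Z env"
    using b by blast
  have "pl R (\<lambda>Z env. 1 + cost l env + cost a env + wd (ev l env) * g Z env)"
    using assms g(1) pol_wd[OF R l] by (intro pl_add pl_mult pl_const) (auto simp: pol_def)
  then show ?thesis
    unfolding pol_def
  proof (rule pl_mono)
    fix Z env assume r: "R Z env"
    let ?xs = "elems (ev l env)"
    have "(\<Sum>k<length ?xs. cost b (?xs ! k # foldl (\<lambda>acc x. ev b (x # acc # env)) (ev a env) (take k ?xs) # env))
      \<le> (\<Sum>k<length ?xs. g Z env)"
      by (intro sum_mono g(2)[OF r]) (auto dest: in_set_takeD)
    also have "\<dots> \<le> wd (ev l env) * g Z env" using wd_length[of "ev l env"] by simp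
    finally show "cost (Foreach b l a) env \<le> 1 + cost l env + cost a env + wd (ev l env) * g Z env"
      by (simp add: cost_Foreach)
  qed
qed

text \<open>For bodies whose cost does not depend on the accumulator; 9 is an allowance for their
  constant overhead.\<close>

lemma pol_loop:
  assumes R: "bd R" and l: "pol R l" and a: "pol R a" and e: "pol (ext R l) e"
    and b: "\<And>x acc env. cost b (x # acc # env) \<le> 9 + cost e (x # env)"
  shows "pol R (Foreach b l a)"
proof (rule pol_Foreach[OF R l a])
  obtain k where k: "\<And>Z env. ext R l Z env \<Longrightarrow> cost e env \<le> Z ^ k" using e unfolding pol_def pl_def by blast
  have "pl R (\<lambda>Z env. 9 + Z ^ k)" using R by (intro pl_add pl_const pl_power pl_Z)
  moreover have "cost b (x # acc # env) \<le> 9 + Z ^ k" if "R Z env" "x \<in> set (elems (ev l env))" for x acc env Z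
    using b[of x acc env] k[of Z "x # env"] that unfolding ext_def by force
  ultimately show "\<exists>g. pl R g \<and> (\<forall>Z env ys x. R Z env \<longrightarrow> x \<in> set (elems (ev l env)) \<longrightarrow> set ys \<subseteq> set (elems (ev l env)) \<longrightarrow>
      length ys \<le> length (elems (ev l env)) \<longrightarrow>
      cost b (x # foldl (\<lambda>acc x. ev b (x # acc # env)) (ev a env) ys # env) \<le> g Z env)"
    by blast
qed

lemma pol_atom:
  assumes "bd R" "\<And>env. cost p env \<le> 1"
  shows "pol R p"
  unfolding pol_def by (rule pl_mono[OF pl_const[OF assms(1), of 1]]) (rule assms(2))

lemma pol_op1:
  assumes "bd R" "pol R a" "\<And>env. cost p env \<le> 1 + cost a env"
  shows "pol R p"
  unfolding pol_def
  by (rule pl_mono[OF pl_add[OF assms(1) pl_const[OF assms(1), of 1] assms(2)[unfolded pol_def]]]) (rule assms(3))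

lemma pol_op2:
  assumes "bd R" "pol R a" "pol R b" "\<And>env. cost p env \<le> 1 + cost a env + cost b env"
  shows "pol R p"
  unfolding pol_def
  by (rule pl_mono[OF pl_add[OF assms(1) pl_add[OF assms(1) pl_const[OF assms(1), of 1]
      assms(2)[unfolded pol_def]] assms(3)[unfolded pol_def]]]) (rule assms(4))

lemma pol_atoms:
  assumes "bd R"
  shows pol_Lit: "pol R (Lit x)" and pol_Var: "pol R (Var i)" and pol_Empty: "pol R Empty"
  by (rule pol_atom[OF assms], simp)+

lemma pol_binary:
  assumes "bd R" "pol R a" "pol R b"
  shows "pol R (Add a b)" "pol R (Sub a b)" "pol R (Mul a b)" "pol R (Div a b)" "pol R (Leq a b)" "pol R (Push a b)"
  by (rule pol_op2[OF assms], simp)+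

lemma pol_unary:
  assumes "bd R" "pol R a"
  shows "pol R (First a)" "pol R (Rest a)" "pol R (IsEmpty a)"
  by (rule pol_op1[OF assms], simp)+

lemma pol_Ite:
  assumes R: "bd R" and c: "pol R c" and a: "pol (\<lambda>Z env. R Z env \<and> tr (ev c env)) a"
    and b: "pol (\<lambda>Z env. R Z env \<and> \<not> tr (ev c env)) b"
  shows "pol R (Ite c a b)"
proof -
  obtain k l where kl: "\<And>Z env. R Z env \<Longrightarrow> tr (ev c env) \<Longrightarrow> cost a env \<le> Z ^ k"
    "\<And>Z env. R Z env \<Longrightarrow> \<not> tr (ev c env) \<Longrightarrow> cost b env \<le> Z ^ l"
    using a b unfolding pol_def pl_def by blast
  have "pl R (\<lambda>Z env. 1 + cost c env + (Z ^ k + Z ^ l))"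
    using R c by (intro pl_add pl_const pl_power pl_Z) (auto simp: pol_def)
  then show ?thesis
    unfolding pol_def by (rule pl_mono) (use kl in \<open>auto simp: trans_le_add1 trans_le_add2\<close>)
qed

lemma pl_sum_list:
  assumes "bd R" "\<And>a. a \<in> set as \<Longrightarrow> pl R (f a)"
  shows "pl R (\<lambda>Z env. \<Sum>a\<leftarrow>as. f a Z env)"
  using assms(2) by (induction as) (auto intro: pl_add[OF assms(1)] pl_const[OF assms(1)])

lemma pol_Call:
  assumes R: "bd R" and as: "\<And>a. a \<in> set as \<Longrightarrow> pol R a"
    and p: "pl R (\<lambda>Z env. cost p (map (\<lambda>a. ev a env) as))"
  shows "pol R (Call p as)"
  using assms pl_sum_list[OF R, of as "\<lambda>a Z env. cost a env"] unfolding pol_def cost_Call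
  by (intro pl_add pl_const) auto

lemma pol_TUP: "bd R \<Longrightarrow> (\<And>a. a \<in> set as \<Longrightarrow> pol R a) \<Longrightarrow> pol R (TUP as)"
  by (induction as) (auto intro: pol_Empty pol_binary)

lemma pol_REV: "bd R \<Longrightarrow> pol R l \<Longrightarrow> pol R (REV l)"
  unfolding REV_def by (rule pol_loop[where e = Empty]) (auto intro: pol_Empty bd_ext)

lemma pol_MAP: "bd R \<Longrightarrow> pol R l \<Longrightarrow> pol (ext R l) e \<Longrightarrow> pol R (MAP e l)"
  unfolding MAP_def by (intro pol_REV, assumption, rule pol_loop[where e = e]) (auto intro: pol_Empty)

lemma pol_FILT: "bd R \<Longrightarrow> pol R l \<Longrightarrow> pol (ext R l) c \<Longrightarrow> pol R (FILT c l)"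
  unfolding FILT_def by (intro pol_REV, assumption, rule pol_loop[where e = c]) (auto intro: pol_Empty)

lemma pol_EXS: "bd R \<Longrightarrow> pol R l \<Longrightarrow> pol (ext R l) c \<Longrightarrow> pol R (EXS c l)"
  unfolding EXS_def by (rule pol_loop[where e = c]) (auto intro: pol_Lit)

lemma pol_TOT: "bd R \<Longrightarrow> pol R l \<Longrightarrow> pol (ext R l) e \<Longrightarrow> pol R (TOT e l)"
  unfolding TOT_def by (rule pol_loop[where e = e]) (auto intro: pol_Lit)

lemma pol_APP: "bd R \<Longrightarrow> pol R a \<Longrightarrow> pol R b \<Longrightarrow> pol R (APP a b)"
  unfolding APP_def by (rule pol_loop[where e = Empty]) (auto intro!: pol_Empty bd_ext pol_REV)

lemma cost_REV: "cost (REV l) env = 2 + cost l env + 3 * length (elems (ev l env))"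
  by (simp add: REV_def cost_Foreach)

lemma cost_APP: "cost (APP a b) env = 7 + cost a env + cost b env + 6 * length (elems (ev a env)) + 6 * length (elems (ev b env))"
  by (simp add: APP_def cost_Foreach cost_REV)

text \<open>Here the accumulator grows and is copied in every iteration. It is a concatenation of
  polynomially many pieces of polynomial length, so copying stays affordable.\<close>

lemma pol_CMAP:
  assumes R: "bd R" and l: "pol R l" and e: "pol (ext R l) e"
  shows "pol R (CMAP e l)"
  unfolding CMAP_def
proof (rule pol_Foreach[OF R pol_REV[OF R l] pol_Empty[OF R]])
  have "pl (ext R l) (\<lambda>Z env. cost e env + wd (ev e env))"
    using e pol_wd[OF bd_ext[OF R l] e] by (intro pl_add bd_ext R l) (auto simp: pol_def)
  then obtain k where k: "\<And>Z env. ext R l Z env \<Longrightarrow> cost e env + wd (ev e env) \<le> Z ^ k"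
    unfolding pl_def by blast
  let ?g = "\<lambda>Z env. 8 + 7 * Z ^ k + 6 * (wd (ev l env) * Z ^ k)"
  have "pl R ?g"
    using R pol_wd[OF R l] by (intro pl_add pl_mult pl_const pl_power pl_Z)
  moreover have "cost (APP (lift e 1) (Var 1)) (x # foldl (\<lambda>acc x. ev (APP (lift e 1) (Var 1)) (x # acc # env)) (ev Empty env) ys # env)
      \<le> ?g Z env"
    if r: "R Z env" "x \<in> set (elems (ev (REV l) env))" "set ys \<subseteq> set (elems (ev (REV l) env))"
      "length ys \<le> length (elems (ev (REV l) env))" for Z env ys x
  proof -
    have kx: "cost e (x # env) + length (elems (ev e (x # env))) \<le> Z ^ k" if "x \<in> set (elems (ev l env))" for x
    proof -
      have "ext R l Z (x # env)" using r(1) that by (auto simp: ext_def)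
      from k[OF this] show ?thesis using wd_length[of "ev e (x # env)"] by linarith
    qed
    have acc: "foldl (\<lambda>acc x. ev (APP (lift e 1) (Var 1)) (x # acc # env)) (ev Empty env) ys
      = Lst (concat (map (\<lambda>x. elems (ev e (x # env))) (rev ys)))"
      using foldl_app[of "\<lambda>x. elems (ev e (x # env))" "[]" ys] by simp
    have "length (concat (map (\<lambda>x. elems (ev e (x # env))) (rev ys))) \<le> length ys * Z ^ k"
      using r(3)
    proof (induction ys)
      case (Cons y ys)
      then show ?case using kx[of y] by simp
    qed simp
    also have "\<dots> \<le> wd (ev l env) * Z ^ k"
      using r(4) wd_length[of "ev l env"] by (intro mult_right_mono) auto
    finally show ?thesis using kx[of x] r(2) unfolding acc by (simp add: cost_APP)
  qed
  ultimately show "\<exists>g. pl R g \<and> (\<forall>Z env ys x. R Z env \<longrightarrow> x \<in> set (elems (ev (REV l) env)) \<longrightarrow>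
      set ys \<subseteq> set (elems (ev (REV l) env)) \<longrightarrow> length ys \<le> length (elems (ev (REV l) env)) \<longrightarrow>
      cost (APP (lift e 1) (Var 1)) (x # foldl (\<lambda>acc x. ev (APP (lift e 1) (Var 1)) (x # acc # env)) (ev Empty env) ys # env) \<le> g Z env)"
    by blast
qed

section \<open>Unconditional cost bounds\<close>

lemma polyc_simple [intro]:
  "polyc (Lit x)" "polyc (Var i)" "polyc Empty"
  by (rule pol_polyc, rule pol_atoms, simp)+

lemma polyc_binary [intro]:
  assumes "polyc a" "polyc b"
  shows "polyc (Add a b)" "polyc (Sub a b)" "polyc (Mul a b)" "polyc (Div a b)" "polyc (Leq a b)" "polyc (Push a b)"
    "polyc (APP a b)"
  using assms by (auto intro!: pol_polyc pol_binary pol_APP intro: polyc_pol)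

lemma polyc_unary [intro]:
  assumes "polyc a"
  shows "polyc (First a)" "polyc (Rest a)" "polyc (IsEmpty a)" "polyc (REV a)"
  using assms by (auto intro!: pol_polyc pol_unary pol_REV intro: polyc_pol)

lemma bd_sub: "bd R \<Longrightarrow> (\<And>Z env. R' Z env \<Longrightarrow> R Z env) \<Longrightarrow> bd R'"
  unfolding bd_def using pl_weaken by blast

lemma polyc_Ite [intro]: "polyc c \<Longrightarrow> polyc a \<Longrightarrow> polyc b \<Longrightarrow> polyc (Ite c a b)"
  by (rule pol_polyc, rule pol_Ite[OF bd_R0])
    (rule polyc_pol, assumption, rule bd_sub[OF bd_R0], simp)+

lemma polyc_ext: "polyc e \<Longrightarrow> polyc l \<Longrightarrow> pol (ext R0 l) e"
  by (rule polyc_pol, assumption, rule bd_ext[OF bd_R0], rule polyc_pol[OF _ bd_R0])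

lemma polyc_loops [intro]:
  assumes "polyc e" "polyc l"
  shows "polyc (MAP e l)" "polyc (FILT e l)" "polyc (EXS e l)" "polyc (TOT e l)" "polyc (CMAP e l)"
  by (rule pol_polyc, (rule pol_MAP pol_FILT pol_EXS pol_TOT pol_CMAP)[1],
      rule bd_R0, rule polyc_pol[OF assms(2) bd_R0], rule polyc_ext[OF assms])+

lemma polyc_bool [intro]:
  assumes "polyc a"
  shows "polyc b \<Longrightarrow> polyc (EQ a b)" "polyc b \<Longrightarrow> polyc (AND a b)" "polyc b \<Longrightarrow> polyc (OR a b)" "polyc (NOT a)"
  using assms by (auto simp: EQ_def AND_def OR_def NOT_def)

lemma polyc_It [intro]: "polyc a \<Longrightarrow> polyc (It n a)"
proof -
  assume "polyc a"
  then have "polyc ((Rest ^^ n) a)" by (induction n) auto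
  then show ?thesis by (auto simp: It_def)
qed

lemma polyc_TUP [intro]: "(\<And>a. a \<in> set as \<Longrightarrow> polyc a) \<Longrightarrow> polyc (TUP as)"
  by (induction as) auto

lemma polyc_Call [intro]:
  assumes p: "polyc p" and as: "\<And>a. a \<in> set as \<Longrightarrow> polyc a"
  shows "polyc (Call p as)"
proof (rule pol_polyc, rule pol_Call)
  show "pol R0 a" if "a \<in> set as" for a using as[OF that] by (auto intro: polyc_pol)
  obtain k where k: "\<And>env. cost p env \<le> (2 + wde env) ^ k" using p unfolding polyc_def by blast
  have wds: "pl R0 (\<lambda>Z env. \<Sum>a\<leftarrow>as. wd (ev a env))"
    using as by (intro pl_sum_list) (auto intro!: pol_wd intro: polyc_pol)
  have "pl R0 (\<lambda>Z env. (2 + (\<Sum>a\<leftarrow>as. wd (ev a env))) ^ k)"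
    by (intro pl_power pl_add pl_const wds) auto
  then show "pl R0 (\<lambda>Z env. cost p (map (\<lambda>a. ev a env) as))"
  proof (rule pl_mono)
    fix Z env
    have "wde (map (\<lambda>a. ev a env) as) \<le> (\<Sum>a\<leftarrow>as. wd (ev a env))" by (induction as) auto
    then show "cost p (map (\<lambda>a. ev a env) as) \<le> (2 + (\<Sum>a\<leftarrow>as. wd (ev a env))) ^ k"
      using k[of "map (\<lambda>a. ev a env) as"] power_mono[of "2 + wde (map (\<lambda>a. ev a env) as)" "2 + (\<Sum>a\<leftarrow>as. wd (ev a env))" k]
      by linarith
  qed
qed simp

lemma polyc_ITERF [intro]:
  assumes c: "polyc c" and l: "polyc l" and a: "polyc a"
  shows "polyc (ITERF c l a)"
  unfolding ITERF_def
proof (rule pol_polyc, rule pol_Foreach)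
  show pl: "pol R0 l" "pol R0 a" using l a by (auto intro: polyc_pol)
  let ?b = "FILT (lift c 1) (Var 1)"
  have "polyc (FILT c (Var 0))" using c by blast
  then obtain k where k: "\<And>env. cost (FILT c (Var 0)) env \<le> (2 + wde env) ^ k" unfolding polyc_def by blast
  have eqc: "cost ?b (y # acc # env) = cost (FILT c (Var 0)) (acc # env)" for y acc env
  proof -
    show ?thesis by (simp add: FILT_def cost_REV cost_Foreach cong: if_cong)
  qed
  have sub: "wd (foldl (\<lambda>acc x. ev ?b (x # acc # env)) v ys) \<le> wd v" for ys v env
  proof (induction ys arbitrary: v)
    case (Cons y ys)
    have "wd (ev ?b (y # v # env)) \<le> wd v"
      using wd_elem[of _ v] wd_length[of v] by (auto simp: wd_Lst intro: order_trans[OF length_filter_le])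
    then show ?case using Cons[of "ev ?b (y # v # env)"] by simp
  qed simp
  have "pl R0 (\<lambda>Z env. (2 + (wd (ev a env) + wde env)) ^ k)"
    using pol_wd[OF _ pl(2)] bd_R0 unfolding bd_def by (intro pl_power pl_add pl_const) auto
  moreover have "cost ?b (x # foldl (\<lambda>acc x. ev ?b (x # acc # env)) (ev a env) ys # env)
      \<le> (2 + (wd (ev a env) + wde env)) ^ k" for x ys env
  proof -
    have "cost ?b (x # foldl (\<lambda>acc x. ev ?b (x # acc # env)) (ev a env) ys # env)
       \<le> (2 + wde (foldl (\<lambda>acc x. ev ?b (x # acc # env)) (ev a env) ys # env)) ^ k"
      unfolding eqc by (rule k)
    also have "\<dots> \<le> (2 + (wd (ev a env) + wde env)) ^ k"
      using sub[of env "ev a env" ys] by (intro power_mono) auto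
    finally show ?thesis .
  qed
  ultimately show "\<exists>g. pl R0 g \<and> (\<forall>Z env ys x. R0 Z env \<longrightarrow> x \<in> set (elems (ev l env)) \<longrightarrow> set ys \<subseteq> set (elems (ev l env)) \<longrightarrow>
      length ys \<le> length (elems (ev l env)) \<longrightarrow>
      cost ?b (x # foldl (\<lambda>acc x. ev ?b (x # acc # env)) (ev a env) ys # env) \<le> g Z env)"
    by blast
qed simp

section \<open>Local subprograms\<close>

definition "eqe a b = AND (EQ (It 0 a) (It 0 b)) (EQ (It 1 a) (It 1 b))"
definition "memn a l = EXS (EQ (Var 0) (lift a 0)) l"

text \<open>The complement of a graph search, in the form of filtering: from the list of all
  endpoints, \<open>u\<close> is deleted and then every vertex joined by an edge other than
  \<open>e\<close> to a vertex no longer listed.\<close>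

definition "p_reach = ITERF
  (AND (NOT (EQ (Var 0) (Var 4)))
    (NOT (EXS (AND (NOT (eqe (Var 0) (Var 3)))
       (OR (AND (EQ (It 0 (Var 0)) (Var 1)) (NOT (memn (It 1 (Var 0)) (Var 2))))
           (AND (EQ (It 1 (Var 0)) (Var 1)) (NOT (memn (It 0 (Var 0)) (Var 2)))))) (Var 3))))
  (APP (MAP (It 0 (Var 0)) (Var 1)) (MAP (It 1 (Var 0)) (Var 1)))
  (APP (MAP (It 0 (Var 0)) (Var 1)) (MAP (It 1 (Var 0)) (Var 1)))"
definition "p_sep = memn (Var 3) p_reach"
text \<open>The path is computed as a \<open>cut\<close>: the edges without which one end is not
  reached from the other.\<close>

definition "p_path = FILT (Call p_sep [Var 0, Var 1, Var 2, Var 3]) (Var 0)"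
definition "p_meet = EXS (EXS (eqe (Var 0) (Var 1)) (Var 2)) (Var 0)"

text \<open>Items describe demand instances; the fields are the demand, the tree-network, profit, height,
  residual profit, path, and the state and decision of the simulated vertex.\<close>

definition "p_narrow a = Leq (Add (It 3 a) (It 3 a)) (Lit 1)"
definition "p_conf = AND (NOT (EQ (It 0 (Var 0)) (It 0 (Var 1))))
  (AND (EQ (p_narrow (Var 0)) (p_narrow (Var 1))) (Call p_meet [It 5 (Var 0), It 5 (Var 1)]))"

primrec p_hits :: "nat \<Rightarrow> prog" where
  "p_hits 0 = IsEmpty (Var 1)"
| "p_hits (Suc k) = OR (IsEmpty (Var 1))
     (EXS (Call (p_hits k) [Var 1, FILT (NOT (EXS (eqe (Var 0) (Var 2)) (It 5 (Var 0)))) (Var 2)]) (Var 0))"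

definition "p_pierce = Call (p_hits 8) [It 5 (Var 0), FILT (Call p_meet [It 5 (Var 1), It 5 (Var 0)]) (Var 1)]"
definition "p_unsat = NOT (Leq (Add (It 4 (Var 0)) (It 4 (Var 0))) (It 2 (Var 0)))"
definition "p_rem = ITERF (OR (NOT (Call p_pierce [Var 0, Var 1]))
   (EXS (AND (Call p_unsat [Var 0]) (Call p_pierce [Var 0, Var 2])) (Var 1))) (Var 0) (Var 0)"
definition "p_flag2 = AND (AND (Call p_unsat [Var 0]) (Call p_pierce [Var 0, Var 2]))
   (NOT (EXS (AND (AND (AND (Call p_unsat [Var 0]) (Call p_pierce [Var 0, Var 3])) (Call p_conf [Var 1, Var 0]))
     (NOT (Leq (It 2 (Var 0)) (Add (It 2 (Var 1)) (It 2 (Var 1)))))) (Var 1)))"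
definition "p_flag = Call p_flag2 [Var 0, Var 1, Call p_rem [Var 1]]"
definition "p_active = Call p_flag [Var 0, FILT (EQ (It 1 (Var 0)) (It 1 (Var 1))) (Var 1)]"
definition "p_adj = AND (OR (AND (EQ (It 0 (Var 0)) (It 0 (Var 1))) (NOT (EQ (It 1 (Var 0)) (It 1 (Var 1)))))
     (AND (EQ (It 1 (Var 0)) (It 1 (Var 1))) (Call p_conf [Var 0, Var 1])))
   (AND (Call p_active [Var 0, Var 2]) (Call p_active [Var 1, Var 2]))"


lemma lift_It [simp]: "lift (It n a) k = It n (lift a k)"
proof -
  have "lift ((Rest ^^ n) a) k = (Rest ^^ n) (lift a k)" by (induction n) auto
  then show ?thesis by (simp add: It_def)
qed

lemma polyc_list:
  "list_all polyc []" "polyc a \<Longrightarrow> list_all polyc as \<Longrightarrow> list_all polyc (a # as)"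
  "polyc p \<Longrightarrow> list_all polyc as \<Longrightarrow> polyc (Call p as)" "list_all polyc as \<Longrightarrow> polyc (TUP as)"
  by (auto simp: list_all_iff)

lemma polyc_eqe: "polyc a \<Longrightarrow> polyc b \<Longrightarrow> polyc (eqe a b)"
  by (auto simp: eqe_def)

lemma polyc_memn: "polyc (lift a 0) \<Longrightarrow> polyc l \<Longrightarrow> polyc (memn a l)"
  by (auto simp: memn_def)

lemmas polycI = polyc_list polyc_simple polyc_binary polyc_unary polyc_Ite polyc_loops polyc_bool polyc_It
  polyc_ITERF polyc_eqe polyc_memn

lemma polyc_meet [intro]: "polyc p_meet"
  unfolding p_meet_def by (intro polycI)

lemma polyc_path [intro]: "polyc p_path"
  unfolding p_path_def p_sep_def p_reach_def by (intro polycI; simp; intro polycI)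

lemma polyc_conf [intro]: "polyc p_conf"
  unfolding p_conf_def p_narrow_def by (intro polycI polyc_meet)

lemma polyc_hits [intro]: "polyc (p_hits k)"
  by (induction k) (simp_all, (intro polycI | assumption)+)

lemma polyc_pierce [intro]: "polyc p_pierce"
  unfolding p_pierce_def by (intro polycI polyc_hits polyc_meet)

lemma polyc_unsat [intro]: "polyc p_unsat"
  unfolding p_unsat_def by (intro polycI)

lemma polyc_active [intro]: "polyc p_active"
  unfolding p_active_def p_flag_def p_flag2_def p_rem_def
  by (intro polycI polyc_pierce polyc_unsat polyc_conf)

lemma polyc_adj [intro]: "polyc p_adj"
  unfolding p_adj_def by (intro polycI polyc_active polyc_conf)

section \<open>Encodings, and values of the local subprograms\<close>

definition encp :: "nat \<times> nat \<Rightarrow> val" where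
  "encp e = Lst [Num (real (fst e)), Num (real (snd e))]"

lemma num_encp [simp]: "nthv (encp e) 0 = Num (real (fst e))" "nthv (encp e) (Suc 0) = Num (real (snd e))"
  by (simp_all add: encp_def)

lemma ev_eqe [simp]: "ev (eqe a b) env =
    bv (num (nthv (ev a env) 0) = num (nthv (ev b env) 0) \<and> num (nthv (ev a env) (Suc 0)) = num (nthv (ev b env) (Suc 0)))"
  by (simp add: eqe_def)

lemma ev_memn [simp]: "ev (memn a l) env = bv (\<exists>x\<in>set (elems (ev l env)). num x = num (ev a env))"
  by (simp add: memn_def)

text \<open>A step that changes the list shortens it, so it comes to rest within
  \<open>length A\<close> steps.\<close>

lemma iter_filter_stable:
  assumes "\<And>A. f A = filter (Q A) A"
  shows "f ((f ^^ length A) A) = (f ^^ length A) A"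
proof -
  have "f ((f ^^ k) A) = (f ^^ k) A \<or> length ((f ^^ k) A) + k \<le> length A" for k
  proof (induction k)
    case (Suc k)
    let ?B = "(f ^^ k) A"
    show ?case
    proof (cases "f ?B = ?B")
      case False
      then have "length (f ?B) < length ?B"
        using assms[of ?B] by (metis filter_True length_filter_less)
      then show ?thesis using Suc False by auto
    qed simp
  qed simp
  from this[of "length A"] show ?thesis using assms[of "[]"] by auto
qed

text \<open>Ordered pairs give each edge a single code, so programs may compare edges
  componentwise.\<close>

definition ordered_edges :: "nat set set \<Rightarrow> (nat \<times> nat) list \<Rightarrow> bool" where
  "ordered_edges E es \<longleftrightarrow> (\<forall>(x, y)\<in>set es. x < y) \<and> E = (\<lambda>(x, y). {x, y}) ` set es"

lemma ordered_edges_mem: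
  assumes "ordered_edges E es"
  shows "{x, y} \<in> E \<longleftrightarrow> (x, y) \<in> set es \<or> (y, x) \<in> set es"
proof
  assume "{x, y} \<in> E"
  then obtain a b where "(a, b) \<in> set es" "{x, y} = {a, b}" using assms by (auto simp: ordered_edges_def)
  then show "(x, y) \<in> set es \<or> (y, x) \<in> set es" by (auto simp: doubleton_eq_iff)
next
  have "E = (\<lambda>(x, y). {x, y}) ` set es" using assms by (simp add: ordered_edges_def)
  moreover assume "(x, y) \<in> set es \<or> (y, x) \<in> set es"
  ultimately show "{x, y} \<in> E"
    using image_eqI[of "{x, y}" "\<lambda>(x, y). {x, y}" "(x, y)" "set es"]
      image_eqI[of "{x, y}" "\<lambda>(x, y). {x, y}" "(y, x)" "set es"] by (auto simp: insert_commute)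
qed

definition unreached :: "(nat \<times> nat) list \<Rightarrow> nat \<times> nat \<Rightarrow> nat \<Rightarrow> nat list \<Rightarrow> nat list" where
  "unreached es e u A = filter (\<lambda>x. x \<noteq> u \<and> \<not> (\<exists>f\<in>set es. f \<noteq> e \<and>
      (fst f = x \<and> snd f \<notin> set A \<or> snd f = x \<and> fst f \<notin> set A))) A"

lemma set_unreached: "x \<in> set (unreached es e u A) \<longleftrightarrow> x \<in> set A \<and> x \<noteq> u \<and> \<not> (\<exists>f\<in>set es. f \<noteq> e \<and>
      (fst f = x \<and> snd f \<notin> set A \<or> snd f = x \<and> fst f \<notin> set A))"
  by (simp add: unreached_def)

definition endpoints :: "(nat \<times> nat) list \<Rightarrow> nat list" where
  "endpoints es = map fst es @ map snd es"

lemma ev_reach: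
  "ev p_reach [encp e, Lst (map encp es), Num (real u), v] =
     Lst (map (\<lambda>x. Num (real x)) ((unreached es e u ^^ length (endpoints es)) (endpoints es)))"
proof -
  let ?N = "\<lambda>A. Lst (map (\<lambda>x. Num (real x)) A)"
  let ?env = "[encp e, Lst (map encp es), Num (real u), v]"
  have step: "Lst (filter (\<lambda>x. tr (ev
    (AND (NOT (EQ (Var 0) (Var 4)))
    (NOT (EXS (AND (NOT (eqe (Var 0) (Var 3)))
       (OR (AND (EQ (It 0 (Var 0)) (Var 1)) (NOT (memn (It 1 (Var 0)) (Var 2))))
           (AND (EQ (It 1 (Var 0)) (Var 1)) (NOT (memn (It 0 (Var 0)) (Var 2)))))) (Var 3))))
    (x # ?N A # ?env))) (elems (?N A))) = ?N (unreached es e u A)" for A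
    by (auto simp: unreached_def filter_map o_def prod_eq_iff intro!: arg_cong[of _ _ "map _"] filter_cong)
  have "((\<lambda>acc. Lst (filter (\<lambda>x. tr (ev
    (AND (NOT (EQ (Var 0) (Var 4)))
    (NOT (EXS (AND (NOT (eqe (Var 0) (Var 3)))
       (OR (AND (EQ (It 0 (Var 0)) (Var 1)) (NOT (memn (It 1 (Var 0)) (Var 2))))
           (AND (EQ (It 1 (Var 0)) (Var 1)) (NOT (memn (It 0 (Var 0)) (Var 2)))))) (Var 3))))
    (x # acc # ?env))) (elems acc))) ^^ k) (?N A) = ?N ((unreached es e u ^^ k) A)" for k A
    by (induction k) (simp_all only: funpow.simps o_apply id_apply step)
  note pow = this
  have start: "ev (APP (MAP (It 0 (Var 0)) (Var 1)) (MAP (It 1 (Var 0)) (Var 1))) ?env = ?N (endpoints es)"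
    by (simp add: endpoints_def)
  show ?thesis
    unfolding p_reach_def ev_ITERF start elems.simps length_map by (rule pow)
qed

text \<open>Vertices that disappear are reachable from \<open>u\<close>, by induction over the
  steps. Conversely the final list is stable, so no remaining edge joins it to its complement, which
  contains \<open>u\<close>.\<close>

lemma (in tree_net) unreached_cut:
  assumes es: "ordered_edges E es" and e: "e \<in> set es" and uv: "u < n" "v < n"
  shows "v \<in> set ((unreached es e u ^^ length (endpoints es)) (endpoints es)) \<longleftrightarrow> {fst e, snd e} \<in> P u v"
proof -
  let ?F = "E - {{fst e, snd e}}"
  define A where "A = (unreached es e u ^^ length (endpoints es)) (endpoints es)"
  have ord: "x < y" if "(x, y) \<in> set es" for x y using es that by (auto simp: ordered_edges_def)
  have neq: "{x, y} = {fst e, snd e} \<longleftrightarrow> (x, y) = e" if "(x, y) \<in> set es" for x y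
    using ord[OF that] ord[of "fst e" "snd e"] e by (auto simp: doubleton_eq_iff)
  have F: "{x, y} \<in> ?F \<longleftrightarrow> (x, y) \<in> set es - {e} \<or> (y, x) \<in> set es - {e}" for x y
    using ordered_edges_mem[OF es, of x y] neq[of x y] neq[of y x] by (auto simp: insert_commute)
  have stable: "unreached es e u A = A"
    unfolding A_def by (rule iter_filter_stable) (simp add: unreached_def)
  have A1: "x \<noteq> u" "{x, y} \<in> ?F \<Longrightarrow> y \<in> set A" if x: "x \<in> set A" for x y
  proof -
    have "x \<in> set (unreached es e u A)" using x stable by simp
    then have *: "x \<noteq> u" "\<And>f. f \<in> set es \<Longrightarrow> f \<noteq> e \<Longrightarrow> \<not> (fst f = x \<and> snd f \<notin> set A \<or> snd f = x \<and> fst f \<notin> set A)"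
      unfolding set_unreached by blast+
    show "x \<noteq> u" by (rule *)
    assume "{x, y} \<in> ?F"
    then show "y \<in> set A" using *(2)[of "(x, y)"] *(2)[of "(y, x)"] unfolding F by auto
  qed
  have removed: "cn ?F u x" if "x \<in> set (endpoints es)" "x \<notin> set ((unreached es e u ^^ k) (endpoints es))" for k x
    using that
  proof (induction k arbitrary: x)
    case (Suc k)
    let ?B = "(unreached es e u ^^ k) (endpoints es)"
    show ?case
    proof (cases "x \<in> set ?B")
      case True
      then consider "x = u" | f where "f \<in> set es" "f \<noteq> e" "fst f = x \<and> snd f \<notin> set ?B \<or> snd f = x \<and> fst f \<notin> set ?B"
        using Suc.prems(2) unfolding funpow.simps o_apply set_unreached by blast
      then show ?thesis
      proof cases
        case (2 f)
        have ends: "fst f \<in> set (endpoints es)" "snd f \<in> set (endpoints es)"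
          using 2(1) by (auto simp: endpoints_def)
        have ed: "{fst f, snd f} \<in> ?F" "{snd f, fst f} \<in> ?F" unfolding F using 2(1,2) by auto
        from 2(3) show ?thesis
        proof
          assume "fst f = x \<and> snd f \<notin> set ?B"
          then show ?thesis using cn_trans[OF Suc.IH[OF ends(2)] cn_edge[OF ed(2)]] by auto
        next
          assume "snd f = x \<and> fst f \<notin> set ?B"
          then show ?thesis using cn_trans[OF Suc.IH[OF ends(1)] cn_edge[OF ed(1)]] by auto
        qed
      qed simp
    qed (use Suc in blast)
  qed simp
  have "v \<in> set A \<longleftrightarrow> \<not> cn ?F u v"
  proof
    assume v: "v \<in> set A"
    show "\<not> cn ?F u v"
    proof
      assume "cn ?F u v"
      moreover have "y \<notin> set A" if "x \<notin> set A" "{x, y} \<in> ?F" for x y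
        using A1(2)[of y x] that by (auto simp: insert_commute)
      moreover have "u \<notin> set A" using A1(1)[of u] by blast
      ultimately have "v \<in> - set A" by (intro cn_closed[of ?F u v "- set A"]) auto
      then show False using v by blast
    qed
  next
    assume ncn: "\<not> cn ?F u v"
    \<comment> \<open>The list starts with the endpoints of edges only; \<open>v\<close> is among
      them because it differs from \<open>u\<close> and the tree is connected.\<close>
    have "v \<in> set (endpoints es)"
    proof -
      have "u \<noteq> v" using ncn by auto
      then obtain w where "{w, v} \<in> E"
        using conn[OF uv] unfolding cn_def by (auto elim: rtranclE)
      then show ?thesis using ordered_edges_mem[OF es, of w v] by (force simp: endpoints_def)
    qed
    then show "v \<in> set A" using removed ncn unfolding A_def by blast
  qed
  moreover have "{fst e, snd e} \<in> E" using ordered_edges_mem[OF es, of "fst e" "snd e"] e by simp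
  ultimately show ?thesis unfolding A_def[symmetric] cut_def by simp
qed

context prob
begin

definition edl :: "nat \<Rightarrow> (nat \<times> nat) list" where
  "edl j = concat (map (\<lambda>x. map (Pair x) (filter (\<lambda>y. {x, y} \<in> tree I j) [Suc x..<nv])) [0..<nv])"

lemma tree_input_edl: "tree_input I j = Lst [Num (real j), Lst (map encp (edl j))]"
proof -
  have "map encp (map (Pair x) (filter Q ys)) = concat (map (\<lambda>y. if Q y then [Lst [Num (real x), Num (real y)]] else []) ys)"
    for x Q ys by (induction ys) (auto simp: encp_def)
  then show ?thesis
    unfolding tree_input_def edl_def by (simp add: map_concat o_def)
qed

lemma edl_ordered: "j < r \<Longrightarrow> ordered_edges (tree I j) (edl j)"
proof -
  assume j: "j < r"
  interpret tree_net nv "tree I j" by (rule tree_net[OF j])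
  have set: "set (edl j) = {(x, y). x < y \<and> y < nv \<and> {x, y} \<in> tree I j}"
    by (auto simp: edl_def image_iff Suc_le_eq)
  have "tree I j \<subseteq> (\<lambda>(x, y). {x, y}) ` set (edl j)"
  proof
    fix e assume e: "e \<in> tree I j"
    then obtain x y where xy: "e = {x, y}" "x < nv" "y < nv" "x \<noteq> y" using edge_form by blast
    show "e \<in> (\<lambda>(x, y). {x, y}) ` set (edl j)"
    proof (cases "x < y")
      case True
      then show ?thesis using xy e by (intro image_eqI[of _ _ "(x, y)"]) (auto simp: set)
    next
      case False
      then show ?thesis using xy e
        by (intro image_eqI[of _ _ "(y, x)"]) (auto simp: set insert_commute)
    qed
  qed
  then show ?thesis unfolding ordered_edges_def set by auto
qed

definition pthl :: "nat \<Rightarrow> nat \<Rightarrow> (nat \<times> nat) list" where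
  "pthl i j = filter (\<lambda>e. {fst e, snd e} \<in> pth i j) (edl j)"

lemma pth_pthl: "j < r \<Longrightarrow> pth i j = (\<lambda>e. {fst e, snd e}) ` set (pthl i j)"
proof -
  assume j: "j < r"
  have E: "tree I j = (\<lambda>(x, y). {x, y}) ` set (edl j)" using edl_ordered[OF j] by (simp add: ordered_edges_def)
  show ?thesis
  proof (intro equalityI subsetI)
    fix e assume e: "e \<in> pth i j"
    then obtain x y where "(x, y) \<in> set (edl j)" "e = {x, y}" using pth_subset[of i j] E by auto
    then show "e \<in> (\<lambda>e. {fst e, snd e}) ` set (pthl i j)"
      using e by (intro image_eqI[of _ _ "(x, y)"]) (auto simp: pthl_def)
  qed (auto simp: pthl_def)
qed

lemma pthl_inj: "j < r \<Longrightarrow> e \<in> set (pthl i j) \<Longrightarrow> f \<in> set (pthl i' j) \<Longrightarrow> {fst e, snd e} = {fst f, snd f} \<longleftrightarrow> e = f"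
proof -
  assume "j < r" "e \<in> set (pthl i j)" "f \<in> set (pthl i' j)"
  then have "fst e < snd e" "fst f < snd f"
    using edl_ordered[of j] by (auto simp: pthl_def ordered_edges_def)
  then show ?thesis by (auto simp: doubleton_eq_iff prod_eq_iff)
qed

lemma ev_path:
  assumes "i < m" "j < r"
  shows "ev p_path [Lst (map encp (edl j)), Num (real (src I i)), Num (real (dst I i))] = Lst (map encp (pthl i j))"
proof -
  interpret tree_net nv "tree I j" by (rule tree_net[OF assms(2)])
  have "tr (ev p_sep [encp e, Lst (map encp (edl j)), Num (real (src I i)), Num (real (dst I i))])
     \<longleftrightarrow> {fst e, snd e} \<in> pth i j" if "e \<in> set (edl j)" for e
    using unreached_cut[OF edl_ordered[OF assms(2)] that proc_facts(1,2)[OF assms(1)]]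
    by (auto simp: p_sep_def ev_reach pth_def)
  then show ?thesis
    by (auto simp: p_path_def pthl_def filter_map o_def intro!: arg_cong[of _ _ "map _"] filter_cong)
qed

definition item :: "nat \<Rightarrow> nat \<Rightarrow> real \<Rightarrow> val \<Rightarrow> val \<Rightarrow> val" where
  "item i j w a d = Lst [Num (real i), Num (real j), Num (pr i), Num (hh i), Num w, Lst (map encp (pthl i j)), a, d]"

lemma item_simps [simp]:
  "nthv (item i j w a d) 0 = Num (real i)" "nthv (item i j w a d) (Suc 0) = Num (real j)"
  "nthv (item i j w a d) 2 = Num (pr i)" "nthv (item i j w a d) 3 = Num (hh i)"
  "nthv (item i j w a d) 4 = Num w" "nthv (item i j w a d) 5 = Lst (map encp (pthl i j))"
  "nthv (item i j w a d) 6 = a" "nthv (item i j w a d) 7 = d"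
  by (simp_all add: item_def)

lemma ev_meet:
  assumes "j < r"
  shows "ev p_meet [Lst (map encp (pthl i j)), Lst (map encp (pthl i' j))] = bv (pth i j \<inter> pth i' j \<noteq> {})"
proof -
  have "(\<exists>e\<in>set (pthl i j). \<exists>f\<in>set (pthl i' j). f = e) \<longleftrightarrow> pth i j \<inter> pth i' j \<noteq> {}"
    unfolding pth_pthl[OF assms] using pthl_inj[OF assms] by blast
  then show ?thesis
    by (simp add: p_meet_def prod_eq_iff[symmetric] conj_commute eq_commute)
qed

lemma ev_conf:
  assumes "j < r"
  shows "ev p_conf [item i j w a d, item i' j w' a' d'] = bv (conf j i i')"
  by (simp add: p_conf_def p_narrow_def conf_def narrow_def ev_meet[OF assms])

lemma ev_hits:
  assumes "j < r"
  shows "ev (p_hits k) [Lst (map encp (pthl i j)), Lst (map (\<lambda>i'. item i' j (w i') (a i') (d i')) is)] =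
    bv (hits k (pth i j) ((\<lambda>i'. pth i' j) ` set is))"
proof (induction k arbitrary: "is")
  case (Suc k)
  have 1: "{q \<in> (\<lambda>i'. pth i' j) ` set is. e \<notin> q} = (\<lambda>i'. pth i' j) ` set (filter (\<lambda>i'. e \<notin> pth i' j) is)" for e
    by auto
  have mem: "(\<exists>z\<in>set (pthl i' j). z = e) \<longleftrightarrow> {fst e, snd e} \<in> pth i' j" if "e \<in> set (pthl i j)" for e i'
    unfolding pth_pthl[OF assms] using pthl_inj[OF assms _ that] by (auto simp: image_iff)
  have 2: "filter (\<lambda>y. tr (ev (NOT (EXS (eqe (Var 0) (Var 2)) (It 5 (Var 0)))) (y # encp e # env)))
     (map (\<lambda>i'. item i' j (w i') (a i') (d i')) is) = map (\<lambda>i'. item i' j (w i') (a i') (d i')) (filter (\<lambda>i'. {fst e, snd e} \<notin> pth i' j) is)"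
    if "e \<in> set (pthl i j)" for e env
    using mem[OF that] by (auto simp: filter_map o_def prod_eq_iff[symmetric] intro!: arg_cong[of _ _ "map _"] filter_cong)
  let ?P = "Lst (map encp (pthl i j))" and ?Q = "Lst (map (\<lambda>i'. item i' j (w i') (a i') (d i')) is)"
  let ?c = "NOT (EXS (eqe (Var 0) (Var 2)) (It 5 (Var 0)))"
  have step: "tr (ev (Call (p_hits k) [Var 1, FILT ?c (Var 2)]) [encp e, ?P, ?Q]) \<longleftrightarrow>
     hits k (pth i j) ((\<lambda>i'. pth i' j) ` set (filter (\<lambda>i'. {fst e, snd e} \<notin> pth i' j) is))"
    if e: "e \<in> set (pthl i j)" for e
  proof -
    have "ev (FILT ?c (Var 2)) [encp e, ?P, ?Q] =
      Lst (map (\<lambda>i'. item i' j (w i') (a i') (d i')) (filter (\<lambda>i'. {fst e, snd e} \<notin> pth i' j) is))"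
      unfolding ev_FILT using 2[OF e, of "[?P, ?Q]"] by (simp del: ev_bool ev_EXS)
    then have "map (\<lambda>a. ev a [encp e, ?P, ?Q]) [Var 1, FILT ?c (Var 2)] =
      [?P, Lst (map (\<lambda>i'. item i' j (w i') (a i') (d i')) (filter (\<lambda>i'. {fst e, snd e} \<notin> pth i' j) is))]"
      by (simp del: ev_FILT)
    then show ?thesis unfolding ev_Call by (simp only: Suc.IH tr_bv)
  qed
  have "(\<exists>e\<in>set (pthl i j). hits k (pth i j) ((\<lambda>i'. pth i' j) ` set (filter (\<lambda>i'. {fst e, snd e} \<notin> pth i' j) is))) \<longleftrightarrow>
    (\<exists>e\<in>pth i j. hits k (pth i j) {q \<in> (\<lambda>i'. pth i' j) ` set is. e \<notin> q})"
    unfolding 1 by (subst (2) pth_pthl[OF assms]) simp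
  then have "(\<exists>x\<in>set (pthl i j). tr (ev (Call (p_hits k) [Var 1, FILT ?c (Var 2)]) [encp x, ?P, ?Q])) \<longleftrightarrow>
    (\<exists>e\<in>pth i j. hits k (pth i j) {q \<in> (\<lambda>i'. pth i' j) ` set is. e \<notin> q})"
    using step by simp
  then show ?case by (simp del: ev_Call ev_FILT)
qed (simp add: bv_def)

end

context prob
begin

lemma ev_pierce:
  assumes "j < r"
  shows "ev p_pierce [item i j w0 a0 d0, Lst (map (\<lambda>i'. item i' j (w i') (a i') (d i')) is)] =
    bv (pierce j i (set is))"
proof -
  let ?IT = "\<lambda>i'. item i' j (w i') (a i') (d i')"
  have "ev (FILT (Call p_meet [It 5 (Var 1), It 5 (Var 0)]) (Var 1)) [item i j w0 a0 d0, Lst (map ?IT is)] =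
    Lst (map ?IT (filter (\<lambda>i'. pth i j \<inter> pth i' j \<noteq> {}) is))"
    by (simp add: ev_meet[OF assms] filter_map o_def)
  then have "map (\<lambda>a. ev a [item i j w0 a0 d0, Lst (map ?IT is)])
      [It 5 (Var 0), FILT (Call p_meet [It 5 (Var 1), It 5 (Var 0)]) (Var 1)] =
    [Lst (map encp (pthl i j)), Lst (map ?IT (filter (\<lambda>i'. pth i j \<inter> pth i' j \<noteq> {}) is))]"
    by (simp del: ev_FILT)
  then have "ev p_pierce [item i j w0 a0 d0, Lst (map ?IT is)] =
     bv (hits 8 (pth i j) ((\<lambda>i'. pth i' j) ` set (filter (\<lambda>i'. pth i j \<inter> pth i' j \<noteq> {}) is)))"
    unfolding p_pierce_def ev_Call by (simp only: ev_hits[OF assms])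
  then show ?thesis by (simp add: pierce_def)
qed

lemma ev_unsat: "ev p_unsat [item i j w a d] = bv (\<not> w + w \<le> pr i)"
  by (simp add: p_unsat_def)

text \<open>As \<open>cl\<close> has no repetitions, one iteration per list element is the iteration
  count in \<open>rem\<close>.\<close>

lemma ev_rem:
  assumes j: "j < r" and cl: "set cl = clients j" "distinct cl"
  shows "ev p_rem [Lst (map (\<lambda>i. item i j (w i j) (a i) (d i)) cl)] =
    Lst (map (\<lambda>i. item i j (w i j) (a i) (d i)) (filter (\<lambda>i. i \<in> rem j (unsat w j)) cl))"
proof -
  let ?IT = "\<lambda>i. item i j (w i j) (a i) (d i)" and ?U = "unsat w j"
  let ?c = "OR (NOT (Call p_pierce [Var 0, Var 1]))
   (EXS (AND (Call p_unsat [Var 0]) (Call p_pierce [Var 0, Var 2])) (Var 1))"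
  have step: "Lst (filter (\<lambda>x. tr (ev ?c (x # Lst (map ?IT A) # env))) (map ?IT A)) =
     Lst (map ?IT (filter (\<lambda>i. i \<in> peel j ?U (set A)) A))" if A: "set A \<subseteq> clients j" for A env
  proof -
    have U: "(y \<in> ?U) = (\<not> w y j + w y j \<le> pr y)" if "y \<in> set A" for y
      using A that by (auto simp: unsat_def)
    show ?thesis
      by (auto simp: filter_map o_def ev_pierce[OF j] ev_unsat peel_def U intro!: arg_cong[of _ _ "map _"] filter_cong)
  qed
  have "((\<lambda>acc. Lst (filter (\<lambda>x. tr (ev ?c (x # acc # env))) (elems acc))) ^^ k) (Lst (map ?IT cl)) =
     Lst (map ?IT (filter (\<lambda>i. i \<in> (peel j ?U ^^ k) (clients j)) cl))" for k env
  proof (induction k)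
    case 0
    have "filter (\<lambda>i. i \<in> clients j) cl = cl" using cl by (simp add: filter_id_conv)
    then show ?case by simp
  next
    case (Suc k)
    let ?R = "(peel j ?U ^^ k) (clients j)"
    have "?R \<subseteq> clients j"
    proof (induction k)
      case (Suc k)
      then show ?case using peel_subset by (metis funpow.simps(2) o_apply order_trans)
    qed simp
    then have s: "set (filter (\<lambda>i. i \<in> ?R) cl) = ?R" using cl by auto
    have "filter (\<lambda>i. i \<in> peel j ?U ?R) (filter (\<lambda>i. i \<in> ?R) cl) = filter (\<lambda>i. i \<in> peel j ?U ?R) cl"
      using peel_subset[of j ?U ?R] by (auto intro!: filter_cong)
    then show ?case
      using step[of "filter (\<lambda>i. i \<in> ?R) cl" env] \<open>?R \<subseteq> clients j\<close> unfolding s funpow.simps o_apply Suc elems.simps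
      by simp
  qed
  then show ?thesis
    unfolding p_rem_def ev_ITERF using cl by (simp add: rem_def distinct_card[symmetric])
qed

lemma ev_active:
  fixes vs :: "(nat \<times> nat) list" and w :: "nat \<Rightarrow> nat \<Rightarrow> real" and a d :: "nat \<Rightarrow> nat \<Rightarrow> val"
  defines "IT \<equiv> \<lambda>(i, j). item i j (w i j) (a i j) (d i j)"
  assumes j: "j < r" and vs: "distinct vs" "clients j = {i. (i, j) \<in> set vs}" and i: "i \<in> clients j"
  shows "ev p_active [item i j (w i j) a0 d0, Lst (map IT vs)] = bv (active w i j)"
proof -
  define cl where "cl = map fst (filter (\<lambda>p. snd p = j) vs)"
  let ?IT = "\<lambda>i. item i j (w i j) (a i j) (d i j)"
  have setcl: "set cl = clients j" unfolding vs(2) cl_def by force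
  have dcl: "distinct cl" unfolding cl_def using vs(1) by (auto simp: distinct_map inj_on_def prod_eq_iff)
  have "filter (\<lambda>y. num (nthv y (Suc 0)) = real j) (map IT vs) = map IT (filter (\<lambda>p. snd p = j) vs)"
    by (auto simp: filter_map o_def IT_def case_prod_unfold intro!: arg_cong[of _ _ "map _"] filter_cong)
  also have "\<dots> = map ?IT cl" by (auto simp: cl_def IT_def)
  finally have filt: "filter (\<lambda>y. num (nthv y (Suc 0)) = real j) (map IT vs) = map ?IT cl" .
  let ?rm = "filter (\<lambda>i. i \<in> rem j (unsat w j)) cl"
  have rm: "set ?rm = rem j (unsat w j)"
  proof -
    have "(peel j (unsat w j) ^^ k) (clients j) \<subseteq> clients j" for k
    proof (induction k)
      case (Suc k)
      then show ?case using peel_subset by (metis funpow.simps(2) o_apply order_trans)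
    qed simp
    then have "rem j (unsat w j) \<subseteq> clients j" by (simp add: rem_def)
    then show ?thesis using setcl by auto
  qed
  have el: "elig j (unsat w j) y \<longleftrightarrow> \<not> w y j + w y j \<le> pr y \<and> pierce j y (rem j (unsat w j))" if "y \<in> clients j" for y
    using that by (auto simp: elig_def unsat_def)
  have "ev p_flag2 [item i j (w i j) a0 d0, Lst (map ?IT cl), Lst (map ?IT ?rm)] = bv (flag j (unsat w j) i)"
    using el setcl i
    by (simp add: p_flag2_def ev_unsat ev_pierce[OF j] ev_conf[OF j] rm flag_def del: set_filter)
  then show ?thesis
    unfolding p_active_def p_flag_def active_def
    by (simp add: filt ev_rem[OF j setcl dcl, of w "\<lambda>i. a i j" "\<lambda>i. d i j"] item_simps(2))
qed

section \<open>Instances visible to one processor\<close>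

definition tl :: "nat \<Rightarrow> nat list" where "tl i = filter (\<lambda>j. j \<in> acc I i) [0..<r]"
definition nb :: "nat \<Rightarrow> nat list" where "nb i = filter (\<lambda>i'. i' = i \<or> comm I i i') [0..<m]"
text \<open>The order is that of the vertex numbers \<open>i * r + j\<close>, so simulated messages
  come in the order in which \<open>received\<close> lists them.\<close>

definition VL :: "nat \<Rightarrow> (nat \<times> nat) list" where
  "VL i = concat (map (\<lambda>i'. map (Pair i') (tl i')) (nb i))"

definition adjp :: "(nat \<Rightarrow> nat \<Rightarrow> real) \<Rightarrow> nat \<times> nat \<Rightarrow> nat \<times> nat \<Rightarrow> bool" where
  "adjp w = (\<lambda>(i, j) (i', j'). (i = i' \<and> j \<noteq> j' \<or> j = j' \<and> conf j i i') \<and> active w i j \<and> active w i' j')"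

lemma set_tl: "i < m \<Longrightarrow> set (tl i) = acc I i"
  using acc_lt by (auto simp: tl_def)

lemma set_nb: "i < m \<Longrightarrow> set (nb i) = {i'. i' < m \<and> (i' = i \<or> acc I i \<inter> acc I i' \<noteq> {})}"
  by (auto simp: nb_def comm_def)

lemma nb_self: "i < m \<Longrightarrow> i \<in> set (nb i)"
  by (simp add: set_nb)

lemma set_VL: "i < m \<Longrightarrow> set (VL i) = {(i', j'). i' \<in> set (nb i) \<and> j' \<in> acc I i'}"
  using set_tl by (auto simp: VL_def set_nb)

lemma distinct_VL: "distinct (VL i)"
proof -
  have "distinct (concat (map (\<lambda>i'. map (Pair i') (tl i')) xs))" if "distinct xs" for xs
    using that
  proof (induction xs)
    case (Cons x xs)
    then show ?case by (auto simp: distinct_map inj_on_def tl_def)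
  qed simp
  then show ?thesis by (simp add: VL_def nb_def)
qed

text \<open>Processors sharing a tree are neighbours, so no client of an accessible tree is missing.
  This makes layers and activity locally computable.\<close>

lemma VL_complete: "i < m \<Longrightarrow> j \<in> acc I i \<Longrightarrow> clients j = {i'. (i', j) \<in> set (VL i)}"
  by (auto simp: set_VL set_nb clients_def)

text \<open>For a tree that \<open>i\<close> cannot access, the visible clients may be incomplete
  and the computed activity wrong; but such a pair is rejected by the first conjunct of
  \<open>p_adj\<close>.\<close>

lemma ev_adj:
  fixes w :: "nat \<Rightarrow> nat \<Rightarrow> real" and a d :: "nat \<Rightarrow> nat \<Rightarrow> val"
  defines "IT \<equiv> \<lambda>(i, j). item i j (w i j) (a i j) (d i j)"
  assumes ij: "i < m" "j \<in> acc I i" and q: "q \<in> set (VL i)"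
  shows "ev p_adj [item i j (w i j) a0 d0, IT q, Lst (map IT (VL i))] = bv (adjp w (i, j) q)"
proof -
  obtain i' j' where q': "q = (i', j')" by (cases q)
  have i': "i' < m" "j' \<in> acc I i'" using q ij by (auto simp: q' set_VL set_nb)
  have jr: "j < r" "j' < r" using acc_lt ij i' by auto
  have act: "ev p_active [item i j (w i j) a0 d0, Lst (map IT (VL i))] = bv (active w i j)"
    using ev_active[OF jr(1) distinct_VL VL_complete[OF ij], where i = i and w = w and a = a and d = d and ?a0.0 = a0 and ?d0.0 = d0] ij unfolding IT_def
    by (simp add: clients_def)
  have act': "ev p_active [item i' j' (w i' j') (a i' j') (d i' j'), Lst (map IT (VL i))] = bv (active w i' j')"
    if "j' \<in> acc I i"
    using ev_active[OF jr(2) distinct_VL VL_complete[OF ij(1) that], where i = i' and w = w and a = a and d = d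
        and ?a0.0 = "a i' j'" and ?d0.0 = "d i' j'"] i' unfolding IT_def
    by (simp add: clients_def)
  show ?thesis
  proof (cases "i = i' \<or> j = j'")
    case True
    then have "j' \<in> acc I i" using ij i' by auto
    show ?thesis
    proof (cases "j = j'")
      case True
      have "ev p_conf [item i j (w i j) a0 d0, item i' j' (w i' j') (a i' j') (d i' j')] = bv (conf j i i')"
        using ev_conf[OF jr(1)] True by simp
      then show ?thesis
        using act act'[OF \<open>j' \<in> acc I i\<close>] True by (simp add: p_adj_def adjp_def q' IT_def) 
    next
      case False
      then show ?thesis
        using act act'[OF \<open>j' \<in> acc I i\<close>] by (simp add: p_adj_def adjp_def q' IT_def)
    qed
  next
    case False
    then show ?thesis by (simp add: p_adj_def adjp_def q' IT_def)
  qed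
qed

lemma concat_map_filter: "(\<And>x. x \<in> set xs \<Longrightarrow> \<not> Q x \<Longrightarrow> g x = []) \<Longrightarrow> concat (map g xs) = concat (map g (filter Q xs))"
  by (induction xs) auto

lemma upt_mult: "[0..<k * r] = concat (map (\<lambda>i. map (\<lambda>j. i * r + j) [0..<r]) [0..<k])"
proof (induction k)
  case (Suc k)
  have "[0..<Suc k * r] = [0..<k * r] @ [k * r..<k * r + r]"
    using upt_add_eq_append[of 0 "k * r" r] by (simp add: add.commute)
  also have "[k * r..<k * r + r] = map (\<lambda>j. k * r + j) [0..<r]"
    using map_add_upt[of "k * r" r] by (simp add: add.commute)
  finally show ?case using Suc by simp
qed simp

text \<open>An equality of lists, not only of sets: a simulated step may depend on the order of its
  messages.\<close>

lemma gr_neighbours: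
  assumes ij: "i < m" "j \<in> acc I i"
  shows "filter (gr w (i * r + j)) [0..<m * r] = map (\<lambda>(i', j'). i' * r + j') (filter (adjp w (i, j)) (VL i))"
proof -
  have jr: "j < r" using acc_lt ij by blast
  let ?g = "\<lambda>i'. map (\<lambda>j'. i' * r + j') (filter (\<lambda>j'. adjp w (i, j) (i', j')) (tl i'))"
  have g: "filter (gr w (i * r + j)) (map (\<lambda>j'. i' * r + j') [0..<r]) = ?g i'" for i'
  proof -
    have "filter (\<lambda>j'. gr w (i * r + j) (i' * r + j')) [0..<r] = filter (\<lambda>j'. adjp w (i, j) (i', j')) (tl i')"
      unfolding tl_def filter_filter using gr_vid[OF jr, of _ w i i'] activeD(1)[of w i']
      by (intro filter_cong) (auto simp: adjp_def clients_def)
    then show ?thesis by (simp add: filter_map o_def)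
  qed
  have empty: "?g i' = []" if "i' \<in> set [0..<m]" "\<not> (i' = i \<or> comm I i i')" for i'
  proof -
    have "\<not> adjp w (i, j) (i', j')" if "j' \<in> set (tl i')" for j'
      using that \<open>\<not> (i' = i \<or> comm I i i')\<close> ij by (auto simp: adjp_def comm_def tl_def)
    then show ?thesis by simp
  qed
  have "filter (gr w (i * r + j)) [0..<m * r] = concat (map ?g [0..<m])"
    unfolding upt_mult filter_concat map_map o_def g ..
  also have "\<dots> = concat (map ?g (nb i))"
    unfolding nb_def by (rule concat_map_filter) (use empty in blast)
  also have "\<dots> = map (\<lambda>(i', j'). i' * r + j') (filter (adjp w (i, j)) (VL i))"
    unfolding VL_def filter_concat map_concat map_map o_def by (simp add: filter_map o_def)
  finally show ?thesis .
qed

end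

section \<open>The distributed program\<close>

text \<open>A processor's state consists of its input, its records (newest first), the superstep and
  tree-network in which its demand was raised, its selection bit and its decision; the whole state
  is sent as message. The record of a superstep holds its number, the number of simulated rounds of
  \<open>M\<close>, and for every own demand instance the residual profit, the last two states of the simulated
  vertex and the first decision of that vertex. Simulations continue after they have been decided,
  because other processors may still depend on them.\<close>

definition "p_rec = First (FILT (EQ (It 0 (Var 0)) (Var 2)) (It 1 (Var 0)))"
text \<open>The own state is inserted at its place among the identifiers, because the order of the
  simulated messages derives from this list.\<close>

definition "p_all = APP (FILT (NOT (Leq (It 5 (It 0 (Var 1))) (It 5 (It 0 (Var 0))))) (Var 1))
  (Push (Var 0) (FILT (NOT (Leq (It 5 (It 0 (Var 0))) (It 5 (It 0 (Var 1))))) (Var 1)))"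
definition "p_item = TUP [It 5 (It 0 (Var 0)), It 0 (Var 1), It 8 (It 0 (Var 0)), It 9 (It 0 (Var 0)), It 1 (Var 1),
  Call p_path [It 1 (First (FILT (EQ (It 0 (Var 0)) (It 0 (Var 2))) (It 10 (It 0 (Var 0))))),
    It 6 (It 0 (Var 0)), It 7 (It 0 (Var 0))], Var 2, It 4 (Var 1)]"
text \<open>\<open>Var 5\<close> is the round to be simulated; a neighbour already one round ahead
  contributes its previous state.\<close>

definition "p_vs = CMAP (MAP (Call p_item [Var 1, Var 0,
      Ite (EQ (It 1 (Call p_rec [Var 1, Var 4])) (Var 5)) (It 2 (Var 0)) (It 3 (Var 0))])
    (It 2 (Call p_rec [Var 0, Var 3]))) (Call p_all [Var 0, Var 1])"

definition "p_cond_adv = NOT (EXS (OR (IsEmpty (Call p_rec [Var 0, It 0 (Var 1)]))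
    (NOT (Leq (It 1 (Var 1)) (It 1 (Call p_rec [Var 0, It 0 (Var 1)]))))) (Var 2))"
definition "p_ent2 M = TUP [It 0 (Var 0), It 1 (Var 0), Var 1, It 2 (Var 0),
  Ite (IsEmpty (It 4 (Var 0))) (Call (out_of M) [Var 1]) (It 4 (Var 0))]"
definition "p_nbrs = FILT (Call p_adj [Call p_item [Var 2, Var 1, Empty], Var 0, Var 3]) (Var 2)"
definition "p_newst M = Call (step_of M) [It 2 (Var 0), MAP (Call (msg_of M) [It 6 (Var 0)]) (Call p_nbrs [Var 0, Var 1, Var 2])]"
definition "p_entadv M = Call (p_ent2 M) [Var 0, Call (p_newst M) [Var 0, Var 1, Var 2]]"
definition "p_adv2 M = TUP [It 0 (Var 0), Add (It 1 (Var 0)) (Lit 1),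
  MAP (Call (p_entadv M) [Var 0, Var 2, Var 3]) (It 2 (Var 0))]"
definition "p_adv M = Ite (Call p_cond_adv [Var 0, Var 1, Var 2])
  (Call (p_adv2 M) [Var 0, Var 1, Call p_vs [Var 1, Var 2, It 0 (Var 0), It 1 (Var 0)]]) (Var 0)"
definition "p_recs M = MAP (Call (p_adv M) [Var 0, Var 1, Var 2]) (It 1 (Var 0))"

definition "p_alldec = AND (NOT (IsEmpty (Var 0))) (NOT (EXS (IsEmpty (It 4 (Var 0))) (It 2 (Var 0))))"
definition "p_cond_new = AND (Call p_alldec [First (It 1 (Var 0))])
  (NOT (EXS (NOT (Call p_alldec [Call p_rec [Var 0, It 0 (First (It 1 (Var 1)))]])) (Var 1)))"
definition "p_chosen = AND (EQ (First (It 7 (Var 0))) (Lit 1)) (Call p_active [Var 0, Var 1])"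
definition "p_coef = Ite (p_narrow (Var 0)) (Add (It 3 (Var 0)) (It 3 (Var 0))) (Lit 1)"
definition "p_upd = Sub (It 4 (Var 0)) (TOT
   (Ite (EQ (It 0 (Var 0)) (It 0 (Var 1)))
     (Ite (Call p_chosen [Var 0, Var 2]) (It 4 (Var 0)) (Lit 0))
     (Ite (AND (EQ (It 1 (Var 0)) (It 1 (Var 1))) (Call p_conf [Var 1, Var 0]))
       (Ite (Call p_chosen [Var 0, Var 2]) (Mul (Call p_coef [Var 1]) (It 4 (Var 0))) (Lit 0)) (Lit 0))) (Var 1))"
definition "p_newent2 M = TUP [It 0 (Var 0), Var 1, Var 2, Var 2, Call (out_of M) [Var 2]]"
definition "p_init_mis M = Call (init_of M) [TUP [Mul (It 2 (Var 0)) (It 1 (Var 0)),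
   Add (Mul (It 5 (Var 0)) (It 1 (Var 0))) (Var 1)]]"
definition "p_newent M = Call (p_newent2 M) [Var 0, Call p_upd [Call p_item [Var 1, Var 0, Empty], Var 2],
   Call (p_init_mis M) [It 0 (Var 1), It 0 (Var 0)]]"
definition "p_newrec M = TUP [Add (It 0 (First (It 1 (Var 0)))) (Lit 1), Lit 0,
   MAP (Call (p_newent M) [Var 0, Var 1, Var 2]) (It 2 (First (It 1 (Var 0))))]"
definition "p_newrais2 = Ite (IsEmpty (Var 1)) (It 2 (Var 0)) (TUP [It 0 (First (It 1 (Var 0))), It 0 (First (Var 1))])"
definition "p_newrais = Call p_newrais2 [Var 0,
   FILT (Call p_chosen [Call p_item [Var 1, Var 0, Empty], Var 2]) (It 2 (First (It 1 (Var 0))))]"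

definition "p_comp = NOT (EXS (NOT (Leq (Add (It 1 (Var 0)) (It 1 (Var 0))) (It 8 (It 0 (Var 1))))) (It 2 (First (It 1 (Var 0)))))"
definition "p_later = AND (AND (NOT (IsEmpty (It 2 (Var 0)))) (NOT (IsEmpty (It 2 (Var 1)))))
   (AND (EQ (It 1 (It 2 (Var 0))) (It 1 (It 2 (Var 1)))) (NOT (Leq (It 0 (It 2 (Var 1))) (It 0 (It 2 (Var 0))))))"
definition "p_rpath = It 5 (Call p_item [Var 0, TUP [It 1 (It 2 (Var 0))], Empty])"
definition "p_nar y = Leq (Add (It 9 (It 0 y)) (It 9 (It 0 y))) (Lit 1)"
definition "p_blk = AND (AND (Call p_later [Var 2, Var 0]) (First (It 3 (Var 0))))
   (AND (EQ (p_nar (Var 2)) (p_nar (Var 0))) (EXS (eqe (Var 0) (Var 2)) (Call p_rpath [Var 0])))"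
definition "p_over = NOT (Leq (Add (TOT (Ite (Call p_blk [Var 0, Var 1, Var 2]) (It 9 (It 0 (Var 0))) (Lit 0)) (Var 2))
   (It 9 (It 0 (Var 1)))) (Lit 1))"
definition "p_val = AND (NOT (IsEmpty (It 2 (Var 0)))) (NOT (EXS (Call p_over [Var 0, Var 1, Var 2]) (Call p_rpath [Var 0])))"
definition "p_ready = AND (Call p_comp [Var 0]) (NOT (EXS (NOT (AND (Call p_comp [Var 0])
   (OR (NOT (Call p_later [Var 1, Var 0])) (NOT (IsEmpty (It 3 (Var 0))))))) (Var 1)))"
text \<open>The answer is wrapped in a list, so that a negative answer differs from a missing
  one.\<close>

definition "p_sel = Ite (NOT (IsEmpty (It 3 (Var 0)))) (It 3 (Var 0))
   (Ite p_ready (TUP [p_val]) Empty)"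
text \<open>\<open>b\<close> picks the height class: \<open>id\<close> sums narrow demands,
  \<open>NOT\<close> wide ones. The own state is pushed onto those received.\<close>

definition "p_sum b = TOT (Ite (AND (First (It 3 (Var 0))) (AND (EQ (It 1 (It 2 (Var 0))) (It 1 (It 2 (Var 1))))
    (b (p_nar (Var 0))))) (It 8 (It 0 (Var 0))) (Lit 0)) (Push (Var 0) (Var 1))"
text \<open>\<open>Empty\<close> inside the list is a decision that is not a number: the demand
  stays unscheduled.\<close>

definition "p_dec = Ite (AND (First (It 3 (Var 0))) (EQ (p_nar (Var 0)) (Leq (p_sum NOT) (p_sum id))))
   (TUP [It 1 (It 2 (Var 0))]) (TUP [Empty])"
definition "p_fin = Ite (NOT (IsEmpty (It 4 (Var 0)))) (It 4 (Var 0))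
   (Ite (AND (NOT (IsEmpty (It 3 (Var 0)))) (NOT (EXS (IsEmpty (It 3 (Var 0))) (Var 1)))) p_dec Empty)"

definition "p_vs0 = Call p_vs [Var 0, Var 1, It 0 (First (It 1 (Var 0))), Lit 0]"
definition "p_step M = TUP [It 0 (Var 0),
   Ite p_cond_new (Push (Call (p_newrec M) [Var 0, p_vs0]) (p_recs M)) (p_recs M),
   Ite p_cond_new (Call p_newrais [Var 0, p_vs0]) (It 2 (Var 0)), p_sel, p_fin]"

definition "p_ent0 M = Call (p_newent2 M) [Var 0, It 8 (Var 1), Call (p_init_mis M) [Var 1, It 0 (Var 0)]]"
definition "p_init M = TUP [Var 0, TUP [TUP [Lit 0, Lit 0, MAP (Call (p_ent0 M) [Var 0, Var 1]) (It 10 (Var 0))]], Empty, Empty,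
   Ite (Leq (Mul (It 2 (Var 0)) (It 1 (Var 0))) (Lit 1))
     (Ite (IsEmpty (It 10 (Var 0))) (TUP [Empty]) (TUP [It 0 (First (It 10 (Var 0)))])) Empty]"

definition "alg M = \<lparr>init_of = p_init M, msg_of = Var 0, step_of = p_step M, out_of = It 4 (Var 0)\<rparr>"

section \<open>The abstract state\<close>

text \<open>The time-dependent part of a state: the current superstep, the simulated rounds of each
  superstep, selection and decision. All else is determined by these and the reference run.\<close>

record ast =
  ak :: nat
  aL :: "nat \<Rightarrow> nat"
  asel :: "bool option"
  afin :: val

section \<open>The simulated runs of \<open>M\<close> and the abstract step\<close>

locale sim = prob +
  fixes M :: dist_alg and T :: "nat \<Rightarrow> nat" and \<epsilon> :: real
  assumes M: "mis_algorithm M T"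
begin

text \<open>The outcome of \<open>M\<close> is a function of the graph alone. The reference run is
  therefore fixed in advance, independently of when processors carry out its supersteps.\<close>

definition msel :: "(nat \<Rightarrow> nat \<Rightarrow> bool) \<Rightarrow> nat set" where
  "msel adj = {v. v < m * r \<and> result M (m * r) adj (mis_input (m * r)) v = Num 1}"

sublocale run hmin I msel
proof unfold_locales
  show "simple_graph (m * r) adj \<Longrightarrow> maximal_independent_set (m * r) adj (msel adj)" for adj
    using M unfolding mis_algorithm_def msel_def by blast
qed

definition Mst :: "nat \<Rightarrow> nat \<Rightarrow> nat \<Rightarrow> val" where
  "Mst s L = state M (m * r) (gr (W s)) (mis_input (m * r)) L"

text \<open>Once nonempty, the output is kept, since only the first decision of a node
  counts.\<close>

primrec Dv :: "nat \<Rightarrow> nat \<Rightarrow> nat \<Rightarrow> val" where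
  "Dv s 0 v = ev (out_of M) [Mst s 0 v]"
| "Dv s (Suc L) v = (if elems (Dv s L v) = [] then ev (out_of M) [Mst s (Suc L) v] else Dv s L v)"

lemma decision_out: "decision M (m * r) (gr (W s)) (mis_input (m * r)) t v =
    (if elems (ev (out_of M) [Mst s t v]) = [] then None else Some (hd (elems (ev (out_of M) [Mst s t v]))))"
  unfolding decision_def Mst_def by (auto split: val.split list.split)

lemma Dv_none: "elems (Dv s L v) = [] \<longleftrightarrow>
    (\<forall>t\<le>L. decision M (m * r) (gr (W s)) (mis_input (m * r)) t v = None)"
  by (induction L) (auto simp: decision_out le_Suc_eq)

lemma Dv_result:
  "elems (Dv s L v) \<noteq> [] \<Longrightarrow> hd (elems (Dv s L v)) = result M (m * r) (gr (W s)) (mis_input (m * r)) v"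
proof (induction L)
  case 0
  then have "(LEAST t. decision M (m * r) (gr (W s)) (mis_input (m * r)) t v \<noteq> None) = 0"
    by (intro Least_equality) (auto simp: decision_out)
  then show ?case using 0 by (simp add: result_def decision_out)
next
  case (Suc L)
  show ?case
  proof (cases "elems (Dv s L v) = []")
    case True
    have "(LEAST t. decision M (m * r) (gr (W s)) (mis_input (m * r)) t v \<noteq> None) = Suc L"
    proof (rule Least_equality)
      show "decision M (m * r) (gr (W s)) (mis_input (m * r)) (Suc L) v \<noteq> None"
        using Suc.prems True by (simp add: decision_out)
      show "Suc L \<le> t" if "decision M (m * r) (gr (W s)) (mis_input (m * r)) t v \<noteq> None" for t
        using True that unfolding Dv_none by (meson not_less_eq_eq)
    qed
    then show ?thesis using Suc.prems True by (simp add: result_def decision_out)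
  qed (use Suc in simp)
qed

lemma Dv_T: "v < m * r \<Longrightarrow> T (m * r) \<le> L \<Longrightarrow> elems (Dv s L v) \<noteq> []"
  using M simple_gr[of "W s"] unfolding mis_algorithm_def terminates_within_def Dv_none
  by (meson order_trans)

lemma ch_Dv:
  assumes "i < m" "j < r" "elems (Dv s L (i * r + j)) \<noteq> []"
  shows "ch s i j \<longleftrightarrow> num (hd (elems (Dv s L (i * r + j)))) = 1 \<and> active (W s) i j"
proof -
  have "x = Num 1 \<longleftrightarrow> num x = 1" for x by (cases x) auto
  then show ?thesis
    using Dv_result[OF assms(3)] vid_lt[OF assms(1,2)] by (auto simp: ch_def chosen_def msel_def)
qed

primrec rz :: "nat \<Rightarrow> nat \<Rightarrow> (nat \<times> nat) option" where
  "rz i 0 = None"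
| "rz i (Suc s) = (let l = filter (ch s i) (tl i) in if l = [] then rz i s else Some (s, hd l))"

text \<open>In round 0 the previous state is the current one, as \<open>0 - 1 = 0\<close>. A
  neighbour asks for the previous state only when it is one round behind.\<close>

definition ent :: "nat \<Rightarrow> nat \<Rightarrow> nat \<Rightarrow> nat \<Rightarrow> val" where
  "ent i s L j = Lst [Num (real j), Num (W s i j), Mst s L (i * r + j), Mst s (L - 1) (i * r + j), Dv s L (i * r + j)]"

definition encrec :: "nat \<Rightarrow> nat \<Rightarrow> nat \<Rightarrow> val" where
  "encrec i s L = Lst [Num (real s), Num (real L), Lst (map (ent i s L) (tl i))]"

definition encrz :: "(nat \<times> nat) option \<Rightarrow> val" where
  "encrz x = (case x of None \<Rightarrow> Lst [] | Some (s, j) \<Rightarrow> Lst [Num (real s), Num (real j)])"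

definition encsel :: "bool option \<Rightarrow> val" where
  "encsel x = (case x of None \<Rightarrow> Lst [] | Some b \<Rightarrow> Lst [bv b])"

definition encst :: "nat \<Rightarrow> ast \<Rightarrow> val" where
  "encst i x = Lst [proc_input hmin \<epsilon> I i, Lst (map (\<lambda>s. encrec i s (aL x s)) (rev [0..<Suc (ak x)])),
     encrz (rz i (ak x)), encsel (asel x), afin x]"

definition nbl :: "nat \<Rightarrow> nat list" where "nbl i = filter (comm I i) [0..<m]"

definition alldec :: "nat \<Rightarrow> nat \<Rightarrow> nat \<Rightarrow> bool" where
  "alldec i s L \<longleftrightarrow> (\<forall>j\<in>acc I i. elems (Dv s L (i * r + j)) \<noteq> [])"

text \<open>Only the neighbours must have decided the current superstep; distant processors may lag
  several supersteps behind.\<close>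

definition anew :: "(nat \<Rightarrow> ast) \<Rightarrow> nat \<Rightarrow> bool" where
  "anew a i \<longleftrightarrow> (let s = ak (a i) in alldec i s (aL (a i) s) \<and>
     (\<forall>i'\<in>set (nbl i). s \<le> ak (a i') \<and> alldec i' s (aL (a i') s)))"

definition aadv :: "(nat \<Rightarrow> ast) \<Rightarrow> nat \<Rightarrow> nat \<Rightarrow> bool" where
  "aadv a i s \<longleftrightarrow> s \<le> ak (a i) \<and> (\<forall>i'\<in>set (nbl i). s \<le> ak (a i') \<and> aL (a i) s \<le> aL (a i') s)"

definition alater :: "(nat \<Rightarrow> ast) \<Rightarrow> nat \<Rightarrow> nat \<Rightarrow> bool" where
  "alater a i i' \<longleftrightarrow> (\<exists>s j s'. rz i (ak (a i)) = Some (s, j) \<and> rz i' (ak (a i')) = Some (s', j) \<and> s < s')"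

definition acomp :: "(nat \<Rightarrow> ast) \<Rightarrow> nat \<Rightarrow> bool" where
  "acomp a i \<longleftrightarrow> (\<forall>j\<in>acc I i. W (ak (a i)) i j + W (ak (a i)) i j \<le> pr i)"

text \<open>Satisfied neighbours will never be raised again, so the instances raised later than the
  own one are all known. Waiting for their selection is waiting for all data in
  \<open>sel_iff\<close>.\<close>

definition aready :: "(nat \<Rightarrow> ast) \<Rightarrow> nat \<Rightarrow> bool" where
  "aready a i \<longleftrightarrow> acomp a i \<and> (\<forall>i'\<in>set (nbl i). acomp a i' \<and> (alater a i i' \<longrightarrow> asel (a i') \<noteq> None))"

definition aval :: "(nat \<Rightarrow> ast) \<Rightarrow> nat \<Rightarrow> bool" where
  "aval a i \<longleftrightarrow> (case rz i (ak (a i)) of None \<Rightarrow> False | Some (s, j) \<Rightarrow>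
     \<forall>e\<in>pth i j. (\<Sum>i'\<in>{i' \<in> set (nbl i). alater a i i' \<and> asel (a i') = Some True \<and> narrow i = narrow i' \<and> e \<in> pth i' j}. hh i')
       + hh i \<le> 1)"

definition asum :: "(nat \<Rightarrow> ast) \<Rightarrow> nat \<Rightarrow> nat \<Rightarrow> bool \<Rightarrow> real" where
  "asum a i j c = (\<Sum>i'\<in>{i' \<in> set (nb i). asel (a i') = Some True \<and> (\<exists>s. rz i' (ak (a i')) = Some (s, j)) \<and> narrow i' = c}. pr i')"

definition adec :: "(nat \<Rightarrow> ast) \<Rightarrow> nat \<Rightarrow> val" where
  "adec a i = (case rz i (ak (a i)) of None \<Rightarrow> Lst [Lst []] | Some (s, j) \<Rightarrow>
     if asel (a i) = Some True \<and> narrow i = (asum a i j False \<le> asum a i j True)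
     then Lst [Num (real j)] else Lst [Lst []])"

definition astep :: "(nat \<Rightarrow> ast) \<Rightarrow> nat \<Rightarrow> ast" where
  "astep a i = \<lparr>ak = (if anew a i then Suc (ak (a i)) else ak (a i)),
     aL = (\<lambda>s. if aadv a i s then Suc (aL (a i) s) else aL (a i) s),
     asel = (if asel (a i) \<noteq> None then asel (a i) else if aready a i then Some (aval a i) else None),
     afin = (if elems (afin (a i)) \<noteq> [] then afin (a i)
       else if asel (a i) \<noteq> None \<and> (\<forall>i'\<in>set (nbl i). asel (a i') \<noteq> None) then adec a i else Lst [])\<rparr>"

text \<open>With at most one vertex the round bound may be 0, so the decision is made in the initial
  state.\<close>

definition ainit :: "nat \<Rightarrow> ast" where
  "ainit i = \<lparr>ak = 0, aL = (\<lambda>s. 0), asel = None,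
     afin = (if m * r \<le> 1 then if tl i = [] then Lst [Lst []] else Lst [Num (real (hd (tl i)))] else Lst [])\<rparr>"

primrec ab :: "nat \<Rightarrow> nat \<Rightarrow> ast" where
  "ab 0 = ainit"
| "ab (Suc t) = astep (ab t)"

text \<open>Neighbouring simulations of a superstep differ by at most one round; hence two states per
  vertex suffice. A decision is only made after a selection.\<close>

definition inv :: "(nat \<Rightarrow> ast) \<Rightarrow> bool" where
  "inv a \<longleftrightarrow> (\<forall>i<m. (\<forall>s. ak (a i) < s \<longrightarrow> aL (a i) s = 0) \<and>
     (\<forall>i'\<in>set (nbl i). \<forall>s. aL (a i') s \<le> Suc (aL (a i) s)) \<and>
     (asel (a i) = Some True \<longrightarrow> rz i (ak (a i)) \<noteq> None))"

lemma invD: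
  assumes "inv a" "i < m"
  shows "ak (a i) < s \<Longrightarrow> aL (a i) s = 0" "i' \<in> set (nbl i) \<Longrightarrow> aL (a i') s \<le> Suc (aL (a i) s)"
    "asel (a i) = Some True \<Longrightarrow> rz i (ak (a i)) \<noteq> None"
  using assms by (auto simp only: inv_def)

lemma set_nbl: "set (nbl i) = {i'. i' < m \<and> comm I i i'}"
  by (auto simp: nbl_def)

lemma nbl_sym: "i < m \<Longrightarrow> i' \<in> set (nbl i) \<Longrightarrow> i \<in> set (nbl i') \<and> i' < m"
  by (auto simp: set_nbl comm_def)

lemma set_nb_nbl: "i < m \<Longrightarrow> set (nb i) = insert i (set (nbl i))"
  by (auto simp: nb_def nbl_def)

lemma rz_mono:
  assumes "k \<le> k'" "rz i k = Some x"
  shows "rz i k' \<noteq> None"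
  using assms by (induction rule: dec_induct) (auto simp: Let_def)

text \<open>A simulation advances only if no neighbour is behind it, so a lead of one never grows. A
  selection bit is true only for a recorded raise, and records persist.\<close>

lemma inv_step:
  assumes "inv a"
  shows "inv (astep a)"
  unfolding inv_def
proof (intro allI impI conjI ballI)
  fix i s assume i: "i < m" "ak (astep a i) < s"
  have "ak (a i) \<le> ak (astep a i)" by (simp add: astep_def)
  then have "ak (a i) < s" using i(2) by linarith
  moreover from this have "aL (a i) s = 0" using invD(1)[OF assms i(1)] by simp
  ultimately show "aL (astep a i) s = 0" by (simp add: astep_def aadv_def)
next
  fix i i' s assume i: "i < m" "i' \<in> set (nbl i)"
  have i': "i \<in> set (nbl i')" "i' < m" using nbl_sym[OF i] by auto
  show "aL (astep a i') s \<le> Suc (aL (astep a i) s)"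
  proof (cases "aadv a i' s \<and> \<not> aadv a i s")
    case True
    then have "aL (a i') s \<le> aL (a i) s" using i' by (auto simp: aadv_def)
    then show ?thesis using True by (simp add: astep_def)
  next
    case False
    have "aL (a i') s \<le> Suc (aL (a i) s)" using invD(2)[OF assms i] .
    then show ?thesis using False by (auto simp: astep_def)
  qed
next
  fix i assume i: "i < m" "asel (astep a i) = Some True"
  have "rz i (ak (a i)) \<noteq> None"
  proof (cases "asel (a i) = None")
    case True
    then have "aval a i" using i by (auto simp: astep_def split: if_splits)
    then show ?thesis by (auto simp: aval_def split: option.splits)
  next
    case False
    then show ?thesis using i(2) invD(3)[OF assms i(1)] by (simp add: astep_def)
  qed
  then obtain x where "rz i (ak (a i)) = Some x" by blast
  then show "rz i (ak (astep a i)) \<noteq> None" using rz_mono[of "ak (a i)" "ak (astep a i)" i x] by (simp add: astep_def)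
qed

lemma inv_ab: "inv (ab t)"
proof (induction t)
  case 0
  show ?case by (simp add: inv_def ainit_def)
qed (simp add: inv_step)

section \<open>Correctness of the program\<close>

lemma inp_simps [simp]:
  "nthv (proc_input hmin \<epsilon> I i) (Suc 0) = Num (real r)"
  "nthv (proc_input hmin \<epsilon> I i) 2 = Num (real m)"
  "nthv (proc_input hmin \<epsilon> I i) 5 = Num (real i)"
  "nthv (proc_input hmin \<epsilon> I i) 6 = Num (real (src I i))"
  "nthv (proc_input hmin \<epsilon> I i) 7 = Num (real (dst I i))"
  "nthv (proc_input hmin \<epsilon> I i) 8 = Num (pr i)"
  "nthv (proc_input hmin \<epsilon> I i) 9 = Num (hh i)"
  "nthv (proc_input hmin \<epsilon> I i) 10 = Lst (map (tree_input I) (tl i))"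
  by (simp_all add: proc_input_def tl_def)

lemma encst_simps [simp]:
  "nthv (encst i x) 0 = proc_input hmin \<epsilon> I i"
  "nthv (encst i x) (Suc 0) = Lst (map (\<lambda>s. encrec i s (aL x s)) (rev [0..<Suc (ak x)]))"
  "nthv (encst i x) 2 = encrz (rz i (ak x))"
  "nthv (encst i x) 3 = encsel (asel x)"
  "nthv (encst i x) 4 = afin x"
  by (simp_all add: encst_def)

lemma encrec_simps [simp]:
  "nthv (encrec i s L) 0 = Num (real s)" "nthv (encrec i s L) (Suc 0) = Num (real L)"
  "nthv (encrec i s L) 2 = Lst (map (ent i s L) (tl i))" "elems (encrec i s L) \<noteq> []"
  by (simp_all add: encrec_def)

lemma ent_simps [simp]:
  "nthv (ent i s L j) 0 = Num (real j)" "nthv (ent i s L j) (Suc 0) = Num (W s i j)"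
  "nthv (ent i s L j) 2 = Mst s L (i * r + j)" "nthv (ent i s L j) 3 = Mst s (L - 1) (i * r + j)"
  "nthv (ent i s L j) 4 = Dv s L (i * r + j)"
  by (simp_all add: ent_def)

lemma first_rec [simp]: "nthv (Lst (map f (rev [0..<Suc k]))) 0 = f k"
  by simp

lemma filter_eq_distinct: "distinct xs \<Longrightarrow> filter (\<lambda>x. x = s) xs = (if s \<in> set xs then [s] else [])"
  by (induction xs) auto

lemma ev_rec: "ev p_rec [encst i x, Num (real s)] = (if s \<le> ak x then encrec i s (aL x s) else Lst [])"
proof -
  have "filter (\<lambda>s'. s' = s) (rev [0..<Suc (ak x)]) = (if s \<le> ak x then [s] else [])"
    using filter_eq_distinct[of "rev [0..<Suc (ak x)]" s] by auto
  then show ?thesis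
    by (simp add: p_rec_def filter_map o_def del: upt_Suc)
qed

lemma ev_item:
  assumes ij: "i < m" "j \<in> acc I i" and e: "nthv e 0 = Num (real j)"
  shows "ev p_item [encst i x, e, ms] = Lst [Num (real i), Num (real j), Num (pr i), Num (hh i), nthv e (Suc 0),
     Lst (map encp (pthl i j)), ms, nthv e 4]"
proof -
  have j: "j < r" using acc_lt ij by blast
  have "filter (\<lambda>j'. j' = j) (tl i) = [j]"
    using filter_eq_distinct[of "tl i" j] set_tl[OF ij(1)] ij(2) by (auto simp: tl_def)
  then have "filter (\<lambda>z. num (nthv z 0) = real j) (map (tree_input I) (tl i)) = [tree_input I j]"
    by (simp add: filter_map o_def tree_input_edl)
  then show ?thesis
    by (simp add: p_item_def e ev_path[OF ij(1) j] tree_input_edl[of j])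
qed

lemma ev_item_ent:
  assumes "i < m" "j \<in> acc I i"
  shows "ev p_item [encst i x, ent i s L j, ms] = item i j (W s i j) ms (Dv s L (i * r + j))"
  using ev_item[OF assms, of "ent i s L j"] by (simp add: item_def)

abbreviation "rcv a i \<equiv> Lst (map (\<lambda>i'. encst i' (a i')) (nbl i))"

lemma ev_all:
  assumes "i < m"
  shows "ev p_all [encst i (a i), rcv a i] = Lst (map (\<lambda>i'. encst i' (a i')) (nb i))"
proof -
  have up: "[0..<m] = [0..<i] @ i # [Suc i..<m]"
    using assms upt_add_eq_append[of 0 i "m - i"] by (simp add: upt_conv_Cons)
  have "nb i = filter (\<lambda>i'. \<not> i \<le> i') (nbl i) @ i # filter (\<lambda>i'. \<not> i' \<le> i) (nbl i)"
  proof -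
    have 1: "filter (\<lambda>i'. i' = i \<or> comm I i i') [0..<i] = filter (\<lambda>i'. \<not> i \<le> i') (filter (comm I i) [0..<i])"
      "filter (\<lambda>i'. i' = i \<or> comm I i i') [Suc i..<m] = filter (\<lambda>i'. \<not> i' \<le> i) (filter (comm I i) [Suc i..<m])"
      "filter (\<lambda>i'. \<not> i \<le> i') (filter (comm I i) [Suc i..<m]) = []"
      "filter (\<lambda>i'. \<not> i' \<le> i) (filter (comm I i) [0..<i]) = []"
      by (auto intro!: filter_cong simp: filter_empty_conv)
    have "\<not> comm I i i" by (simp add: comm_def)
    then show ?thesis unfolding nb_def nbl_def up filter_append filter.simps 1 by simp
  qed
  then show ?thesis by (simp add: p_all_def filter_map o_def)
qed

definition VI :: "(nat \<Rightarrow> ast) \<Rightarrow> nat \<Rightarrow> nat \<Rightarrow> nat \<times> nat \<Rightarrow> val" where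
  "VI a s L = (\<lambda>(i, j). item i j (W s i j)
     (if aL (a i) s = L then Mst s (aL (a i) s) (i * r + j) else Mst s (aL (a i) s - 1) (i * r + j))
     (Dv s (aL (a i) s) (i * r + j)))"

lemma ev_vs:
  assumes i: "i < m" and s: "\<And>i'. i' \<in> set (nb i) \<Longrightarrow> s \<le> ak (a i')"
  shows "ev p_vs [encst i (a i), rcv a i, Num (real s), Num (real L)] = Lst (map (VI a s L) (VL i))"
proof -
  have nbm: "i' < m" if "i' \<in> set (nb i)" for i' using that by (auto simp: nb_def)
  have "map (\<lambda>e. ev (Call p_item [Var 1, Var 0,
      Ite (EQ (It 1 (Call p_rec [Var 1, Var 4])) (Var 5)) (It 2 (Var 0)) (It 3 (Var 0))])
      [e, encst i' (a i'), encst i (a i), rcv a i, Num (real s), Num (real L)])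
     (map (ent i' s (aL (a i') s)) (tl i')) = map (VI a s L) (map (Pair i') (tl i'))"
    if i': "i' \<in> set (nb i)" for i'
    using set_tl[OF nbm[OF i']] s[OF i'] nbm[OF i'] by (auto simp: ev_rec ev_item_ent VI_def)
  then have "map (\<lambda>y. elems (ev (MAP (Call p_item [Var 1, Var 0,
      Ite (EQ (It 1 (Call p_rec [Var 1, Var 4])) (Var 5)) (It 2 (Var 0)) (It 3 (Var 0))])
    (It 2 (Call p_rec [Var 0, Var 3]))) (y # [encst i (a i), rcv a i, Num (real s), Num (real L)])))
     (map (\<lambda>i'. encst i' (a i')) (nb i)) = map (\<lambda>i'. map (VI a s L) (map (Pair i') (tl i'))) (nb i)"
    using s by (simp add: ev_rec del: map_map ev_Call) (simp add: ev_rec)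
  then show ?thesis
    unfolding p_vs_def VL_def ev_CMAP by (simp add: ev_all[OF i] map_concat o_def cong: map_cong)
qed

end

section \<open>One round of the program on encoded states\<close>

context sim
begin

lemma ev_cond_adv:
  "ev p_cond_adv [encrec i s L, y, rcv a i] = bv (\<forall>i'\<in>set (nbl i). s \<le> ak (a i') \<and> L \<le> aL (a i') s)"
proof -
  have "tr (ev (OR (IsEmpty (Call p_rec [Var 0, It 0 (Var 1)]))
    (NOT (Leq (It 1 (Var 1)) (It 1 (Call p_rec [Var 0, It 0 (Var 1)])))))
    [encst i' (a i'), encrec i s L, y, rcv a i]) \<longleftrightarrow> \<not> (s \<le> ak (a i') \<and> L \<le> aL (a i') s)" for i'
    by (simp add: ev_rec)
  then show ?thesis by (simp add: p_cond_adv_def del: ev_bool(3))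
qed

lemma VI_eq: "VI a s L = (\<lambda>(i, j). item i j (W s i j)
   ((\<lambda>i j. if aL (a i) s = L then Mst s (aL (a i) s) (i * r + j) else Mst s (aL (a i) s - 1) (i * r + j)) i j)
   ((\<lambda>i j. Dv s (aL (a i) s) (i * r + j)) i j))"
  by (simp add: VI_def)

lemma ev_nbrs:
  assumes ij: "i < m" "j \<in> acc I i"
  shows "ev p_nbrs [ent i s l j, encst i (a i), Lst (map (VI a s L) (VL i))] =
     Lst (map (VI a s L) (filter (adjp (W s) (i, j)) (VL i)))"
proof -
  have "tr (ev p_adj [item i j (W s i j) (Lst []) (Dv s l (i * r + j)), VI a s L q, Lst (map (VI a s L) (VL i))])
     \<longleftrightarrow> adjp (W s) (i, j) q" if "q \<in> set (VL i)" for q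
    using ev_adj[OF ij that, where w = "W s" and ?a0.0 = "Lst []" and ?d0.0 = "Dv s l (i * r + j)"
        and a = "\<lambda>i j. if aL (a i) s = L then Mst s (aL (a i) s) (i * r + j) else Mst s (aL (a i) s - 1) (i * r + j)"
        and d = "\<lambda>i j. Dv s (aL (a i) s) (i * r + j)"]
    unfolding VI_def by (simp only: tr_bv)
  then show ?thesis
    using ij by (auto simp: p_nbrs_def ev_item_ent filter_map o_def intro!: arg_cong[of _ _ "map _"] filter_cong)
qed

text \<open>By \<open>inv\<close> and \<open>aadv\<close>, a neighbour is at round \<open>L\<close>
  or \<open>Suc L\<close>; its record contains the state of round \<open>L\<close> in either
  case.\<close>

lemma VI_state:
  assumes a: "inv a" and i: "i < m" and adv: "aadv a i s" and L: "L = aL (a i) s" and q: "q \<in> set (VL i)"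
  shows "nthv (VI a s L q) 6 = Mst s L (fst q * r + snd q)" "fst q * r + snd q < m * r"
proof -
  obtain i' j' where q': "q = (i', j')" by (cases q)
  have i': "i' = i \<or> i' \<in> set (nbl i)" "i' < m" "j' \<in> acc I i'"
    using q i set_nb_nbl by (auto simp: q' set_VL set_nb)
  have "aL (a i') s = L \<or> aL (a i') s = Suc L"
  proof (cases "i' = i")
    case False
    then have "L \<le> aL (a i') s" "aL (a i') s \<le> Suc L"
      using i'(1) adv invD(2)[OF a i, of i' s] L unfolding aadv_def by auto
    then show ?thesis by linarith
  qed (simp add: L)
  then show "nthv (VI a s L q) 6 = Mst s L (fst q * r + snd q)" by (auto simp: VI_def q')
  show "fst q * r + snd q < m * r" using vid_lt acc_lt i' by (simp add: q')
qed

text \<open>Stated for the argument list, since both the value and the cost of a simulated step are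
  obtained from it.\<close>

lemma newst_args:
  assumes a: "inv a" and ij: "i < m" "j \<in> acc I i" and adv: "aadv a i s" and L: "L = aL (a i) s"
  shows "map (\<lambda>p. ev p [ent i s L j, encst i (a i), Lst (map (VI a s L) (VL i))])
      [It 2 (Var 0), MAP (Call (msg_of M) [It 6 (Var 0)]) (Call p_nbrs [Var 0, Var 1, Var 2])] =
    [Mst s L (i * r + j), received M (m * r) (gr (W s)) (Mst s L) (i * r + j)]"
proof -
  have "map (\<lambda>x. ev (msg_of M) [nthv x 6]) (map (VI a s L) (filter (adjp (W s) (i, j)) (VL i))) =
    map (\<lambda>w. ev (msg_of M) [Mst s L w]) (map (\<lambda>(i', j'). i' * r + j') (filter (adjp (W s) (i, j)) (VL i)))"
    using VI_state(1)[OF a ij(1) adv L] by (simp add: case_prod_unfold)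
  also have "\<dots> = map (\<lambda>w. ev (msg_of M) [Mst s L w]) (filter (gr (W s) (i * r + j)) [0..<m * r])"
    by (simp add: gr_neighbours[OF ij])
  finally show ?thesis
    by (simp add: ev_nbrs[OF ij] received_def o_def del: map_map)
qed

lemma ev_newst:
  assumes "inv a" "i < m" "j \<in> acc I i" "aadv a i s" "L = aL (a i) s"
  shows "ev (p_newst M) [ent i s L j, encst i (a i), Lst (map (VI a s L) (VL i))] = Mst s (Suc L) (i * r + j)"
  unfolding p_newst_def ev_Call newst_args[OF assms] by (simp add: Mst_def)

lemma ev_entadv:
  assumes "inv a" "i < m" "j \<in> acc I i" "aadv a i s" "L = aL (a i) s"
  shows "ev (p_entadv M) [ent i s L j, encst i (a i), Lst (map (VI a s L) (VL i))] = ent i s (Suc L) j"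
  using ev_newst[OF assms] by (simp add: p_entadv_def p_ent2_def) (simp add: ent_def)

lemma ev_adv:
  assumes a: "inv a" and i: "i < m" and s: "s \<le> ak (a i)"
  shows "ev (p_adv M) [encrec i s (aL (a i) s), encst i (a i), rcv a i] = encrec i s (aL (astep a i) s)"
proof -
  let ?L = "aL (a i) s"
  have c: "(\<forall>i'\<in>set (nbl i). s \<le> ak (a i') \<and> ?L \<le> aL (a i') s) \<longleftrightarrow> aadv a i s"
    using s by (simp add: aadv_def)
  show ?thesis
  proof (cases "aadv a i s")
    case True
    then have "\<And>i'. i' \<in> set (nb i) \<Longrightarrow> s \<le> ak (a i')"
      using set_nb_nbl[OF i] by (auto simp: aadv_def)
    then have vs: "ev p_vs [encst i (a i), rcv a i, Num (real s), Num (real ?L)] = Lst (map (VI a s ?L) (VL i))"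
      by (rule ev_vs[OF i])
    have "map (\<lambda>x. ev (p_entadv M) [x, encst i (a i), Lst (map (VI a s ?L) (VL i))]) (map (ent i s ?L) (tl i)) =
      map (ent i s (Suc ?L)) (tl i)"
      using ev_entadv[OF a i _ True refl] set_tl[OF i] by simp
    then have "ev (p_adv2 M) [encrec i s ?L, encst i (a i), Lst (map (VI a s ?L) (VL i))] = encrec i s (Suc ?L)"
      by (simp add: p_adv2_def encrec_def[of i s "Suc ?L"] add.commute del: map_map)
    then show ?thesis
      using True by (simp add: p_adv_def ev_cond_adv c vs astep_def)
  next
    case False
    then show ?thesis by (simp add: p_adv_def ev_cond_adv c astep_def)
  qed
qed

lemma ev_recs:
  assumes a: "inv a" and i: "i < m"
  shows "ev (p_recs M) [encst i (a i), rcv a i] =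
    Lst (map (\<lambda>s. encrec i s (aL (astep a i) s)) (rev [0..<Suc (ak (a i))]))"
  using ev_adv[OF a i] by (simp add: p_recs_def)

lemma ev_alldec: "i < m \<Longrightarrow> ev p_alldec [encrec i s L] = bv (alldec i s L)"
  using set_tl[of i] by (simp add: p_alldec_def alldec_def)

lemma ev_alldec_Nil: "ev p_alldec [Lst []] = bv False"
  by (simp add: p_alldec_def)

lemma ev_cond_new:
  assumes i: "i < m"
  shows "ev p_cond_new [encst i (a i), rcv a i] = bv (anew a i)"
proof -
  have "tr (ev p_alldec [if s \<le> ak (a i') then encrec i' s (aL (a i') s) else Lst []]) \<longleftrightarrow>
    s \<le> ak (a i') \<and> alldec i' s (aL (a i') s)" if "i' \<in> set (nbl i)" for i' s
    using that by (simp add: ev_alldec ev_alldec_Nil set_nbl)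
  then show ?thesis
    using i by (simp add: p_cond_new_def ev_alldec ev_rec anew_def Let_def first_rec del: upt_Suc)
qed

lemma anewD:
  assumes "anew a i" "i < m" "i' \<in> set (nb i)"
  shows "ak (a i) \<le> ak (a i')" "alldec i' (ak (a i)) (aL (a i') (ak (a i)))"
  using assms set_nb_nbl[OF assms(2)] by (auto simp: anew_def Let_def)

lemma ev_vs0:
  assumes "anew a i" "i < m"
  shows "ev p_vs0 [encst i (a i), rcv a i] = Lst (map (VI a (ak (a i)) 0) (VL i))"
  using ev_vs[OF assms(2), of "ak (a i)" a 0] anewD(1)[OF assms] by (simp add: p_vs0_def first_rec del: upt_Suc)

lemma ev_chosen:
  assumes i: "i < m" "j \<in> acc I i" and i': "i' < m" "j \<in> acc I i'" and d: "elems (Dv s L' (i' * r + j)) \<noteq> []"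
  shows "ev p_chosen [item i' j (W s i' j) ms (Dv s L' (i' * r + j)), Lst (map (VI a s L) (VL i))] = bv (ch s i' j)"
proof -
  have j: "j < r" using acc_lt i by blast
  have "ev p_active [item i' j (W s i' j) ms (Dv s L' (i' * r + j)), Lst (map (VI a s L) (VL i))] = bv (active (W s) i' j)"
    unfolding VI_eq by (rule ev_active[OF j distinct_VL VL_complete[OF i]]) (use i' in \<open>simp add: clients_def\<close>)
  moreover have "nthv (Dv s L' (i' * r + j)) 0 = hd (elems (Dv s L' (i' * r + j)))"
    using d by (simp add: nthv_def hd_conv_nth)
  ultimately show ?thesis
    using ch_Dv[OF i'(1) j d] by (simp add: p_chosen_def)
qed

lemma sum_list_VL: "(\<Sum>q\<leftarrow>VL i. f q) = (\<Sum>q\<in>set (VL i). f q :: real)"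
  using distinct_VL by (rule sum_list_distinct_conv_sum_set)

text \<open>When a superstep is closed, all visible instances have decided, and all raised instances
  that occur in \<open>upd\<close> are visible. So the local sum is exact.\<close>

lemma ev_upd:
  assumes new: "anew a i" and i: "i < m" "j \<in> acc I i" and s: "s = ak (a i)"
  shows "ev p_upd [item i j (W s i j) ms (Dv s (aL (a i) s) (i * r + j)), Lst (map (VI a s L) (VL i))] = Num (W (Suc s) i j)"
proof -
  let ?x = "item i j (W s i j) ms (Dv s (aL (a i) s) (i * r + j))"
  let ?vs = "Lst (map (VI a s L) (VL i))"
  let ?b = "Ite (EQ (It 0 (Var 0)) (It 0 (Var 1)))
     (Ite (Call p_chosen [Var 0, Var 2]) (It 4 (Var 0)) (Lit 0))
     (Ite (AND (EQ (It 1 (Var 0)) (It 1 (Var 1))) (Call p_conf [Var 1, Var 0]))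
       (Ite (Call p_chosen [Var 0, Var 2]) (Mul (Call p_coef [Var 1]) (It 4 (Var 0))) (Lit 0)) (Lit 0))"
  let ?g = "\<lambda>q. (if fst q = i \<and> ch s i (snd q) then W s i (snd q) else 0) +
     (if snd q = j \<and> conf j i (fst q) \<and> ch s (fst q) j then coef i * W s (fst q) j else 0)"
  have jr: "j < r" using acc_lt i by blast
  have cf: "ev p_coef [?x] = Num (coef i)"
    by (simp add: p_coef_def p_narrow_def coef_def narrow_def)
  have body: "num (ev ?b (VI a s L q # [?x, ?vs])) = ?g q" if q: "q \<in> set (VL i)" for q
  proof -
    obtain i' j' where q': "q = (i', j')" by (cases q)
    have i': "i' \<in> set (nb i)" "j' \<in> acc I i'" "i' < m" using q i by (auto simp: q' set_VL set_nb)
    have dec: "elems (Dv s (aL (a i') s) (i' * r + j')) \<noteq> []"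
      using anewD(2)[OF new i(1) i'(1)] i' s by (simp add: alldec_def)
    consider "i' = i" | "i' \<noteq> i" "j' = j" | "i' \<noteq> i" "j' \<noteq> j" by blast
    then show ?thesis
    proof cases
      case 1
      have c: "ev p_chosen [VI a s L q, ?vs] = bv (ch s i' j')"
        using ev_chosen[OF i(1) _ i'(3,2) dec] i'(2) 1 by (simp add: VI_def q')
      show ?thesis using 1 c by (simp add: q' VI_def)
    next
      case 2
      have c: "ev p_chosen [VI a s L q, ?vs] = bv (ch s i' j')"
        using ev_chosen[OF i(1) _ i'(3,2) dec] i(2) 2 by (simp add: VI_def q')
      have cc: "ev p_conf [?x, VI a s L q] = bv (conf j i i')"
        using ev_conf[OF jr] 2 by (simp add: VI_def q')
      have f: "nthv (VI a s L q) 0 = Num (real i')" "nthv (VI a s L q) (Suc 0) = Num (real j)" "nthv (VI a s L q) 4 = Num (W s i' j)"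
        using 2 by (simp_all add: VI_def q')
      show ?thesis using 2 c cc cf f by (simp add: q')
    next
      case 3
      then show ?thesis by (simp add: q' VI_def)
    qed
  qed
  have "(\<Sum>q\<leftarrow>VL i. num (ev ?b (VI a s L q # [?x, ?vs]))) = (\<Sum>q\<in>set (VL i). ?g q)"
    unfolding sum_list_VL by (rule sum.cong[OF refl body])
  also have "\<dots> = own_dec s i + conf_dec s i j"
  proof -
    have fin: "finite (set (VL i))" by simp
    have "(\<Sum>q\<in>set (VL i). if fst q = i \<and> ch s i (snd q) then W s i (snd q) else 0) =
      (\<Sum>q\<in>{q \<in> set (VL i). fst q = i \<and> ch s i (snd q)}. W s i (snd q))"
      by (rule sum.inter_filter[OF fin, symmetric])
    also have "{q \<in> set (VL i). fst q = i \<and> ch s i (snd q)} = Pair i ` {j'. ch s i j'}"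
      using i nb_self[OF i(1)] chD(4) by (auto simp: set_VL)
    also have "(\<Sum>q\<in>Pair i ` {j'. ch s i j'}. W s i (snd q)) = own_dec s i"
      by (simp add: sum.reindex inj_on_def own_dec_def)
    finally have 1: "(\<Sum>q\<in>set (VL i). if fst q = i \<and> ch s i (snd q) then W s i (snd q) else 0) = own_dec s i" .
    have "(\<Sum>q\<in>set (VL i). if snd q = j \<and> conf j i (fst q) \<and> ch s (fst q) j then coef i * W s (fst q) j else 0) =
      (\<Sum>q\<in>{q \<in> set (VL i). snd q = j \<and> conf j i (fst q) \<and> ch s (fst q) j}. coef i * W s (fst q) j)"
      by (rule sum.inter_filter[OF fin, symmetric])
    also have "{q \<in> set (VL i). snd q = j \<and> conf j i (fst q) \<and> ch s (fst q) j} =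
      (\<lambda>i'. (i', j)) ` {i'. conf j i i' \<and> ch s i' j}"
      using i chD(2,4) by (force simp: set_VL set_nb)
    also have "(\<Sum>q\<in>(\<lambda>i'. (i', j)) ` {i'. conf j i i' \<and> ch s i' j}. coef i * W s (fst q) j) = conf_dec s i j"
      by (simp add: sum.reindex inj_on_def conf_dec_def)
    finally show ?thesis using 1 by (simp add: sum.distrib)
  qed
  finally have tot: "(\<Sum>q\<leftarrow>VL i. num (ev ?b (VI a s L q # [?x, ?vs]))) = own_dec s i + conf_dec s i j" .
  have "ev (TOT ?b (Var 1)) [?x, ?vs] = Num (own_dec s i + conf_dec s i j)"
    unfolding ev_TOT using tot by (simp add: o_def del: ev_Ite)
  then show ?thesis unfolding p_upd_def by (simp add: W_Suc del: ev_TOT W.simps)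
qed

lemma ev_init_mis:
  "ev (p_init_mis M) [proc_input hmin \<epsilon> I i, Num (real j)] = Mst s 0 (i * r + j)"
  by (simp add: p_init_mis_def Mst_def mis_input_def)

lemma ev_newent2: "nthv e 0 = Num (real j) \<Longrightarrow>
    ev (p_newent2 M) [e, Num (W s i j), Mst s 0 (i * r + j)] = ent i s 0 j"
  by (simp add: p_newent2_def ent_def)

lemma ev_newrec:
  assumes new: "anew a i" and i: "i < m"
  shows "ev (p_newrec M) [encst i (a i), Lst (map (VI a (ak (a i)) 0) (VL i))] = encrec i (Suc (ak (a i))) 0"
proof -
  let ?s = "ak (a i)" and ?vs = "Lst (map (VI a (ak (a i)) 0) (VL i))"
  have "ev (p_newent M) [ent i ?s (aL (a i) ?s) j, encst i (a i), ?vs] = ent i (Suc ?s) 0 j" if j: "j \<in> acc I i" for j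
    unfolding p_newent_def
    by (simp add: ev_item_ent[OF i j] ev_upd[OF new i j refl] ev_init_mis[of i j "Suc ?s"] ev_newent2 del: W.simps)
  then show ?thesis
    using set_tl[OF i] by (simp add: p_newrec_def first_rec encrec_def add.commute del: upt_Suc)
qed

lemma ev_newrais:
  assumes new: "anew a i" and i: "i < m"
  shows "ev p_newrais [encst i (a i), Lst (map (VI a (ak (a i)) 0) (VL i))] = encrz (rz i (Suc (ak (a i))))"
proof -
  let ?s = "ak (a i)" and ?vs = "Lst (map (VI a (ak (a i)) 0) (VL i))"
  have "ev p_chosen [ev p_item [encst i (a i), ent i ?s (aL (a i) ?s) j, Lst []], ?vs] = bv (ch ?s i j)"
    if j: "j \<in> acc I i" for j
    using anewD(2)[OF new i nb_self[OF i]] j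
    by (simp add: ev_item_ent[OF i j] ev_chosen[OF i j i j] alldec_def)
  then have f: "filter (\<lambda>x. tr (ev p_chosen [ev p_item [encst i (a i), x, Lst []], ?vs])) (map (ent i ?s (aL (a i) ?s)) (tl i)) =
    map (ent i ?s (aL (a i) ?s)) (filter (ch ?s i) (tl i))"
    using set_tl[OF i] by (auto simp: filter_map o_def intro!: arg_cong[of _ _ "map _"] filter_cong)
  show ?thesis
  proof (cases "filter (ch ?s i) (tl i) = []")
    case True
    then show ?thesis by (simp add: p_newrais_def p_newrais2_def first_rec f del: upt_Suc)
  next
    case False
    then obtain j js where "filter (ch ?s i) (tl i) = j # js" by (cases "filter (ch ?s i) (tl i)") auto
    then show ?thesis by (simp add: p_newrais_def p_newrais2_def first_rec f encrz_def del: upt_Suc)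
  qed
qed

section \<open>Selection phase and final decision\<close>

lemma ev_comp: "i < m \<Longrightarrow> ev p_comp [encst i (a i)] = bv (acomp a i)"
  using set_tl[of i] by (simp add: p_comp_def acomp_def first_rec del: upt_Suc)

lemma encrz_Nil [simp]: "elems (encrz x) = [] \<longleftrightarrow> x = None"
  by (auto simp: encrz_def split: option.splits)

lemma encrz_Some [simp]: "nthv (encrz (Some (s, j))) 0 = Num (real s)" "nthv (encrz (Some (s, j))) (Suc 0) = Num (real j)"
  by (simp_all add: encrz_def)

lemma encsel_simps [simp]: "elems (encsel x) = [] \<longleftrightarrow> x = None" "tr (nthv (encsel x) 0) \<longleftrightarrow> x = Some True"
proof -
  show "elems (encsel x) = [] \<longleftrightarrow> x = None" by (auto simp: encsel_def split: option.splits)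
  have "\<not> tr (Lst [])" by (simp add: tr_def)
  then show "tr (nthv (encsel x) 0) \<longleftrightarrow> x = Some True" by (cases x) (auto simp: encsel_def)
qed

lemma ev_later: "ev p_later [encst i (a i), encst i' (a i')] = bv (alater a i i')"
  by (cases "rz i (ak (a i))"; cases "rz i' (ak (a i'))") (auto simp: p_later_def alater_def intro!: arg_cong[of _ _ bv])

lemma rz_ch: "rz i k = Some (s, j) \<Longrightarrow> s < k \<and> ch s i j"
proof (induction k)
  case (Suc k)
  show ?case
  proof (cases "filter (ch k i) (tl i) = []")
    case False
    then have "hd (filter (ch k i) (tl i)) \<in> set (filter (ch k i) (tl i))" by (rule hd_in_set)
    then show ?thesis using Suc.prems False by (auto simp: Let_def)
  qed (use Suc in \<open>auto simp: Let_def\<close>)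
qed simp

lemma ev_rpath:
  assumes "rz i (ak x) = Some (s, j)" "i < m"
  shows "ev p_rpath [encst i x] = Lst (map encp (pthl i j))"
proof -
  have "j \<in> acc I i" using rz_ch[OF assms(1)] chD(4) by blast
  then show ?thesis
    using ev_item[OF assms(2), of j "Lst [Num (real j)]" x "Lst []"] by (simp add: p_rpath_def assms(1))
qed

lemma ev_nar: "ev (p_nar y) env = bv (narrow i)" if "ev y env = encst i x"
  using that by (simp add: p_nar_def narrow_def)

lemma ev_blk:
  assumes i: "i' < m" "rz i (ak (a i)) = Some (s, j)" and e: "e \<in> set (pthl i j)"
  shows "ev p_blk [encst i' (a i'), encp e, encst i (a i)] =
    bv (alater a i i' \<and> asel (a i') = Some True \<and> narrow i = narrow i' \<and> {fst e, snd e} \<in> pth i' j)"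
proof (cases "alater a i i'")
  case True
  then obtain s' where s': "rz i' (ak (a i')) = Some (s', j)" using i by (auto simp: alater_def)
  have j: "j < r" using chD(3) rz_ch[OF s'] by blast
  have "(\<exists>z\<in>set (pthl i' j). z = e) \<longleftrightarrow> {fst e, snd e} \<in> pth i' j"
    unfolding pth_pthl[OF j] using pthl_inj[OF j _ e] by (auto simp: image_iff)
  then show ?thesis
    by (simp add: p_blk_def ev_later ev_rpath[OF s' i(1)] ev_nar[of _ _ i "a i"] ev_nar[of _ _ i' "a i'"] prod_eq_iff[symmetric])
next
  case False
  then show ?thesis by (simp add: p_blk_def ev_later)
qed

lemma sum_list_nbl: "(\<Sum>x\<leftarrow>nbl i. if Q x then f x else (0::real)) = (\<Sum>x\<in>{x \<in> set (nbl i). Q x}. f x)"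
proof -
  have "(\<Sum>x\<leftarrow>nbl i. if Q x then f x else 0) = (\<Sum>x\<in>set (nbl i). if Q x then f x else 0)"
    by (rule sum_list_distinct_conv_sum_set) (simp add: nbl_def)
  then show ?thesis using sum.inter_filter[of "set (nbl i)" f Q] by simp
qed

lemma ev_over:
  assumes i: "i < m" "rz i (ak (a i)) = Some (s, j)" and e: "e \<in> set (pthl i j)"
  shows "ev p_over [encp e, encst i (a i), rcv a i] =
    bv (\<not> (\<Sum>i'\<in>{i' \<in> set (nbl i). alater a i i' \<and> asel (a i') = Some True \<and> narrow i = narrow i' \<and> {fst e, snd e} \<in> pth i' j}. hh i')
       + hh i \<le> 1)"
proof -
  let ?Q = "\<lambda>i'. alater a i i' \<and> asel (a i') = Some True \<and> narrow i = narrow i' \<and> {fst e, snd e} \<in> pth i' j"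
  have "num (ev (Ite (Call p_blk [Var 0, Var 1, Var 2]) (It 9 (It 0 (Var 0))) (Lit 0))
      (encst i' (a i') # [encp e, encst i (a i), rcv a i])) = (if ?Q i' then hh i' else 0)" if "i' \<in> set (nbl i)" for i'
    using ev_blk[where a = a and i = i, OF _ i(2) e, of i'] that by (simp add: set_nbl)
  then have "(\<Sum>x\<leftarrow>map (\<lambda>i'. encst i' (a i')) (nbl i). num (ev (Ite (Call p_blk [Var 0, Var 1, Var 2]) (It 9 (It 0 (Var 0))) (Lit 0))
      (x # [encp e, encst i (a i), rcv a i]))) = (\<Sum>i'\<leftarrow>nbl i. if ?Q i' then hh i' else 0)"
    unfolding map_map o_def by (intro arg_cong[of _ _ sum_list] map_cong refl)
  then show ?thesis
    unfolding sum_list_nbl p_over_def by (simp del: ev_Ite map_map)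
qed

lemma ev_val:
  assumes i: "i < m"
  shows "ev p_val [encst i (a i), rcv a i] = bv (aval a i)"
proof (cases "rz i (ak (a i))")
  case None
  then show ?thesis by (simp add: p_val_def aval_def)
next
  case (Some p)
  then obtain s j where sj: "rz i (ak (a i)) = Some (s, j)" by (cases p) auto
  have j: "j < r" using chD(3) rz_ch[OF sj] by blast
  show ?thesis
    unfolding aval_def sj using ev_over[where a = a and i = i, OF i sj]
    by (simp add: p_val_def sj ev_rpath[OF sj i] pth_pthl[OF j, of i])
qed

lemma ev_ready:
  assumes i: "i < m"
  shows "ev p_ready [encst i (a i), rcv a i] = bv (aready a i)"
proof -
  have "tr (ev (NOT (AND (Call p_comp [Var 0]) (OR (NOT (Call p_later [Var 1, Var 0])) (NOT (IsEmpty (It 3 (Var 0)))))))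
     [encst i' (a i'), encst i (a i), rcv a i]) \<longleftrightarrow> \<not> (acomp a i' \<and> (alater a i i' \<longrightarrow> asel (a i') \<noteq> None))"
    if "i' \<in> set (nbl i)" for i'
    using that by (auto simp: ev_comp ev_later set_nbl)
  then show ?thesis
    using i by (simp add: p_ready_def aready_def ev_comp del: ev_bool(2,3,4)) (simp add: ev_comp)
qed

lemma ev_sel:
  assumes i: "i < m"
  shows "ev p_sel [encst i (a i), rcv a i] = encsel (asel (astep a i))"
proof (cases "asel (a i)")
  case None
  then show ?thesis using i by (simp add: p_sel_def ev_ready ev_val astep_def encsel_def)
qed (simp add: p_sel_def astep_def)

lemma ev_sum:
  assumes i: "i < m" and a: "inv a" and sj: "rz i (ak (a i)) = Some (s, j)"
    and b: "\<And>p env. tr (ev (b p) env) \<longleftrightarrow> tr (ev p env) = c"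
  shows "ev (p_sum b) [encst i (a i), rcv a i] = Num (asum a i j c)"
proof -
  let ?Q = "\<lambda>i'. asel (a i') = Some True \<and> (\<exists>s. rz i' (ak (a i')) = Some (s, j)) \<and> narrow i' = c"
  let ?b = "Ite (AND (First (It 3 (Var 0))) (AND (EQ (It 1 (It 2 (Var 0))) (It 1 (It 2 (Var 1))))
    (b (p_nar (Var 0))))) (It 8 (It 0 (Var 0))) (Lit 0)"
  have body: "num (ev ?b (encst i' (a i') # [encst i (a i), rcv a i])) = (if ?Q i' then pr i' else 0)" if im: "i' < m" for i'
  proof (cases "asel (a i') = Some True")
    case True
    then obtain s' j' where "rz i' (ak (a i')) = Some (s', j')" using invD(3)[OF a im] by auto
    then show ?thesis using True by (simp add: sj b ev_nar[of _ _ i' "a i'"])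
  qed simp
  have lt: "i' < m" if "i' \<in> set (i # nbl i)" for i'
    using that i by (auto simp: set_nbl)
  have eq: "(\<Sum>x\<leftarrow>map (\<lambda>i'. encst i' (a i')) (i # nbl i). num (ev ?b (x # [encst i (a i), rcv a i]))) =
    (\<Sum>i'\<leftarrow>i # nbl i. if ?Q i' then pr i' else 0)"
    unfolding map_map o_def by (intro arg_cong[of _ _ sum_list] map_cong refl body lt)
  also have "\<dots> = (\<Sum>i'\<in>set (i # nbl i). if ?Q i' then pr i' else 0)"
    by (rule sum_list_distinct_conv_sum_set) (simp add: nbl_def comm_def)
  also have "\<dots> = asum a i j c"
    unfolding asum_def set_nb_nbl[OF i] list.set(2) by (rule sum.inter_filter[symmetric]) simp
  finally show ?thesis unfolding p_sum_def ev_TOT by (simp del: ev_Ite map_map add: o_def)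
qed

lemma ev_dec:
  assumes i: "i < m" and a: "inv a" and sel: "asel (a i) \<noteq> None"
  shows "ev p_dec [encst i (a i), rcv a i] = adec a i"
proof (cases "rz i (ak (a i))")
  case None
  then have "asel (a i) \<noteq> Some True" using invD(3)[OF a i] by blast
  then show ?thesis using None by (simp add: p_dec_def adec_def)
next
  case (Some p)
  then obtain s j where sj: "rz i (ak (a i)) = Some (s, j)" by (cases p) auto
  have sums: "ev (p_sum NOT) [encst i (a i), rcv a i] = Num (asum a i j False)"
    "ev (p_sum id) [encst i (a i), rcv a i] = Num (asum a i j True)"
  proof -
    show "ev (p_sum NOT) [encst i (a i), rcv a i] = Num (asum a i j False)"
      by (rule ev_sum[OF i a sj]) simp
    show "ev (p_sum id) [encst i (a i), rcv a i] = Num (asum a i j True)"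
      by (rule ev_sum[OF i a sj]) simp
  qed
  have n: "ev (p_nar (Var 0)) [encst i (a i), rcv a i] = bv (narrow i)" by (rule ev_nar[of _ _ i "a i"]) simp
  show ?thesis
    unfolding p_dec_def adec_def sj ev_Ite ev_bool n sums ev_Leq by (simp add: sj)
qed

lemma ev_fin:
  assumes i: "i < m" and a: "inv a"
  shows "ev p_fin [encst i (a i), rcv a i] = afin (astep a i)"
  using ev_dec[OF i a] by (auto simp: p_fin_def astep_def)

lemma ev_step:
  assumes a: "inv a" and i: "i < m"
  shows "ev (p_step M) [encst i (a i), rcv a i] = encst i (astep a i)"
proof -
  \<comment> \<open>The record to be created starts at round 0, which is the value
    \<open>inv\<close> prescribes for supersteps not yet begun.\<close>
  have aL: "aL (astep a i) (Suc (ak (a i))) = 0"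
    using invD(1)[OF a i] by (simp add: astep_def aadv_def)
  have rcs: "ev (p_recs M) [encst i (a i), rcv a i] =
    Lst (map (\<lambda>s. encrec i s (aL (astep a i) s)) (rev [0..<Suc (ak (a i))]))"
    by (rule ev_recs[OF a i])
  show ?thesis
  proof (cases "anew a i")
    case True
    then have k: "ak (astep a i) = Suc (ak (a i))" by (simp add: astep_def)
    have "map (\<lambda>s. encrec i s (aL (astep a i) s)) (rev [0..<Suc (Suc (ak (a i)))]) =
      encrec i (Suc (ak (a i))) 0 # map (\<lambda>s. encrec i s (aL (astep a i) s)) (rev [0..<Suc (ak (a i))])"
      using aL by simp
    then show ?thesis
      using True i a unfolding p_step_def encst_def[of i "astep a i"] k
      by (simp add: rcs ev_cond_new ev_vs0 ev_newrec ev_newrais ev_sel ev_fin del: upt_Suc rz.simps)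
  next
    case False
    then have k: "ak (astep a i) = ak (a i)" by (simp add: astep_def)
    show ?thesis
      using False i a unfolding p_step_def encst_def[of i "astep a i"] k
      by (simp add: rcs ev_cond_new ev_sel ev_fin del: upt_Suc)
  qed
qed

lemma ev_init:
  assumes i: "i < m"
  shows "ev (p_init M) [proc_input hmin \<epsilon> I i] = encst i (ainit i)"
proof -
  have t: "nthv (tree_input I j) 0 = Num (real j)" for j by (simp add: tree_input_edl)
  have "ev (p_ent0 M) [tree_input I j, proc_input hmin \<epsilon> I i] = ent i 0 0 j" for j
    using ev_newent2[where s = 0 and i = i and j = j, OF t] by (simp add: p_ent0_def t ev_init_mis[of i j 0])
  then have "map (\<lambda>x. ev (p_ent0 M) [x, proc_input hmin \<epsilon> I i]) (map (tree_input I) (tl i)) = map (ent i 0 0) (tl i)" by simp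
  moreover have "real m * real r \<le> 1 \<longleftrightarrow> m * r \<le> 1" using of_nat_le_iff[of "m * r" 1, where 'a = real] by simp
  moreover have "nthv (nthv (Lst (map (tree_input I) (tl i))) 0) 0 = Num (real (hd (tl i)))" if "tl i \<noteq> []"
    using that t by (cases "tl i") auto
  ultimately show ?thesis
    by (simp add: p_init_def encst_def ainit_def encrec_def encrz_def encsel_def del: map_map)
qed

theorem state_ab:
  assumes "i < m"
  shows "state (alg M) m (comm I) (proc_input hmin \<epsilon> I) t i = encst i (ab t i)"
  using assms
proof (induction t arbitrary: i)
  case 0
  then show ?case by (simp add: alg_def ev_init)
next
  case (Suc t)
  have "received (alg M) m (comm I) (state (alg M) m (comm I) (proc_input hmin \<epsilon> I) t) i = rcv (ab t) i"
    using Suc.IH by (simp add: received_def alg_def nbl_def)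
  then show ?case using Suc ev_step[OF inv_ab Suc.prems] by (simp add: alg_def)
qed

end

section \<open>Timing and outcome\<close>

text \<open>Without communication a vertex cannot tell the empty graph, where every vertex must
  join, from a graph with one edge, where two vertices must not both join.\<close>

lemma mis_time_pos:
  assumes M: "mis_algorithm M T" and N: "2 \<le> N"
  shows "1 \<le> T N"
proof (rule ccontr)
  assume "\<not> 1 \<le> T N"
  then have T0: "T N = 0" by simp
  have M': "terminates_within M N adj (mis_input N) 0"
    "maximal_independent_set N adj {v. v < N \<and> result M N adj (mis_input N) v = Num 1}"
    if "simple_graph N adj" for adj
  proof -
    have "terminates_within M N adj (mis_input N) (T N) \<and>
      maximal_independent_set N adj {v. v < N \<and> result M N adj (mis_input N) v = Num 1}"
      using M that unfolding mis_algorithm_def by blast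
    then show "terminates_within M N adj (mis_input N) 0"
      "maximal_independent_set N adj {v. v < N \<and> result M N adj (mis_input N) v = Num 1}"
      unfolding T0 by blast+
  qed
  \<comment> \<open>Initial states do not depend on the adjacency, so every decision at time 0 is
    the one for the empty graph.\<close>
  have res: "result M N adj (mis_input N) v = the (decision M N (\<lambda>_ _. False) (mis_input N) 0 v)"
    if "simple_graph N adj" "v < N" for adj v
  proof -
    have "decision M N adj (mis_input N) 0 v \<noteq> None"
      using M'(1)[OF that(1)] that(2) unfolding terminates_within_def by auto
    then have "(LEAST t. decision M N adj (mis_input N) t v \<noteq> None) = 0" by (intro Least_equality) auto
    then show ?thesis by (simp add: result_def decision_def)
  qed
  let ?A = "\<lambda>_ _. False" and ?B = "\<lambda>u v. u = 0 \<and> v = 1 \<or> u = 1 \<and> v = (0 :: nat)"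
  have sg: "simple_graph N ?A" "simple_graph N ?B" using N by (auto simp: simple_graph_def)
  have "independent_set N ?A {..<N}" by (simp add: independent_set_def)
  then have "{v. v < N \<and> result M N ?A (mis_input N) v = Num 1} = {..<N}"
    using M'(2)[OF sg(1)] unfolding maximal_independent_set_def independent_set_def by blast
  then have one: "result M N ?A (mis_input N) v = Num 1" if "v < N" for v using that by blast
  have "result M N ?B (mis_input N) v = Num 1" if "v < N" for v
    using one[OF that] res[OF sg(1) that] res[OF sg(2) that] by simp
  then have "0 \<in> {v. v < N \<and> result M N ?B (mis_input N) v = Num 1}" "1 \<in> {v. v < N \<and> result M N ?B (mis_input N) v = Num 1}"
    using N by auto
  then show False
    using M'(2)[OF sg(2)] unfolding maximal_independent_set_def independent_set_def by blast
qed

section \<open>Progress, correctness of the selection, and output\<close>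

context sim
begin

lemma ak_Suc: "ak (ab t i) \<le> ak (ab (Suc t) i)"
  by (simp add: astep_def)

lemma ak_mono: "t \<le> t' \<Longrightarrow> ak (ab t i) \<le> ak (ab t' i)"
  using lift_Suc_mono_le[of "\<lambda>t. ak (ab t i)"] ak_Suc by blast

text \<open>Once superstep \<open>s\<close> has begun everywhere, a processor with the fewest
  simulated rounds is held up by nobody, so the minimum grows in every round.\<close>

lemma aL_progress:
  assumes "\<And>i. i < m \<Longrightarrow> s \<le> ak (ab t i)" "i < m"
  shows "k \<le> aL (ab (t + k) i) s"
  using assms(2)
proof (induction k arbitrary: i)
  case (Suc k)
  show ?case
  proof (cases "aL (ab (t + k) i) s = k")
    case True
    have "s \<le> ak (ab (t + k) i')" if "i' < m" for i'
      using assms(1)[OF that] ak_mono[of t "t + k" i'] by simp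
    then have "aadv (ab (t + k)) i s"
      using True Suc by (auto simp: aadv_def set_nbl)
    then show ?thesis using True by (simp add: astep_def)
  next
    case False
    then have "Suc k \<le> aL (ab (t + k) i) s" using Suc by (simp add: le_neq_implies_less Suc_leI)
    also have "\<dots> \<le> aL (ab (t + Suc k) i) s" by (simp add: astep_def)
    finally show ?thesis .
  qed
qed simp

lemma alldec_T: "i < m \<Longrightarrow> T (m * r) \<le> L \<Longrightarrow> alldec i s L"
  using Dv_T vid_lt acc_lt unfolding alldec_def by blast

text \<open>\<open>T (m * r)\<close> rounds decide a superstep everywhere, and one more begins the
  next.\<close>

lemma ak_progress:
  assumes "i < m" "s * (T (m * r) + 1) \<le> t"
  shows "s \<le> ak (ab t i)"
proof -
  have "\<forall>i<m. s \<le> ak (ab (s * (T (m * r) + 1)) i)"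
  proof (induction s)
    case (Suc s)
    let ?t = "s * (T (m * r) + 1)"
    let ?u = "?t + T (m * r)"
    have dec: "s \<le> ak (ab ?u i)" "alldec i s (aL (ab ?u i) s)" if "i < m" for i
    proof -
      show "s \<le> ak (ab ?u i)" using Suc.IH that ak_mono[of ?t ?u i] le_trans by auto
      show "alldec i s (aL (ab ?u i) s)"
        using aL_progress[of s ?t i "T (m * r)"] Suc.IH that by (intro alldec_T) auto
    qed
    have "Suc s \<le> ak (ab (Suc ?u) i)" if i: "i < m" for i
    proof (cases "ak (ab ?u i) = s")
      case True
      have "anew (ab ?u) i"
        unfolding anew_def Let_def True using dec i by (auto simp: set_nbl)
      then show ?thesis using True by (simp add: astep_def)
    next
      case False
      then have "Suc s \<le> ak (ab ?u i)" using dec(1)[OF i] by simp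
      then show ?thesis using ak_Suc[of ?u i] by simp
    qed
    then show ?case by (simp add: algebra_simps)
  qed simp
  then show ?thesis using assms ak_mono[OF assms(2), of i] le_trans by blast
qed

lemma rz_iff: "rz i k = Some (s, j) \<longleftrightarrow> ch s i j \<and> s < k"
proof
  show "rz i k = Some (s, j) \<Longrightarrow> ch s i j \<and> s < k" using rz_ch by blast
next
  assume c: "ch s i j \<and> s < k"
  then have "rz i k \<noteq> None"
  proof (induction k)
    case (Suc k)
    show ?case
    proof (cases "s = k")
      case True
      then have "j \<in> set (filter (ch k i) (tl i))" using Suc.prems chD(2,4) set_tl by auto
      then have "filter (ch k i) (tl i) \<noteq> []" by force
      then show ?thesis by simp
    next
      case False
      then show ?thesis using Suc by (simp add: Let_def)
    qed
  qed simp
  then obtain s' j' where "rz i k = Some (s', j')" by auto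
  then show "rz i k = Some (s, j)" using rz_ch[of i k s' j'] raised_once c by blast
qed

text \<open>A demand with all instances satisfied is never raised later, so the record of its raise
  is final even if its processor has not carried out all supersteps.\<close>

lemma rz_comp:
  assumes "acomp a i"
  shows "rz i (ak (a i)) = Some (s, j) \<longleftrightarrow> ch s i j"
proof -
  have "s < ak (a i)" if c: "ch s i j"
  proof (rule ccontr)
    assume "\<not> s < ak (a i)"
    then have "W s i j \<le> W (ak (a i)) i j" using W_mono chD(2)[OF c] by simp
    moreover have "W (ak (a i)) i j + W (ak (a i)) i j \<le> pr i" using assms chD(4)[OF c] unfolding acomp_def by blast
    ultimately show False using chD(5)[OF c] by linarith
  qed
  then show ?thesis using rz_iff by blast
qed

lemma acomp_Suc: "i < m \<Longrightarrow> acomp (ab t) i \<Longrightarrow> acomp (ab (Suc t)) i"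
proof -
  assume i: "i < m" and c: "acomp (ab t) i"
  have "W (ak (ab (Suc t) i)) i j \<le> W (ak (ab t i)) i j" for j using W_mono[OF i ak_Suc] .
  then show ?thesis using c unfolding acomp_def by (smt (verit))
qed

lemma ch_conf_nbl:
  assumes "ch s i j" "ch s' i' j" "s \<noteq> s'"
  shows "i' \<in> set (nbl i)"
proof -
  have "i \<noteq> i'" using raised_once[OF assms(1), of s' j] assms(2,3) by auto
  then show ?thesis using chD(4)[OF assms(1)] chD(2,4)[OF assms(2)] by (auto simp: set_nbl comm_def)
qed

lemma ch_before: "all_sat S \<Longrightarrow> ch s i j \<Longrightarrow> s < S"
proof (rule ccontr)
  assume S: "all_sat S" and c: "ch s i j" and "\<not> s < S"
  then have "W s i j \<le> W S i j" using W_mono chD(2)[OF c] by simp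
  moreover have "W S i j + W S i j \<le> pr i" using S chD(2,4)[OF c] unfolding all_sat_def by blast
  ultimately show False using chD(5)[OF c] by linarith
qed

text \<open>The later raised instances on the tree belong to neighbours with final records and
  correct selections, so the local test coincides with \<open>ok\<close> for \<open>sel S\<close>,
  and \<open>sel_iff\<close> applies.\<close>

lemma aval_sel:
  assumes S: "all_sat S" and i: "i < m" and r: "aready a i"
    and IH: "\<And>i' b. i' < m \<Longrightarrow> asel (a i') = Some b \<Longrightarrow> acomp a i' \<and> b = (i' \<in> sel S)"
  shows "aval a i \<longleftrightarrow> i \<in> sel S"
proof (cases "rz i (ak (a i))")
  case None
  have "acomp a i" using r by (simp add: aready_def)
  then have "\<not> ch s i j" for s j using rz_comp[of a i s j] None by simp
  then have "i \<notin> sel S" using sel_raised[of i S] by blast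
  then show ?thesis using None by (simp add: aval_def)
next
  case (Some p)
  then obtain s j where sj: "rz i (ak (a i)) = Some (s, j)" by (cases p) auto
  then have c: "ch s i j" using rz_ch by blast
  have "{i' \<in> set (nbl i). alater a i i' \<and> asel (a i') = Some True \<and> narrow i = narrow i' \<and> e \<in> pth i' j} =
    {i' \<in> sel S. (\<exists>s'. s < s' \<and> s' < S \<and> ch s' i' j) \<and> narrow i' = narrow i \<and> e \<in> pth i' j}" for e
  proof (intro equalityI subsetI)
    fix i' assume i': "i' \<in> {i' \<in> set (nbl i). alater a i i' \<and> asel (a i') = Some True \<and> narrow i = narrow i' \<and> e \<in> pth i' j}"
    then obtain s' where s': "rz i' (ak (a i')) = Some (s', j)" "s < s'" using sj by (auto simp: alater_def)
    then have "ch s' i' j" using rz_ch by blast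
    moreover from this have "s' < S" using ch_before[OF S] by blast
    moreover have "i' \<in> sel S" using IH[of i' True] i' by (auto simp: set_nbl)
    ultimately show "i' \<in> {i' \<in> sel S. (\<exists>s'. s < s' \<and> s' < S \<and> ch s' i' j) \<and> narrow i' = narrow i \<and> e \<in> pth i' j}"
      using i' s' by auto
  next
    fix i' assume i': "i' \<in> {i' \<in> sel S. (\<exists>s'. s < s' \<and> s' < S \<and> ch s' i' j) \<and> narrow i' = narrow i \<and> e \<in> pth i' j}"
    then obtain s' where s': "s < s'" "ch s' i' j" by blast
    then have n: "i' \<in> set (nbl i)" using ch_conf_nbl[OF c] by blast
    then have "acomp a i'" using r by (auto simp: aready_def)
    then have "rz i' (ak (a i')) = Some (s', j)" using rz_comp s' by blast
    then have l: "alater a i i'" using sj s' by (auto simp: alater_def)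
    then obtain b where "asel (a i') = Some b" using r n by (auto simp: aready_def)
    moreover from this have "b" using IH[of i' b] i' n by (auto simp: set_nbl)
    ultimately show "i' \<in> {i' \<in> set (nbl i). alater a i i' \<and> asel (a i') = Some True \<and> narrow i = narrow i' \<and> e \<in> pth i' j}"
      using n l i' by auto
  qed
  then show ?thesis
    using sel_iff[OF c ch_before[OF S c]] by (simp add: aval_def sj ok_def)
qed

text \<open>\<open>S\<close> belongs to the analysis; no processor knows it. Local readiness already
  ensures the outcome, whenever it is reached.\<close>

lemma asel_correct:
  assumes S: "all_sat S"
  shows "i < m \<Longrightarrow> asel (ab t i) = Some b \<Longrightarrow> acomp (ab t) i \<and> b = (i \<in> sel S)"
proof (induction t arbitrary: i b)
  case 0
  then show ?case by (simp add: ainit_def)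
next
  case (Suc t)
  show ?case
  proof (cases "asel (ab t i)")
    case None
    then have "aready (ab t) i" "b = aval (ab t) i" using Suc.prems by (auto simp: astep_def split: if_splits)
    moreover from this have "acomp (ab t) i" by (simp add: aready_def)
    ultimately show ?thesis using aval_sel[OF S Suc.prems(1) _ Suc.IH] acomp_Suc Suc.prems(1) by blast
  next
    case (Some c)
    then have "c = b" using Suc.prems by (simp add: astep_def)
    then show ?thesis using Suc.IH[OF Suc.prems(1) Some] acomp_Suc Suc.prems(1) by blast
  qed
qed

text \<open>Selections propagate backwards through the supersteps: a demand raised at
  \<open>S - d\<close> or later waits only for demands raised strictly later. For
  \<open>d = 0\<close> there was no raise, hence nothing to wait for.\<close>

lemma asel_time:
  assumes S: "all_sat S" and t0: "t0 = S * (T (m * r) + 1)"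
  shows "i < m \<Longrightarrow> (\<And>s j. ch s i j \<Longrightarrow> S \<le> s + d) \<Longrightarrow> asel (ab (t0 + Suc d) i) \<noteq> None"
proof (induction d arbitrary: i)
  case (0 i)
  have comp: "acomp (ab t0) i'" if "i' < m" for i'
  proof -
    have "S \<le> ak (ab t0 i')" using ak_progress[OF that] t0 by simp
    then have "W (ak (ab t0 i')) i' j \<le> W S i' j" for j using W_mono[OF that] by blast
    then show ?thesis using S that unfolding acomp_def all_sat_def by (smt (verit))
  qed
  have "\<not> ch s i j" for s j using 0(2)[of s j] ch_before[OF S, of s i j] by auto
  then have "rz i (ak (ab t0 i)) = None" using rz_iff by (metis not_None_eq surj_pair)
  then have "aready (ab t0) i" using comp 0(1) by (auto simp: aready_def alater_def set_nbl)
  then show ?case by (simp add: astep_def)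
next
  case (Suc d i)
  let ?t = "t0 + Suc d"
  have comp: "acomp (ab ?t) i'" if "i' < m" for i'
  proof -
    have "S \<le> ak (ab ?t i')" by (rule ak_progress[OF that]) (simp add: t0)
    then have "W (ak (ab ?t i')) i' j \<le> W S i' j" for j using W_mono[OF that] by blast
    then show ?thesis using S that unfolding acomp_def all_sat_def by (smt (verit))
  qed
  have "asel (ab ?t i') \<noteq> None" if i': "i' \<in> set (nbl i)" "alater (ab ?t) i i'" for i'
  proof -
    obtain s j s' where s: "rz i (ak (ab ?t i)) = Some (s, j)" "rz i' (ak (ab ?t i')) = Some (s', j)" "s < s'"
      using i'(2) unfolding alater_def by blast
    have "S \<le> s + Suc d" using Suc.prems(2) rz_ch[OF s(1)] by blast
    then have "S \<le> s' + d" using s(3) by simp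
    then have "S \<le> s'' + d" if "ch s'' i' j''" for s'' j''
      using raised_once[OF that, of s' j] rz_ch[OF s(2)] by blast
    then show ?thesis using Suc.IH[of i'] i'(1) by (auto simp: set_nbl)
  qed
  then have "aready (ab ?t) i" using comp Suc.prems(1) unfolding aready_def set_nbl by blast
  then show ?case by (simp add: astep_def)
qed

definition fdec :: "nat \<Rightarrow> nat \<Rightarrow> val" where
  "fdec S i = (if \<exists>j. (i, j) \<in> solution S then Num (real (THE j. (i, j) \<in> solution S)) else Lst [])"

text \<open>The choice of a height class depends on all selected demands of one tree, and these are
  all neighbours.\<close>

lemma adec_solution:
  assumes S: "all_sat S" and i: "i < m" and known: "\<And>i'. i' \<in> set (nb i) \<Longrightarrow> asel (ab t i') \<noteq> None"
  shows "adec (ab t) i = Lst [fdec S i]"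
proof -
  have nbm: "i' < m" if "i' \<in> set (nb i)" for i' using that by (auto simp: nb_def)
  have sl: "acomp (ab t) i'" "asel (ab t i') = Some True \<longleftrightarrow> i' \<in> sel S" if i': "i' \<in> set (nb i)" for i'
  proof -
    obtain b where b: "asel (ab t i') = Some b" using known[OF i'] by auto
    then show "acomp (ab t) i'" "asel (ab t i') = Some True \<longleftrightarrow> i' \<in> sel S"
      using asel_correct[OF S nbm[OF i'] b] by auto
  qed
  have rz: "rz i' (ak (ab t i')) = Some (s, j) \<longleftrightarrow> ch s i' j" if "i' \<in> set (nb i)" for i' s j
    using rz_comp[of "ab t" i'] sl(1)[OF that] by blast
  show ?thesis
  proof (cases "rz i (ak (ab t i))")
    case None
    then have "\<not> ch s i j" for s j using rz[OF nb_self[OF i], of s j] by simp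
    then have "(i, j) \<notin> solution S" for j by (auto simp: solution_def on_tree_def)
    then show ?thesis using None by (simp add: adec_def fdec_def)
  next
    case (Some p)
    then obtain s j where sj: "rz i (ak (ab t i)) = Some (s, j)" by (cases p) auto
    have c: "ch s i j" using rz_ch[OF sj] by blast
    have sets: "{i' \<in> set (nb i). asel (ab t i') = Some True \<and> (\<exists>s. rz i' (ak (ab t i')) = Some (s, j)) \<and> narrow i' = b} =
      {i'. on_tree S i' j \<and> narrow i' = b}" for b
    proof (intro equalityI subsetI)
      fix i' assume "i' \<in> {i' \<in> set (nb i). asel (ab t i') = Some True \<and> (\<exists>s. rz i' (ak (ab t i')) = Some (s, j)) \<and> narrow i' = b}"
      then show "i' \<in> {i'. on_tree S i' j \<and> narrow i' = b}"
        using sl(2) rz ch_before[OF S] unfolding on_tree_def by blast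
    next
      fix i' assume "i' \<in> {i'. on_tree S i' j \<and> narrow i' = b}"
      then obtain s' where s': "ch s' i' j" "i' \<in> sel S" "narrow i' = b" unfolding on_tree_def by blast
      have "i' \<in> set (nb i)" using chD(2,4)[OF s'(1)] chD(4)[OF c] set_nb[OF i] by auto
      then show "i' \<in> {i' \<in> set (nb i). asel (ab t i') = Some True \<and> (\<exists>s. rz i' (ak (ab t i')) = Some (s, j)) \<and> narrow i' = b}"
        using s' sl(2) rz by blast
    qed
    have "(asum (ab t) i j False \<le> asum (ab t) i j True) = best S j"
      using sets[of True] sets[of False] by (simp add: asum_def best_def)
    moreover have "on_tree S i j \<longleftrightarrow> i \<in> sel S" using c ch_before[OF S c] unfolding on_tree_def by blast
    ultimately have iff: "asel (ab t i) = Some True \<and> narrow i = (asum (ab t) i j False \<le> asum (ab t) i j True) \<longleftrightarrow> (i, j) \<in> solution S"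
      using sl(2)[OF nb_self[OF i]] by (simp add: solution_def)
    have uniq: "(i, j') \<in> solution S \<Longrightarrow> j' = j" for j'
      using c raised_once unfolding solution_def on_tree_def by blast
    show ?thesis
    proof (cases "(i, j) \<in> solution S")
      case True
      then have "(THE j. (i, j) \<in> solution S) = j" using uniq by blast
      then show ?thesis using True iff sj by (auto simp: adec_def fdec_def)
    next
      case False
      then have "\<not> (\<exists>j. (i, j) \<in> solution S)" using uniq by blast
      then show ?thesis using False iff sj by (simp add: adec_def fdec_def)
    qed
  qed
qed

lemma afin_solution:
  assumes S: "all_sat S" and N: "\<not> m * r \<le> 1" and i: "i < m"
  shows "elems (afin (ab t i)) \<noteq> [] \<Longrightarrow> afin (ab t i) = Lst [fdec S i]"
proof (induction t)
  case 0
  then show ?case using N by (simp add: ainit_def)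
next
  case (Suc t)
  show ?case
  proof (cases "elems (afin (ab t i)) = []")
    case True
    then have "asel (ab t i) \<noteq> None \<and> (\<forall>i'\<in>set (nbl i). asel (ab t i') \<noteq> None)"
      using Suc.prems by (auto simp: astep_def split: if_splits)
    moreover from this have "adec (ab t) i = Lst [fdec S i]"
      by (intro adec_solution[OF S i]) (auto simp: set_nb_nbl[OF i])
    ultimately show ?thesis using True by (simp add: astep_def)
  next
    case False
    then show ?thesis using Suc.IH by (simp add: astep_def)
  qed
qed

lemma decision_alg: "i < m \<Longrightarrow> decision (alg M) m (comm I) (proc_input hmin \<epsilon> I) t i =
    (if elems (afin (ab t i)) = [] then None else Some (hd (elems (afin (ab t i)))))"
  using state_ab[of i t] by (auto simp: decision_def alg_def split: val.split list.split)

lemma afin_time: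
  assumes S: "all_sat S" and N: "\<not> m * r \<le> 1" and i: "i < m"
  shows "elems (afin (ab (S * (T (m * r) + 1) + S + 2) i)) \<noteq> []"
proof -
  let ?t = "S * (T (m * r) + 1) + Suc S"
  have known: "asel (ab ?t i') \<noteq> None" if "i' < m" for i'
    by (rule asel_time[OF S refl that]) simp
  then have "adec (ab ?t) i = Lst [fdec S i]"
    by (intro adec_solution[OF S i]) (auto simp: nb_def)
  then have "elems (afin (ab (Suc ?t) i)) \<noteq> []"
    using known i by (auto simp: astep_def set_nbl)
  then show ?thesis by simp
qed

lemma result_alg:
  assumes S: "all_sat S" and N: "\<not> m * r \<le> 1" and i: "i < m"
  shows "result (alg M) m (comm I) (proc_input hmin \<epsilon> I) i = fdec S i"
proof -
  let ?d = "\<lambda>t. decision (alg M) m (comm I) (proc_input hmin \<epsilon> I) t i"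
  have "?d (S * (T (m * r) + 1) + S + 2) \<noteq> None" using afin_time[OF assms] by (simp add: decision_alg[OF i])
  then have "?d (LEAST t. ?d t \<noteq> None) \<noteq> None" by (rule LeastI[of "\<lambda>t. ?d t \<noteq> None"])
  then have ne: "elems (afin (ab (LEAST t. ?d t \<noteq> None) i)) \<noteq> []" by (simp add: decision_alg[OF i] split: if_splits)
  then show ?thesis
    using afin_solution[OF S N i ne] unfolding result_def by (simp add: decision_alg[OF i])
qed

lemma computed_solution_alg:
  assumes S: "all_sat S" and N: "\<not> m * r \<le> 1"
  shows "computed_solution (alg M) hmin \<epsilon> I = solution S"
proof -
  have "fdec S i = Num (real j) \<longleftrightarrow> (i, j) \<in> solution S" for i j
  proof -
    have uniq: "(i, j) \<in> solution S \<Longrightarrow> (i, j') \<in> solution S \<Longrightarrow> j = j'" for j j'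
      using on_tree_unique by (auto simp: solution_def)
    show ?thesis
    proof (cases "\<exists>j. (i, j) \<in> solution S")
      case True
      then obtain j' where j': "(i, j') \<in> solution S" by blast
      then have "(THE j. (i, j) \<in> solution S) = j'" using uniq by blast
      then show ?thesis using True j' uniq by (auto simp: fdec_def)
    qed (simp add: fdec_def)
  qed
  moreover have "(i, j) \<in> solution S \<Longrightarrow> i < m" for i j
    using on_tree_facts by (auto simp: solution_def)
  ultimately show ?thesis
    using result_alg[OF S N] by (auto simp: computed_solution_def)
qed

lemma terminates_alg:
  assumes S: "all_sat S" and N: "\<not> m * r \<le> 1"
  shows "terminates_within (alg M) m (comm I) (proc_input hmin \<epsilon> I) (S * (T (m * r) + 1) + S + 2)"
  unfolding terminates_within_def
proof (intro allI impI)
  fix i assume i: "i < m"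
  show "\<exists>t\<le>S * (T (m * r) + 1) + S + 2. decision (alg M) m (comm I) (proc_input hmin \<epsilon> I) t i \<noteq> None"
    using afin_time[OF S N i] unfolding decision_alg[OF i]
    by (intro exI[of _ "S * (T (m * r) + 1) + S + 2"]) (simp del: ab.simps)
qed

text \<open>There is at most one demand instance, and a single height never exceeds the bandwidth,
  so all instances are scheduled.\<close>

lemma small_case:
  assumes N: "m * r \<le> 1"
  shows "terminates_within (alg M) m (comm I) (proc_input hmin \<epsilon> I) 0"
    and "computed_solution (alg M) hmin \<epsilon> I = demand_instances I"
    and "feasible I (demand_instances I)"
proof -
  have d0: "decision (alg M) m (comm I) (proc_input hmin \<epsilon> I) 0 i =
    Some (if tl i = [] then Lst [] else Num (real (hd (tl i))))" if "i < m" for i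
    using N by (simp add: decision_alg[OF that] ainit_def)
  then show "terminates_within (alg M) m (comm I) (proc_input hmin \<epsilon> I) 0"
    by (auto simp: terminates_within_def)
  have res: "result (alg M) m (comm I) (proc_input hmin \<epsilon> I) i =
    (if tl i = [] then Lst [] else Num (real (hd (tl i))))" if "i < m" for i
  proof -
    have "(LEAST t. decision (alg M) m (comm I) (proc_input hmin \<epsilon> I) t i \<noteq> None) = 0"
      using d0[OF that] by (intro Least_equality) auto
    then show ?thesis using d0[OF that] by (simp add: result_def)
  qed
  have m0: "0 < m" using valid by (simp add: valid_problem_def)
  have rm: "r = 0 \<or> r = 1 \<and> m = 1"
  proof -
    have "r \<le> m * r" "m \<le> m * r \<or> r = 0" using m0 by (cases m; cases r; simp)+
    then show ?thesis using N m0 by linarith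
  qed
  have tl01: "tl i = (if r = 1 \<and> 0 \<in> acc I i then [0] else [])" if "i < m" for i
    using rm by (auto simp: tl_def)
  show "computed_solution (alg M) hmin \<epsilon> I = demand_instances I"
  proof -
    have "(result (alg M) m (comm I) (proc_input hmin \<epsilon> I) i = Num (real j)) \<longleftrightarrow> j \<in> acc I i" if "i < m" for i j
      using res[OF that] tl01[OF that] acc_lt[OF that, of j] rm by auto
    then show ?thesis by (auto simp: computed_solution_def demand_instances_def)
  qed
  have sub: "demand_instances I \<subseteq> {(0, 0)}"
  proof
    fix d assume "d \<in> demand_instances I"
    then obtain i j where d: "d = (i, j)" "i < m" "j \<in> acc I i" by (auto simp: demand_instances_def)
    then have "j < r" using acc_lt by blast
    then show "d \<in> {(0, 0)}" using rm d by auto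
  qed
  show "feasible I (demand_instances I)"
    unfolding feasible_def
  proof (intro conjI allI impI ballI)
    show "j = j'" if "(i, j) \<in> demand_instances I \<and> (i, j') \<in> demand_instances I" for i j j'
      using that sub by blast
    fix j e
    have "(\<Sum>d\<in>{d \<in> demand_instances I. snd d = j \<and> e \<in> inst_path I d}. hh (fst d)) \<le> (\<Sum>d\<in>{(0::nat, 0::nat)}. hh (fst d))"
      using sub proc_facts(4)[OF m0] by (intro sum_mono2) auto
    also have "\<dots> \<le> 1" using proc_facts(5)[OF m0] by simp
    finally show "(\<Sum>d\<in>{d \<in> demand_instances I. snd d = j \<and> e \<in> inst_path I d}. hh (fst d)) \<le> 1" .
  qed simp
qed

end

section \<open>Cost of the program\<close>

text \<open>A cost bound for a prescribed form \<open>Q\<close> of environments. The width bound is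
  left to the caller, so it can be passed down through nested calls.\<close>

definition polS :: "(nat \<Rightarrow> val list \<Rightarrow> bool) \<Rightarrow> prog \<Rightarrow> bool" where
  "polS Q p \<longleftrightarrow> (\<forall>R. bd R \<longrightarrow> (\<forall>Z env. R Z env \<longrightarrow> Q Z env) \<longrightarrow> pol R p)"

lemma polSI: "(\<And>R. bd R \<Longrightarrow> (\<And>Z env. R Z env \<Longrightarrow> Q Z env) \<Longrightarrow> pol R p) \<Longrightarrow> polS Q p"
  unfolding polS_def by blast

lemma polSD: "polS Q p \<Longrightarrow> bd R \<Longrightarrow> (\<And>Z env. R Z env \<Longrightarrow> Q Z env) \<Longrightarrow> pol R p"
  unfolding polS_def by blast

definition arg :: "(nat \<Rightarrow> val list \<Rightarrow> bool) \<Rightarrow> prog list \<Rightarrow> nat \<Rightarrow> val list \<Rightarrow> bool" where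
  "arg R as Z env' \<longleftrightarrow> (\<exists>env. R Z env \<and> env' = map (\<lambda>a. ev a env) as)"

lemma bd_arg:
  assumes R: "bd R" and as: "\<And>a. a \<in> set as \<Longrightarrow> pol R a"
  shows "bd (arg R as)"
proof -
  have "pl R (\<lambda>Z env. \<Sum>a\<leftarrow>as. wd (ev a env))"
    using as by (intro pl_sum_list[OF R] pol_wd[OF R])
  then obtain k where k: "\<And>Z env. R Z env \<Longrightarrow> (\<Sum>a\<leftarrow>as. wd (ev a env)) \<le> Z ^ k" unfolding pl_def by blast
  have "wde env' \<le> Z ^ k" if h: "arg R as Z env'" for Z env'
  proof -
    obtain env where e: "R Z env" "env' = map (\<lambda>a. ev a env) as" using h unfolding arg_def by blast
    have "wde (map (\<lambda>a. ev a env) as) \<le> (\<Sum>a\<leftarrow>as. wd (ev a env))" by (induction as) auto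
    then show ?thesis using k[OF e(1)] e(2) by simp
  qed
  moreover have "2 \<le> Z" if h: "arg R as Z env'" for Z env' using h bd2[OF R] unfolding arg_def by blast
  ultimately show ?thesis unfolding bd_def pl_def by blast
qed

lemma pol_CallS:
  assumes R: "bd R" and as: "list_all (pol R) as" and q: "polS Q q"
    and sub: "\<And>Z env. R Z env \<Longrightarrow> Q Z (map (\<lambda>a. ev a env) as)"
  shows "pol R (Call q as)"
proof (rule pol_Call[OF R])
  show as': "pol R a" if "a \<in> set as" for a using as that by (simp add: list_all_iff)
  have "pol (arg R as) q"
    by (rule polSD[OF q bd_arg[OF R as']]) (use sub in \<open>auto simp: arg_def\<close>)
  then obtain k where k: "\<And>Z env'. arg R as Z env' \<Longrightarrow> cost q env' \<le> Z ^ k" unfolding pol_def pl_def by blast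
  then have "R Z env \<Longrightarrow> cost q (map (\<lambda>a. ev a env) as) \<le> Z ^ k" for Z env
    by (auto simp: arg_def)
  then show "pl R (\<lambda>Z env. cost q (map (\<lambda>a. ev a env) as))" unfolding pl_def by blast
qed

lemma pol_list: "list_all (pol R) []" "pol R a \<Longrightarrow> list_all (pol R) as \<Longrightarrow> list_all (pol R) (a # as)"
  by auto

lemma pol_TUP': "bd R \<Longrightarrow> list_all (pol R) as \<Longrightarrow> pol R (TUP as)"
  by (rule pol_TUP) (auto simp: list_all_iff)

lemma poly_le_power: "\<exists>k. \<forall>x. poly (q :: nat poly) x \<le> (x + 2) ^ k"
proof (induction q)
  case 0
  show ?case by simp
next
  case (pCons a q)
  then obtain k where k: "\<And>x. poly q x \<le> (x + 2) ^ k" by blast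
  have "poly (pCons a q) x \<le> (x + 2) ^ (a + k + 2)" for x
  proof -
    have "a \<le> (x + 2) ^ a" using less_exp[of a] power_mono[of 2 "x + 2" a] by linarith
    then have 1: "a \<le> (x + 2) ^ (a + k + 1)" using power_increasing[of a "a + k + 1" "x + 2"] by linarith
    have "x * poly q x \<le> (x + 2) * (x + 2) ^ k" using k by (intro mult_mono) auto
    also have "\<dots> = (x + 2) ^ (k + 1)" by simp
    also have "\<dots> \<le> (x + 2) ^ (a + k + 1)" by (rule power_increasing) auto
    finally have "poly (pCons a q) x \<le> 2 * (x + 2) ^ (a + k + 1)" using 1 by simp
    also have "\<dots> \<le> (x + 2) * (x + 2) ^ (a + k + 1)" by (rule mult_right_mono) auto
    finally show ?thesis by simp
  qed
  then show ?case by blast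
qed

section \<open>Width of the states along a run\<close>

locale simk = sim +
  fixes K :: nat
  assumes K: "simple_graph N adj \<Longrightarrow> v < N \<Longrightarrow> local_work M N adj (mis_input N) t v \<le> (N + t + 2) ^ K"
begin

text \<open>The size parameter of all bounds; the summand 2 lets powers of it absorb
  constants.\<close>

definition zz :: "nat \<Rightarrow> nat" where "zz t = nv + m + r + t + 2"

lemma zz2: "2 \<le> zz t"
  by (simp add: zz_def)

lemma zz_pow: "k \<le> l \<Longrightarrow> zz t ^ k \<le> zz t ^ l"
  by (rule power_increasing) (auto simp: zz_def)

lemma num_le_zz: "c \<le> 2 ^ k \<Longrightarrow> c \<le> zz t ^ k"
  using power_mono[OF zz2, of k t] by linarith

lemma mr_zz: "L \<le> Suc t \<Longrightarrow> m * r + L + 2 \<le> zz t ^ 3"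
proof -
  assume L: "L \<le> Suc t"
  have "m * r + (m + r + t + 2) \<le> (m + r + t + 2) * (m + r + t + 2)"
  proof -
    have "m * r \<le> (m + r + t + 2) * (m + r + t + 1)" by (rule mult_le_mono) auto
    then have "m * r + (m + r + t + 2) \<le> (m + r + t + 2) * (m + r + t + 1) + (m + r + t + 2)" by linarith
    also have "\<dots> = (m + r + t + 2) * (m + r + t + 2)" by (simp add: algebra_simps)
    finally show ?thesis .
  qed
  also have "\<dots> \<le> zz t * zz t" by (rule mult_le_mono) (auto simp: zz_def)
  finally have "m * r + L + 2 \<le> zz t * zz t + zz t * zz t" using L zz2[of t] mult_le_mono[OF zz2[of t] zz2[of t]] by linarith
  also have "\<dots> = 2 * (zz t * zz t)" by simp
  also have "\<dots> \<le> zz t * (zz t * zz t)" using zz2 by (rule mult_right_mono) simp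
  finally show ?thesis by (simp add: power3_eq_cube)
qed

lemma work:
  assumes "v < m * r" "L \<le> Suc t"
  shows "local_work M (m * r) (gr (W s)) (mis_input (m * r)) L v \<le> zz t ^ (3 * K)"
proof -
  have "local_work M (m * r) (gr (W s)) (mis_input (m * r)) L v \<le> (m * r + L + 2) ^ K"
    by (rule K[OF simple_gr assms(1)])
  also have "\<dots> \<le> (zz t ^ 3) ^ K" by (rule power_mono[OF mr_zz[OF assms(2)]]) simp
  finally show ?thesis by (simp add: power_mult)
qed

lemma M_costs:
  assumes "v < m * r" "L \<le> Suc t"
  shows "cost (init_of M) [mis_input (m * r) v] \<le> zz t ^ (3 * K)"
    "cost (out_of M) [Mst s L v] \<le> zz t ^ (3 * K)"
    "cost (msg_of M) [Mst s L v] \<le> zz t ^ (3 * K)"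
    "cost (step_of M) [Mst s L v, received M (m * r) (gr (W s)) (Mst s L) v] \<le> zz t ^ (3 * K)"
  using work[OF assms, of s] unfolding local_work_def Let_def Mst_def by linarith+

definition cc :: nat where "cc = 3 * K + 6"

text \<open>A simulated round adds to the width at most the costs of a message and a step and the
  length of the message list. The growth is additive; a polynomial bound applied once per round
  would compound to an exponential one.\<close>

lemma wd_Mst:
  assumes "v < m * r" "L \<le> Suc t"
  shows "wd (Mst s L v) \<le> (L + 1) * (2 * zz t ^ (3 * K) + zz t ^ 3)"
  using assms
proof (induction L arbitrary: v)
  case 0
  have "wd (Mst s 0 v) \<le> wde [mis_input (m * r) v] + cost (init_of M) [mis_input (m * r) v]"
    unfolding Mst_def by (simp only: state.simps wd_ev)
  moreover have "wde [mis_input (m * r) v] \<le> zz t ^ 3"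
    using num_le_zz[of 2 3 t] by (simp add: mis_input_def wd_Lst)
  ultimately show ?case using M_costs(1)[OF 0] by simp
next
  case (Suc L)
  let ?B = "2 * zz t ^ (3 * K) + zz t ^ 3"
  have L: "L \<le> Suc t" using Suc.prems by simp
  have "wd (received M (m * r) (gr (W s)) (Mst s L) v) \<le> (L + 1) * ?B + zz t ^ (3 * K) + zz t ^ 3"
    unfolding received_def wd_Lst
  proof (intro conjI ballI)
    have "length (filter (gr (W s) v) [0..<m * r]) \<le> m * r"
      using length_filter_le[of "gr (W s) v" "[0..<m * r]"] by simp
    then show "length (map (\<lambda>w. ev (msg_of M) [Mst s L w]) (filter (gr (W s) v) [0..<m * r])) \<le> (L + 1) * ?B + zz t ^ (3 * K) + zz t ^ 3"
      using mr_zz[OF L] by simp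
    fix x assume "x \<in> set (map (\<lambda>w. ev (msg_of M) [Mst s L w]) (filter (gr (W s) v) [0..<m * r]))"
    then obtain w where w: "w < m * r" "x = ev (msg_of M) [Mst s L w]" by auto
    have "wd x \<le> wde [Mst s L w] + cost (msg_of M) [Mst s L w]" unfolding w(2) by (rule wd_ev)
    then show "wd x \<le> (L + 1) * ?B + zz t ^ (3 * K) + zz t ^ 3"
      using Suc.IH[OF w(1) L] M_costs(3)[OF w(1) L, of s] by simp
  qed
  moreover have "wd (Mst s L v) \<le> (L + 1) * ?B" by (rule Suc.IH[OF Suc.prems(1) L])
  ultimately have "wde [Mst s L v, received M (m * r) (gr (W s)) (Mst s L) v] \<le> (L + 1) * ?B + zz t ^ (3 * K) + zz t ^ 3"
    by simp
  moreover have "wd (Mst s (Suc L) v) \<le> wde [Mst s L v, received M (m * r) (gr (W s)) (Mst s L) v] +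
     cost (step_of M) [Mst s L v, received M (m * r) (gr (W s)) (Mst s L) v]"
    unfolding Mst_def by (simp only: state.simps wd_ev)
  ultimately have "wd (Mst s (Suc L) v) \<le> ((L + 1) * ?B + zz t ^ (3 * K) + zz t ^ 3) + zz t ^ (3 * K)"
    using M_costs(4)[OF Suc.prems(1) L, of s] by linarith
  also have "\<dots> = (Suc L + 1) * ?B" by (simp add: algebra_simps)
  finally show ?case .
qed

lemma double_zz: "zz t ^ k + zz t ^ k \<le> zz t ^ (k + 1)"
proof -
  have "2 * zz t ^ k \<le> zz t * zz t ^ k" by (rule mult_right_mono[OF zz2]) simp
  also have "\<dots> = zz t ^ (k + 1)" by simp
  finally show ?thesis unfolding mult_2 .
qed

lemma wd_Mst':
  assumes "v < m * r" "L \<le> t"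
  shows "wd (Mst s L v) \<le> zz t ^ cc"
proof -
  have "wd (Mst s L v) \<le> (L + 1) * (2 * zz t ^ (3 * K) + zz t ^ 3)" using assms by (intro wd_Mst) auto
  also have "\<dots> \<le> zz t * zz t ^ (3 * K + 4)"
  proof (rule mult_le_mono)
    show "L + 1 \<le> zz t" using assms(2) by (simp add: zz_def)
    have "2 * zz t ^ (3 * K) + zz t ^ 3 \<le> zz t ^ (3 * K + 1) + zz t ^ 3"
      using double_zz[of t "3 * K"] by linarith
    also have "\<dots> \<le> zz t ^ (3 * K + 3) + zz t ^ (3 * K + 3)"
      by (intro add_mono zz_pow) auto
    also have "\<dots> \<le> zz t ^ (3 * K + 4)" using double_zz[of t "3 * K + 3"] by (simp only: add.assoc one_plus_numeral numeral_plus_one semiring_norm)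
    finally show "2 * zz t ^ (3 * K) + zz t ^ 3 \<le> zz t ^ (3 * K + 4)" .
  qed
  also have "\<dots> = zz t ^ (3 * K + 5)" by (simp add: power_add power_numeral_reduce)
  also have "\<dots> \<le> zz t ^ cc" by (rule zz_pow) (simp add: cc_def)
  finally show ?thesis .
qed

lemma wd_Dv:
  assumes "v < m * r" "L \<le> t"
  shows "wd (Dv s L v) \<le> zz t ^ (cc + 1)"
  using assms
proof (induction L)
  case (Suc L)
  show ?case
  proof (cases "elems (Dv s L v) = []")
    case True
    have "wd (ev (out_of M) [Mst s (Suc L) v]) \<le> wd (Mst s (Suc L) v) + cost (out_of M) [Mst s (Suc L) v]"
      using wd_ev[of "out_of M" "[Mst s (Suc L) v]"] by simp
    also have "\<dots> \<le> zz t ^ cc + zz t ^ cc"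
      using wd_Mst'[OF Suc.prems, of s] M_costs(2)[OF Suc.prems(1), of "Suc L" t s] Suc.prems zz_pow[of "3 * K" cc t]
      by (simp add: cc_def)
    also have "\<dots> \<le> zz t ^ (cc + 1)" by (rule double_zz)
    finally show ?thesis using True by simp
  next
    case False
    then show ?thesis using Suc by simp
  qed
next
  case 0
  have "wd (ev (out_of M) [Mst s 0 v]) \<le> wd (Mst s 0 v) + cost (out_of M) [Mst s 0 v]"
    using wd_ev[of "out_of M" "[Mst s 0 v]"] by simp
  also have "\<dots> \<le> zz t ^ cc + zz t ^ cc"
    using wd_Mst'[OF 0, of s] M_costs(2)[OF 0(1), of 0 t s] zz_pow[of "3 * K" cc t]
    by (simp add: cc_def)
  also have "\<dots> \<le> zz t ^ (cc + 1)" by (rule double_zz)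
  finally show ?case by simp
qed

lemma aL_le: "aL (ab t i) s \<le> t"
  by (induction t arbitrary: i) (simp_all add: ainit_def astep_def le_SucI)

lemma ak_le: "ak (ab t i) \<le> t"
  by (induction t arbitrary: i) (simp_all add: ainit_def astep_def le_SucI)

lemma wd_afin: "wd (afin (ab t i)) \<le> 1"
proof (induction t)
  case 0
  show ?case by (auto simp: ainit_def wd_Lst)
next
  case (Suc t)
  then show ?case by (auto simp: astep_def adec_def wd_Lst split: option.split)
qed

lemma length_tl: "length (tl i) \<le> r"
  unfolding tl_def using length_filter_le[of "\<lambda>j. j \<in> acc I i" "[0..<r]"] by simp

lemma length_edl: "length (edl j) \<le> nv * nv"
proof -
  have "length (edl j) = (\<Sum>x\<leftarrow>[0..<nv]. length (filter (\<lambda>y. {x, y} \<in> tree I j) [Suc x..<nv]))"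
    by (simp add: edl_def length_concat o_def)
  also have "\<dots> \<le> (\<Sum>x\<leftarrow>[0..<nv]. nv)"
    by (rule sum_list_mono) (auto intro: order_trans[OF length_filter_le])
  also have "\<dots> = nv * nv" by (simp add: sum_list_triv)
  finally show ?thesis .
qed

lemma wd_tree_input: "wd (tree_input I j) \<le> zz t ^ 4"
proof -
  have "length (edl j) \<le> zz t * zz t"
    using length_edl[of j] mult_le_mono[of nv "zz t" nv "zz t"] by (simp add: zz_def)
  also have "\<dots> = zz t ^ 2" by (simp add: power2_eq_square)
  also have "\<dots> \<le> zz t ^ 4" by (rule zz_pow) simp
  finally show ?thesis
    using num_le_zz[of 2 4 t] by (auto simp: tree_input_edl wd_Lst encp_def)
qed

lemma wd_input: "wd (proc_input hmin \<epsilon> I i) \<le> zz t ^ 4"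
proof -
  have "length (tl i) \<le> zz t ^ 1" using length_tl[of i] by (simp add: zz_def)
  also have "\<dots> \<le> zz t ^ 4" by (rule zz_pow) simp
  finally have "wd (Lst (map (tree_input I) (tl i))) \<le> zz t ^ 4"
    using wd_tree_input by (auto simp: wd_Lst)
  then show ?thesis
    using num_le_zz[of 11 4 t] unfolding proc_input_def tl_def[symmetric] by (auto simp: wd_Lst[of "_ # _"])
qed

lemma wd_encst:
  assumes "i < m"
  shows "wd (encst i (ab t i)) \<le> zz t ^ (cc + 1)"
proof -
  have big: "zz t ^ 4 \<le> zz t ^ (cc + 1)" by (rule zz_pow) (simp add: cc_def)
  have one: "zz t \<le> zz t ^ (cc + 1)" using zz_pow[of 1 "cc + 1" t] by simp
  have five: "5 \<le> zz t ^ (cc + 1)" using num_le_zz[of 5 4 t] big by simp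
  have ent: "wd (ent i s (aL (ab t i) s) j) \<le> zz t ^ (cc + 1)" if "j \<in> acc I i" for s j
  proof -
    have v: "i * r + j < m * r" using vid_lt acc_lt assms that by blast
    have "zz t ^ cc \<le> zz t ^ (cc + 1)" by (rule zz_pow) simp
    then have "wd (Mst s (aL (ab t i) s) (i * r + j)) \<le> zz t ^ (cc + 1)" "wd (Mst s (aL (ab t i) s - 1) (i * r + j)) \<le> zz t ^ (cc + 1)"
      using wd_Mst'[OF v, of "aL (ab t i) s" t s] wd_Mst'[OF v, of "aL (ab t i) s - 1" t s] aL_le[of t i s] by linarith+
    then show ?thesis
      using wd_Dv[OF v aL_le, of s i s] wd_Dv[OF v aL_le[of t i s], of s] five unfolding ent_def wd_Lst by simp
  qed
  have rec: "wd (encrec i s (aL (ab t i) s)) \<le> zz t ^ (cc + 1)" for s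
  proof -
    have "length (tl i) \<le> zz t ^ (cc + 1)" using length_tl[of i] one by (simp add: zz_def)
    then have "wd (Lst (map (ent i s (aL (ab t i) s)) (tl i))) \<le> zz t ^ (cc + 1)"
      using ent set_tl[OF assms] by (auto simp: wd_Lst)
    then show ?thesis using five unfolding encrec_def by (simp add: wd_Lst[of "_ # _"])
  qed
  have "Suc (ak (ab t i)) \<le> zz t ^ (cc + 1)" using ak_le[of t i] one unfolding zz_def by linarith
  then have "wd (Lst (map (\<lambda>s. encrec i s (aL (ab t i) s)) (rev [0..<Suc (ak (ab t i))]))) \<le> zz t ^ (cc + 1)"
    using rec unfolding wd_Lst by (auto simp del: upt_Suc power_Suc)
  moreover have "wd (encrz x) \<le> zz t ^ (cc + 1)" for x
  proof -
    have "wd (encrz x) \<le> 2" by (auto simp: encrz_def wd_Lst split: option.split)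
    then show ?thesis using five by linarith
  qed
  moreover have "wd (encsel x) \<le> zz t ^ (cc + 1)" for x
  proof -
    have "wd (encsel x) \<le> 1" by (auto simp: encsel_def wd_Lst bv_def split: option.split)
    then show ?thesis using five by linarith
  qed
  moreover have "wd (afin (ab t i)) \<le> zz t ^ (cc + 1)" using wd_afin[of t i] five by linarith
  ultimately show ?thesis
    using wd_input[of i t] big five unfolding encst_def by (simp add: wd_Lst[of "_ # _"] del: upt_Suc)
qed

lemma wd_rcv: "wd (rcv (ab t) i) \<le> zz t ^ (cc + 1)"
proof -
  have "length (nbl i) \<le> m" unfolding nbl_def using length_filter_le[of "comm I i" "[0..<m]"] by simp
  also have "m \<le> zz t ^ 1" by (simp add: zz_def)
  also have "\<dots> \<le> zz t ^ (cc + 1)" by (rule zz_pow) simp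
  finally show ?thesis using wd_encst by (auto simp: wd_Lst set_nbl)
qed

text \<open>These predicates describe the environments that lead to calls of programs of
  \<open>M\<close>; each is tied to an actual run, where the cost of \<open>M\<close> is
  bounded.\<close>

definition "sc_step Z env \<longleftrightarrow> (\<exists>t i. Z = zz t \<and> i < m \<and> env = [encst i (ab t i), rcv (ab t) i])"
definition "sc_adv Z env \<longleftrightarrow> (\<exists>t i s. Z = zz t \<and> i < m \<and> s \<le> ak (ab t i) \<and>
  env = [encrec i s (aL (ab t i) s), encst i (ab t i), rcv (ab t) i])"
definition "sc_adv2 Z env \<longleftrightarrow> (\<exists>t i s L. Z = zz t \<and> i < m \<and> aadv (ab t) i s \<and> L = aL (ab t i) s \<and>
  env = [encrec i s L, encst i (ab t i), Lst (map (VI (ab t) s L) (VL i))])"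
definition "sc_ent Z env \<longleftrightarrow> (\<exists>t i s L j. Z = zz t \<and> i < m \<and> aadv (ab t) i s \<and> L = aL (ab t i) s \<and> j \<in> acc I i \<and>
  env = [ent i s L j, encst i (ab t i), Lst (map (VI (ab t) s L) (VL i))])"
definition "sc_out Z env \<longleftrightarrow> (\<exists>t s L v e. Z = zz t \<and> v < m * r \<and> L \<le> Suc t \<and> env = [e, Mst s L v])"
definition "sc_out0 Z env \<longleftrightarrow> (\<exists>t s v e x. Z = zz t \<and> v < m * r \<and> env = [e, x, Mst s 0 v])"
definition "sc_new Z env \<longleftrightarrow> (\<exists>t i. Z = zz t \<and> i < m \<and> env = [encst i (ab t i), Lst (map (VI (ab t) (ak (ab t i)) 0) (VL i))])"
definition "sc_newent Z env \<longleftrightarrow> (\<exists>t i j y vs. Z = zz t \<and> i < m \<and> j \<in> acc I i \<and> nthv y 0 = Num (real j) \<and>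
  env = [y, encst i (ab t i), vs])"
definition "sc_initm Z env \<longleftrightarrow> (\<exists>t i j. Z = zz t \<and> i < m \<and> j \<in> acc I i \<and> env = [proc_input hmin \<epsilon> I i, Num (real j)])"
definition "sc_init Z env \<longleftrightarrow> (\<exists>t i. Z = zz t \<and> i < m \<and> env = [proc_input hmin \<epsilon> I i])"
definition "sc_ent0 Z env \<longleftrightarrow> (\<exists>t i j. Z = zz t \<and> i < m \<and> j \<in> acc I i \<and> env = [tree_input I j, proc_input hmin \<epsilon> I i])"
end

section \<open>Subprograms that do not run \<open>M\<close>\<close>

lemma polyc_rec [intro]: "polyc p_rec"
  unfolding p_rec_def by (intro polycI)

lemma polyc_all [intro]: "polyc p_all"
  unfolding p_all_def by (intro polycI)

lemma polyc_item [intro]: "polyc p_item"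
  unfolding p_item_def by (intro polycI polyc_path)

lemma polyc_vs [intro]: "polyc p_vs"
  unfolding p_vs_def by (intro polycI polyc_item polyc_rec polyc_all)

lemma polyc_cond_adv [intro]: "polyc p_cond_adv"
  unfolding p_cond_adv_def by (intro polycI polyc_rec)

lemma polyc_nbrs [intro]: "polyc p_nbrs"
  unfolding p_nbrs_def by (intro polycI polyc_item polyc_adj)

lemma polyc_alldec [intro]: "polyc p_alldec"
  unfolding p_alldec_def by (intro polycI)

lemma polyc_cond_new [intro]: "polyc p_cond_new"
  unfolding p_cond_new_def by (intro polycI polyc_alldec polyc_rec)

lemma polyc_chosen [intro]: "polyc p_chosen"
  unfolding p_chosen_def by (intro polycI polyc_active)

lemma polyc_narrow: "polyc a \<Longrightarrow> polyc (p_narrow a)"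
  unfolding p_narrow_def by (intro polycI)

lemma polyc_upd [intro]: "polyc p_upd"
  unfolding p_upd_def p_coef_def by (intro polycI polyc_chosen polyc_conf polyc_narrow)

lemma polyc_newrais [intro]: "polyc p_newrais"
  unfolding p_newrais_def p_newrais2_def by (intro polycI polyc_chosen polyc_item)

lemma polyc_later [intro]: "polyc p_later"
  unfolding p_later_def by (intro polycI)

lemma polyc_comp [intro]: "polyc p_comp"
  unfolding p_comp_def by (intro polycI)

lemma polyc_rpath [intro]: "polyc p_rpath"
  unfolding p_rpath_def by (intro polycI polyc_item)

lemma polyc_nar: "polyc a \<Longrightarrow> polyc (p_nar a)"
  unfolding p_nar_def by (intro polycI)

lemma polyc_blk [intro]: "polyc p_blk"
  unfolding p_blk_def by (intro polycI polyc_later polyc_nar polyc_rpath)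

lemma polyc_sel [intro]: "polyc p_sel"
  unfolding p_sel_def p_val_def p_over_def p_ready_def
  by (intro polycI polyc_later polyc_comp polyc_rpath polyc_blk)

lemma polyc_fin [intro]: "polyc p_fin"
  unfolding p_fin_def p_dec_def p_sum_def id_apply by (intro polycI polyc_nar)

lemma polyc_vs0 [intro]: "polyc p_vs0"
  unfolding p_vs0_def by (intro polycI polyc_vs)

lemma pol_gen: "bd R \<Longrightarrow> polyc p \<Longrightarrow> pol R p"
  by (rule polyc_pol)

lemma pol_leaf:
  assumes "bd R" "list_all (pol R) as" "\<And>Z env. R Z env \<Longrightarrow> cost q (map (\<lambda>a. ev a env) as) \<le> Z ^ k"
  shows "pol R (Call q as)"
  using assms by (intro pol_Call) (auto simp: list_all_iff pl_def)

lemma ext_iff: "ext R l Z env' \<longleftrightarrow> (\<exists>env x. R Z env \<and> x \<in> set (elems (ev l env)) \<and> env' = x # env)"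
  by (simp add: ext_def)

section \<open>Bounds uniform over all problems\<close>

locale fam =
  fixes hmin :: real and M :: dist_alg and T :: "nat \<Rightarrow> nat" and \<epsilon> :: real and K :: nat
  assumes M: "mis_algorithm M T" and hmin: "0 < hmin" "hmin \<le> 1 / 2"
    and K: "simple_graph N adj \<Longrightarrow> v < N \<Longrightarrow> local_work M N adj (mis_input N) t v \<le> (N + t + 2) ^ K"
begin

lemma simkI: "valid_problem hmin I \<Longrightarrow> simk hmin I M T K"
  by unfold_locales (use M hmin K in auto)

text \<open>The union over all problems: the final polynomial is chosen before the problem, so one
  exponent must serve all of them.\<close>

definition FAM :: "(problem \<Rightarrow> nat \<Rightarrow> val list \<Rightarrow> bool) \<Rightarrow> nat \<Rightarrow> val list \<Rightarrow> bool" where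
  "FAM Q Z env \<longleftrightarrow> (\<exists>I. simk hmin I M T K \<and> Q I Z env)"

abbreviation "f_step \<equiv> FAM (\<lambda>I. simk.sc_step hmin I M \<epsilon>)"
abbreviation "f_adv \<equiv> FAM (\<lambda>I. simk.sc_adv hmin I M \<epsilon>)"
abbreviation "f_adv2 \<equiv> FAM (\<lambda>I. simk.sc_adv2 hmin I M \<epsilon>)"
abbreviation "f_ent \<equiv> FAM (\<lambda>I. simk.sc_ent hmin I M \<epsilon>)"
abbreviation "f_out \<equiv> FAM (\<lambda>I. simk.sc_out I M)"
abbreviation "f_out0 \<equiv> FAM (\<lambda>I. simk.sc_out0 I M)"
abbreviation "f_new \<equiv> FAM (\<lambda>I. simk.sc_new hmin I M \<epsilon>)"
abbreviation "f_newent \<equiv> FAM (\<lambda>I. simk.sc_newent hmin I M \<epsilon>)"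
abbreviation "f_initm \<equiv> FAM (\<lambda>I. simk.sc_initm hmin I \<epsilon>)"
abbreviation "f_init \<equiv> FAM (\<lambda>I. simk.sc_init hmin I \<epsilon>)"
abbreviation "f_ent0 \<equiv> FAM (\<lambda>I. simk.sc_ent0 hmin I \<epsilon>)"

lemma pol_ent2: "polS f_out (p_ent2 M)"
proof (rule polSI)
  fix R assume R: "bd R" "\<And>Z env. R Z env \<Longrightarrow> f_out Z env"
  have c: "pol (\<lambda>Z env. R Z env \<and> tr (ev (IsEmpty (It 4 (Var 0))) env)) (Call (out_of M) [Var 1])"
  proof (rule pol_leaf)
    show "bd (\<lambda>Z env. R Z env \<and> tr (ev (IsEmpty (It 4 (Var 0))) env))" using R(1) by (rule bd_sub) simp
    then show "list_all (pol (\<lambda>Z env. R Z env \<and> tr (ev (IsEmpty (It 4 (Var 0))) env))) [Var 1]"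
      by (intro pol_list pol_gen polycI)
    fix Z env assume "R Z env \<and> tr (ev (IsEmpty (It 4 (Var 0))) env)"
    then obtain I where I: "simk hmin I M T K" "simk.sc_out I M Z env" using R(2) unfolding FAM_def by blast
    interpret simk hmin I M T \<epsilon> K by (rule I(1))
    show "cost (out_of M) (map (\<lambda>a. ev a env) [Var 1]) \<le> Z ^ (3 * K)"
      using I(2) M_costs(2) unfolding sc_out_def by auto
  qed
  have b: "bd (\<lambda>Z env. R Z env \<and> \<not> tr (ev (IsEmpty (It 4 (Var 0))) env))" using R(1) by (rule bd_sub) simp
  show "pol R (p_ent2 M)"
    unfolding p_ent2_def
    by (intro pol_TUP' pol_list pol_Ite R(1) c) (intro pol_gen R(1) b polycI)+
qed

lemma pol_newst: "polS f_ent (p_newst M)"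
proof (rule polSI)
  fix R assume R: "bd R" "\<And>Z env. R Z env \<Longrightarrow> f_ent Z env"
  let ?l = "Call p_nbrs [Var 0, Var 1, Var 2]"
  have l: "pol R ?l" by (intro pol_gen R(1) polycI polyc_nbrs)
  have msg: "pol (ext R ?l) (Call (msg_of M) [It 6 (Var 0)])"
  proof (rule pol_leaf)
    show "bd (ext R ?l)" by (rule bd_ext[OF R(1) l])
    then show "list_all (pol (ext R ?l)) [It 6 (Var 0)]" by (intro pol_list pol_gen polycI)
    fix Z env assume "ext R ?l Z env"
    then obtain env' x where e: "R Z env'" "x \<in> set (elems (ev ?l env'))" "env = x # env'" unfolding ext_iff by blast
    then obtain I where I: "simk hmin I M T K" "simk.sc_ent hmin I M \<epsilon> Z env'" using R(2) unfolding FAM_def by blast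
    interpret simk hmin I M T \<epsilon> K by (rule I(1))
    obtain t i s L j where *: "Z = zz t" "i < m" "aadv (ab t) i s" "L = aL (ab t i) s" "j \<in> acc I i"
      "env' = [ent i s L j, encst i (ab t i), Lst (map (VI (ab t) s L) (VL i))]"
      using I(2) unfolding sc_ent_def by blast
    obtain q where q: "q \<in> set (VL i)" "x = VI (ab t) s L q"
      using e(2) ev_nbrs[OF *(2,5)] by (auto simp: *(6))
    have "L \<le> Suc t" using aL_le[of t i s] *(4) by simp
    then show "cost (msg_of M) (map (\<lambda>a. ev a env) [It 6 (Var 0)]) \<le> Z ^ (3 * K)"
      using VI_state[OF inv_ab *(2,3,4) q(1)] M_costs(3) by (simp add: e(3) q(2) *(1))
  qed
  show "pol R (p_newst M)"
    unfolding p_newst_def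
  proof (rule pol_leaf[OF R(1)])
    show "list_all (pol R) [It 2 (Var 0), MAP (Call (msg_of M) [It 6 (Var 0)]) ?l]"
      by (intro pol_list pol_MAP R(1) l msg) (intro pol_gen R(1) polycI)
    fix Z env assume "R Z env"
    then obtain I where I: "simk hmin I M T K" "simk.sc_ent hmin I M \<epsilon> Z env" using R(2) unfolding FAM_def by blast
    interpret simk hmin I M T \<epsilon> K by (rule I(1))
    obtain t i s L j where *: "Z = zz t" "i < m" "aadv (ab t) i s" "L = aL (ab t i) s" "j \<in> acc I i"
      "env = [ent i s L j, encst i (ab t i), Lst (map (VI (ab t) s L) (VL i))]"
      using I(2) unfolding sc_ent_def by blast
    have "i * r + j < m * r" using vid_lt acc_lt * by blast
    moreover have "L \<le> Suc t" using aL_le[of t i s] *(4) by simp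
    ultimately show "cost (step_of M) (map (\<lambda>a. ev a env) [It 2 (Var 0), MAP (Call (msg_of M) [It 6 (Var 0)]) ?l]) \<le> Z ^ (3 * K)"
      unfolding *(1,6) newst_args[OF inv_ab *(2,5,3,4)] by (rule M_costs(4))
  qed
qed

lemma pol_entadv: "polS f_ent (p_entadv M)"
proof (rule polSI)
  fix R assume R: "bd R" "\<And>Z env. R Z env \<Longrightarrow> f_ent Z env"
  have sh: "map (\<lambda>a. ev a env) [Var 0, Var 1, Var 2] = env" if h: "R Z env" for Z env
  proof -
    obtain I where I: "simk hmin I M T K" "simk.sc_ent hmin I M \<epsilon> Z env" using R(2)[OF h] unfolding FAM_def by blast
    interpret simk hmin I M T \<epsilon> K by (rule I(1))
    show ?thesis using I(2) unfolding sc_ent_def by auto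
  qed
  have new: "pol R (Call (p_newst M) [Var 0, Var 1, Var 2])"
    by (rule pol_CallS[OF R(1) _ pol_newst]) (intro pol_list pol_gen R(1) polycI, use sh R(2) in metis)
  show "pol R (p_entadv M)"
    unfolding p_entadv_def
  proof (rule pol_CallS[OF R(1) _ pol_ent2])
    show "list_all (pol R) [Var 0, Call (p_newst M) [Var 0, Var 1, Var 2]]"
      by (intro pol_list new) (intro pol_gen R(1) polycI)
    fix Z env assume RZ: "R Z env"
    then obtain I where I: "simk hmin I M T K" "simk.sc_ent hmin I M \<epsilon> Z env" using R(2) unfolding FAM_def by blast
    interpret simk hmin I M T \<epsilon> K by (rule I(1))
    obtain t i s L j where *: "Z = zz t" "i < m" "aadv (ab t) i s" "L = aL (ab t i) s" "j \<in> acc I i"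
      "env = [ent i s L j, encst i (ab t i), Lst (map (VI (ab t) s L) (VL i))]"
      using I(2) unfolding sc_ent_def by blast
    have "i * r + j < m * r" using vid_lt acc_lt * by blast
    moreover have "Suc L \<le> Suc t" using aL_le[of t i s] *(4) by simp
    moreover have eq: "map (\<lambda>a. ev a env) [Var 0, Call (p_newst M) [Var 0, Var 1, Var 2]] =
      [ent i s L j, Mst s (Suc L) (i * r + j)]"
      using ev_newst[OF inv_ab *(2,5,3,4)] by (simp add: *(6))
    ultimately have "sc_out Z (map (\<lambda>a. ev a env) [Var 0, Call (p_newst M) [Var 0, Var 1, Var 2]])"
      unfolding eq sc_out_def *(1) by blast
    then show "f_out Z (map (\<lambda>a. ev a env) [Var 0, Call (p_newst M) [Var 0, Var 1, Var 2]])"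
      unfolding FAM_def using I(1) by blast
  qed
qed

lemma pol_adv2: "polS f_adv2 (p_adv2 M)"
proof (rule polSI)
  fix R assume R: "bd R" "\<And>Z env. R Z env \<Longrightarrow> f_adv2 Z env"
  let ?l = "It 2 (Var 0)"
  have l: "pol R ?l" by (intro pol_gen R(1) polycI)
  have e: "pol (ext R ?l) (Call (p_entadv M) [Var 0, Var 2, Var 3])"
  proof (rule pol_CallS[OF bd_ext[OF R(1) l] _ pol_entadv])
    show "list_all (pol (ext R ?l)) [Var 0, Var 2, Var 3]" by (intro pol_list pol_gen bd_ext[OF R(1) l] polycI)
    fix Z env assume "ext R ?l Z env"
    then obtain env' x where e: "R Z env'" "x \<in> set (elems (ev ?l env'))" "env = x # env'" unfolding ext_iff by blast
    then obtain I where I: "simk hmin I M T K" "simk.sc_adv2 hmin I M \<epsilon> Z env'" using R(2) unfolding FAM_def by blast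
    interpret simk hmin I M T \<epsilon> K by (rule I(1))
    obtain t i s L where *: "Z = zz t" "i < m" "aadv (ab t) i s" "L = aL (ab t i) s"
      "env' = [encrec i s L, encst i (ab t i), Lst (map (VI (ab t) s L) (VL i))]"
      using I(2) unfolding sc_adv2_def by blast
    obtain j where "j \<in> acc I i" "x = ent i s L j" using e(2) set_tl[OF *(2)] by (auto simp: *(5))
    then have "sc_ent Z (map (\<lambda>a. ev a env) [Var 0, Var 2, Var 3])"
      unfolding sc_ent_def using * by (auto simp: e(3))
    then show "f_ent Z (map (\<lambda>a. ev a env) [Var 0, Var 2, Var 3])" unfolding FAM_def using I(1) by blast
  qed
  show "pol R (p_adv2 M)"
    unfolding p_adv2_def by (intro pol_TUP' pol_list pol_MAP R(1) l e) (intro pol_gen R(1) polycI)+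
qed

lemma pol_adv: "polS f_adv (p_adv M)"
proof (rule polSI)
  fix R assume R: "bd R" "\<And>Z env. R Z env \<Longrightarrow> f_adv Z env"
  let ?c = "Call p_cond_adv [Var 0, Var 1, Var 2]" and ?v = "Call p_vs [Var 1, Var 2, It 0 (Var 0), It 1 (Var 0)]"
  let ?R = "\<lambda>Z env. R Z env \<and> tr (ev ?c env)"
  have b: "bd ?R" "bd (\<lambda>Z env. R Z env \<and> \<not> tr (ev ?c env))" using R(1) by (rule bd_sub, simp)+
  have adv2: "pol ?R (Call (p_adv2 M) [Var 0, Var 1, ?v])"
  proof (rule pol_CallS[OF b(1) _ pol_adv2])
    show "list_all (pol ?R) [Var 0, Var 1, ?v]" by (intro pol_list pol_gen b polycI polyc_vs)
    fix Z env assume e: "?R Z env"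
    then obtain I where I: "simk hmin I M T K" "simk.sc_adv hmin I M \<epsilon> Z env" using R(2) unfolding FAM_def by blast
    interpret simk hmin I M T \<epsilon> K by (rule I(1))
    obtain t i s where *: "Z = zz t" "i < m" "s \<le> ak (ab t i)"
      "env = [encrec i s (aL (ab t i) s), encst i (ab t i), rcv (ab t) i]"
      using I(2) unfolding sc_adv_def by blast
    have adv: "aadv (ab t) i s"
      using e *(3) by (simp add: *(4) ev_cond_adv aadv_def)
    then have "\<And>i'. i' \<in> set (nb i) \<Longrightarrow> s \<le> ak (ab t i')" using set_nb_nbl[OF *(2)] by (auto simp: aadv_def)
    then have eq: "map (\<lambda>a. ev a env) [Var 0, Var 1, ?v] =
      [encrec i s (aL (ab t i) s), encst i (ab t i), Lst (map (VI (ab t) s (aL (ab t i) s)) (VL i))]"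
      using ev_vs[OF *(2), of s "ab t" "aL (ab t i) s"] by (simp add: *(4))
    then have "sc_adv2 Z (map (\<lambda>a. ev a env) [Var 0, Var 1, ?v])"
      unfolding eq sc_adv2_def *(1) using *(2) adv by blast
    then show "f_adv2 Z (map (\<lambda>a. ev a env) [Var 0, Var 1, ?v])" unfolding FAM_def using I(1) by blast
  qed
  show "pol R (p_adv M)"
    unfolding p_adv_def
    by (intro pol_Ite R(1) adv2) (intro pol_gen R(1) b polycI polyc_cond_adv)+
qed

lemma pol_recs: "polS f_step (p_recs M)"
proof (rule polSI)
  fix R assume R: "bd R" "\<And>Z env. R Z env \<Longrightarrow> f_step Z env"
  let ?l = "It 1 (Var 0)"
  have l: "pol R ?l" by (intro pol_gen R(1) polycI)
  have "pol (ext R ?l) (Call (p_adv M) [Var 0, Var 1, Var 2])"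
  proof (rule pol_CallS[OF bd_ext[OF R(1) l] _ pol_adv])
    show "list_all (pol (ext R ?l)) [Var 0, Var 1, Var 2]" by (intro pol_list pol_gen bd_ext[OF R(1) l] polycI)
    fix Z env assume "ext R ?l Z env"
    then obtain env' x where e: "R Z env'" "x \<in> set (elems (ev ?l env'))" "env = x # env'" unfolding ext_iff by blast
    then obtain I where I: "simk hmin I M T K" "simk.sc_step hmin I M \<epsilon> Z env'" using R(2) unfolding FAM_def by blast
    interpret simk hmin I M T \<epsilon> K by (rule I(1))
    obtain t i where *: "Z = zz t" "i < m" "env' = [encst i (ab t i), rcv (ab t) i]"
      using I(2) unfolding sc_step_def by blast
    obtain s where s: "s \<le> ak (ab t i)" "x = encrec i s (aL (ab t i) s)"
      using e(2) by (auto simp: *(3) less_Suc_eq_le simp del: upt_Suc)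
    have "sc_adv Z (map (\<lambda>a. ev a env) [Var 0, Var 1, Var 2])"
      unfolding sc_adv_def using * s by (auto simp: e(3))
    then show "f_adv Z (map (\<lambda>a. ev a env) [Var 0, Var 1, Var 2])" unfolding FAM_def using I(1) by blast
  qed
  then show "pol R (p_recs M)"
    unfolding p_recs_def by (rule pol_MAP[OF R(1) l])
qed

lemma pol_newent2: "polS f_out0 (p_newent2 M)"
proof (rule polSI)
  fix R assume R: "bd R" "\<And>Z env. R Z env \<Longrightarrow> f_out0 Z env"
  have out: "pol R (Call (out_of M) [Var 2])"
  proof (rule pol_leaf[OF R(1)])
    show "list_all (pol R) [Var 2]" by (intro pol_list pol_gen R(1) polycI)
    fix Z env assume "R Z env"
    then obtain I where I: "simk hmin I M T K" "simk.sc_out0 I M Z env" using R(2) unfolding FAM_def by blast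
    interpret simk hmin I M T \<epsilon> K by (rule I(1))
    show "cost (out_of M) (map (\<lambda>a. ev a env) [Var 2]) \<le> Z ^ (3 * K)"
      using I(2) M_costs(2)[where L = 0] unfolding sc_out0_def by auto
  qed
  show "pol R (p_newent2 M)"
    unfolding p_newent2_def by (intro pol_TUP' pol_list R(1) out) (intro pol_gen R(1) polycI)+
qed

lemma pol_init_mis: "polS f_initm (p_init_mis M)"
proof (rule polSI)
  fix R assume R: "bd R" "\<And>Z env. R Z env \<Longrightarrow> f_initm Z env"
  show "pol R (p_init_mis M)"
    unfolding p_init_mis_def
  proof (rule pol_leaf[OF R(1)])
    show "list_all (pol R) [TUP [Mul (It 2 (Var 0)) (It 1 (Var 0)), Add (Mul (It 5 (Var 0)) (It 1 (Var 0))) (Var 1)]]"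
      by (intro pol_list pol_gen R(1) polycI)
    fix Z env assume "R Z env"
    then obtain I where I: "simk hmin I M T K" "simk.sc_initm hmin I \<epsilon> Z env" using R(2) unfolding FAM_def by blast
    interpret simk hmin I M T \<epsilon> K by (rule I(1))
    obtain t i j where *: "Z = zz t" "i < m" "j \<in> acc I i" "env = [proc_input hmin \<epsilon> I i, Num (real j)]"
      using I(2) unfolding sc_initm_def by blast
    have "i * r + j < m * r" using vid_lt acc_lt * by blast
    then show "cost (init_of M) (map (\<lambda>a. ev a env) [TUP [Mul (It 2 (Var 0)) (It 1 (Var 0)), Add (Mul (It 5 (Var 0)) (It 1 (Var 0))) (Var 1)]])
       \<le> Z ^ (3 * K)"
      using M_costs(1)[of "i * r + j" 0 t] by (simp add: *(1,4) mis_input_def)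
  qed
qed

lemma pol_newent: "polS f_newent (p_newent M)"
proof (rule polSI)
  fix R assume R: "bd R" "\<And>Z env. R Z env \<Longrightarrow> f_newent Z env"
  let ?u = "Call p_upd [Call p_item [Var 1, Var 0, Empty], Var 2]" and ?i = "Call (p_init_mis M) [It 0 (Var 1), It 0 (Var 0)]"
  have i: "pol R ?i"
  proof (rule pol_CallS[OF R(1) _ pol_init_mis])
    show "list_all (pol R) [It 0 (Var 1), It 0 (Var 0)]" by (intro pol_list pol_gen R(1) polycI)
    fix Z env assume "R Z env"
    then obtain I where I: "simk hmin I M T K" "simk.sc_newent hmin I M \<epsilon> Z env" using R(2) unfolding FAM_def by blast
    interpret simk hmin I M T \<epsilon> K by (rule I(1))
    have "sc_initm Z (map (\<lambda>a. ev a env) [It 0 (Var 1), It 0 (Var 0)])"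
      using I(2) unfolding sc_newent_def sc_initm_def by auto
    then show "f_initm Z (map (\<lambda>a. ev a env) [It 0 (Var 1), It 0 (Var 0)])" unfolding FAM_def using I(1) by blast
  qed
  show "pol R (p_newent M)"
    unfolding p_newent_def
  proof (rule pol_CallS[OF R(1) _ pol_newent2])
    show "list_all (pol R) [Var 0, ?u, ?i]"
      by (intro pol_list i) (intro pol_gen R(1) polycI polyc_upd polyc_item)+
    fix Z env assume "R Z env"
    then obtain I where I: "simk hmin I M T K" "simk.sc_newent hmin I M \<epsilon> Z env" using R(2) unfolding FAM_def by blast
    interpret simk hmin I M T \<epsilon> K by (rule I(1))
    obtain t i j y vs where *: "Z = zz t" "i < m" "j \<in> acc I i" "nthv y 0 = Num (real j)" "env = [y, encst i (ab t i), vs]"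
      using I(2) unfolding sc_newent_def by blast
    have v: "i * r + j < m * r" using vid_lt acc_lt * by blast
    have "ev ?i env = Mst 0 0 (i * r + j)" using ev_init_mis[of i j 0] * by simp
    then have eq: "map (\<lambda>a. ev a env) [Var 0, ?u, ?i] = [ev (Var 0) env, ev ?u env, Mst 0 0 (i * r + j)]"
      by (simp del: ev_Call)
    then have "sc_out0 Z (map (\<lambda>a. ev a env) [Var 0, ?u, ?i])"
      unfolding eq sc_out0_def *(1) using v by blast
    then show "f_out0 Z (map (\<lambda>a. ev a env) [Var 0, ?u, ?i])" unfolding FAM_def using I(1) by blast
  qed
qed

lemma pol_newrec: "polS f_new (p_newrec M)"
proof (rule polSI)
  fix R assume R: "bd R" "\<And>Z env. R Z env \<Longrightarrow> f_new Z env"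
  let ?l = "It 2 (First (It 1 (Var 0)))"
  have l: "pol R ?l" by (intro pol_gen R(1) polycI)
  have e: "pol (ext R ?l) (Call (p_newent M) [Var 0, Var 1, Var 2])"
  proof (rule pol_CallS[OF bd_ext[OF R(1) l] _ pol_newent])
    show "list_all (pol (ext R ?l)) [Var 0, Var 1, Var 2]" by (intro pol_list pol_gen bd_ext[OF R(1) l] polycI)
    fix Z env assume "ext R ?l Z env"
    then obtain env' x where e: "R Z env'" "x \<in> set (elems (ev ?l env'))" "env = x # env'" unfolding ext_iff by blast
    then obtain I where I: "simk hmin I M T K" "simk.sc_new hmin I M \<epsilon> Z env'" using R(2) unfolding FAM_def by blast
    interpret simk hmin I M T \<epsilon> K by (rule I(1))
    obtain t i where *: "Z = zz t" "i < m" "env' = [encst i (ab t i), Lst (map (VI (ab t) (ak (ab t i)) 0) (VL i))]"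
      using I(2) unfolding sc_new_def by blast
    obtain j where j: "j \<in> acc I i" "x = ent i (ak (ab t i)) (aL (ab t i) (ak (ab t i))) j"
      using e(2) set_tl[OF *(2)] by (auto simp: *(3) first_rec simp del: upt_Suc)
    have "sc_newent Z (map (\<lambda>a. ev a env) [Var 0, Var 1, Var 2])"
      unfolding sc_newent_def using * j by (auto simp: e(3))
    then show "f_newent Z (map (\<lambda>a. ev a env) [Var 0, Var 1, Var 2])" unfolding FAM_def using I(1) by blast
  qed
  show "pol R (p_newrec M)"
    unfolding p_newrec_def by (intro pol_TUP' pol_list pol_MAP R(1) l e) (intro pol_gen R(1) polycI)+
qed

lemma pol_step: "polS f_step (p_step M)"
proof (rule polSI)
  fix R assume R: "bd R" "\<And>Z env. R Z env \<Longrightarrow> f_step Z env"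
  let ?R = "\<lambda>Z env. R Z env \<and> tr (ev p_cond_new env)" and ?R' = "\<lambda>Z env. R Z env \<and> \<not> tr (ev p_cond_new env)"
  have b: "bd ?R" "bd ?R'" using R(1) by (rule bd_sub, simp)+
  have recs: "pol ?R (p_recs M)" "pol ?R' (p_recs M)"
    by (rule polSD[OF pol_recs b(1)], use R(2) in blast) (rule polSD[OF pol_recs b(2)], use R(2) in blast)
  have newrec: "pol ?R (Call (p_newrec M) [Var 0, p_vs0])"
  proof (rule pol_CallS[OF b(1) _ pol_newrec])
    show "list_all (pol ?R) [Var 0, p_vs0]" by (intro pol_list pol_gen b polycI polyc_vs0)
    fix Z env assume e: "?R Z env"
    then obtain I where I: "simk hmin I M T K" "simk.sc_step hmin I M \<epsilon> Z env" using R(2) unfolding FAM_def by blast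
    interpret simk hmin I M T \<epsilon> K by (rule I(1))
    obtain t i where *: "Z = zz t" "i < m" "env = [encst i (ab t i), rcv (ab t) i]"
      using I(2) unfolding sc_step_def by blast
    have "anew (ab t) i" using e ev_cond_new[OF *(2)] by (simp add: *(3))
    then have "sc_new Z (map (\<lambda>a. ev a env) [Var 0, p_vs0])"
      unfolding sc_new_def using * ev_vs0[OF _ *(2)] by auto
    then show "f_new Z (map (\<lambda>a. ev a env) [Var 0, p_vs0])" unfolding FAM_def using I(1) by blast
  qed
  have c: "pol R (Ite p_cond_new (Push (Call (p_newrec M) [Var 0, p_vs0]) (p_recs M)) (p_recs M))"
    by (intro pol_Ite R(1) pol_binary(6) b recs newrec) (intro pol_gen R(1) polyc_cond_new)
  show "pol R (p_step M)"
    unfolding p_step_def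
    by (intro pol_TUP' pol_list R(1) c)
      (intro pol_gen R(1) polycI polyc_cond_new polyc_newrais polyc_vs0 polyc_sel polyc_fin)+
qed

lemma pol_ent0: "polS f_ent0 (p_ent0 M)"
proof (rule polSI)
  fix R assume R: "bd R" "\<And>Z env. R Z env \<Longrightarrow> f_ent0 Z env"
  let ?i = "Call (p_init_mis M) [Var 1, It 0 (Var 0)]"
  have i: "pol R ?i"
  proof (rule pol_CallS[OF R(1) _ pol_init_mis])
    show "list_all (pol R) [Var 1, It 0 (Var 0)]" by (intro pol_list pol_gen R(1) polycI)
    fix Z env assume "R Z env"
    then obtain I where I: "simk hmin I M T K" "simk.sc_ent0 hmin I \<epsilon> Z env" using R(2) unfolding FAM_def by blast
    interpret simk hmin I M T \<epsilon> K by (rule I(1))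
    have "sc_initm Z (map (\<lambda>a. ev a env) [Var 1, It 0 (Var 0)])"
      using I(2) unfolding sc_ent0_def sc_initm_def by (auto simp: tree_input_edl)
    then show "f_initm Z (map (\<lambda>a. ev a env) [Var 1, It 0 (Var 0)])" unfolding FAM_def using I(1) by blast
  qed
  show "pol R (p_ent0 M)"
    unfolding p_ent0_def
  proof (rule pol_CallS[OF R(1) _ pol_newent2])
    show "list_all (pol R) [Var 0, It 8 (Var 1), ?i]"
      by (intro pol_list i) (intro pol_gen R(1) polycI)+
    fix Z env assume "R Z env"
    then obtain I where I: "simk hmin I M T K" "simk.sc_ent0 hmin I \<epsilon> Z env" using R(2) unfolding FAM_def by blast
    interpret simk hmin I M T \<epsilon> K by (rule I(1))
    obtain t i j where *: "Z = zz t" "i < m" "j \<in> acc I i" "env = [tree_input I j, proc_input hmin \<epsilon> I i]"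
      using I(2) unfolding sc_ent0_def by blast
    have v: "i * r + j < m * r" using vid_lt acc_lt * by blast
    have "ev ?i env = Mst 0 0 (i * r + j)" using ev_init_mis[of i j 0] * by (simp add: tree_input_edl)
    then have eq: "map (\<lambda>a. ev a env) [Var 0, It 8 (Var 1), ?i] = [ev (Var 0) env, ev (It 8 (Var 1)) env, Mst 0 0 (i * r + j)]"
      by (simp del: ev_Call)
    then have "sc_out0 Z (map (\<lambda>a. ev a env) [Var 0, It 8 (Var 1), ?i])"
      unfolding eq sc_out0_def *(1) using v by blast
    then show "f_out0 Z (map (\<lambda>a. ev a env) [Var 0, It 8 (Var 1), ?i])" unfolding FAM_def using I(1) by blast
  qed
qed

lemma pol_init: "polS f_init (p_init M)"
proof (rule polSI)
  fix R assume R: "bd R" "\<And>Z env. R Z env \<Longrightarrow> f_init Z env"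
  let ?l = "It 10 (Var 0)"
  have l: "pol R ?l" by (intro pol_gen R(1) polycI)
  have e: "pol (ext R ?l) (Call (p_ent0 M) [Var 0, Var 1])"
  proof (rule pol_CallS[OF bd_ext[OF R(1) l] _ pol_ent0])
    show "list_all (pol (ext R ?l)) [Var 0, Var 1]" by (intro pol_list pol_gen bd_ext[OF R(1) l] polycI)
    fix Z env assume "ext R ?l Z env"
    then obtain env' x where e: "R Z env'" "x \<in> set (elems (ev ?l env'))" "env = x # env'" unfolding ext_iff by blast
    then obtain I where I: "simk hmin I M T K" "simk.sc_init hmin I \<epsilon> Z env'" using R(2) unfolding FAM_def by blast
    interpret simk hmin I M T \<epsilon> K by (rule I(1))
    obtain t i where *: "Z = zz t" "i < m" "env' = [proc_input hmin \<epsilon> I i]"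
      using I(2) unfolding sc_init_def by blast
    obtain j where j: "j \<in> acc I i" "x = tree_input I j"
      using e(2) set_tl[OF *(2)] by (auto simp: *(3))
    have "sc_ent0 Z (map (\<lambda>a. ev a env) [Var 0, Var 1])"
      unfolding sc_ent0_def using * j by (auto simp: e(3))
    then show "f_ent0 Z (map (\<lambda>a. ev a env) [Var 0, Var 1])" unfolding FAM_def using I(1) by blast
  qed
  show "pol R (p_init M)"
    unfolding p_init_def by (intro pol_TUP' pol_list pol_MAP R(1) l e) (intro pol_gen R(1) polycI)+
qed

lemma bd_step: "bd f_step"
proof -
  have "2 \<le> Z \<and> wde env \<le> Z ^ (simk.cc K + 1)" if h: "f_step Z env" for Z env
  proof -
    obtain I where I: "simk hmin I M T K" "simk.sc_step hmin I M \<epsilon> Z env" using h unfolding FAM_def by blast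
    interpret simk hmin I M T \<epsilon> K by (rule I(1))
    show ?thesis using I(2) wd_encst wd_rcv zz2 unfolding sc_step_def by fastforce
  qed
  then show ?thesis unfolding bd_def pl_def by blast
qed

lemma bd_init: "bd f_init"
proof -
  have "2 \<le> Z \<and> wde env \<le> Z ^ 4" if h: "f_init Z env" for Z env
  proof -
    obtain I where I: "simk hmin I M T K" "simk.sc_init hmin I \<epsilon> Z env" using h unfolding FAM_def by blast
    interpret simk hmin I M T \<epsilon> K by (rule I(1))
    show ?thesis using I(2) wd_input zz2 unfolding sc_init_def by fastforce
  qed
  then show ?thesis unfolding bd_def pl_def by blast
qed

theorem local_work_alg:
  "\<exists>k. \<forall>I t i. valid_problem hmin I \<longrightarrow> i < n_procs I \<longrightarrow>
     local_work (alg M) (n_procs I) (comm I) (proc_input hmin \<epsilon> I) t i \<le> (n_vertices I + n_procs I + n_trees I + t + 2) ^ k"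
proof -
  obtain k1 where k1: "\<And>Z env. f_step Z env \<Longrightarrow> cost (p_step M) env \<le> Z ^ k1"
    using polSD[OF pol_step bd_step] unfolding pol_def pl_def by blast
  obtain k2 where k2: "\<And>Z env. f_init Z env \<Longrightarrow> cost (p_init M) env \<le> Z ^ k2"
    using polSD[OF pol_init bd_init] unfolding pol_def pl_def by blast
  have "local_work (alg M) (n_procs I) (comm I) (proc_input hmin \<epsilon> I) t i
      \<le> (n_vertices I + n_procs I + n_trees I + t + 2) ^ (k1 + k2 + 5)" if h: "valid_problem hmin I" "i < n_procs I" for I t i
  proof -
    interpret simk hmin I M T \<epsilon> K by (rule simkI[OF h(1)])
    have rc: "received (alg M) m (comm I) (state (alg M) m (comm I) (proc_input hmin \<epsilon> I) t) i = rcv (ab t) i"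
      using state_ab by (simp add: received_def alg_def nbl_def)
    have "sc_step (zz t) [encst i (ab t i), rcv (ab t) i]" "sc_init (zz t) [proc_input hmin \<epsilon> I i]"
      using h(2) unfolding sc_step_def sc_init_def by blast+
    then have "f_step (zz t) [encst i (ab t i), rcv (ab t) i]" "f_init (zz t) [proc_input hmin \<epsilon> I i]"
      unfolding FAM_def using simkI[OF h(1)] by blast+
    then have c: "cost (p_step M) [encst i (ab t i), rcv (ab t) i] \<le> zz t ^ k1" "cost (p_init M) [proc_input hmin \<epsilon> I i] \<le> zz t ^ k2"
      using k1 k2 by blast+
    have io: "cost (It 4 (Var 0)) env = 6" for env
      by (simp add: It_def numeral_eq_Suc)
    have "local_work (alg M) m (comm I) (proc_input hmin \<epsilon> I) t i =
      cost (p_init M) [proc_input hmin \<epsilon> I i] + 6 + 1 + cost (p_step M) [encst i (ab t i), rcv (ab t) i]"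
      unfolding local_work_def Let_def rc state_ab[OF h(2)] by (simp add: alg_def io)
    \<comment> \<open>The constant 7 is the cost 6 of the output program plus the cost 1 of the
      message program.\<close>
    also have "\<dots> \<le> zz t ^ k2 + zz t ^ 3 + zz t ^ k1" using c num_le_zz[of 7 3 t] by simp
    also have "\<dots> \<le> zz t ^ (k1 + k2 + 3) + zz t ^ (k1 + k2 + 3) + zz t ^ (k1 + k2 + 3)"
      by (intro add_mono zz_pow) auto
    also have "\<dots> \<le> zz t ^ 2 * zz t ^ (k1 + k2 + 3)"
    proof -
      have "3 * x \<le> zz t ^ 2 * x" for x using num_le_zz[of 3 2 t] by (intro mult_right_mono) auto
      from this[of "zz t ^ (k1 + k2 + 3)"] show ?thesis by linarith
    qed
    also have "\<dots> = zz t ^ (k1 + k2 + 5)" by (simp add: power_add[symmetric] add.commute)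
    finally show ?thesis by (simp add: zz_def)
  qed
  then show ?thesis by blast
qed

end

text \<open>A strict power of two above \<open>x\<close> has exponent at most
  \<open>log 2 x + 1\<close>; since \<open>lg\<close> is at least 1, this is within a factor
  2.\<close>

lemma lg_exponent:
  assumes "1 \<le> x"
  shows "\<exists>k. x < 2 ^ k \<and> 1 \<le> k \<and> real k \<le> 2 * lg x"
proof -
  have l: "0 \<le> log 2 x" using assms by simp
  define k where "k = nat \<lfloor>log 2 x\<rfloor> + 1"
  have k: "log 2 x < real k" "real k \<le> log 2 x + 1" using l unfolding k_def by linarith+
  have "x < 2 powr real k" using k(1) assms by (simp add: log_less_iff)
  then have "x < 2 ^ k" by (simp add: powr_realpow)
  moreover have "real k \<le> 2 * lg x" using k(2) l unfolding lg_def by linarith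
  ultimately show ?thesis using k_def by (metis le_add2)
qed

section \<open>Constants of the ratio and of the round bound\<close>

context run
begin

lemma total_profit_nonneg: "X \<subseteq> demand_instances I \<Longrightarrow> 0 \<le> total_profit I X"
  unfolding total_profit_def using valid unfolding valid_problem_def demand_instances_def
  by (intro sum_nonneg) (force intro: less_imp_le)

lemma opt_profit_le:
  assumes "\<And>X. feasible I X \<Longrightarrow> total_profit I X \<le> b"
  shows "opt_profit I \<le> b"
proof -
  have "finite {X. feasible I X}"
    by (rule finite_subset[of _ "Pow (demand_instances I)"]) (auto simp: feasible_def finite_instances)
  moreover have "feasible I {}" by (simp add: feasible_def)
  ultimately show ?thesis unfolding opt_profit_def using assms by (subst Max_le_iff) auto
qed

lemma ratio:
  assumes "0 < \<epsilon>" "feasible I S" "\<And>X. feasible I X \<Longrightarrow> total_profit I X \<le> 68 * total_profit I S"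
  shows "opt_profit I / (80 + \<epsilon>) \<le> total_profit I S"
proof -
  have n: "0 \<le> total_profit I S" using assms(2) total_profit_nonneg unfolding feasible_def by blast
  have "opt_profit I \<le> 68 * total_profit I S" using assms(3) by (rule opt_profit_le)
  also have "\<dots> \<le> (80 + \<epsilon>) * total_profit I S" using n assms(1) by (intro mult_right_mono) auto
  finally show ?thesis using assms(1) by (simp add: divide_le_eq mult.commute)
qed

text \<open>\<open>k\<close> counts halvings of a tree, \<open>q\<close> profit classes, and
  \<open>K\<close> supersteps for each class; rounding up costs each of them a factor 2.\<close>

lemma rounds_exist:
  "\<exists>k q K. 1 / hmin \<le> real K \<and> nv < 2 ^ k \<and> (\<forall>i<m. p_max I < 2 ^ q * pr i) \<and> 1 \<le> k \<and> 1 \<le> q \<and> 1 \<le> K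
    \<and> real k \<le> 2 * lg (real nv) \<and> real q \<le> 2 * lg (p_max I / p_min I) \<and> real K \<le> 2 / hmin"
proof -
  have m: "0 < m" using valid unfolding valid_problem_def by blast
  have nv: "1 \<le> real nv" using valid m unfolding valid_problem_def by fastforce
  have ne: "finite (pr ` {..<m})" "pr ` {..<m} \<noteq> {}" using m by auto
  have pmin: "p_min I \<in> pr ` {..<m}" unfolding p_min_def using ne by (rule Min_in)
  then have pos: "0 < p_min I" using valid unfolding valid_problem_def by auto
  have "p_min I \<le> p_max I" unfolding p_max_def using ne(1) pmin by (rule Max_ge)
  then have "1 \<le> p_max I / p_min I" using pos by simp
  from lg_exponent[OF this] obtain q where q: "p_max I / p_min I < 2 ^ q" "1 \<le> q" "real q \<le> 2 * lg (p_max I / p_min I)"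
    by blast
  from lg_exponent[OF nv] obtain k where k: "real nv < 2 ^ k" "1 \<le> k" "real k \<le> 2 * lg (real nv)" by blast
  have "p_max I < 2 ^ q * pr i" if "i < m" for i
  proof -
    have "p_min I \<le> pr i" unfolding p_min_def using ne(1) that by (intro Min_le) auto
    then have "2 ^ q * p_min I \<le> 2 ^ q * pr i" by simp
    moreover have "p_max I < 2 ^ q * p_min I" using q(1) pos by (simp add: divide_less_eq)
    ultimately show ?thesis by linarith
  qed
  moreover have "nv < 2 ^ k" using k(1) by (metis of_nat_less_iff of_nat_numeral of_nat_power)
  moreover define K where "K = nat \<lceil>1 / hmin\<rceil>"
  moreover have "1 \<le> 1 / hmin" using hmin by simp
  then have "1 / hmin \<le> real K" "1 \<le> K" "real K \<le> 1 / hmin + 1 / hmin" unfolding K_def by linarith+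
  ultimately show ?thesis using k q by (intro exI[of _ k] exI[of _ q] exI[of _ K]) auto
qed

end

context sim
begin

text \<open>The constant is 64 = 4 * 2 * 8. The rounds are at most \<open>4 * (S * t)\<close>, as
  \<open>S \<ge> 2\<close> and \<open>t \<ge> 1\<close>; the two layers per halving give the 2 in
  \<open>S\<close>, and rounding \<open>k\<close>, \<open>q\<close> and \<open>K\<close> gives the
  8.\<close>

lemma round_bound:
  assumes N: "\<not> m * r \<le> 1"
  shows "\<exists>S. all_sat S \<and> real (S * (T (m * r) + 1) + S + 2)
    \<le> 64 * (real (T (m * r)) / hmin) * lg (real nv) * lg (1 / \<delta>) * lg (p_max I / p_min I)"
proof -
  obtain k q K where s: "1 / hmin \<le> real K" "nv < 2 ^ k" "\<And>i. i < m \<Longrightarrow> p_max I < 2 ^ q * pr i"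
      "1 \<le> k" "1 \<le> q" "1 \<le> K"
      "real k \<le> 2 * lg (real nv)" "real q \<le> 2 * lg (p_max I / p_min I)" "real K \<le> 2 / hmin"
    using rounds_exist by blast
  have "pr i \<le> p_max I" if "i < m" for i unfolding p_max_def using that by (intro Max_ge) auto
  then have sat: "all_sat (2 * k * q * K)" by (intro progress[OF s(1-3)]) auto
  define S where "S = 2 * k * q * K"
  define t where "t = T (m * r)"
  have t: "1 \<le> t" unfolding t_def using mis_time_pos[OF M, of "m * r"] N by linarith
  have "1 \<le> k * q * K" using s by simp
  then have S: "2 \<le> S" unfolding S_def by (simp add: mult.assoc)
  have "S \<le> S * t" "2 \<le> S * t" using S t by (auto intro: order_trans)
  then have "S * (t + 1) + S + 2 \<le> 4 * (S * t)" unfolding add_mult_distrib2 by linarith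
  then have "real (S * (t + 1) + S + 2) \<le> real (4 * (S * t))" by (rule of_nat_mono)
  also have "\<dots> = 8 * real t * (real k * real q * real K)" by (simp add: S_def)
  also have "\<dots> \<le> 8 * real t * ((2 * lg (real nv)) * (2 * lg (p_max I / p_min I)) * (2 / hmin))"
    using s by (intro mult_left_mono mult_mono) (auto simp: lg_def)
  also have "\<dots> = 64 * (real t / hmin) * lg (real nv) * lg (p_max I / p_min I) * 1" by simp
  also have "\<dots> \<le> 64 * (real t / hmin) * lg (real nv) * lg (p_max I / p_min I) * lg (1 / \<delta>)"
    using hmin by (intro mult_left_mono mult_nonneg_nonneg) (auto simp: lg_def)
  finally show ?thesis using sat unfolding S_def t_def by (intro exI[of _ "2 * k * q * K"]) (simp add: mult_ac)
qed

end

theorem theorem2: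
  shows "\<exists>C::real. C > 0 \<and>
    (\<forall>M T. mis_algorithm M T \<longrightarrow>
      (\<forall>hmin \<epsilon> :: real. 0 < hmin \<and> hmin \<le> 1 / 2 \<and> 0 < \<epsilon> \<longrightarrow>
        (\<exists>(A :: dist_alg) (q :: nat poly). \<forall>I. valid_problem hmin I \<longrightarrow>
          (\<exists>R :: nat.
             terminates_within A (n_procs I) (comm I) (proc_input hmin \<epsilon> I) R \<and>
             real R \<le> C * (real (T (n_procs I * n_trees I)) / hmin)
                        * lg (real (n_vertices I)) * lg (1 / \<epsilon>) * lg (p_max I / p_min I)) \<and>
          feasible I (computed_solution A hmin \<epsilon> I) \<and>
          total_profit I (computed_solution A hmin \<epsilon> I) \<ge> opt_profit I / (80 + \<epsilon>) \<and>
          (\<forall>t. \<forall>i<n_procs I.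
             local_work A (n_procs I) (comm I) (proc_input hmin \<epsilon> I) t i
               \<le> poly q (n_vertices I + n_procs I + n_trees I + t)))))"
proof (intro exI[of _ 64] conjI allI impI)
  fix M T and hmin \<epsilon> :: real
  assume M: "mis_algorithm M T" and h: "0 < hmin \<and> hmin \<le> 1 / 2 \<and> 0 < \<epsilon>"
  obtain p :: "nat poly" where p: "\<And>N adj t v. simple_graph N adj \<Longrightarrow> v < N \<Longrightarrow>
      local_work M N adj (mis_input N) t v \<le> poly p (N + t)"
    using M unfolding mis_algorithm_def by blast
  obtain K where K: "\<And>x. poly p x \<le> (x + 2) ^ K" using poly_le_power by blast
  interpret fam hmin M T \<epsilon> K
  proof
    show "local_work M N adj (mis_input N) t v \<le> (N + t + 2) ^ K" if "simple_graph N adj" "v < N" for N adj t v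
      using p[OF that] K by (rule order_trans)
  qed (use M h in auto)
  obtain k where k: "\<And>I t i. valid_problem hmin I \<Longrightarrow> i < n_procs I \<Longrightarrow>
      local_work (alg M) (n_procs I) (comm I) (proc_input hmin \<epsilon> I) t i \<le> (n_vertices I + n_procs I + n_trees I + t + 2) ^ k"
    using local_work_alg by blast
  \<comment> \<open>\<open>[:2, 1:]\<close> is the linear polynomial \<open>x + 2\<close>.\<close>
  have q: "poly ([:2, 1:] ^ k) x = (x + 2) ^ k" for x :: nat by (simp add: poly_power add.commute)
  have main: "(\<exists>R :: nat.
             terminates_within (alg M) (n_procs I) (comm I) (proc_input hmin \<epsilon> I) R \<and>
             real R \<le> 64 * (real (T (n_procs I * n_trees I)) / hmin)
                        * lg (real (n_vertices I)) * lg (1 / \<epsilon>) * lg (p_max I / p_min I)) \<and>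
          feasible I (computed_solution (alg M) hmin \<epsilon> I) \<and>
          total_profit I (computed_solution (alg M) hmin \<epsilon> I) \<ge> opt_profit I / (80 + \<epsilon>)"
    if v: "valid_problem hmin I" for I
  proof -
    interpret sim hmin I M T \<epsilon> by unfold_locales (use v h M in auto)
    have nn: "0 \<le> 64 * (real (T (m * r)) / hmin) * lg (real nv) * lg (1 / \<epsilon>) * lg (p_max I / p_min I)"
      using h by (intro mult_nonneg_nonneg) (auto simp: lg_def)
    show ?thesis
    proof (cases "m * r \<le> 1")
      case True
      note sc = small_case[OF True]
      \<comment> \<open>Here the set of all instances is feasible, so no feasible set has a larger
        profit.\<close>
      have "total_profit I X \<le> 68 * total_profit I (demand_instances I)" if X: "feasible I X" for X
      proof -
        have "X \<subseteq> demand_instances I" using X by (simp add: feasible_def)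
        moreover have "0 \<le> profit I (fst d)" if "d \<in> demand_instances I" for d
          using that v unfolding valid_problem_def demand_instances_def by (auto intro: less_imp_le)
        ultimately have "total_profit I X \<le> total_profit I (demand_instances I)"
          unfolding total_profit_def by (intro sum_mono2 finite_instances) auto
        then show ?thesis using total_profit_nonneg[of "demand_instances I"] by simp
      qed
      then show ?thesis using sc nn ratio[of \<epsilon> "demand_instances I"] h by (auto intro!: exI[of _ 0])
    next
      case False
      obtain S where S: "all_sat S" and R: "real (S * (T (m * r) + 1) + S + 2)
          \<le> 64 * (real (T (m * r)) / hmin) * lg (real nv) * lg (1 / \<epsilon>) * lg (p_max I / p_min I)"
        using round_bound[OF False] by blast
      have "opt_profit I / (80 + \<epsilon>) \<le> total_profit I (solution S)"
        by (rule ratio) (use h solution_feasible approximation[OF S] in auto)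
      then show ?thesis
        unfolding computed_solution_alg[OF S False] using terminates_alg[OF S False] R solution_feasible by blast
    qed
  qed
  show "\<exists>(A :: dist_alg) (q :: nat poly). \<forall>I. valid_problem hmin I \<longrightarrow>
          (\<exists>R :: nat.
             terminates_within A (n_procs I) (comm I) (proc_input hmin \<epsilon> I) R \<and>
             real R \<le> 64 * (real (T (n_procs I * n_trees I)) / hmin)
                        * lg (real (n_vertices I)) * lg (1 / \<epsilon>) * lg (p_max I / p_min I)) \<and>
          feasible I (computed_solution A hmin \<epsilon> I) \<and>
          total_profit I (computed_solution A hmin \<epsilon> I) \<ge> opt_profit I / (80 + \<epsilon>) \<and>
          (\<forall>t. \<forall>i<n_procs I.
             local_work A (n_procs I) (comm I) (proc_input hmin \<epsilon> I) t i
               \<le> poly q (n_vertices I + n_procs I + n_trees I + t))"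
    using main k unfolding q[symmetric] by blast
qed simp

end
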